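(* Let $\mathbf{k}$ be an algebraically closed field with $\mathrm{char}(\mathbf{k})\neq 2$, let $E=\bigwedge E_1$ be the exterior algebra of a $5$-dimensional $\mathbf{k}$-vector space $E_1=\langle e_1,\ldots,e_5\rangle$, with its standard grading, and let $\mathcal{H}=\mathcal{H}^{(1,5,7,2)}(E)$ be the standard graded Hilbert scheme parametrizing homogeneous ideals $I\subseteq E$ such that $E/I$ has Hilbert function $(1,5,7,2)$ (i.e. $I_0=I_1=0$, $\dim_{\mathbf{k}}I_2=3$, $\dim_{\mathbf{k}}I_3=8$, $I_4=E_4$, $I_5=E_5$). Then $\mathcal{H}$ is the union of two irreducible components, of dimensions $14$ and $15$, and the lexicographic point of $\mathcal{H}$ lies in the intersection of the two components; in particular, it is a singular point of $\mathcal{H}$.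
   Context: The lexicographic order on monomials of $E$ is taken with $e_1>e_2>\cdots>e_5$. The lexicographic point is the point given by the unique lexicographic ideal of $\mathcal{H}$ (the monomial ideal whose graded components are spanned by the lexicographically largest monomials of each degree), namely $L=(e_1\wedge e_2,e_1\wedge e_3,e_1\wedge e_4,e_2\wedge e_3\wedge e_4,e_2\wedge e_3\wedge e_5)$. *)

theory Defs
  imports "HOL-Analysis.Analysis" "HOL-Computational_Algebra.Polynomial" "HOL-Library.Function_Algebras"
begin

text \<open>Basis vectors e_1,...,e_5 are indexed 0,...,4. An element of E is a coefficient
  function on subsets S of {0..4} (coefficient of the monomial e_S = wedge of e_i, i in S,
  in increasing order), vanishing outside Pow {..<5}.\<close>

type_synonym 'k ext = "nat set \<Rightarrow> 'k"

definition ext_elem :: "'k::field ext \<Rightarrow> bool" where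
  "ext_elem x \<longleftrightarrow> (\<forall>S. x S \<noteq> 0 \<longrightarrow> S \<subseteq> {..<5})"

definition ext_scale :: "'k::field \<Rightarrow> 'k ext \<Rightarrow> 'k ext" where
  "ext_scale c x = (\<lambda>S. c * x S)"

definition wsign :: "nat set \<Rightarrow> nat set \<Rightarrow> 'k::field" where
  "wsign S T = (-1) ^ card {(s,t). s \<in> S \<and> t \<in> T \<and> t < s}"

definition wedge :: "'k::field ext \<Rightarrow> 'k ext \<Rightarrow> 'k ext" where
  "wedge x y = (\<lambda>U. \<Sum>S\<in>Pow {..<5}. \<Sum>T\<in>Pow {..<5}.
      if S \<inter> T = {} \<and> S \<union> T = U then wsign S T * x S * y T else 0)"

definition hom_comp :: "nat \<Rightarrow> 'k::field ext \<Rightarrow> 'k ext" where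
  "hom_comp d x = (\<lambda>S. if card S = d then x S else 0)"

definition ext_deg :: "nat \<Rightarrow> 'k::field ext set" where
  "ext_deg d = {x. ext_elem x \<and> (\<forall>S. x S \<noteq> 0 \<longrightarrow> card S = d)}"

definition basis_mon :: "nat set \<Rightarrow> 'k::field ext" where
  "basis_mon T = (\<lambda>S. if S = T then 1 else 0)"

definition kdim :: "'k::field ext set \<Rightarrow> nat" where
  "kdim V = vector_space.dim (ext_scale :: 'k \<Rightarrow> 'k ext \<Rightarrow> 'k ext) V"

definition ext_ideal :: "'k::field ext set \<Rightarrow> bool" where
  "ext_ideal I \<longleftrightarrow> I \<subseteq> {x. ext_elem x} \<and> 0 \<in> I \<and>
     (\<forall>x\<in>I. \<forall>y\<in>I. x + y \<in> I) \<and> (\<forall>c. \<forall>x\<in>I. ext_scale c x \<in> I) \<and>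
     (\<forall>x\<in>I. \<forall>y. ext_elem y \<longrightarrow> wedge x y \<in> I \<and> wedge y x \<in> I)"

definition hom_ideal :: "'k::field ext set \<Rightarrow> bool" where
  "hom_ideal I \<longleftrightarrow> ext_ideal I \<and> (\<forall>x\<in>I. \<forall>d. hom_comp d x \<in> I)"

definition hf1572 :: "nat \<Rightarrow> nat" where
  "hf1572 d = (if d = 0 then 1 else if d = 1 then 5 else if d = 2 then 7
               else if d = 3 then 2 else 0)"

text \<open>k-points of H^(1,5,7,2)(E): homogeneous ideals I with
  dim_k (E/I)_d = dim E_d - dim I_d = hf1572 d for all d.\<close>
definition Hilb :: "'k::field ext set set" where
  "Hilb = {I. hom_ideal I \<and>
     (\<forall>d. kdim (ext_deg d :: 'k ext set) - kdim (I \<inter> ext_deg d) = hf1572 d)}"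

inductive_set polyfun :: "(('v \<Rightarrow> 'k::field) \<Rightarrow> 'k) set" where
  pconst: "(\<lambda>x. c) \<in> polyfun"
| pvar: "(\<lambda>x. x v) \<in> polyfun"
| padd: "p \<in> polyfun \<Longrightarrow> q \<in> polyfun \<Longrightarrow> (\<lambda>x. p x + q x) \<in> polyfun"
| pmult: "p \<in> polyfun \<Longrightarrow> q \<in> polyfun \<Longrightarrow> (\<lambda>x. p x * q x) \<in> polyfun"

definition zariski_closed :: "('v \<Rightarrow> 'k::field) set \<Rightarrow> bool" where
  "zariski_closed Z \<longleftrightarrow> (\<exists>P \<subseteq> polyfun. Z = {x. \<forall>p\<in>P. p x = 0})"

text \<open>Frames: a point x gives a 3 x 10 matrix (rows x(2,i,-), i<3, in E_2) and an
  8 x 10 matrix (rows x(3,i,-), i<8, in E_3). Coordinates are indexed by (d,i,S).\<close>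
definition frames :: "(nat \<times> nat \<times> nat set \<Rightarrow> 'k::field) set" where
  "frames = {x. \<forall>d i S. x (d,i,S) \<noteq> 0 \<longrightarrow>
     ((d = 2 \<and> i < 3) \<or> (d = 3 \<and> i < 8)) \<and> S \<subseteq> {..<5} \<and> card S = d}"

definition rspan :: "(nat \<times> nat \<times> nat set \<Rightarrow> 'k::field) \<Rightarrow> nat \<Rightarrow> nat \<Rightarrow> 'k ext set" where
  "rspan x d r = {(\<lambda>S. \<Sum>i<r. c i * x (d,i,S)) | c. True}"

definition Iof :: "(nat \<times> nat \<times> nat set \<Rightarrow> 'k::field) \<Rightarrow> 'k ext set" where
  "Iof x = {y. ext_elem y \<and> hom_comp 0 y = 0 \<and> hom_comp 1 y = 0 \<and>
              hom_comp 2 y \<in> rspan x 2 3 \<and> hom_comp 3 y \<in> rspan x 3 8}"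

definition pts_over :: "'k::field ext set set \<Rightarrow> (nat \<times> nat \<times> nat set \<Rightarrow> 'k) set" where
  "pts_over C = {x \<in> frames. Iof x \<in> C}"

text \<open>C \<subseteq> H is Zariski closed iff its preimage in the space of frames over H is closed
  (H is a closed subset of Gr(3,E_2) x Gr(8,E_3), whose topology is the quotient
  topology of the space of full-rank frames).\<close>
definition H_closed :: "'k::field ext set set \<Rightarrow> bool" where
  "H_closed C \<longleftrightarrow> C \<subseteq> Hilb \<and>
     (\<exists>Z :: (nat \<times> nat \<times> nat set \<Rightarrow> 'k) set. zariski_closed Z \<and>
        pts_over C = Z \<inter> pts_over Hilb)"

definition H_irreducible :: "'k::field ext set set \<Rightarrow> bool" where
  "H_irreducible C \<longleftrightarrow> H_closed C \<and> C \<noteq> {} \<and>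
     (\<forall>C1 C2. H_closed C1 \<longrightarrow> H_closed C2 \<longrightarrow> C \<subseteq> C1 \<union> C2 \<longrightarrow> C \<subseteq> C1 \<or> C \<subseteq> C2)"

definition H_component :: "'k::field ext set set \<Rightarrow> bool" where
  "H_component C \<longleftrightarrow> H_irreducible C \<and> (\<forall>D. H_irreducible D \<longrightarrow> C \<subseteq> D \<longrightarrow> D = C)"

definition H_chain :: "'k::field ext set set \<Rightarrow> nat \<Rightarrow> bool" where
  "H_chain C n \<longleftrightarrow> (\<exists>f :: nat \<Rightarrow> 'k ext set set.
     (\<forall>i\<le>n. H_irreducible (f i) \<and> f i \<subseteq> C) \<and> (\<forall>i<n. f i \<subset> f (Suc i)))"

definition H_dim_eq :: "'k::field ext set set \<Rightarrow> nat \<Rightarrow> bool" where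
  "H_dim_eq C n \<longleftrightarrow> H_chain C n \<and> \<not> H_chain C (Suc n)"

definition ideal_gen :: "'k::field ext set \<Rightarrow> 'k ext set" where
  "ideal_gen G = \<Inter>{I. ext_ideal I \<and> G \<subseteq> I}"

text \<open>L = (e1e2, e1e3, e1e4, e2e3e4, e2e3e5), with e_{i+1} indexed by i.\<close>
definition lex_point :: "'k::field ext set" where
  "lex_point = ideal_gen (basis_mon ` {{0,1},{0,2},{0,3},{1,2,3},{1,2,4}})"

definition alg_closed_field :: "'k::field itself \<Rightarrow> bool" where
  "alg_closed_field _ \<longleftrightarrow> (\<forall>p :: 'k poly. degree p > 0 \<longrightarrow> (\<exists>z. poly p z = 0))"

end

theory Submission imports Defs begin

text \<open>An ideal I with this Hilbert function is a pair of subspaces I_2, I_3 with E_1 I_2 contained in I_3. Under the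
  pairing of E_2 with E_3 the annihilator of I_3 is a pencil of 2-vectors u. If every u satisfies u u = 0, the
  pencil is p <q, r> for vectors p, q, r, and I is determined by the flag <p>, <p, q, r> (8 parameters) and by I_2
  in the five-dimensional space p E_1 + <q r> (6 parameters). If some u u is nonzero, it singles out a
  hyperplane H of E_1 (4 parameters) such that I_2 consists of 2-vectors of H and I_3 contains all 3-vectors
  of H; then I_3 is determined by a four-dimensional space T of 2-vectors of H (8 parameters) and I_2 is a
  hyperplane in T (3 parameters). Closures of the two families cover the Hilbert scheme, and both families
  specialize to the lexicographic ideal when all parameters vanish.

  A chain of irreducible closed sets in the closure of an n-parameter family has length at most n, because the
  functions separating its members are algebraically independent and pull back to polynomials in n variables;
  switching on one parameter after another gives a chain of length n. By dimension, the second closure is not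
  contained in the first; the converse inclusion fails because on the second family all products of two
  elements of I_2 are proportional.\<close>

text \<open>Dimension is defined by chains in a quotient of the space of frames, so it is measured
  upstairs. The frames of one ideal correspond to pairs of an invertible 3 x 3 and an invertible 8 x
  8 matrix, which adds 9 + 64 = 73 independent functions to those coming from a chain; n + 1 strict
  inclusions would give n + 74 independent polynomials in n + 73 variables. The parametrizations
  \<open>phi1\<close> and \<open>phi2\<close> are affine charts around the lexicographic ideal and
  miss points of their families. Every ideal is moved by an invertible matrix into one of two
  coordinate conditions, \<open>std1\<close> or \<open>std2\<close>, and then joined to the chart by
  a line in a larger parameter space; this uses that the field is infinite. The characteristic
  enters because the coefficients of u u are twice the 4 x 4 Pfaffians of u: a zero square must make
  u decomposable, and a nonzero product u1 u2 must show up in the square of u1 + u2. The delicate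
  case of the classification is a pencil with a nonzero square: that its other members are 2-vectors
  of the same hyperplane uses that I_2 has dimension 3.\<close>

type_synonym 'k frame = "nat \<times> nat \<times> nat set \<Rightarrow> 'k"

section \<open>Linear algebra with families of coordinate rows\<close>

text \<open>Independence is tested on the columns in \<open>A\<close>. With \<open>A = UNIV\<close>
  this is independence of the rows; with as many columns as rows it is the chart condition that the
  coordinates in \<open>A\<close> can serve as pivots.\<close>

definition rows_indep :: "nat \<Rightarrow> (nat \<Rightarrow> 's \<Rightarrow> 'k::field) \<Rightarrow> 's set \<Rightarrow> bool" where
  "rows_indep r y A \<longleftrightarrow> (\<forall>c. (\<forall>S\<in>A. (\<Sum>i<r. c i * y i S) = 0) \<longrightarrow> (\<forall>i<r. c i = 0))"

definition lincomb :: "nat \<Rightarrow> (nat \<Rightarrow> 'k::field) \<Rightarrow> (nat \<Rightarrow> 's \<Rightarrow> 'k) \<Rightarrow> 's \<Rightarrow> 'k" where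
  "lincomb r c y = (\<lambda>S. \<Sum>i<r. c i * y i S)"

definition rowspan :: "nat \<Rightarrow> (nat \<Rightarrow> 's \<Rightarrow> 'k::field) \<Rightarrow> ('s \<Rightarrow> 'k) set" where
  "rowspan r y = range (\<lambda>c. lincomb r c y)"

lemma rows_indepD: "rows_indep r y A \<Longrightarrow> (\<And>S. S \<in> A \<Longrightarrow> (\<Sum>i<r. c i * y i S) = 0) \<Longrightarrow> i < r \<Longrightarrow> c i = 0"
  unfolding rows_indep_def by blast

lemma rows_indep_mono: "rows_indep r y A \<Longrightarrow> A \<subseteq> B \<Longrightarrow> rows_indep r y B"
  unfolding rows_indep_def by blast

lemma rows_indep_cong: "(\<And>i S. i < r \<Longrightarrow> S \<in> A \<Longrightarrow> y i S = z i S) \<Longrightarrow> rows_indep r y A = rows_indep r z A"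
  unfolding rows_indep_def by simp

lemma lincomb_cong: "(\<And>i. i < r \<Longrightarrow> c i = d i) \<Longrightarrow> (\<And>i. i < r \<Longrightarrow> y i = z i) \<Longrightarrow> lincomb r c y = lincomb r d z"
  unfolding lincomb_def by simp

lemma rowspan_cong: "(\<And>i. i < r \<Longrightarrow> y i = z i) \<Longrightarrow> rowspan r y = rowspan r z"
  unfolding rowspan_def using lincomb_cong[of r _ _ y z] by auto

lemma lincomb_lincomb:
  assumes "\<And>i. i < m \<Longrightarrow> z i = lincomb r (c i) y"
  shows "lincomb m d z = lincomb r (\<lambda>j. \<Sum>i<m. d i * c i j) y"
proof
  fix S
  have "lincomb m d z S = (\<Sum>i<m. d i * (\<Sum>j<r. c i j * y j S))"
    using assms by (simp add: lincomb_def)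
  also have "\<dots> = (\<Sum>j<r. \<Sum>i<m. d i * c i j * y j S)"
    by (subst sum.swap) (simp add: sum_distrib_left mult.assoc)
  finally show "lincomb m d z S = lincomb r (\<lambda>j. \<Sum>i<m. d i * c i j) y S"
    by (simp add: lincomb_def sum_distrib_right)
qed

lemma row_in_rowspan: "i < r \<Longrightarrow> y i \<in> rowspan r y"
proof -
  assume i: "i < r"
  have "lincomb r (\<lambda>j. if j = i then 1 else 0) y S = y i S" for S
  proof -
    have "lincomb r (\<lambda>j. if j = i then 1 else 0) y S = (\<Sum>j<r. if j = i then y j S else 0)"
      unfolding lincomb_def by (rule sum.cong) auto
    then show ?thesis using i by simp
  qed
  then have "lincomb r (\<lambda>j. if j = i then 1 else 0) y = y i" by blast
  then show ?thesis unfolding rowspan_def by (metis rangeI)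
qed

lemma rowspan_add: "u \<in> rowspan r y \<Longrightarrow> v \<in> rowspan r y \<Longrightarrow> u + v \<in> rowspan r y"
proof -
  assume "u \<in> rowspan r y" "v \<in> rowspan r y"
  then obtain c d where "u = lincomb r c y" "v = lincomb r d y" by (auto simp: rowspan_def)
  then have "u + v = lincomb r (\<lambda>i. c i + d i) y"
    by (auto simp: lincomb_def fun_eq_iff distrib_right sum.distrib)
  then show ?thesis by (auto simp: rowspan_def)
qed

lemma rowspan_scale: "u \<in> rowspan r y \<Longrightarrow> (\<lambda>S. a * u S) \<in> rowspan r y"
proof -
  assume "u \<in> rowspan r y"
  then obtain c where "u = lincomb r c y" by (auto simp: rowspan_def)
  then have "(\<lambda>S. a * u S) = lincomb r (\<lambda>i. a * c i) y"
    by (auto simp: lincomb_def fun_eq_iff sum_distrib_left mult.assoc)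
  then show ?thesis by (auto simp: rowspan_def)
qed

lemma rowspan_zero: "0 \<in> rowspan r y"
proof -
  have "0 = lincomb r (\<lambda>i. 0) y" by (auto simp: lincomb_def fun_eq_iff)
  then show ?thesis by (auto simp: rowspan_def)
qed

lemma lincomb_in_closed:
  assumes "0 \<in> X" "\<And>u v. u \<in> X \<Longrightarrow> v \<in> X \<Longrightarrow> u + v \<in> X" "\<And>a u. u \<in> X \<Longrightarrow> (\<lambda>S. a * u S) \<in> X"
    and "\<And>i. i < r \<Longrightarrow> z i \<in> X"
  shows "lincomb r c z \<in> X"
  using assms(4)
proof (induction r)
  case 0 then show ?case using assms(1) by (simp add: lincomb_def zero_fun_def)
next
  case (Suc r)
  have "lincomb (Suc r) c z = lincomb r c z + (\<lambda>S. c r * z r S)"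
    by (auto simp: lincomb_def fun_eq_iff)
  then show ?case using Suc.IH Suc.prems assms(2,3) by (metis lessI less_Suc_eq)
qed

lemma rowspan_subsetI:
  assumes "\<And>i. i < m \<Longrightarrow> z i \<in> rowspan r y" shows "rowspan m z \<subseteq> rowspan r y"
  using lincomb_in_closed[where X="rowspan r y"] assms rowspan_add rowspan_scale rowspan_zero
  by (fastforce simp: rowspan_def[of m])

text \<open>Gaussian elimination, by induction on the number of equations: either the last equation
  is void, or an unknown with nonzero coefficient in it is eliminated from the others by
  cross-multiplication.\<close>

lemma homogeneous_nontrivial_solution:
  fixes c :: "nat \<Rightarrow> nat \<Rightarrow> 'k::field"
  assumes "r < m"
  shows "\<exists>d. (\<exists>i<m. d i \<noteq> 0) \<and> (\<forall>j<r. (\<Sum>i<m. d i * c i j) = 0)"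
  using assms
proof (induction r arbitrary: m c)
  case 0 then show ?case by (intro exI[of _ "\<lambda>_. 1"]) auto
next
  case (Suc r)
  show ?case
  proof (cases "\<forall>i<m. c i r = 0")
    case True
    obtain d where "\<exists>i<m. d i \<noteq> 0" "\<forall>j<r. (\<Sum>i<m. d i * c i j) = 0" using Suc.IH[of m c] Suc.prems by auto
    then show ?thesis using True by (intro exI[of _ d]) (auto simp: less_Suc_eq)
  next
    case False
    then obtain p where p: "p < m" "c p r \<noteq> 0" by blast
    obtain n where m: "m = Suc n" using Suc.prems by (cases m) auto
    define \<sigma> where "\<sigma> i = (if i < p then i else Suc i)" for i
    have inj: "inj_on \<sigma> {..<n}" by (auto simp: inj_on_def \<sigma>_def split: if_splits)
    have im: "\<sigma> ` {..<n} = {..<m} - {p}"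
    proof
      show "\<sigma> ` {..<n} \<subseteq> {..<m} - {p}" using m by (auto simp: \<sigma>_def)
      show "{..<m} - {p} \<subseteq> \<sigma> ` {..<n}"
      proof
        fix x assume x: "x \<in> {..<m} - {p}"
        show "x \<in> \<sigma> ` {..<n}"
        proof (cases "x < p")
          case True then show ?thesis using x p m by (intro image_eqI[of _ _ x]) (auto simp: \<sigma>_def)
        next
          case False then show ?thesis using x p m
            by (intro image_eqI[of _ _ "x - 1"]) (auto simp: \<sigma>_def)
        qed
      qed
    qed
    obtain d where d: "\<exists>i<n. d i \<noteq> 0"
      "\<forall>j<r. (\<Sum>i<n. d i * (c p r * c (\<sigma> i) j - c (\<sigma> i) r * c p j)) = 0"
      using Suc.IH[of n "\<lambda>i j. c p r * c (\<sigma> i) j - c (\<sigma> i) r * c p j"] Suc.prems m by auto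
    define \<tau> where "\<tau> = inv_into {..<n} \<sigma>"
    have \<tau>: "\<tau> (\<sigma> i) = i" if "i < n" for i using inj that by (simp add: \<tau>_def)
    \<comment> \<open>The pivot unknown is solved from equation \<open>r\<close>; scaling the other
      unknowns by the pivot coefficient avoids a division.\<close>
    define e where "e x = (if x = p then - (\<Sum>i<n. d i * c (\<sigma> i) r) else c p r * d (\<tau> x))" for x
    have sp: "\<sigma> i \<noteq> p" for i by (auto simp: \<sigma>_def)
    have sum: "(\<Sum>x<m. e x * c x j) = (\<Sum>i<n. d i * (c p r * c (\<sigma> i) j - c (\<sigma> i) r * c p j))" for j
    proof -
      have "(\<Sum>x<m. e x * c x j) = e p * c p j + (\<Sum>x\<in>{..<m}-{p}. e x * c x j)"
        using p by (subst sum.remove[of _ p]) auto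
      also have "(\<Sum>x\<in>{..<m}-{p}. e x * c x j) = (\<Sum>i<n. e (\<sigma> i) * c (\<sigma> i) j)"
        unfolding im[symmetric] by (simp add: sum.reindex[OF inj])
      also have "\<dots> = (\<Sum>i<n. c p r * d i * c (\<sigma> i) j)"
        by (rule sum.cong) (auto simp: e_def sp \<tau>)
      finally have "(\<Sum>x<m. e x * c x j) = (\<Sum>i<n. c p r * d i * c (\<sigma> i) j) - (\<Sum>i<n. d i * c (\<sigma> i) r * c p j)"
        by (simp add: e_def sum_distrib_right)
      then show ?thesis by (simp add: sum_subtractf[symmetric] algebra_simps)
    qed
    show ?thesis
    proof (intro exI[of _ e] conjI allI impI)
      from d(1) obtain i where i: "i < n" "d i \<noteq> 0" by blast
      then have "e (\<sigma> i) \<noteq> 0" using p by (simp add: e_def sp \<tau>)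
      moreover have "\<sigma> i < m" using i im by auto
      ultimately show "\<exists>i<m. e i \<noteq> 0" by blast
      fix j assume "j < Suc r"
      then show "(\<Sum>i<m. e i * c i j) = 0"
        unfolding sum using d(2) by (cases "j = r") (auto simp: mult.commute)
    qed
  qed
qed

lemma dependent_if_in_rowspan:
  assumes "r < m" "\<And>i. i < m \<Longrightarrow> z i \<in> rowspan r y"
  shows "\<exists>d. (\<exists>i<m. d i \<noteq> 0) \<and> lincomb m d z = 0"
proof -
  have "\<forall>i. \<exists>c. i < m \<longrightarrow> z i = lincomb r c y" using assms(2) by (auto simp: rowspan_def)
  then obtain c where c: "\<And>i. i < m \<Longrightarrow> z i = lincomb r (c i) y" by metis
  obtain d where d: "\<exists>i<m. d i \<noteq> 0" "\<forall>j<r. (\<Sum>i<m. d i * c i j) = 0"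
    using homogeneous_nontrivial_solution[OF assms(1), of c] by blast
  have "lincomb m d z = lincomb r (\<lambda>j. \<Sum>i<m. d i * c i j) y" by (rule lincomb_lincomb[OF c])
  also have "\<dots> = 0" using d(2) by (auto simp: lincomb_def fun_eq_iff)
  finally show ?thesis using d(1) by blast
qed

text \<open>In a nontrivial relation between independent rows and one further vector
  \<open>b\<close> the coefficient of \<open>b\<close> cannot vanish, so one may divide by
  it.\<close>

lemma in_rowspan_if_dependent:
  assumes ind: "rows_indep r y A" and e: "e r \<noteq> (0::'k::field) \<or> (\<exists>i<r. e i \<noteq> 0)"
    and rel: "\<And>S. S \<in> A \<Longrightarrow> (\<Sum>i<r. e i * y i S) + e r * b S = 0"
  shows "\<exists>c. \<forall>S\<in>A. (\<Sum>i<r. c i * y i S) = b S"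
proof -
  have er: "e r \<noteq> 0"
  proof
    assume "e r = 0"
    then have "\<forall>i<r. e i = 0" using rows_indepD[OF ind, of e] rel by auto
    then show False using e \<open>e r = 0\<close> by auto
  qed
  show ?thesis
  proof (intro exI[of _ "\<lambda>i. - e i / e r"] ballI)
    fix S assume "S \<in> A"
    then have "(\<Sum>i<r. e i * y i S) = - e r * b S" using rel[of S] by (simp add: eq_neg_iff_add_eq_0)
    moreover have "(\<Sum>i<r. - e i / e r * y i S) = - (\<Sum>i<r. e i * y i S) / e r"
      by (subst sum_negf[symmetric], subst sum_divide_distrib) simp
    ultimately show "(\<Sum>i<r. - e i / e r * y i S) = b S" using er by simp
  qed
qed

text \<open>In \<open>r\<close> columns the \<open>r\<close> rows together with \<open>b\<close> are
  dependent, and independence of the rows solves the relation for \<open>b\<close>.\<close>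

lemma rows_indep_surj:
  fixes y :: "nat \<Rightarrow> 's \<Rightarrow> 'k::field"
  assumes ind: "rows_indep r y A" and A: "finite A" "card A = r"
  shows "\<exists>c. \<forall>S\<in>A. (\<Sum>i<r. c i * y i S) = b S"
proof -
  obtain f where f: "bij_betw f {..<r} A" using ex_bij_betw_nat_finite[OF A(1)] A(2) by (auto simp: atLeast0LessThan)
  obtain e where e: "\<exists>i<Suc r. e i \<noteq> 0" "\<forall>j<r. (\<Sum>i<Suc r. e i * (if i < r then y i (f j) else b (f j))) = 0"
    using homogeneous_nontrivial_solution[of r "Suc r" "\<lambda>i j. if i < r then y i (f j) else b (f j)"] by auto
  show ?thesis
  proof (rule in_rowspan_if_dependent[OF ind, of e])
    show "e r \<noteq> 0 \<or> (\<exists>i<r. e i \<noteq> 0)" using e(1) less_Suc_eq by auto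
    fix S assume "S \<in> A"
    then obtain j where "j < r" "S = f j" using f by (auto simp: bij_betw_def)
    then show "(\<Sum>i<r. e i * y i S) + e r * b S = 0" using e(2) by simp
  qed
qed

text \<open>A further vector of the larger span would be one of \<open>r + 1\<close> vectors in the
  span of \<open>r\<close>, hence it depends on the independent rows \<open>z\<close>.\<close>

lemma rowspan_eqI:
  fixes y z :: "nat \<Rightarrow> 's \<Rightarrow> 'k::field"
  assumes ind: "rows_indep r z UNIV" and sub: "\<And>i. i < r \<Longrightarrow> z i \<in> rowspan r y"
  shows "rowspan r z = rowspan r y"
proof
  show "rowspan r z \<subseteq> rowspan r y" using sub by (rule rowspan_subsetI)
  show "rowspan r y \<subseteq> rowspan r z"
  proof
    fix b assume b: "b \<in> rowspan r y"
    obtain e where e: "\<exists>i<Suc r. e i \<noteq> 0" "lincomb (Suc r) e (\<lambda>i. if i < r then z i else b) = 0"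
      using dependent_if_in_rowspan[of r "Suc r" "\<lambda>i. if i < r then z i else b" y] b sub
      by (metis lessI)
    have "\<exists>c. \<forall>S\<in>UNIV. (\<Sum>i<r. c i * z i S) = b S"
    proof (rule in_rowspan_if_dependent[OF ind, of e])
      show "e r \<noteq> 0 \<or> (\<exists>i<r. e i \<noteq> 0)" using e(1) less_Suc_eq by auto
      fix S show "(\<Sum>i<r. e i * z i S) + e r * b S = 0"
        using fun_cong[OF e(2), of S] by (simp add: lincomb_def)
    qed
    then obtain c where "lincomb r c z = b" by (auto simp: lincomb_def fun_eq_iff)
    then show "b \<in> rowspan r z" by (auto simp: rowspan_def)
  qed
qed

text \<open>If \<open>r < card A\<close> rows represented every vector on \<open>A\<close>, they
  would represent all unit vectors, which are more than \<open>r\<close> and would therefore be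
  dependent. So some \<open>b\<close> can be added.\<close>

lemma rows_indep_extend:
  fixes y :: "nat \<Rightarrow> 's \<Rightarrow> 'k::field"
  assumes ind: "rows_indep r y A" and A: "finite A" and r: "r \<le> card A"
  shows "\<exists>z. rows_indep (card A) z A \<and> (\<forall>i<r. z i = y i)"
  using r ind
proof (induction "card A - r" arbitrary: r y)
  case 0 then show ?case by (intro exI[of _ y]) auto
next
  case (Suc n)
  then have lt: "r < card A" by simp
  have "\<exists>b. \<not> (\<exists>c. \<forall>S\<in>A. (\<Sum>i<r. c i * y i S) = b S)"
  proof (rule ccontr)
    assume "\<nexists>b. \<not> (\<exists>c. \<forall>S\<in>A. (\<Sum>i<r. c i * y i S) = b S)"
    then have all: "\<forall>b. \<exists>c. \<forall>S\<in>A. (\<Sum>i<r. c i * y i S) = b S" by blast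
    have "\<exists>c. \<forall>S\<in>A. (\<Sum>i<r. c i * y i S) = (\<lambda>S. if S = T then 1 else 0) S" for T
      by (rule all[rule_format])
    then have "\<forall>T. \<exists>c. \<forall>S\<in>A. (\<Sum>i<r. c i * y i S) = (if S = T then 1 else 0)" by simp
    then obtain c where c: "\<And>T S. S \<in> A \<Longrightarrow> (\<Sum>i<r. c T i * y i S) = (if S = T then 1 else 0)" by metis
    obtain f where f: "bij_betw f {..<card A} A" using ex_bij_betw_nat_finite[OF A] by (auto simp: atLeast0LessThan)
    obtain d where d: "\<exists>i<card A. d i \<noteq> 0" "\<forall>j<r. (\<Sum>i<card A. d i * c (f i) j) = 0"
      using homogeneous_nontrivial_solution[OF lt, of "\<lambda>i. c (f i)"] by blast
    then obtain k where k: "k < card A" "d k \<noteq> 0" by blast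
    have fk: "f k \<in> A" using f k by (auto simp: bij_betw_def)
    have eq: "f k = f i \<longleftrightarrow> i = k" if "i < card A" for i using f k that by (auto simp: bij_betw_def inj_on_def)
    have "0 = (\<Sum>j<r. (\<Sum>i<card A. d i * c (f i) j) * y j (f k))" using d by simp
    also have "\<dots> = (\<Sum>i<card A. d i * (\<Sum>j<r. c (f i) j * y j (f k)))"
      by (simp add: sum_distrib_right sum_distrib_left mult.assoc) (rule sum.swap)
    also have "\<dots> = (\<Sum>i<card A. if i = k then d i else 0)"
      using c[OF fk] by (intro sum.cong) (auto simp: eq)
    also have "\<dots> = d k" using k by simp
    finally show False using k by simp
  qed
  then obtain b where b: "\<nexists>c. \<forall>S\<in>A. (\<Sum>i<r. c i * y i S) = b S" by blast
  have ind': "rows_indep (Suc r) (\<lambda>i. if i = r then b else y i) A"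
    unfolding rows_indep_def
  proof (intro allI impI)
    fix e i assume e: "\<forall>S\<in>A. (\<Sum>i<Suc r. e i * (if i = r then b else y i) S) = 0" and i: "i < Suc r"
    have e': "(\<Sum>i<r. e i * y i S) + e r * b S = 0" if "S \<in> A" for S using e that by simp
    then have "\<not> (e r \<noteq> 0 \<or> (\<exists>i<r. e i \<noteq> 0))" using in_rowspan_if_dependent[OF Suc.prems(2), of e b] b by blast
    then show "e i = 0" using i less_Suc_eq by auto
  qed
  obtain z where "rows_indep (card A) z A" "\<forall>i<Suc r. z i = (if i = r then b else y i)"
  proof -
    have "n = card A - Suc r" "Suc r \<le> card A" using Suc.hyps(2) lt by auto
    from Suc.hyps(1)[OF this ind'] show ?thesis using that by blast
  qed
  then show ?case by (intro exI[of _ z]) auto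
qed

text \<open>A square matrix y with independent rows has a two-sided inverse: surjectivity gives P y
  = 1, and then (y P - 1) y = 0 gives y P = 1 by independence of the rows.\<close>

lemma rows_indep_dual:
  fixes y :: "nat \<Rightarrow> 's \<Rightarrow> 'k::field"
  assumes ind: "rows_indep (card A) y A" and A: "finite A"
  obtains P where "\<And>S T. S \<in> A \<Longrightarrow> T \<in> A \<Longrightarrow> (\<Sum>i<card A. P T i * y i S) = (if S = T then 1 else 0)"
    "\<And>i j. i < card A \<Longrightarrow> j < card A \<Longrightarrow> (\<Sum>S\<in>A. y i S * P S j) = (if i = j then 1 else 0)"
proof -
  have "\<forall>T. \<exists>c. \<forall>S\<in>A. (\<Sum>i<card A. c i * y i S) = (if S = T then 1 else 0)"
  proof
    fix T show "\<exists>c. \<forall>S\<in>A. (\<Sum>i<card A. c i * y i S) = (if S = T then 1 else 0)"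
      using rows_indep_surj[OF ind A refl, of "\<lambda>S. if S = T then 1 else 0"] by simp
  qed
  then obtain P where P: "\<And>T S. S \<in> A \<Longrightarrow> (\<Sum>i<card A. P T i * y i S) = (if S = T then 1 else 0)" by metis
  have "(\<Sum>S\<in>A. y i S * P S j) = (if i = j then 1 else 0)" if i: "i < card A" and j: "j < card A" for i j
  proof -
    have "(\<Sum>S\<in>A. y i S * P S j) - (if i = j then 1 else 0) = 0"
    proof (rule rows_indepD[OF ind _ j])
      fix T assume T: "T \<in> A"
      have "(\<Sum>j<card A. (\<Sum>S\<in>A. y i S * P S j) * y j T) = (\<Sum>S\<in>A. y i S * (\<Sum>j<card A. P S j * y j T))"
        by (simp add: sum_distrib_right sum_distrib_left mult.assoc) (rule sum.swap)
      also have "\<dots> = (\<Sum>S\<in>A. if S = T then y i S else 0)"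
        by (intro sum.cong) (auto simp: P[OF T])
      also have "\<dots> = y i T" using T A by simp
      finally have 1: "(\<Sum>j<card A. (\<Sum>S\<in>A. y i S * P S j) * y j T) = y i T" .
      have "(\<Sum>j<card A. (if i = j then 1 else 0) * y j T) = (\<Sum>j<card A. if j = i then y j T else 0)"
        by (intro sum.cong) auto
      then have 2: "(\<Sum>j<card A. (if i = j then 1 else 0) * y j T) = y i T" using i by simp
      show "(\<Sum>j<card A. ((\<Sum>S\<in>A. y i S * P S j) - (if i = j then 1 else 0)) * y j T) = 0"
        by (simp add: left_diff_distrib sum_subtractf 1 2)
    qed
    then show ?thesis by simp
  qed
  then show ?thesis using that P by blast
qed

section \<open>Polynomial functions\<close>

lemma polyfun_subst:
  assumes "p \<in> polyfun" "\<And>v. (\<lambda>a. f a v) \<in> polyfun"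
  shows "(\<lambda>a. p (f a)) \<in> polyfun"
  using assms(1) by induction (auto intro: polyfun.intros assms(2))

lemma polyfun_sum [intro]: "(\<And>i. i \<in> A \<Longrightarrow> f i \<in> polyfun) \<Longrightarrow> (\<lambda>x. \<Sum>i\<in>A. f i x) \<in> polyfun"
  by (induction A rule: infinite_finite_induct) (auto intro: polyfun.intros)

lemma polyfun_prod [intro]: "(\<And>i. i \<in> A \<Longrightarrow> f i \<in> polyfun) \<Longrightarrow> (\<lambda>x. \<Prod>i\<in>A. f i x) \<in> polyfun"
  by (induction A rule: infinite_finite_induct) (auto intro: polyfun.intros)

lemma polyfun_power: "f \<in> polyfun \<Longrightarrow> (\<lambda>x. f x ^ n) \<in> polyfun"
  by (induction n) (auto intro: polyfun.intros)

lemma polyfun_uminus: "f \<in> polyfun \<Longrightarrow> (\<lambda>x. - f x) \<in> polyfun"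
  using polyfun.pmult[OF polyfun.pconst[of "-1"], of f] by simp

lemma polyfun_diff: "f \<in> polyfun \<Longrightarrow> g \<in> polyfun \<Longrightarrow> (\<lambda>x. f x - g x) \<in> polyfun"
  using polyfun.padd[OF _ polyfun_uminus, of f g] by simp

lemma polyfun_if: "f \<in> polyfun \<Longrightarrow> g \<in> polyfun \<Longrightarrow> (\<lambda>x. if P then f x else g x) \<in> polyfun"
  by (cases P) simp_all

lemmas polyfun_intros = polyfun.intros polyfun_power polyfun_uminus polyfun_diff polyfun_if

lemma polyfun_on_line:
  assumes "p \<in> polyfun" shows "\<exists>q. \<forall>t. p (\<lambda>v. a v + t * b v) = poly q t"
  using assms
proof induction
  case (pconst c) show ?case by (intro exI[of _ "[:c:]"]) auto
next
  case (pvar v) show ?case by (intro exI[of _ "[:a v, b v:]"]) auto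
next
  case (padd p q)
  then obtain r s where "\<And>t. p (\<lambda>v. a v + t * b v) = poly r t" "\<And>t. q (\<lambda>v. a v + t * b v) = poly s t" by blast
  then show ?case by (intro exI[of _ "r + s"]) auto
next
  case (pmult p q)
  then obtain r s where "\<And>t. p (\<lambda>v. a v + t * b v) = poly r t" "\<And>t. q (\<lambda>v. a v + t * b v) = poly s t" by blast
  then show ?case by (intro exI[of _ "r * s"]) auto
qed

text \<open>Irreducibility of affine space: on the line through \<open>a\<close> and
  \<open>b\<close> both functions become nonzero polynomials in one variable, whose roots do not
  exhaust an infinite field.\<close>

lemma polyfun_common_nonzero:
  assumes inf: "infinite (UNIV :: 'k::field set)"
    and p: "p \<in> polyfun" "q \<in> polyfun" and a: "p a \<noteq> (0::'k)" "q b \<noteq> 0"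
  shows "\<exists>x. p x \<noteq> 0 \<and> q x \<noteq> 0"
proof -
  obtain r where r: "\<And>t. p (\<lambda>v. a v + t * (b v - a v)) = poly r t"
    using polyfun_on_line[OF p(1), of a "\<lambda>v. b v - a v"] by blast
  obtain s where s: "\<And>t. q (\<lambda>v. a v + t * (b v - a v)) = poly s t"
    using polyfun_on_line[OF p(2), of a "\<lambda>v. b v - a v"] by blast
  have "poly r 0 \<noteq> 0" "poly s 1 \<noteq> 0" using r[of 0] s[of 1] a by auto
  then have "r * s \<noteq> 0" by auto
  then have "finite {t. poly (r * s) t = 0}" by (rule poly_roots_finite)
  then obtain t where "poly (r * s) t \<noteq> 0" using inf by (metis (mono_tags, lifting) UNIV_eq_I mem_Collect_eq)
  then show ?thesis using r[of t] s[of t] by (intro exI[of _ "\<lambda>v. a v + t * (b v - a v)"]) auto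
qed

text \<open>Independence is an open condition. Elimination without divisions yields a polynomial
  \<open>h\<close> that certifies it near \<open>y\<close>, in place of a maximal minor.\<close>

lemma rows_indep_open:
  fixes y :: "nat \<Rightarrow> 's \<Rightarrow> 'k::field"
  assumes "rows_indep r y A"
  shows "\<exists>h\<in>polyfun. h (\<lambda>(i,S). y i S) \<noteq> 0 \<and> (\<forall>z. h (\<lambda>(i,S). z i S) \<noteq> 0 \<longrightarrow> rows_indep r z A)"
  using assms
proof (induction r arbitrary: y)
  case 0 show ?case by (intro bexI[of _ "\<lambda>_. 1"]) (auto intro: polyfun.intros simp: rows_indep_def)
next
  case (Suc r)
  have "\<exists>S\<in>A. y r S \<noteq> 0"
  proof (rule ccontr)
    assume "\<not> (\<exists>S\<in>A. y r S \<noteq> 0)"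
    then have "(if r = r then 1 else 0::'k) = 0"
      using rows_indepD[OF Suc.prems, of "\<lambda>i. if i = r then 1 else 0" r] by simp
    then show False by simp
  qed
  then obtain S where S: "S \<in> A" "y r S \<noteq> 0" by blast
  \<comment> \<open>Row \<open>r\<close> serves as pivot row and \<open>S\<close> as pivot column;
    cross-multiplication clears column \<open>S\<close> from the other rows.\<close>
  define e where "e z = (\<lambda>i T. z r S * z i T - z i S * z r T)" for z :: "nat \<Rightarrow> 's \<Rightarrow> 'k"
  have sum: "(\<Sum>i<r. c i * e z i T) = z r S * (\<Sum>i<r. c i * z i T) - (\<Sum>i<r. c i * z i S) * z r T" for c z T
    by (simp add: e_def sum_distrib_left sum_distrib_right sum_subtractf algebra_simps)
  have "rows_indep r (e y) A"
    unfolding rows_indep_def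
  proof (intro allI impI)
    fix c i assume c: "\<forall>T\<in>A. (\<Sum>i<r. c i * e y i T) = 0" and i: "i < r"
    have "(\<lambda>i. if i = r then - (\<Sum>i<r. c i * y i S) else y r S * c i) i = 0"
    proof (rule rows_indepD[OF Suc.prems])
      fix T assume "T \<in> A"
      then show "(\<Sum>i<Suc r. (if i = r then - (\<Sum>i<r. c i * y i S) else y r S * c i) * y i T) = 0"
        using c[rule_format, of T] by (simp add: sum sum_distrib_left mult.assoc)
    qed (use i in auto)
    then show "c i = 0" using i S by simp
  qed
  from Suc.IH[OF this] obtain h where h: "h \<in> polyfun" "h (\<lambda>(i,S). e y i S) \<noteq> 0"
    "\<And>z. h (\<lambda>(i,S). z i S) \<noteq> 0 \<Longrightarrow> rows_indep r z A" by blast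
  \<comment> \<open>The factor \<open>x (r,S)\<close> keeps the pivot nonzero wherever
    \<open>h'\<close> is nonzero.\<close>
  define h' where "h' x = x (r,S) * h (\<lambda>(i,T). x (r,S) * x (i,T) - x (i,S) * x (r,T))" for x :: "nat \<times> 's \<Rightarrow> 'k"
  have "h' \<in> polyfun" unfolding h'_def
    by (intro polyfun.pmult polyfun.pvar polyfun_subst[OF h(1)])
      (simp add: case_prod_beta, intro polyfun_diff polyfun.pmult polyfun.pvar)
  moreover have "h' (\<lambda>(i,S). y i S) \<noteq> 0" using h(2) S by (simp add: h'_def e_def)
  moreover have "rows_indep (Suc r) z A" if "h' (\<lambda>(i,S). z i S) \<noteq> 0" for z
    unfolding rows_indep_def
  proof (intro allI impI)
    fix c i assume c: "\<forall>T\<in>A. (\<Sum>i<Suc r. c i * z i T) = 0" and i: "i < Suc r"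
    have z: "z r S \<noteq> 0" "h (\<lambda>(i,T). e z i T) \<noteq> 0" using that by (auto simp: h'_def e_def)
    have A: "(\<Sum>i<r. c i * z i T) = - c r * z r T" if "T \<in> A" for T
      using c that by (auto simp: eq_neg_iff_add_eq_0)
    have "(\<Sum>i<r. c i * e z i T) = 0" if "T \<in> A" for T
      unfolding sum A[OF that] A[OF S(1)] by simp
    then have *: "c i = 0" if "i < r" for i
      by (rule rows_indepD[OF h(3)[OF z(2)] _ that])
    then have "c r * z r S = 0" using A[OF S(1)] by simp
    then show "c i = 0" using * i z by (auto simp: less_Suc_eq)
  qed
  ultimately show ?case by blast
qed

section \<open>Algebraic independence\<close>

text \<open>The polynomials vanishing on \<open>X\<close> form a prime ideal, or the unit ideal when
  \<open>X\<close> is empty.\<close>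

definition poly_irreducible :: "('v \<Rightarrow> 'k::field) set \<Rightarrow> bool" where
  "poly_irreducible X \<longleftrightarrow> (\<forall>p\<in>polyfun. \<forall>q\<in>polyfun.
     (\<forall>x\<in>X. p x * q x = 0) \<longrightarrow> (\<forall>x\<in>X. p x = 0) \<or> (\<forall>x\<in>X. q x = 0))"

lemma poly_irreducibleD:
  "poly_irreducible X \<Longrightarrow> p \<in> polyfun \<Longrightarrow> q \<in> polyfun \<Longrightarrow> (\<And>x. x \<in> X \<Longrightarrow> p x * q x = 0) \<Longrightarrow>
    (\<forall>x\<in>X. p x = 0) \<or> (\<forall>x\<in>X. q x = 0)"
  unfolding poly_irreducible_def by blast

text \<open>The monomial in F_0, ..., F_(m-1) whose exponents are the digits of N in base d.\<close>
fun digit_monomial :: "nat \<Rightarrow> (nat \<Rightarrow> 'x \<Rightarrow> 'k::field) \<Rightarrow> nat \<Rightarrow> nat \<Rightarrow> 'x \<Rightarrow> 'k" where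
  "digit_monomial d F 0 N x = 1"
| "digit_monomial d F (Suc m) N x = digit_monomial d F m (N mod d ^ m) x * F m x ^ (N div d ^ m)"

text \<open>Only monomials with exponents below \<open>d\<close> are tested, which turns algebraic
  independence into linear independence of \<open>d ^ m\<close> functions; it is established for
  every \<open>d\<close>.\<close>

definition alg_indep :: "nat \<Rightarrow> nat \<Rightarrow> (nat \<Rightarrow> 'x \<Rightarrow> 'k::field) \<Rightarrow> 'x set \<Rightarrow> bool" where
  "alg_indep d m F X \<longleftrightarrow> (\<forall>c. (\<forall>x\<in>X. (\<Sum>N<d ^ m. c N * digit_monomial d F m N x) = 0) \<longrightarrow> (\<forall>N<d ^ m. c N = 0))"

lemma digit_monomial_cong:
  "(\<And>i. i < m \<Longrightarrow> F i x = G i y) \<Longrightarrow> digit_monomial d F m N x = digit_monomial d G m N y"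
  by (induction m arbitrary: N) auto

lemma alg_indep_cong:
  "(\<And>i. i < m \<Longrightarrow> F i = G i) \<Longrightarrow> alg_indep d m F X = alg_indep d m G X"
  using digit_monomial_cong[of m F _ G] by (simp add: alg_indep_def)

lemma digit_monomial_polyfun:
  "(\<And>i. i < m \<Longrightarrow> F i \<in> polyfun) \<Longrightarrow> digit_monomial d F m N \<in> polyfun"
proof (induction m arbitrary: N)
  case 0
  have "digit_monomial d F 0 N = (\<lambda>x. 1)" by auto
  then show ?case by (simp add: polyfun.pconst)
next
  case (Suc m)
  have "digit_monomial d F (Suc m) N = (\<lambda>x. digit_monomial d F m (N mod d ^ m) x * F m x ^ (N div d ^ m))" by auto
  then show ?case using Suc by (auto intro!: polyfun.pmult polyfun_power)
qed

lemma sum_lessThan_add: "(\<Sum>i<m + k. f i) = (\<Sum>i<m. f i) + (\<Sum>i<(k::nat). f (i + m) :: 'a::comm_monoid_add)"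
  by (induction k) (auto simp: ac_simps)

lemma sum_digits: "(\<Sum>N<a * k. f N) = (\<Sum>j<a. \<Sum>n<k. f (n + j * k) :: 'a::comm_monoid_add)" for k :: nat
proof (induction a)
  case (Suc a)
  have "(\<Sum>N<Suc a * k. f N) = (\<Sum>N<a * k + k. f N)" by (simp add: add.commute)
  then show ?case using Suc by (simp add: sum_lessThan_add)
qed simp

text \<open>Sort a relation by powers of \<open>F m\<close>. By irreducibility of \<open>X'\<close>
  the lowest power can be cancelled; on \<open>X\<close>, where \<open>F m\<close> vanishes, only
  the lowest coefficient survives, and independence on \<open>X\<close> makes it zero.\<close>

lemma alg_indep_Suc:
  assumes ind: "alg_indep d m F X" and sub: "X \<subseteq> X'" and irr: "poly_irreducible X'"
    and F: "\<And>i. i \<le> m \<Longrightarrow> F i \<in> polyfun"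
    and F0: "\<And>x. x \<in> X \<Longrightarrow> F m x = 0" and F1: "x1 \<in> X'" "F m x1 \<noteq> 0"
  shows "alg_indep d (Suc m) F X'"
  unfolding alg_indep_def
proof (intro allI impI)
  fix c N
  assume rel: "\<forall>x\<in>X'. (\<Sum>N<d ^ Suc m. c N * digit_monomial d F (Suc m) N x) = 0" and N: "N < d ^ Suc m"
  define Q where "Q j x = (\<Sum>n<d ^ m. c (n + j * d ^ m) * digit_monomial d F m n x)" for j x
  have rel': "(\<Sum>j<d. Q j x * F m x ^ j) = 0" if "x \<in> X'" for x
  proof -
    have "(\<Sum>N<d ^ Suc m. c N * digit_monomial d F (Suc m) N x) = (\<Sum>j<d. Q j x * F m x ^ j)"
      unfolding power_Suc sum_digits Q_def sum_distrib_right
      by (intro sum.cong refl) (auto simp: mult.assoc)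
    then show ?thesis using rel that by auto
  qed
  have Qp: "Q j \<in> polyfun" for j
    unfolding Q_def using digit_monomial_polyfun[of m F d] F by (auto intro!: polyfun.intros)
  have *: "\<forall>n<d ^ m. c (n + j * d ^ m) = 0" if "j < d" for j
    using that
  proof (induction j rule: less_induct)
    case (less j)
    have Q0: "Q i x = 0" if "i < j" for i x using less that by (auto simp: Q_def)
    \<comment> \<open>What remains after cancelling the power \<open>j\<close> of
      \<open>F m\<close>; where \<open>F m\<close> vanishes its value is \<open>Q j\<close>.\<close>
    define R where "R x = (\<Sum>i\<in>{j..<d}. Q i x * F m x ^ (i - j))" for x
    have "F m x ^ j * R x = (\<Sum>i<d. Q i x * F m x ^ i)" for x
    proof -
      have "(\<Sum>i<d. Q i x * F m x ^ i) = (\<Sum>i\<in>{j..<d}. Q i x * F m x ^ i)"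
        by (rule sum.mono_neutral_right) (auto simp: Q0)
      also have "\<dots> = F m x ^ j * R x"
        unfolding R_def sum_distrib_left by (rule sum.cong) (auto simp: mult.left_commute[of "F m x ^ j"] power_add[symmetric])
      finally show ?thesis by simp
    qed
    then have "\<forall>x\<in>X'. F m x ^ j * R x = 0" using rel' by simp
    moreover have "R \<in> polyfun" unfolding R_def using Qp F by (auto intro!: polyfun.intros polyfun_power)
    moreover have "(\<lambda>x. F m x ^ j) \<in> polyfun" using F by (auto intro: polyfun_power)
    ultimately have "(\<forall>x\<in>X'. F m x ^ j = 0) \<or> (\<forall>x\<in>X'. R x = 0)"
      using poly_irreducibleD[OF irr, of "\<lambda>x. F m x ^ j" R] by blast
    then have "\<forall>x\<in>X'. R x = 0" using F1 by auto
    then have R0: "R x = 0" if "x \<in> X" for x using sub that by auto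
    have "Q j x = 0" if "x \<in> X" for x
    proof -
      have "R x = (\<Sum>i\<in>{j..<d}. if i = j then Q j x else 0)"
        unfolding R_def using F0[OF that] by (intro sum.cong) auto
      then show ?thesis using R0[OF that] less.prems by simp
    qed
    then show ?case using ind[unfolded alg_indep_def, rule_format, of "\<lambda>n. c (n + j * d ^ m)"] unfolding Q_def by blast
  qed
  have "0 < d" using N by (cases d) auto
  then have "N div d ^ m < d" "N mod d ^ m < d ^ m" using N by (auto simp: less_mult_imp_div_less)
  then have "c (N mod d ^ m + N div d ^ m * d ^ m) = 0" using * by blast
  then show "c N = 0" by (simp only: mod_div_mult_eq)
qed

section \<open>Counting monomials with bounded exponents\<close>

inductive_set bounded_poly :: "nat \<Rightarrow> nat \<Rightarrow> ((nat \<Rightarrow> 'k::field) \<Rightarrow> 'k) set" for n D where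
  monom: "(\<And>i. i < n \<Longrightarrow> e i \<le> D) \<Longrightarrow> (\<lambda>a. c * (\<Prod>i<n. a i ^ e i)) \<in> bounded_poly n D"
| add: "p \<in> bounded_poly n D \<Longrightarrow> q \<in> bounded_poly n D \<Longrightarrow> (\<lambda>a. p a + q a) \<in> bounded_poly n D"

lemma bounded_poly_mono: "p \<in> bounded_poly n D \<Longrightarrow> D \<le> D' \<Longrightarrow> p \<in> bounded_poly n D'"
  by (induction rule: bounded_poly.induct) (auto intro: bounded_poly.add intro!: bounded_poly.monom order_trans[of _ D D'])

lemma bounded_poly_const: "(\<lambda>a. c) \<in> bounded_poly n D"
  using bounded_poly.monom[of n "\<lambda>_. 0" D c] by simp

lemma bounded_poly_mult:
  assumes "p \<in> bounded_poly n D" "q \<in> bounded_poly n E"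
  shows "(\<lambda>a. p a * q a) \<in> bounded_poly n (D + E)"
  using assms(1)
proof induction
  case (monom e c)
  show ?case using assms(2)
  proof induction
    case (monom f d)
    have "(\<lambda>a. (c * d) * (\<Prod>i<n. a i ^ (e i + f i))) \<in> bounded_poly n (D + E)"
      using \<open>\<And>i. i < n \<Longrightarrow> e i \<le> D\<close> monom by (intro bounded_poly.monom) (simp add: add_mono)
    then show ?case by (simp add: power_add prod.distrib algebra_simps)
  next
    case (add p q) then show ?case using bounded_poly.add[OF add.IH] by (simp add: distrib_left)
  qed
next
  case (add p q) then show ?case using bounded_poly.add[OF add.IH] by (simp add: distrib_right)
qed

lemma bounded_poly_power: "p \<in> bounded_poly n D \<Longrightarrow> (\<lambda>a. p a ^ k) \<in> bounded_poly n (k * D)"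
proof (induction k)
  case (Suc k) then show ?case using bounded_poly_mult[OF Suc.prems Suc.IH] by simp
qed (simp add: bounded_poly_const)

text \<open>Polynomial functions live on sequences with infinitely many entries; setting the entries
  from \<open>n\<close> on to zero turns them into functions of \<open>n\<close> variables.\<close>

definition truncate_seq :: "nat \<Rightarrow> (nat \<Rightarrow> 'k::zero) \<Rightarrow> nat \<Rightarrow> 'k" where
  "truncate_seq n a = (\<lambda>i. if i < n then a i else 0)"

lemma polyfun_truncate_seq: "(\<lambda>a. truncate_seq n a i) \<in> polyfun"
  by (cases "i < n") (auto simp: truncate_seq_def intro: polyfun.intros)

lemma polyfun_bounded:
  fixes p :: "(nat \<Rightarrow> 'k::field) \<Rightarrow> 'k"
  shows "p \<in> polyfun \<Longrightarrow> \<exists>D. (\<lambda>a. p (truncate_seq n a)) \<in> bounded_poly n D"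
proof (induction rule: polyfun.induct)
  case (pconst c) then show ?case using bounded_poly_const by blast
next
  case (pvar i)
  show ?case
  proof (cases "i < n")
    case True
    have "(\<Prod>j<n. a j ^ (if j = i then 1 else 0)) = a i" for a :: "nat \<Rightarrow> 'k"
    proof -
      have "(\<Prod>j<n. a j ^ (if j = i then 1 else 0)) = (\<Prod>j<n. if j = i then a j else 1)"
        by (rule prod.cong) auto
      then show ?thesis using True by simp
    qed
    then have eq: "(\<lambda>a. 1 * (\<Prod>j<n. a j ^ (if j = i then 1 else 0))) = (\<lambda>a. (a i :: 'k))" by (simp add: fun_eq_iff)
    have "(\<lambda>a. 1 * (\<Prod>j<n. (a j :: 'k) ^ (if j = i then 1 else 0))) \<in> bounded_poly n 1"
      by (rule bounded_poly.monom) simp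
    then have "(\<lambda>a. (a i :: 'k)) \<in> bounded_poly n 1" unfolding eq .
    then show ?thesis using True by (auto simp: truncate_seq_def intro!: exI[of _ 1])
  next
    case False then show ?thesis using bounded_poly_const[of 0] by (auto simp: truncate_seq_def)
  qed
next
  case (padd p q)
  then obtain D E where "(\<lambda>a. p (truncate_seq n a)) \<in> bounded_poly n D" "(\<lambda>a. q (truncate_seq n a)) \<in> bounded_poly n E" by blast
  then show ?case by (intro exI[of _ "max D E"] bounded_poly.add) (auto intro: bounded_poly_mono[of _ n D] bounded_poly_mono[of _ n E])
next
  case (pmult p q) then show ?case using bounded_poly_mult by blast
qed

fun exponent_code :: "nat \<Rightarrow> nat \<Rightarrow> (nat \<Rightarrow> nat) \<Rightarrow> nat" where
  "exponent_code d 0 e = 0"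
| "exponent_code d (Suc n) e = exponent_code d n e + e n * d ^ n"

lemma exponent_code:
  assumes "\<And>i. i < n \<Longrightarrow> e i < d"
  shows "exponent_code d n e < d ^ n \<and> digit_monomial d (\<lambda>i a. a i) n (exponent_code d n e) a = (\<Prod>i<n. a i ^ e i)"
  using assms
proof (induction n)
  case (Suc n)
  then have IH: "exponent_code d n e < d ^ n" "digit_monomial d (\<lambda>i a. a i) n (exponent_code d n e) a = (\<Prod>i<n. a i ^ e i)"
    by auto
  have "Suc (e n) * d ^ n \<le> d * d ^ n" using Suc.prems[of n] by (intro mult_le_mono1) auto
  then have "exponent_code d (Suc n) e < d ^ Suc n" using IH(1) by simp
  then show ?case using IH Suc.prems[of n] by simp
qed simp

text \<open>Exponents at most \<open>D\<close> are digits in base \<open>Suc D\<close>, so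
  \<open>Suc D ^ n\<close> monomials in \<open>n\<close> variables are enough.\<close>

lemma bounded_poly_rowspan:
  "p \<in> bounded_poly n D \<Longrightarrow> p \<in> rowspan (Suc D ^ n) (digit_monomial (Suc D) (\<lambda>i a. a i) n)"
proof (induction rule: bounded_poly.induct)
  case (monom e c)
  then have e: "\<And>i. i < n \<Longrightarrow> e i < Suc D" by (simp add: less_Suc_eq_le)
  define N where "N = exponent_code (Suc D) n e"
  have N: "N < Suc D ^ n" "\<And>a. digit_monomial (Suc D) (\<lambda>i a. a i) n N a = (\<Prod>i<n. a i ^ e i :: 'a)"
    using exponent_code[of n e, OF e] by (auto simp: N_def)
  show ?case
    using rowspan_scale[OF row_in_rowspan[OF N(1), of "digit_monomial (Suc D) (\<lambda>i a. a i) n :: _ \<Rightarrow> _ \<Rightarrow> 'a"], of c]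
    by (simp add: N(2))
next
  case (add p q) then show ?case using rowspan_add[OF add.IH] by (simp add: plus_fun_def)
qed

lemma digit_monomial_bounded:
  "N < d ^ m \<Longrightarrow> (\<And>i. i < m \<Longrightarrow> F i \<in> bounded_poly n D) \<Longrightarrow> digit_monomial d F m N \<in> bounded_poly n (m * (d * D))"
proof (induction m arbitrary: N)
  case 0 have "digit_monomial d F 0 N = (\<lambda>x. 1)" by auto
  then show ?case by (simp add: bounded_poly_const)
next
  case (Suc m)
  have d: "0 < d" using Suc.prems(1) by (cases d) auto
  have "N div d ^ m < d" using Suc.prems(1) by (simp add: less_mult_imp_div_less)
  then have le: "N div d ^ m * D \<le> d * D" by simp
  have 1: "digit_monomial d F m (N mod d ^ m) \<in> bounded_poly n (m * (d * D))" using Suc d by simp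
  have 2: "(\<lambda>x. F m x ^ (N div d ^ m)) \<in> bounded_poly n (d * D)"
    by (rule bounded_poly_mono[OF bounded_poly_power[OF Suc.prems(2)] le]) simp
  have "digit_monomial d F (Suc m) N = (\<lambda>x. digit_monomial d F m (N mod d ^ m) x * F m x ^ (N div d ^ m))" by auto
  then show ?case using bounded_poly_mult[OF 1 2] by (simp add: algebra_simps)
qed

text \<open>For large d there are more monomials of degree below d in each of the m functions than
  monomials in the n coordinates that can occur in them.\<close>
lemma algebraic_dependence:
  fixes F :: "nat \<Rightarrow> (nat \<Rightarrow> 'k::field) \<Rightarrow> 'k"
  assumes F: "\<And>i. i < m \<Longrightarrow> F i \<in> polyfun" and nm: "n < m"
  shows "\<exists>d c. (\<exists>N<d ^ m. c N \<noteq> 0) \<and> (\<forall>a. (\<Sum>N<d ^ m. c N * digit_monomial d F m N (truncate_seq n a)) = 0)"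
proof -
  define G where "G i = (\<lambda>a. F i (truncate_seq n a))" for i
  have "\<exists>D. \<forall>i<k. G i \<in> bounded_poly n D" if "k \<le> m" for k
    using that
  proof (induction k)
    case (Suc k)
    then obtain D where D: "\<forall>i<k. G i \<in> bounded_poly n D" by auto
    obtain E where "G k \<in> bounded_poly n E" using polyfun_bounded[OF F[of k]] Suc.prems by (auto simp: G_def)
    then have "\<forall>i<Suc k. G i \<in> bounded_poly n (max D E)" using D by (auto simp: less_Suc_eq intro: bounded_poly_mono[of _ n D] bounded_poly_mono[of _ n E])
    then show ?case by blast
  qed simp
  then obtain D where D: "\<And>i. i < m \<Longrightarrow> G i \<in> bounded_poly n D" by blast
  \<comment> \<open>This choice gives
    \<open>r \<le> d ^ n * Suc (m * D) ^ n < d ^ Suc n \<le> d ^ m\<close>: the number of products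
    grows faster than the number of monomials available for them.\<close>
  define d where "d = Suc (Suc (m * D) ^ n)"
  define r where "r = Suc (m * (d * D)) ^ n"
  have "Suc (m * (d * D)) \<le> d * Suc (m * D)" by (simp add: d_def algebra_simps)
  then have "r \<le> (d * Suc (m * D)) ^ n" unfolding r_def by (rule power_mono) simp
  also have "\<dots> = d ^ n * Suc (m * D) ^ n" by (rule power_mult_distrib)
  also have "\<dots> < d ^ n * d" by (simp add: d_def)
  also have "\<dots> = d ^ Suc n" by simp
  also have "\<dots> \<le> d ^ m" using nm by (intro power_increasing) (auto simp: d_def)
  finally have rlt: "r < d ^ m" .
  have "digit_monomial d G m N \<in> rowspan r (digit_monomial (Suc (m * (d * D))) (\<lambda>i a. a i) n)" if "N < d ^ m" for N
    unfolding r_def by (rule bounded_poly_rowspan[OF digit_monomial_bounded[OF that D]])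
  from dependent_if_in_rowspan[of r "d ^ m" "digit_monomial d G m", OF rlt this]
  obtain c where c: "\<exists>N<d ^ m. c N \<noteq> 0" "lincomb (d ^ m) c (digit_monomial d G m) = 0" by blast
  have "(\<Sum>N<d ^ m. c N * digit_monomial d F m N (truncate_seq n a)) = 0" for a
    using fun_cong[OF c(2), of a] digit_monomial_cong[of m F "truncate_seq n a" G a d]
    by (simp add: lincomb_def G_def)
  then show ?thesis using c(1) by blast
qed

section \<open>Points of the Hilbert scheme in terms of frames\<close>

global_interpretation ext: vector_space "ext_scale :: 'k::field \<Rightarrow> 'k ext \<Rightarrow> 'k ext"
  by unfold_locales (auto simp: ext_scale_def fun_eq_iff algebra_simps)

lemma kdim_ext_dim: "kdim = ext.dim"
  by (simp add: kdim_def fun_eq_iff)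

lemma rowspan_subspace: "ext.subspace (rowspan r y)"
  using rowspan_zero rowspan_add rowspan_scale[of _ r y] by (intro ext.subspaceI) (auto simp: ext_scale_def)

lemma rowspan_eq_span: "rowspan r y = ext.span (y ` {..<r})"
proof
  show "ext.span (y ` {..<r}) \<subseteq> rowspan r y"
    by (rule ext.span_minimal) (auto intro: row_in_rowspan rowspan_subspace)
  show "rowspan r y \<subseteq> ext.span (y ` {..<r})"
    using lincomb_in_closed[where X="ext.span (y ` {..<r})" and r=r and z=y]
    by (auto simp: rowspan_def ext.span_zero ext.span_add ext_scale_def[symmetric] ext.span_scale ext.span_base)
qed

lemma lincomb_eq_sum: "lincomb r c y = (\<Sum>i<r. ext_scale (c i) (y i))"
  by (induction r) (auto simp: lincomb_def ext_scale_def fun_eq_iff)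

lemma rows_indep_UNIV_iff: "rows_indep r y UNIV \<longleftrightarrow> (\<forall>c. lincomb r c y = 0 \<longrightarrow> (\<forall>i<r. c i = 0))"
  by (simp add: rows_indep_def lincomb_def fun_eq_iff)

lemma rows_indep_inj:
  assumes "rows_indep r y UNIV" shows "inj_on y {..<r}"
proof (rule inj_onI)
  fix i j assume ij: "i \<in> {..<r}" "j \<in> {..<r}" "y i = y j"
  show "i = j"
  proof (rule ccontr)
    assume ne: "i \<noteq> j"
    have "(if i = i then 1 else if i = j then -1 else 0::'b) = 0"
    proof (rule rows_indepD[OF assms, of "\<lambda>l. if l = i then 1 else if l = j then -1 else 0" i])
      fix S
      have "(\<Sum>l<r. (if l = i then 1 else if l = j then -1 else 0) * y l S)
        = (\<Sum>l<r. (if l = i then y i S else 0) - (if l = j then y j S else 0))"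
        using ne by (intro sum.cong) auto
      then show "(\<Sum>l<r. (if l = i then 1 else if l = j then -1 else 0) * y l S) = 0"
        using ij by (simp add: sum_subtractf)
    qed (use ij in auto)
    then show False by simp
  qed
qed

lemma rows_indep_independent:
  assumes "rows_indep r y UNIV" shows "ext.independent (y ` {..<r})"
proof -
  note inj = rows_indep_inj[OF assms]
  have "u (y i) = 0" if "(\<Sum>v\<in>y ` {..<r}. ext_scale (u v) v) = 0" "i < r" for u i
  proof -
    have "lincomb r (\<lambda>i. u (y i)) y = 0"
      using that(1) by (simp add: lincomb_eq_sum sum.reindex[OF inj])
    then show ?thesis using assms that(2) unfolding rows_indep_UNIV_iff by blast
  qed
  then show ?thesis by (subst ext.dependent_finite) auto
qed

lemma kdim_rowspan: "rows_indep r y UNIV \<Longrightarrow> kdim (rowspan r y) = r"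
  unfolding kdim_ext_dim rowspan_eq_span ext.dim_span
  using ext.dim_eq_card_independent[OF rows_indep_independent] card_image[OF rows_indep_inj] by fastforce

text \<open>Turns the dimension of the definitions into numbered independent rows; the surrounding
  row span makes a basis finite.\<close>

lemma subspace_rows:
  assumes V: "ext.subspace V" "V \<subseteq> rowspan m z"
  obtains y where "rows_indep (kdim V) y UNIV" "V = rowspan (kdim V) y"
proof -
  obtain B where B: "B \<subseteq> V" "ext.independent B" "V \<subseteq> ext.span B" "card B = ext.dim V"
    using ext.basis_exists by blast
  have fin: "finite B"
    using ext.independent_span_bound[of "z ` {..<m}" B] B V(2) by (auto simp: rowspan_eq_span)
  obtain y where y: "bij_betw y {..<card B} B"
    using ex_bij_betw_nat_finite[OF fin] by (auto simp: atLeast0LessThan)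
  then have im: "y ` {..<card B} = B" and inj: "inj_on y {..<card B}" by (auto simp: bij_betw_def)
  have "V = ext.span B" using B V(1) by (meson ext.span_minimal subset_antisym)
  then have "V = rowspan (kdim V) y" using B(4) im by (simp add: rowspan_eq_span kdim_ext_dim)
  moreover have "rows_indep (card B) y UNIV"
    unfolding rows_indep_UNIV_iff
  proof (intro allI impI)
    fix c i assume c: "lincomb (card B) c y = 0" and i: "i < card B"
    have "(\<Sum>v\<in>B. ext_scale (c (inv_into {..<card B} y v)) v) = (\<Sum>i<card B. ext_scale (c i) (y i))"
      using inj by (subst sum.reindex_bij_betw[OF y, symmetric]) (intro sum.cong, auto)
    also have "\<dots> = 0" using c by (simp add: lincomb_eq_sum)
    finally have "\<forall>v\<in>B. c (inv_into {..<card B} y v) = 0"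
      using ext.independentD[OF B(2) fin subset_refl, of "\<lambda>v. c (inv_into {..<card B} y v)"] by auto
    moreover have "y i \<in> B" using i im by blast
    ultimately have "c (inv_into {..<card B} y (y i)) = 0" by blast
    then show "c i = 0" using i inj by simp
  qed
  ultimately show thesis using that B(4) by (simp add: kdim_ext_dim)
qed

text \<open>Write an independent basis \<open>z\<close> as z_i = sum_j c_ij y_j and let
  \<open>e\<close> be a relation between the rows of \<open>y\<close>. The r + 1 vectors c_i and e
  in r columns are dependent; independence of \<open>z\<close> kills the coefficients of the c_i, so
  \<open>e\<close> itself vanishes.\<close>

lemma rows_indep_if_kdim:
  assumes "kdim (rowspan r y) = r" shows "rows_indep r y UNIV"
proof -
  obtain z where z: "rows_indep r z UNIV" "rowspan r y = rowspan r z"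
    using subspace_rows[OF rowspan_subspace, of r y r y] assms by auto
  have "\<exists>c. z i = lincomb r c y" if "i < r" for i
    using row_in_rowspan[OF that, of z] z(2) by (auto simp: rowspan_def)
  then obtain c where c: "\<And>i. i < r \<Longrightarrow> z i = lincomb r (c i) y" by metis
  show ?thesis unfolding rows_indep_UNIV_iff
  proof (intro allI impI)
    fix e i assume e: "lincomb r e y = 0" and i: "i < r"
    obtain d where d: "\<exists>i<Suc r. d i \<noteq> 0" "\<forall>j<r. (\<Sum>i<Suc r. d i * (if i < r then c i j else e j)) = 0"
      using homogeneous_nontrivial_solution[of r "Suc r" "\<lambda>i j. if i < r then c i j else e j"] by auto
    have rel: "(\<Sum>i<r. d i * c i j) = - d r * e j" if "j < r" for j
      using d(2) that by (simp add: eq_neg_iff_add_eq_0)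
    have "lincomb r d z = lincomb r (\<lambda>j. \<Sum>i<r. d i * c i j) y" by (rule lincomb_lincomb[OF c])
    also have "\<dots> = lincomb r (\<lambda>j. - d r * e j) y" by (rule lincomb_cong) (simp_all add: rel)
    also have "\<dots> = ext_scale (- d r) (lincomb r e y)"
      by (simp add: lincomb_def ext_scale_def sum_distrib_left mult.assoc sum_negf)
    finally have "lincomb r d z = 0" using e by simp
    then have d0: "\<forall>i<r. d i = 0" using z(1) unfolding rows_indep_UNIV_iff by blast
    then have "d r \<noteq> 0" using d(1) by (auto simp: less_Suc_eq)
    then show "e i = 0" using rel[OF i] d0 by simp
  qed
qed

text \<open>Left multiplication by the basis vector number \<open>i\<close>.\<close>

definition ew :: "nat \<Rightarrow> 'k::field ext \<Rightarrow> 'k ext" where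
  "ew i v = (\<lambda>U. if U \<subseteq> {..<5} \<and> i \<in> U then (-1) ^ card {t \<in> U. t < i} * v (U - {i}) else 0)"

lemma wedge_eval:
  assumes "U \<subseteq> {..<5}"
  shows "wedge x y U = (\<Sum>S\<in>Pow U. wsign S (U - S) * x S * y (U - S))"
proof -
  have "wedge x y U = (\<Sum>S\<in>Pow {..<5}. if S \<subseteq> U then wsign S (U - S) * x S * y (U - S) else 0)"
    unfolding wedge_def
  proof (rule sum.cong[OF refl])
    fix S assume "S \<in> Pow {..<5::nat}"
    have "(\<Sum>T\<in>Pow {..<5}. if S \<inter> T = {} \<and> S \<union> T = U then wsign S T * x S * y T else 0)
      = (\<Sum>T\<in>Pow {..<5}. if T = U - S then if S \<subseteq> U then wsign S (U - S) * x S * y (U - S) else 0 else 0)"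
    proof (rule sum.cong[OF refl])
      fix T assume "T \<in> Pow {..<5::nat}"
      have "S \<inter> T = {} \<and> S \<union> T = U \<longleftrightarrow> T = U - S \<and> S \<subseteq> U" by auto
      then show "(if S \<inter> T = {} \<and> S \<union> T = U then wsign S T * x S * y T else 0)
        = (if T = U - S then if S \<subseteq> U then wsign S (U - S) * x S * y (U - S) else 0 else 0)" by auto
    qed
    also have "\<dots> = (if S \<subseteq> U then wsign S (U - S) * x S * y (U - S) else 0)"
      using assms by (subst sum.delta) auto
    finally show "(\<Sum>T\<in>Pow {..<5}. if S \<inter> T = {} \<and> S \<union> T = U then wsign S T * x S * y T else 0)
      = (if S \<subseteq> U then wsign S (U - S) * x S * y (U - S) else 0)" .
  qed
  also have "\<dots> = (\<Sum>S\<in>Pow U. wsign S (U - S) * x S * y (U - S))"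
    using assms by (intro sum.mono_neutral_cong_right) (auto intro: rev_finite_subset)
  finally show ?thesis .
qed

lemma wedge_outside: "\<not> U \<subseteq> {..<5} \<Longrightarrow> wedge x y U = 0"
  unfolding wedge_def by (intro sum.neutral ballI) auto

lemma wsign_singleton: "wsign {i} T = (-1) ^ card {t \<in> T. t < i}"
proof -
  have "{(s, t). s \<in> {i} \<and> t \<in> T \<and> t < s} = Pair i ` {t \<in> T. t < i}" by auto
  then have "card {(s, t). s \<in> {i} \<and> t \<in> T \<and> t < s} = card {t \<in> T. t < i}"
    by (simp add: card_image inj_on_def)
  then show ?thesis by (simp add: wsign_def)
qed

lemma wsign_singleton_right: "wsign S {i} = (-1) ^ card {s \<in> S. i < s}"
proof -
  have "{(s, t). s \<in> S \<and> t \<in> {i} \<and> t < s} = (\<lambda>s. (s, i)) ` {s \<in> S. i < s}" by auto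
  then have "card {(s, t). s \<in> S \<and> t \<in> {i} \<and> t < s} = card {s \<in> S. i < s}"
    by (simp add: card_image inj_on_def)
  then show ?thesis by (simp add: wsign_def)
qed

lemma wsign_empty [simp]: "wsign {} T = 1" "wsign S {} = 1"
  by (simp_all add: wsign_def)

lemma wedge_basis_mon_singleton:
  assumes "i < 5" shows "wedge (basis_mon {i}) v = ew i v"
proof
  fix U
  show "wedge (basis_mon {i}) v U = ew i v U"
  proof (cases "U \<subseteq> {..<5}")
    case True
    have fin: "finite U" using True by (auto intro: rev_finite_subset)
    have "wedge (basis_mon {i}) v U = (\<Sum>S\<in>Pow U. if S = {i} then wsign {i} (U - {i}) * v (U - {i}) else 0)"
      unfolding wedge_eval[OF True] by (intro sum.cong) (auto simp: basis_mon_def)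
    also have "\<dots> = (if i \<in> U then wsign {i} (U - {i}) * v (U - {i}) else 0)"
      using fin by (subst sum.delta) auto
    also have "{t \<in> U - {i}. t < i} = {t \<in> U. t < i}" by auto
    then have "(if i \<in> U then wsign {i} (U - {i}) * v (U - {i}) else 0) = ew i v U"
      using True by (simp add: ew_def wsign_singleton)
    finally show ?thesis .
  qed (simp add: wedge_outside ew_def)
qed

text \<open>The inversions of \<open>i\<close> with \<open>T\<close> on the two sides add up to 2,
  so they have equal parity: a vector commutes with a 2-vector.\<close>

lemma wsign_singleton_commute:
  assumes "finite T" "card T = 2" "i \<notin> T" shows "(wsign T {i} :: 'k::field) = wsign {i} T"
proof -
  have T: "{s \<in> T. i < s} \<union> {t \<in> T. t < i} = T" using assms(3) by auto (metis nat_neq_iff)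
  have "card ({s \<in> T. i < s} \<union> {t \<in> T. t < i}) = card {s \<in> T. i < s} + card {t \<in> T. t < i}"
    using assms(1) by (intro card_Un_disjoint) auto
  then have "card T = card {s \<in> T. i < s} + card {t \<in> T. t < i}" unfolding T .
  then have "card {s \<in> T. i < s} + card {t \<in> T. t < i} = 2" using assms(2) by simp
  then have "even (card {s \<in> T. i < s}) \<longleftrightarrow> even (card {t \<in> T. t < i})" by presburger
  then show ?thesis by (simp add: wsign_singleton wsign_singleton_right minus_one_power_iff)
qed

text \<open>An ideal with this Hilbert function has nothing below degree 2 and everything from
  degree 4 on, so only the coefficients of a product up to degree 3 matter. There left and right
  multiplication agree, since 2-vectors are central.\<close>

lemma wedge_low_right:
  assumes y: "\<And>S. card S < 2 \<Longrightarrow> y S = 0" and U: "U \<subseteq> {..<5}"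
  shows "card U < 2 \<Longrightarrow> wedge y z U = 0" "card U < 2 \<Longrightarrow> wedge z y U = 0"
    "card U = 2 \<Longrightarrow> wedge y z U = z {} * y U" "card U = 2 \<Longrightarrow> wedge z y U = z {} * y U"
    "card U = 3 \<Longrightarrow> wedge y z U = z {} * y U + (\<Sum>i<5. z {i} * ew i y U)"
    "card U = 3 \<Longrightarrow> wedge z y U = z {} * y U + (\<Sum>i<5. z {i} * ew i y U)"
proof -
  have fin: "finite U" using U by (auto intro: rev_finite_subset)
  have c: "card S < card U" if "S \<subset> U" for S using fin that by (rule psubset_card_mono)
  have cd: "card (U - S) < card U" if "S \<subseteq> U" "S \<noteq> {}" for S using fin that c[of "U - S"] by auto
  have le: "card S \<le> card U" if "S \<subseteq> U" for S using fin that by (rule card_mono)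
  show "wedge y z U = 0" if "card U < 2"
    unfolding wedge_eval[OF U]
  proof (intro sum.neutral ballI)
    fix S assume "S \<in> Pow U"
    then have "y S = 0" using y le[of S] that by simp
    then show "wsign S (U - S) * y S * z (U - S) = 0" by simp
  qed
  show "wedge z y U = 0" if "card U < 2"
    unfolding wedge_eval[OF U]
  proof (intro sum.neutral ballI)
    fix S assume "S \<in> Pow U"
    then have "y (U - S) = 0" using y le[of "U - S"] that by auto
    then show "wsign S (U - S) * z S * y (U - S) = 0" by simp
  qed
  have L: "(\<Sum>S\<in>Pow U. if S = U then wsign S (U - S) * y S * z (U - S) else 0) = z {} * y U"
    using fin by simp
  have R: "(\<Sum>S\<in>Pow U. if S = {} then wsign S (U - S) * z S * y (U - S) else 0) = z {} * y U"
    using fin by simp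
  show "wedge y z U = z {} * y U" if "card U = 2"
    unfolding wedge_eval[OF U] L[symmetric]
    using y c that by (intro sum.cong) (auto simp: psubset_eq)
  show "wedge z y U = z {} * y U" if "card U = 2"
    unfolding wedge_eval[OF U] R[symmetric]
    using y cd that by (intro sum.cong) auto
  have E: "(\<Sum>i<5. z {i} * ew i y U) = (\<Sum>i\<in>U. wsign {i} (U - {i}) * z {i} * y (U - {i}))"
  proof -
    have "(\<Sum>i<5. z {i} * ew i y U) = (\<Sum>i\<in>U. z {i} * ew i y U)"
      using U by (intro sum.mono_neutral_right) (auto simp: ew_def)
    also have "\<dots> = (\<Sum>i\<in>U. wsign {i} (U - {i}) * z {i} * y (U - {i}))"
    proof (rule sum.cong[OF refl])
      fix i assume "i \<in> U"
      moreover have "{t \<in> U - {i}. t < i} = {t \<in> U. t < i}" by auto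
      ultimately show "z {i} * ew i y U = wsign {i} (U - {i}) * z {i} * y (U - {i})"
        using U by (simp add: ew_def wsign_singleton algebra_simps)
    qed
    finally show ?thesis .
  qed
  \<comment> \<open>Among the subsets of three indices only the full set and the sets with one index
    removed have at least two elements; the other terms contain a coefficient of \<open>y\<close>
    below degree 2.\<close>
  have nl: "card S < 2" if "S \<subseteq> U" "card U = 3" "S \<noteq> U" "\<forall>i\<in>U. S \<noteq> U - {i}" for S
  proof -
    have "\<exists>i. i \<in> U \<and> i \<notin> S" using that(1,3) by blast
    then obtain i where i: "i \<in> U" "i \<notin> S" by blast
    then have "S \<subset> U - {i}" using that by auto
    then have "card S < card (U - {i})" using fin by (intro psubset_card_mono) auto
    then show ?thesis using i fin that by simp
  qed
  have inj1: "inj_on (\<lambda>i. U - {i}) U" by (auto simp: inj_on_def)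
  have inj2: "inj_on (\<lambda>i. {i}) U" by (auto simp: inj_on_def)
  show "wedge y z U = z {} * y U + (\<Sum>i<5. z {i} * ew i y U)" if U3: "card U = 3"
  proof -
    have "wedge y z U = (\<Sum>S\<in>insert U ((\<lambda>i. U - {i}) ` U). wsign S (U - S) * y S * z (U - S))"
      unfolding wedge_eval[OF U]
    proof (intro sum.mono_neutral_right ballI)
      fix S assume "S \<in> Pow U - insert U ((\<lambda>i. U - {i}) ` U)"
      then have "card S < 2" using U3 by (intro nl) auto
      then show "wsign S (U - S) * y S * z (U - S) = 0" using y by simp
    qed (use fin in auto)
    also have "\<dots> = wsign U {} * y U * z {} + (\<Sum>i\<in>U. wsign (U - {i}) (U - (U - {i})) * y (U - {i}) * z (U - (U - {i})))"
      using fin by (subst sum.insert) (auto simp: sum.reindex[OF inj1])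
    also have "(\<Sum>i\<in>U. wsign (U - {i}) (U - (U - {i})) * y (U - {i}) * z (U - (U - {i})))
       = (\<Sum>i\<in>U. wsign {i} (U - {i}) * z {i} * y (U - {i}))"
    proof (rule sum.cong[OF refl])
      fix i assume i: "i \<in> U"
      then have "U - (U - {i}) = {i}" by auto
      moreover have "(wsign (U - {i}) {i} :: 'a) = wsign {i} (U - {i})"
        using fin i U3 by (intro wsign_singleton_commute) auto
      ultimately show "wsign (U - {i}) (U - (U - {i})) * y (U - {i}) * z (U - (U - {i}))
         = wsign {i} (U - {i}) * z {i} * y (U - {i})" by simp
    qed
    finally show ?thesis by (simp add: E)
  qed
  show "wedge z y U = z {} * y U + (\<Sum>i<5. z {i} * ew i y U)" if U3: "card U = 3"
  proof -
    have "wedge z y U = (\<Sum>S\<in>insert {} ((\<lambda>i. {i}) ` U). wsign S (U - S) * z S * y (U - S))"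
      unfolding wedge_eval[OF U]
    proof (intro sum.mono_neutral_right ballI)
      fix S assume S: "S \<in> Pow U - insert {} ((\<lambda>i. {i}) ` U)"
      have "card (U - S) < 2"
      proof (rule nl)
        show "\<forall>i\<in>U. U - S \<noteq> U - {i}" using S by blast
      qed (use S U3 in auto)
      then show "wsign S (U - S) * z S * y (U - S) = 0" using y by simp
    qed (use fin in auto)
    also have "\<dots> = z {} * y U + (\<Sum>i\<in>U. wsign {i} (U - {i}) * z {i} * y (U - {i}))"
      using fin by (subst sum.insert) (auto simp: sum.reindex[OF inj2])
    finally show ?thesis by (simp add: E)
  qed
qed

lemma ext_elem_wedge: "ext_elem (wedge x y)"
  unfolding ext_elem_def using wedge_outside by blast

section \<open>Ideals attached to frames\<close>

abbreviation row :: "'k frame \<Rightarrow> nat \<Rightarrow> nat \<Rightarrow> 'k ext" where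
  "row x d i \<equiv> \<lambda>S. x (d, i, S)"

lemma rspan_eq: "rspan x d r = rowspan r (row x d)"
  by (auto simp: rspan_def rowspan_def lincomb_def)

lemma framesD: "x \<in> frames \<Longrightarrow> x (d, i, S) \<noteq> 0 \<Longrightarrow>
   ((d = 2 \<and> i < 3) \<or> (d = 3 \<and> i < 8)) \<and> S \<subseteq> {..<5} \<and> card S = d"
  unfolding frames_def by blast

lemma rowspan_frames:
  assumes "x \<in> frames" shows "rowspan r (row x d) \<subseteq> ext_deg d"
proof
  fix v assume "v \<in> rowspan r (row x d)"
  then obtain c where v: "v = lincomb r c (row x d)" by (auto simp: rowspan_def)
  have "v S = 0" if "\<not> (S \<subseteq> {..<5} \<and> card S = d)" for S
    using framesD[OF assms, of d _ S] that unfolding v lincomb_def by (intro sum.neutral) auto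
  then show "v \<in> ext_deg d" by (auto simp: ext_deg_def ext_elem_def)
qed

lemma hom_comp_id: "v \<in> ext_deg d \<Longrightarrow> hom_comp d v = v"
  by (auto simp: ext_deg_def hom_comp_def fun_eq_iff)

lemma hom_comp_other: "v \<in> ext_deg d \<Longrightarrow> d' \<noteq> d \<Longrightarrow> hom_comp d' v = 0"
  by (auto simp: ext_deg_def hom_comp_def fun_eq_iff)

lemma hom_comp_add: "hom_comp d (x + y) = hom_comp d x + hom_comp d y"
  by (auto simp: hom_comp_def fun_eq_iff)

lemma hom_comp_scale: "hom_comp d (ext_scale c x) = ext_scale c (hom_comp d x)"
  by (auto simp: hom_comp_def ext_scale_def fun_eq_iff)

lemma hom_comp_hom_comp: "hom_comp d (hom_comp e x) = (if d = e then hom_comp d x else 0)"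
  by (auto simp: hom_comp_def fun_eq_iff)

lemma hom_comp_in_ext_deg: "ext_elem x \<Longrightarrow> hom_comp d x \<in> ext_deg d"
  by (auto simp: hom_comp_def ext_deg_def ext_elem_def)

lemma rowspan_zero' [simp]: "0 \<in> rowspan r y" "(\<lambda>_. 0) \<in> rowspan r y"
  using rowspan_zero[of r y] by (simp_all add: zero_fun_def)

lemma Iof_deg:
  assumes "x \<in> frames"
  shows "Iof x \<inter> ext_deg 0 = {0}" "Iof x \<inter> ext_deg 1 = {0}"
    "Iof x \<inter> ext_deg 2 = rowspan 3 (row x 2)" "Iof x \<inter> ext_deg 3 = rowspan 8 (row x 3)"
    "d \<ge> 4 \<Longrightarrow> Iof x \<inter> ext_deg d = ext_deg d"
proof -
  have z: "0 \<in> ext_deg d" "hom_comp d 0 = 0" "ext_elem 0" for d by (auto simp: ext_deg_def ext_elem_def hom_comp_def)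
  have e: "v \<in> ext_deg d \<Longrightarrow> ext_elem v" for d v by (simp add: ext_deg_def)
  show "Iof x \<inter> ext_deg 0 = {0}" "Iof x \<inter> ext_deg 1 = {0}"
    by (auto simp: Iof_def rspan_eq hom_comp_id hom_comp_other z)
  show "Iof x \<inter> ext_deg 2 = rowspan 3 (row x 2)" "Iof x \<inter> ext_deg 3 = rowspan 8 (row x 3)"
  proof -
    have "v \<in> Iof x \<longleftrightarrow> v \<in> rowspan 3 (row x 2)" if v: "v \<in> ext_deg 2" for v
      using hom_comp_other[OF v, of 0] hom_comp_other[OF v, of 1] hom_comp_other[OF v, of 3] hom_comp_id[OF v]
        rowspan_zero[of 8 "row x 3"] by (simp add: Iof_def rspan_eq e[OF v])
    moreover have "v \<in> Iof x \<longleftrightarrow> v \<in> rowspan 8 (row x 3)" if v: "v \<in> ext_deg 3" for v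
      using hom_comp_other[OF v, of 0] hom_comp_other[OF v, of 1] hom_comp_other[OF v, of 2] hom_comp_id[OF v]
        rowspan_zero[of 3 "row x 2"] by (simp add: Iof_def rspan_eq e[OF v])
    ultimately show "Iof x \<inter> ext_deg 2 = rowspan 3 (row x 2)" "Iof x \<inter> ext_deg 3 = rowspan 8 (row x 3)"
      using rowspan_frames[OF assms, of 3 2] rowspan_frames[OF assms, of 8 3] by blast+
  qed
  show "Iof x \<inter> ext_deg d = ext_deg d" if "d \<ge> 4"
  proof -
    have "v \<in> Iof x" if v: "v \<in> ext_deg d" for v
      using e[OF v] hom_comp_other[OF v, of 0] hom_comp_other[OF v, of 1] hom_comp_other[OF v, of 2]
        hom_comp_other[OF v, of 3] \<open>d \<ge> 4\<close> rowspan_zero[of 3 "\<lambda>i S. x (2, i, S)"] rowspan_zero[of 8 "\<lambda>i S. x (3, i, S)"]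
      by (simp add: Iof_def rspan_eq)
    then show ?thesis by blast
  qed
qed

definition deg_sets :: "nat \<Rightarrow> nat set set" where
  "deg_sets d = {S. S \<subseteq> {..<5} \<and> card S = d}"

lemma finite_deg_sets [simp]: "finite (deg_sets d)"
  unfolding deg_sets_def by (rule finite_subset[of _ "Pow {..<5}"]) auto

lemma card_deg_sets: "card (deg_sets d) = 5 choose d"
  unfolding deg_sets_def using n_subsets[of "{..<5::nat}" d] by simp

lemma ext_deg_eq: "ext_deg d = {v. \<forall>S. v S \<noteq> 0 \<longrightarrow> S \<in> deg_sets d}"
  by (auto simp: ext_deg_def ext_elem_def deg_sets_def)

lemma ext_deg_rows:
  "\<exists>z. rows_indep (5 choose d) z UNIV \<and> (ext_deg d :: 'k::field ext set) = rowspan (5 choose d) z"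
proof -
  obtain f where f: "bij_betw f {..<5 choose d} (deg_sets d)"
    using ex_bij_betw_nat_finite[OF finite_deg_sets[of d]] by (auto simp: card_deg_sets atLeast0LessThan)
  then have inj: "inj_on f {..<5 choose d}" and im: "f ` {..<5 choose d} = deg_sets d" by (auto simp: bij_betw_def)
  have ev: "lincomb (5 choose d) c (\<lambda>i. basis_mon (f i)) (f j) = c j" if "j < 5 choose d" for c :: "nat \<Rightarrow> 'k" and j
  proof -
    have "lincomb (5 choose d) c (\<lambda>i. basis_mon (f i)) (f j) = (\<Sum>i<5 choose d. if i = j then c i else 0)"
      unfolding lincomb_def using inj that by (intro sum.cong) (auto simp: basis_mon_def inj_on_def)
    then show ?thesis using that by simp
  qed
  have out: "lincomb (5 choose d) c (\<lambda>i. basis_mon (f i)) S = 0" if "S \<notin> deg_sets d" for c :: "nat \<Rightarrow> 'k" and S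
    unfolding lincomb_def using im that by (intro sum.neutral) (auto simp: basis_mon_def)
  have ind: "rows_indep (5 choose d) (\<lambda>i. basis_mon (f i) :: 'k ext) UNIV"
    unfolding rows_indep_UNIV_iff using ev by (metis zero_fun_apply)
  have "v \<in> rowspan (5 choose d) (\<lambda>i. basis_mon (f i))" if v: "v \<in> ext_deg d" for v :: "'k ext"
  proof -
    have "v = lincomb (5 choose d) (\<lambda>i. v (f i)) (\<lambda>i. basis_mon (f i))"
    proof
      fix S show "v S = lincomb (5 choose d) (\<lambda>i. v (f i)) (\<lambda>i. basis_mon (f i)) S"
      proof (cases "S \<in> deg_sets d")
        case True
        then obtain j where "j < 5 choose d" "S = f j" using im by blast
        then show ?thesis using ev[of j "\<lambda>i. v (f i)"] by simp
      next
        case False then show ?thesis using v out unfolding ext_deg_eq by auto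
      qed
    qed
    then show ?thesis by (auto simp: rowspan_def)
  qed
  moreover have "v \<in> ext_deg d" if "v \<in> rowspan (5 choose d) (\<lambda>i. basis_mon (f i))" for v :: "'k ext"
    using that out unfolding rowspan_def ext_deg_eq by auto
  ultimately show ?thesis using ind by blast
qed

lemma kdim_ext_deg: "kdim (ext_deg d :: 'k::field ext set) = 5 choose d"
  using ext_deg_rows[of d] kdim_rowspan by metis

lemma subspace_ext_deg: "ext.subspace (ext_deg d)"
  by (rule ext.subspaceI) (auto simp: ext_deg_eq ext_scale_def, metis add_0)

lemma kdim_zero: "kdim {0 :: 'k::field ext} = 0"
  unfolding kdim_ext_dim using ext.dim_unique[of "{} :: 'k ext set" "{0}" 0] ext.independent_empty by simp

lemma choose_5: "5 choose 2 = 10" "5 choose 3 = 10" "5 choose 4 = (5::nat)" "5 choose 5 = (1::nat)"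
  by (simp_all add: eval_nat_numeral)

lemma ew_add: "ew i (u + v) = ew i u + ew i v"
  by (auto simp: ew_def fun_eq_iff algebra_simps)

lemma ew_scale: "ew i (\<lambda>S. c * v S) = (\<lambda>S. c * ew i v S)"
  by (auto simp: ew_def fun_eq_iff)

lemma ew_zero: "ew i 0 = 0"
  by (auto simp: ew_def fun_eq_iff)

lemma ew_ext_deg: "v \<in> ext_deg d \<Longrightarrow> ew i v \<in> ext_deg (Suc d)"
  unfolding ext_deg_eq deg_sets_def ew_def by (auto split: if_splits) (metis card.remove finite_lessThan rev_finite_subset)

text \<open>Degrees below 2 are zero and degrees from 4 on are full, so of the ideal property only
  E_1 I_2 in I_3 remains, and of the Hilbert function only the ranks 3 and 8 of the two
  frames.\<close>

theorem pts_over_Hilb_iff: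
  "x \<in> pts_over Hilb \<longleftrightarrow> x \<in> frames \<and> rows_indep 3 (row x 2) UNIV \<and> rows_indep 8 (row x 3) UNIV \<and>
     (\<forall>i<5. \<forall>v\<in>rowspan 3 (row x 2). ew i v \<in> rowspan 8 (row x 3))" (is "_ \<longleftrightarrow> ?R")
proof
  assume "x \<in> pts_over Hilb"
  then have x: "x \<in> frames" and I: "Iof x \<in> Hilb" by (auto simp: pts_over_def)
  have id: "ext_ideal (Iof x)" and dim: "\<And>d. kdim (ext_deg d :: 'a ext set) - kdim (Iof x \<inter> ext_deg d) = hf1572 d"
    using I by (auto simp: Hilb_def hom_ideal_def)
  \<comment> \<open>In degrees 2 and 3 the truncated difference is 7 and 2, hence positive, so it
    determines the dimension.\<close>
  have "kdim (rowspan 3 (row x 2)) = 3"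
    using dim[of 2] unfolding Iof_deg[OF x] kdim_ext_deg choose_5 by (simp add: hf1572_def)
  moreover have "kdim (rowspan 8 (row x 3)) = 8"
    using dim[of 3] unfolding Iof_deg[OF x] kdim_ext_deg choose_5 by (simp add: hf1572_def)
  moreover have "ew i v \<in> rowspan 8 (row x 3)" if "i < 5" "v \<in> rowspan 3 (row x 2)" for i v
  proof -
    have v: "v \<in> Iof x" "v \<in> ext_deg 2" using that(2) unfolding Iof_deg(3)[OF x, symmetric] by auto
    have "ext_elem (basis_mon {i} :: 'a ext)" using that(1) by (auto simp: ext_elem_def basis_mon_def)
    then have "ew i v \<in> Iof x"
      using id v(1) unfolding ext_ideal_def wedge_basis_mon_singleton[OF that(1), symmetric] by blast
    moreover have "ew i v \<in> ext_deg 3" using ew_ext_deg[OF v(2)] by (simp add: numeral_3_eq_3)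
    ultimately show ?thesis using Iof_deg(4)[OF x] by blast
  qed
  ultimately show ?R using x rows_indep_if_kdim by blast
next
  assume R: ?R
  then have x: "x \<in> frames" by simp
  have z: "ext_elem (0::'a ext)" "hom_comp d 0 = (0::'a ext)" for d
    by (auto simp: ext_elem_def hom_comp_def)
  have low: "y S = 0" if "y \<in> Iof x" "card S < 2" for y S
  proof -
    have "hom_comp 0 y S = 0" "hom_comp 1 y S = 0" using that by (auto simp: Iof_def)
    moreover have "card S = 0 \<or> card S = 1" using that by auto
    ultimately show ?thesis by (auto simp: hom_comp_def)
  qed
  \<comment> \<open>Both products of \<open>y\<close> with \<open>z\<close> have these coefficients,
    so one argument serves left and right multiplication.\<close>
  have w: "w \<in> Iof x" if y: "y \<in> Iof x" and w: "ext_elem w"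
    "\<And>U. U \<subseteq> {..<5} \<Longrightarrow> card U < 2 \<Longrightarrow> w U = 0"
    "\<And>U. U \<subseteq> {..<5} \<Longrightarrow> card U = 2 \<Longrightarrow> w U = z {} * y U"
    "\<And>U. U \<subseteq> {..<5} \<Longrightarrow> card U = 3 \<Longrightarrow> w U = z {} * y U + (\<Sum>i<5. z {i} * ew i y U)" for y w and z :: "'a ext"
  proof -
    have y2: "hom_comp 2 y \<in> rowspan 3 (row x 2)" and y3: "hom_comp 3 y \<in> rowspan 8 (row x 3)"
      and ye: "ext_elem y" using y by (auto simp: Iof_def rspan_eq)
    have w0: "w U = 0" if "\<not> U \<subseteq> {..<5}" for U using w(1) that unfolding ext_elem_def by blast
    have y0: "y U = 0" if "\<not> U \<subseteq> {..<5}" for U using ye that unfolding ext_elem_def by blast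
    have "w U = 0" if "card U < 2" for U using w(2) w0 that by blast
    then have "hom_comp 0 w = 0" "hom_comp 1 w = 0"
      by (auto simp: hom_comp_def fun_eq_iff)
    moreover have "hom_comp 2 w = (\<lambda>U. z {} * hom_comp 2 y U)"
    proof
      fix U show "hom_comp 2 w U = z {} * hom_comp 2 y U"
        using w(3)[of U] w0[of U] y0[of U] by (cases "U \<subseteq> {..<5}") (auto simp: hom_comp_def)
    qed
    moreover have "hom_comp 3 w = (\<lambda>U. z {} * hom_comp 3 y U) + lincomb 5 (\<lambda>i. z {i}) (\<lambda>i. ew i (hom_comp 2 y))"
    proof
      fix U
      show "hom_comp 3 w U = ((\<lambda>U. z {} * hom_comp 3 y U) + lincomb 5 (\<lambda>i. z {i}) (\<lambda>i. ew i (hom_comp 2 y))) U"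
      proof (cases "U \<subseteq> {..<5} \<and> card U = 3")
        case True
        then have "finite U" by (auto intro: rev_finite_subset)
        then have "ew i (hom_comp 2 y) U = ew i y U" for i using True by (simp add: ew_def hom_comp_def)
        then show ?thesis using True w(4) by (simp add: hom_comp_def lincomb_def)
      next
        case False
        have "ew i (hom_comp 2 y) \<in> ext_deg 3" for i
          using ew_ext_deg[OF hom_comp_in_ext_deg[OF ye]] by (metis numeral_2_eq_2 numeral_3_eq_3)
        then have "ew i (hom_comp 2 y) U = 0" for i using False by (auto simp: ext_deg_eq deg_sets_def)
        then show ?thesis using False w0[of U] y0[of U]
          by (cases "U \<subseteq> {..<5}") (auto simp: hom_comp_def lincomb_def)
      qed
    qed
    moreover have "lincomb 5 (\<lambda>i. z {i}) (\<lambda>i. ew i (hom_comp 2 y)) \<in> rowspan 8 (row x 3)"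
    proof (rule lincomb_in_closed[OF rowspan_zero rowspan_add rowspan_scale])
      show "ew i (hom_comp 2 y) \<in> rowspan 8 (row x 3)" if "i < 5" for i using R y2 that by blast
    qed
    ultimately show ?thesis using w(1) y2 y3 by (simp add: Iof_def rspan_eq rowspan_scale rowspan_add)
  qed
  have "ext_ideal (Iof x)"
    unfolding ext_ideal_def
  proof (intro conjI ballI allI impI)
    show "Iof x \<subseteq> {x. ext_elem x}" by (auto simp: Iof_def)
    show "0 \<in> Iof x" by (simp add: Iof_def z rspan_eq)
    fix y assume y: "y \<in> Iof x"
    show "y + y' \<in> Iof x" if "y' \<in> Iof x" for y'
    proof -
      have "ext_elem (y + y')" using y that unfolding Iof_def ext_elem_def by (metis (mono_tags, lifting) add_0 mem_Collect_eq plus_fun_apply)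
      then show ?thesis using y that by (simp add: Iof_def hom_comp_add rspan_eq rowspan_add)
    qed
    show "ext_scale c y \<in> Iof x" for c
    proof -
      have "ext_elem (ext_scale c y)" using y by (auto simp: Iof_def ext_elem_def ext_scale_def)
      then show ?thesis using y rowspan_scale[of _ 3 "row x 2" c] rowspan_scale[of _ 8 "row x 3" c]
        unfolding ext_scale_def[symmetric] by (simp add: Iof_def hom_comp_scale rspan_eq)
    qed
    fix z :: "'a ext"
    show "wedge y z \<in> Iof x" "wedge z y \<in> Iof x"
      by (rule w[OF y ext_elem_wedge]; rule wedge_low_right[of y, OF low[OF y]]; assumption)+
  qed
  moreover have "hom_comp d y \<in> Iof x" if "y \<in> Iof x" for y d
  proof -
    have "ext_elem (hom_comp d y)" using that by (auto simp: Iof_def ext_elem_def hom_comp_def)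
    then show ?thesis using that by (auto simp: Iof_def hom_comp_hom_comp rspan_eq)
  qed
  moreover have "kdim (ext_deg d :: 'a ext set) - kdim (Iof x \<inter> ext_deg d) = hf1572 d" for d
  proof -
    consider "d = 0" | "d = 1" | "d = 2" | "d = 3" | "d \<ge> 4" by linarith
    then show ?thesis
      using R by cases (auto simp: Iof_deg[OF x] Iof_deg(2)[OF x, simplified] kdim_ext_deg choose_5 hf1572_def kdim_zero kdim_rowspan)
  qed
  ultimately show "x \<in> pts_over Hilb" using x by (auto simp: pts_over_def Hilb_def hom_ideal_def)
qed

text \<open>By homogeneity the ideal is the sum of its graded pieces, and bases of I_2 and I_3 are
  the rows of a frame. Statements about points can therefore be proved on frames.\<close>

lemma Hilb_frame:
  assumes I: "I \<in> Hilb"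
  obtains x where "x \<in> frames" "Iof x = I"
proof -
  have id: "ext_ideal I" and hom: "\<And>x d. x \<in> I \<Longrightarrow> hom_comp d x \<in> I"
    and dim: "\<And>d. kdim (ext_deg d :: 'a ext set) - kdim (I \<inter> ext_deg d) = hf1572 d"
    using I by (auto simp: Hilb_def hom_ideal_def)
  have "ext.subspace I" using id unfolding ext_ideal_def by (auto intro: ext.subspaceI)
  then have sub: "ext.subspace (I \<inter> ext_deg d)" for d using subspace_ext_deg by (rule ext.subspace_inter)
  have rows: "\<exists>y. rows_indep (kdim (I \<inter> ext_deg d)) y UNIV \<and> I \<inter> ext_deg d = rowspan (kdim (I \<inter> ext_deg d)) y" for d
  proof -
    obtain z where z: "(ext_deg d :: 'a ext set) = rowspan (5 choose d) z" using ext_deg_rows[of d] by metis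
    then have "I \<inter> ext_deg d \<subseteq> rowspan (5 choose d) z" by auto
    from subspace_rows[OF sub this] show ?thesis by metis
  qed
  have k: "kdim (I \<inter> ext_deg 0) = 0 \<or> kdim (I \<inter> ext_deg 0) = 0" "kdim (I \<inter> ext_deg 1) = 0"
    "kdim (I \<inter> ext_deg 2) = 3" "kdim (I \<inter> ext_deg 3) = 8"
    using dim[of 0] dim[of 1] dim[of 2] dim[of 3] by (auto simp: kdim_ext_deg hf1572_def choose_5)
  have low: "I \<inter> ext_deg 0 = {0}" "I \<inter> ext_deg 1 = {0}"
    using rows[of 0] rows[of 1] k by (auto simp: rowspan_def lincomb_def zero_fun_def)
  \<comment> \<open>A truncated difference 0 says only that I_d has at least the dimension of E_d;
    that many independent elements of I_d already span E_d.\<close>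
  have high: "ext_deg d \<subseteq> I" if "d \<ge> 4" for d
  proof -
    obtain z where z: "rows_indep (5 choose d) z UNIV" "(ext_deg d :: 'a ext set) = rowspan (5 choose d) z"
      using ext_deg_rows[of d] by metis
    obtain y where y: "rows_indep (kdim (I \<inter> ext_deg d)) y UNIV" "I \<inter> ext_deg d = rowspan (kdim (I \<inter> ext_deg d)) y"
      using rows by blast
    have "5 choose d \<le> kdim (I \<inter> ext_deg d)" using dim[of d] that by (simp add: kdim_ext_deg hf1572_def)
    then have y': "rows_indep (5 choose d) y UNIV"
      unfolding rows_indep_UNIV_iff
    proof (intro allI impI)
      fix c i assume le: "5 choose d \<le> kdim (I \<inter> ext_deg d)" and c: "lincomb (5 choose d) c y = 0" and i: "i < 5 choose d"
      have "lincomb (kdim (I \<inter> ext_deg d)) (\<lambda>i. if i < 5 choose d then c i else 0) y = lincomb (5 choose d) c y"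
        unfolding lincomb_def using le
        by (intro ext sum.mono_neutral_cong_right) auto
      then have "(\<lambda>i. if i < 5 choose d then c i else 0) i = 0"
        using y(1) c i le unfolding rows_indep_UNIV_iff by (metis (mono_tags, lifting) order_less_le_trans)
      then show "c i = 0" using i by simp
    qed
    have mem: "y i \<in> rowspan (5 choose d) z" if "i < 5 choose d" for i
    proof -
      have "y i \<in> rowspan (kdim (I \<inter> ext_deg d)) y" using that \<open>5 choose d \<le> _\<close> by (intro row_in_rowspan) simp
      then have "y i \<in> I \<inter> ext_deg d" using y(2) by simp
      then show ?thesis using z(2) by auto
    qed
    have "rowspan (5 choose d) y = ext_deg d" using rowspan_eqI[OF y' mem] z(2) by simp
    moreover have "rowspan (5 choose d) y \<subseteq> rowspan (kdim (I \<inter> ext_deg d)) y"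
      using \<open>5 choose d \<le> _\<close> by (intro rowspan_subsetI row_in_rowspan) simp
    ultimately show ?thesis using y(2) by auto
  qed
  obtain y where y: "I \<inter> ext_deg 2 = rowspan 3 y" using rows[of 2] k by auto
  obtain w where w: "I \<inter> ext_deg 3 = rowspan 8 w" using rows[of 3] k by auto
  define x where "x = (\<lambda>(d::nat,i,S). if d = 2 \<and> i < 3 then y i S else if d = 3 \<and> i < 8 then w i S else (0::'a))"
  have yd: "y i \<in> ext_deg 2" if "i < 3" for i using row_in_rowspan[OF that, of y] y by auto
  have wd: "w i \<in> ext_deg 3" if "i < 8" for i using row_in_rowspan[OF that, of w] w by auto
  have xf: "x \<in> frames"
    unfolding frames_def x_def using yd wd
    by (auto simp: ext_deg_eq deg_sets_def split: if_splits) (meson lessThan_iff subset_iff)+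
  have r: "rowspan 3 (row x 2) = rowspan 3 y" "rowspan 8 (row x 3) = rowspan 8 w"
    by (auto intro!: rowspan_cong simp: x_def)
  have I0: "0 \<in> I" and Ie: "\<And>v. v \<in> I \<Longrightarrow> ext_elem v" and Iadd: "\<And>u v. u \<in> I \<Longrightarrow> v \<in> I \<Longrightarrow> u + v \<in> I"
    using id unfolding ext_ideal_def by auto
  have "v \<in> I \<longleftrightarrow> v \<in> Iof x" for v
  proof
    assume v: "v \<in> I"
    have h: "hom_comp d v \<in> I \<inter> ext_deg d" for d using hom[OF v] hom_comp_in_ext_deg[OF Ie[OF v]] by blast
    show "v \<in> Iof x" using h[of 0] h[of 1] h[of 2] h[of 3] Ie[OF v] low y w
      by (auto simp: Iof_def rspan_eq r)
  next
    assume v: "v \<in> Iof x"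
    then have e: "ext_elem v" by (simp add: Iof_def)
    have h: "hom_comp d v \<in> I" for d
    proof -
      consider "d = 0" | "d = 1" | "d = 2" | "d = 3" | "d \<ge> 4" by linarith
      then show ?thesis
      proof cases
        case 5 then show ?thesis using high hom_comp_in_ext_deg[OF e] by blast
      qed (use v I0 y w in \<open>auto simp: Iof_def rspan_eq r\<close>)
    qed
    have "v = hom_comp 0 v + hom_comp 1 v + hom_comp 2 v + hom_comp 3 v + hom_comp 4 v + hom_comp 5 v"
    proof
      fix S
      show "v S = (hom_comp 0 v + hom_comp 1 v + hom_comp 2 v + hom_comp 3 v + hom_comp 4 v + hom_comp 5 v) S"
      proof (cases "v S = 0")
        case False
        then have "S \<subseteq> {..<5}" using e by (auto simp: ext_elem_def)
        then have "card S \<le> 5" using card_mono[of "{..<5::nat}" S] by simp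
        then have "card S \<in> {0,1,2,3,4,5}" by auto
        then show ?thesis by (auto simp: hom_comp_def)
      qed (simp add: hom_comp_def)
    qed
    then show "v \<in> I" using h Iadd by metis
  qed
  then show thesis using that[OF xf] by blast
qed

lemma Iof_eq_iff:
  assumes "x \<in> frames" "y \<in> frames"
  shows "Iof x = Iof y \<longleftrightarrow> rowspan 3 (row x 2) = rowspan 3 (row y 2) \<and> rowspan 8 (row x 3) = rowspan 8 (row y 3)"
proof
  assume eq: "Iof x = Iof y"
  show "rowspan 3 (row x 2) = rowspan 3 (row y 2) \<and> rowspan 8 (row x 3) = rowspan 8 (row y 3)"
    unfolding Iof_deg(3,4)[OF assms(1), symmetric] Iof_deg(3,4)[OF assms(2), symmetric] eq by simp
qed (simp add: Iof_def rspan_eq)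

section \<open>The Zariski topology of the Hilbert scheme\<close>

definition frame_size :: "nat \<Rightarrow> nat" where
  "frame_size d = (if d = 2 then 3 else if d = 3 then 8 else 0)"

lemma frame_size_simps [simp]: "frame_size 2 = 3" "frame_size 3 = 8"
  by (simp_all add: frame_size_def)

text \<open>Change of the bases of I_2 and I_3 by a 3 x 3 and an 8 x 8 matrix. Invertibility is
  imposed separately, so that the entries range over an affine space.\<close>

definition frame_act :: "(nat \<times> nat \<times> nat \<Rightarrow> 'k::field) \<Rightarrow> 'k frame \<Rightarrow> 'k frame" where
  "frame_act c x = (\<lambda>(d,i,S). if i < frame_size d then \<Sum>j<frame_size d. c (d,i,j) * x (d,j,S) else 0)"

lemma row_frame_act: "i < frame_size d \<Longrightarrow> row (frame_act c x) d i = lincomb (frame_size d) (\<lambda>j. c (d,i,j)) (row x d)"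
  by (simp add: frame_act_def lincomb_def)

lemma frame_act_cong:
  "(\<And>d i j. i < frame_size d \<Longrightarrow> j < frame_size d \<Longrightarrow> c (d,i,j) = c' (d,i,j)) \<Longrightarrow> frame_act c x = frame_act c' x"
  by (auto simp: frame_act_def fun_eq_iff)

lemma frame_act_frames: "x \<in> frames \<Longrightarrow> frame_act c x \<in> frames"
  unfolding frames_def
proof (intro CollectI allI impI)
  fix d i S
  assume x: "x \<in> {x. \<forall>d i S. x (d, i, S) \<noteq> 0 \<longrightarrow> (d = 2 \<and> i < 3 \<or> d = 3 \<and> i < 8) \<and> S \<subseteq> {..<5} \<and> card S = d}"
    and ne: "frame_act c x (d, i, S) \<noteq> 0"
  then have i: "i < frame_size d" and "(\<Sum>j<frame_size d. c (d,i,j) * x (d,j,S)) \<noteq> 0"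
    by (auto simp: frame_act_def split: if_splits)
  then obtain j where "x (d,j,S) \<noteq> 0" by (metis (no_types, lifting) mult_zero_right sum.neutral)
  then have "(d = 2 \<or> d = 3) \<and> S \<subseteq> {..<5} \<and> card S = d" using x by blast
  then show "(d = 2 \<and> i < 3 \<or> d = 3 \<and> i < 8) \<and> S \<subseteq> {..<5} \<and> card S = d" using i by auto
qed

lemma frame_act_polyfun: "(\<And>v. (\<lambda>a. c a v) \<in> polyfun) \<Longrightarrow> (\<And>v. (\<lambda>a. x a v) \<in> polyfun) \<Longrightarrow>
    (\<lambda>a. frame_act (c a) (x a) v) \<in> polyfun"
  by (cases v) (auto simp: frame_act_def intro!: polyfun.intros polyfun_if)

lemma pts_Hilb_frames: "x \<in> pts_over Hilb \<Longrightarrow> x \<in> frames"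
  and pts_Hilb_rows: "x \<in> pts_over Hilb \<Longrightarrow> rows_indep (frame_size d) (row x d) UNIV"
  by (auto simp: pts_over_Hilb_iff frame_size_def rows_indep_def)

lemma pts_over_mono: "C \<subseteq> D \<Longrightarrow> pts_over C \<subseteq> pts_over D"
  by (auto simp: pts_over_def)

lemma same_pointI:
  assumes z: "z \<in> pts_over Hilb" and w: "w \<in> frames"
    and mem: "\<And>i. i < 3 \<Longrightarrow> row w 2 i \<in> rowspan 3 (row z 2)" "\<And>i. i < 8 \<Longrightarrow> row w 3 i \<in> rowspan 8 (row z 3)"
    and ind: "rows_indep 3 (row w 2) UNIV" "rows_indep 8 (row w 3) UNIV"
  shows "w \<in> pts_over Hilb \<and> Iof w = Iof z"
proof -
  have "rowspan 3 (row w 2) = rowspan 3 (row z 2)" "rowspan 8 (row w 3) = rowspan 8 (row z 3)"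
    using rowspan_eqI[OF ind(1) mem(1)] rowspan_eqI[OF ind(2) mem(2)] by auto
  then have "Iof w = Iof z" using Iof_eq_iff[OF w pts_Hilb_frames[OF z]] by simp
  then show ?thesis using z w by (auto simp: pts_over_def)
qed

text \<open>Independence of the rows of \<open>frame_act c x\<close> for one \<open>x\<close> makes
  the matrices in \<open>c\<close> invertible, and then they carry the frames of any point to frames
  of the same point.\<close>

lemma frame_act_pts:
  assumes z: "z \<in> pts_over Hilb"
    and ind: "\<And>d. rows_indep (frame_size d) (row (frame_act c x) d) UNIV"
  shows "frame_act c z \<in> pts_over Hilb \<and> Iof (frame_act c z) = Iof z"
proof -
  have mem: "row (frame_act c z) d i \<in> rowspan (frame_size d) (row z d)" if "i < frame_size d" for d i
    unfolding row_frame_act[OF that] by (auto simp: rowspan_def)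
  have ind': "rows_indep (frame_size d) (row (frame_act c z) d) UNIV" for d
    unfolding rows_indep_UNIV_iff
  proof (intro allI impI)
    fix e i assume e: "lincomb (frame_size d) e (row (frame_act c z) d) = 0" and i: "i < frame_size d"
    have L: "lincomb (frame_size d) e (row (frame_act c y) d) = lincomb (frame_size d) (\<lambda>j. \<Sum>i<frame_size d. e i * c (d,i,j)) (row y d)" for y
      by (rule lincomb_lincomb) (rule row_frame_act)
    have "\<forall>j<frame_size d. (\<Sum>i<frame_size d. e i * c (d,i,j)) = 0"
      using pts_Hilb_rows[OF z, of d] e unfolding L rows_indep_UNIV_iff by blast
    then have "lincomb (frame_size d) e (row (frame_act c x) d) = 0"
      unfolding L by (auto simp: lincomb_def fun_eq_iff)
    then show "e i = 0" using ind[of d] i unfolding rows_indep_UNIV_iff by blast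
  qed
  show ?thesis
    using mem[of _ 2] mem[of _ 3] ind'[of 2] ind'[of 3]
    by (intro same_pointI[OF z frame_act_frames[OF pts_Hilb_frames[OF z]]]) auto
qed

lemma same_point_act:
  assumes "x \<in> pts_over Hilb" "y \<in> frames" "Iof y = Iof x"
  obtains c where "y = frame_act c x"
proof -
  have y: "y \<in> pts_over Hilb" using assms by (auto simp: pts_over_def)
  have eq: "rowspan 3 (row y 2) = rowspan 3 (row x 2)" "rowspan 8 (row y 3) = rowspan 8 (row x 3)"
    using assms Iof_eq_iff[OF assms(2) pts_Hilb_frames[OF assms(1)]] by auto
  have "\<exists>c. row y d i = lincomb (frame_size d) c (row x d)" if "i < frame_size d" for d i
  proof -
    have "d = 2 \<or> d = 3" using that by (auto simp: frame_size_def split: if_splits)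
    then have "row y d i \<in> rowspan (frame_size d) (row x d)"
      using row_in_rowspan[of i "frame_size d" "row y d"] that eq by auto
    then show ?thesis by (auto simp: rowspan_def)
  qed
  note ex = this
  define c where "c d i = (SOME e. row y d i = lincomb (frame_size d) e (row x d))" for d i
  have c: "row y d i = lincomb (frame_size d) (c d i) (row x d)" if "i < frame_size d" for d i
    unfolding c_def by (rule someI_ex[OF ex[OF that]])
  have "y = frame_act (\<lambda>(d,i,j). c d i j) x"
  proof
    fix v :: "nat \<times> nat \<times> nat set"
    obtain d i S where v: "v = (d,i,S)" by (cases v)
    show "y v = frame_act (\<lambda>(d,i,j). c d i j) x v"
    proof (cases "i < frame_size d")
      case True
      then show ?thesis using fun_cong[OF c[OF True], of S] by (simp add: v frame_act_def lincomb_def)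
    next
      case False
      then have "y (d,i,S) = 0" using framesD[OF assms(2), of d i S] by (auto simp: frame_size_def split: if_splits)
      then show ?thesis using False by (simp add: v frame_act_def)
    qed
  qed
  then show thesis using that by blast
qed

lemma H_closedI:
  assumes "C \<subseteq> Hilb"
    and op: "\<And>x. x \<in> pts_over Hilb \<Longrightarrow> x \<notin> pts_over C \<Longrightarrow>
      \<exists>h\<in>polyfun. h x \<noteq> 0 \<and> (\<forall>y\<in>pts_over C. h y = 0)"
  shows "H_closed C"
proof -
  define P where "P = {p \<in> polyfun. \<forall>y\<in>pts_over C. p y = 0}"
  have "pts_over C = {x. \<forall>p\<in>P. p x = 0} \<inter> pts_over Hilb"
    using op pts_over_mono[OF assms(1)] by (auto simp: P_def)
  moreover have "zariski_closed {x. \<forall>p\<in>P. p x = 0}" unfolding zariski_closed_def P_def by blast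
  ultimately show ?thesis using assms(1) unfolding H_closed_def by blast
qed

lemma H_closedD:
  assumes "H_closed C" "x \<in> pts_over Hilb" "x \<notin> pts_over C"
  obtains p where "p \<in> polyfun" "p x \<noteq> 0" "\<And>y. y \<in> pts_over C \<Longrightarrow> p y = 0"
proof -
  obtain Z where Z: "zariski_closed Z" "pts_over C = Z \<inter> pts_over Hilb" using assms(1) unfolding H_closed_def by blast
  then obtain P where "P \<subseteq> polyfun" "Z = {x. \<forall>p\<in>P. p x = 0}" unfolding zariski_closed_def by blast
  then show thesis using Z(2) assms(2,3) that by blast
qed

lemma H_closed_subset: "H_closed C \<Longrightarrow> C \<subseteq> Hilb"
  by (simp add: H_closed_def)

section \<open>Closures and two kinds of closed conditions\<close>

definition H_closure :: "'k::field ext set set \<Rightarrow> 'k ext set set" where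
  "H_closure X = \<Inter>{D. H_closed D \<and> X \<subseteq> D}"

lemma H_closure_subset: "X \<subseteq> H_closure X"
  by (auto simp: H_closure_def)

lemma H_closure_minimal: "H_closed D \<Longrightarrow> X \<subseteq> D \<Longrightarrow> H_closure X \<subseteq> D"
  by (auto simp: H_closure_def)

lemma H_closed_Hilb: "H_closed Hilb"
  by (rule H_closedI) auto

lemma H_closed_closure:
  assumes "X \<subseteq> Hilb" shows "H_closed (H_closure X)"
proof (rule H_closedI)
  show "H_closure X \<subseteq> Hilb" by (rule H_closure_minimal[OF H_closed_Hilb assms])
  fix x assume x: "x \<in> pts_over Hilb" "x \<notin> pts_over (H_closure X)"
  then obtain D where D: "H_closed D" "X \<subseteq> D" "Iof x \<notin> D" by (auto simp: pts_over_def H_closure_def)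
  then have "x \<notin> pts_over D" by (auto simp: pts_over_def)
  then obtain p where "p \<in> polyfun" "p x \<noteq> 0" "\<And>y. y \<in> pts_over D \<Longrightarrow> p y = 0"
    using H_closedD[OF D(1) x(1)] by metis
  then show "\<exists>h\<in>polyfun. h x \<noteq> 0 \<and> (\<forall>y\<in>pts_over (H_closure X). h y = 0)"
    using pts_over_mono[OF H_closure_minimal[OF D(1,2)]] by blast
qed

text \<open>A polynomial on frames need not be invariant under base change; testing it on all frames
  of a point makes the condition depend on the point alone.\<close>

definition vanishing_locus :: "('k::field frame \<Rightarrow> 'k) \<Rightarrow> 'k ext set set" where
  "vanishing_locus p = {I \<in> Hilb. \<forall>x\<in>frames. Iof x = I \<longrightarrow> p x = 0}"

text \<open>If \<open>p\<close> is nonzero at the frame \<open>frame_act c x\<close>, then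
  \<open>p\<close> composed with this base change is nonzero at \<open>x\<close> and vanishes at all
  frames over the locus.\<close>

lemma H_closed_vanishing_locus:
  assumes p: "p \<in> polyfun" shows "H_closed (vanishing_locus p)"
proof (rule H_closedI)
  show "vanishing_locus p \<subseteq> Hilb" by (auto simp: vanishing_locus_def)
  fix x assume x: "x \<in> pts_over Hilb" "x \<notin> pts_over (vanishing_locus p)"
  then obtain y where y: "y \<in> frames" "Iof y = Iof x" "p y \<noteq> 0" by (auto simp: pts_over_def vanishing_locus_def)
  then obtain c where c: "y = frame_act c x" using same_point_act[OF x(1)] by metis
  have yH: "y \<in> pts_over Hilb" using x y by (auto simp: pts_over_def)
  show "\<exists>h\<in>polyfun. h x \<noteq> 0 \<and> (\<forall>z\<in>pts_over (vanishing_locus p). h z = 0)"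
  proof (intro bexI conjI ballI)
    show "(\<lambda>z. p (frame_act c z)) \<in> polyfun"
      by (rule polyfun_subst[OF p]) (auto intro: frame_act_polyfun polyfun.intros)
    show "p (frame_act c x) \<noteq> 0" using y c by simp
    fix z assume z: "z \<in> pts_over (vanishing_locus p)"
    then have "z \<in> pts_over Hilb" by (auto simp: pts_over_def vanishing_locus_def)
    from frame_act_pts[OF this pts_Hilb_rows[OF yH, unfolded c]]
    show "p (frame_act c z) = 0" using z by (auto simp: pts_over_def vanishing_locus_def)
  qed
qed

text \<open>A Schubert condition: the graded piece of degree \<open>d\<close> meets the coordinate
  subspace on which all coordinates in \<open>A\<close> vanish.\<close>

definition meets :: "nat \<Rightarrow> nat set set \<Rightarrow> 'k::field ext set set" where
  "meets d A = {I \<in> Hilb. \<exists>v\<in>I \<inter> ext_deg d. v \<noteq> 0 \<and> (\<forall>S\<in>A. v S = 0)}"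

lemma Iof_inter_ext_deg:
  "x \<in> frames \<Longrightarrow> d = 2 \<or> d = 3 \<Longrightarrow> Iof x \<inter> ext_deg d = rowspan (frame_size d) (row x d)"
  using Iof_deg(3,4)[of x] by auto

lemma meets_iff:
  assumes x: "x \<in> pts_over Hilb" and d: "d = 2 \<or> d = 3"
  shows "Iof x \<in> meets d A \<longleftrightarrow> \<not> rows_indep (frame_size d) (row x d) A"
proof -
  note xf = pts_Hilb_frames[OF x]
  have I: "Iof x \<in> Hilb" using x by (simp add: pts_over_def)
  show ?thesis
  proof
    assume "Iof x \<in> meets d A"
    then have "\<exists>v\<in>Iof x \<inter> ext_deg d. v \<noteq> 0 \<and> (\<forall>S\<in>A. v S = 0)" by (simp add: meets_def)
    then obtain v where "v \<in> rowspan (frame_size d) (row x d)" "v \<noteq> 0" "\<forall>S\<in>A. v S = 0"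
      unfolding Iof_inter_ext_deg[OF xf d] by blast
    then obtain c where c: "v = lincomb (frame_size d) c (row x d)" by (auto simp: rowspan_def)
    show "\<not> rows_indep (frame_size d) (row x d) A"
    proof
      assume "rows_indep (frame_size d) (row x d) A"
      then have "\<forall>i<frame_size d. c i = 0" using \<open>\<forall>S\<in>A. v S = 0\<close> unfolding c lincomb_def rows_indep_def by blast
      then show False using \<open>v \<noteq> 0\<close> unfolding c by (auto simp: lincomb_def fun_eq_iff)
    qed
  next
    assume "\<not> rows_indep (frame_size d) (row x d) A"
    then obtain c i where c: "\<forall>S\<in>A. lincomb (frame_size d) c (row x d) S = 0" "i < frame_size d" "c i \<noteq> 0"
      unfolding rows_indep_def lincomb_def by blast
    then have "lincomb (frame_size d) c (row x d) \<noteq> 0" using pts_Hilb_rows[OF x, of d] unfolding rows_indep_UNIV_iff by blast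
    moreover have "lincomb (frame_size d) c (row x d) \<in> rowspan (frame_size d) (row x d)" by (auto simp: rowspan_def)
    ultimately show "Iof x \<in> meets d A" using c(1) I
      unfolding meets_def Iof_inter_ext_deg[OF xf d, symmetric] by blast
  qed
qed

lemma rows_indep_open_subst:
  fixes x :: "('v \<Rightarrow> 'k::field) \<Rightarrow> nat \<Rightarrow> 's \<Rightarrow> 'k"
  assumes "rows_indep r (x a0) A" "\<And>i S. (\<lambda>a. x a i S) \<in> polyfun"
  obtains h where "h \<in> polyfun" "h a0 \<noteq> 0" "\<And>a. h a \<noteq> 0 \<Longrightarrow> rows_indep r (x a) A"
proof -
  obtain h where h: "h \<in> polyfun" "h (\<lambda>(i,S). x a0 i S) \<noteq> 0"
    "\<And>z. h (\<lambda>(i,S). z i S) \<noteq> 0 \<Longrightarrow> rows_indep r z A" using rows_indep_open[OF assms(1)] by blast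
  show thesis
  proof (rule that)
    show "(\<lambda>a. h (\<lambda>(i,S). x a i S)) \<in> polyfun"
      by (rule polyfun_subst[OF h(1)]) (auto simp: case_prod_beta assms(2))
    show "h (\<lambda>(i,S). x a0 i S) \<noteq> 0" by (rule h(2))
    show "rows_indep r (x a) A" if "h (\<lambda>(i,S). x a i S) \<noteq> 0" for a using h(3) that by blast
  qed
qed

lemma H_closed_meets:
  assumes d: "d = 2 \<or> d = 3" shows "H_closed (meets d A)"
proof (rule H_closedI)
  show "meets d A \<subseteq> Hilb" by (auto simp: meets_def)
  fix x :: "nat \<times> nat \<times> nat set \<Rightarrow> 'a" assume x: "x \<in> pts_over Hilb" "x \<notin> pts_over (meets d A)"
  then have "rows_indep (frame_size d) (row x d) A"
    using meets_iff[OF x(1) d, of A] by (auto simp: pts_over_def)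
  then obtain h where h: "h \<in> polyfun" "h x \<noteq> 0" "\<And>a. h a \<noteq> 0 \<Longrightarrow> rows_indep (frame_size d) (row a d) A"
    by (rule rows_indep_open_subst[of "frame_size d" "\<lambda>x. row x d" x A]) (auto intro: polyfun.intros)
  have "h y = 0" if y: "y \<in> pts_over (meets d A)" for y
  proof -
    have "y \<in> pts_over Hilb" using y by (auto simp: pts_over_def meets_def)
    then show ?thesis using meets_iff[of y d A] d y h(3)[of y] by (auto simp: pts_over_def)
  qed
  then show "\<exists>h\<in>polyfun. h x \<noteq> 0 \<and> (\<forall>y\<in>pts_over (meets d A). h y = 0)" using h by blast
qed

text \<open>The matrices that turn \<open>x\<close> into another frame form an open set, nonempty
  because of the identity; over an infinite field it meets the set where \<open>p\<close> is
  nonzero.\<close>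

lemma generic_frame_act:
  fixes x :: "'k::field frame"
  assumes inf: "infinite (UNIV :: 'k set)" and x: "x \<in> pts_over Hilb"
    and p: "p \<in> polyfun" "p c0 \<noteq> 0"
  obtains c where "p c \<noteq> 0" "frame_act c x \<in> pts_over Hilb" "Iof (frame_act c x) = Iof x"
proof -
  define id where "id = (\<lambda>(d::nat,i::nat,j). if i = j then 1 else 0::'k)"
  have "row (frame_act id x) d i = row x d i" if "i < frame_size d" for d i
  proof
    fix S
    have "(\<Sum>j<frame_size d. (if i = j then 1 else 0) * x (d,j,S)) = (\<Sum>j<frame_size d. if j = i then x (d,j,S) else 0)"
      by (intro sum.cong) auto
    then show "row (frame_act id x) d i S = row x d i S" using that by (simp add: frame_act_def id_def)
  qed
  then have "rows_indep (frame_size d) (row (frame_act id x) d) UNIV" for d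
    using pts_Hilb_rows[OF x, of d] rows_indep_cong[of "frame_size d" UNIV "row (frame_act id x) d" "row x d"]
    by (metis fun_cong)
  note ind = this
  have pol: "(\<lambda>c. row (frame_act c x) d i S) \<in> polyfun" for d i S
    by (rule frame_act_polyfun) (auto intro: polyfun.intros)
  obtain h2 where h2: "h2 \<in> polyfun" "h2 id \<noteq> 0" "\<And>c. h2 c \<noteq> 0 \<Longrightarrow> rows_indep 3 (row (frame_act c x) 2) UNIV"
    using rows_indep_open_subst[of 3 "\<lambda>c. row (frame_act c x) 2" id UNIV] ind[of 2] pol by auto
  obtain h3 where h3: "h3 \<in> polyfun" "h3 id \<noteq> 0" "\<And>c. h3 c \<noteq> 0 \<Longrightarrow> rows_indep 8 (row (frame_act c x) 3) UNIV"
    using rows_indep_open_subst[of 8 "\<lambda>c. row (frame_act c x) 3" id UNIV] ind[of 3] pol by auto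
  have "(\<lambda>c. h2 c * h3 c) \<in> polyfun" "h2 id * h3 id \<noteq> 0" using h2 h3 by (auto intro: polyfun.intros)
  then obtain c where c: "p c \<noteq> 0" "h2 c * h3 c \<noteq> 0" using polyfun_common_nonzero[OF inf p(1) _ p(2)] by blast
  have ind': "rows_indep (frame_size d) (row (frame_act c x) d) UNIV" for d
    using h2(3)[of c] h3(3)[of c] c(2) by (cases "d = 2 \<or> d = 3") (auto simp: frame_size_def rows_indep_def[of 0])
  show thesis using that c(1) frame_act_pts[OF x ind'] by blast
qed

text \<open>The fibres are irreducible: two polynomials that are each nonzero somewhere over a point
  are simultaneously nonzero at one of its frames. Hence if a product vanishes over
  \<open>Y\<close>, the two vanishing loci cover \<open>Y\<close>.\<close>

lemma pts_over_irreducible: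
  fixes Y :: "'k::field ext set set"
  assumes inf: "infinite (UNIV :: 'k set)" and Y: "H_irreducible Y"
  shows "poly_irreducible (pts_over Y)"
  unfolding poly_irreducible_def
proof (intro ballI impI)
  fix p q :: "'k frame \<Rightarrow> 'k"
  assume p: "p \<in> polyfun" and q: "q \<in> polyfun" and pq: "\<forall>x\<in>pts_over Y. p x * q x = 0"
  have YH: "Y \<subseteq> Hilb" using Y H_closed_subset by (auto simp: H_irreducible_def)
  have "Y \<subseteq> vanishing_locus p \<union> vanishing_locus q"
  proof (rule ccontr)
    assume "\<not> Y \<subseteq> vanishing_locus p \<union> vanishing_locus q"
    then obtain I where I: "I \<in> Y" "I \<notin> vanishing_locus p" "I \<notin> vanishing_locus q" by blast
    then obtain y where y: "y \<in> frames" "Iof y = I" "p y \<noteq> 0" using YH by (auto simp: vanishing_locus_def)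
    obtain z where z: "z \<in> frames" "Iof z = I" "q z \<noteq> 0" using I YH by (auto simp: vanishing_locus_def)
    obtain x where x: "x \<in> frames" "Iof x = I" using Hilb_frame I YH by blast
    then have xH: "x \<in> pts_over Hilb" using I YH by (auto simp: pts_over_def)
    obtain c where c: "y = frame_act c x" using same_point_act[OF xH y(1)] x y by metis
    obtain d where d: "z = frame_act d x" using same_point_act[OF xH z(1)] x z by metis
    have pol: "(\<lambda>c. p (frame_act c x)) \<in> polyfun" "(\<lambda>c. q (frame_act c x)) \<in> polyfun"
      by (rule polyfun_subst[OF p] polyfun_subst[OF q]; rule frame_act_polyfun; rule polyfun.intros)+
    obtain c0 where "p (frame_act c0 x) \<noteq> 0" "q (frame_act c0 x) \<noteq> 0"
      using polyfun_common_nonzero[OF inf pol, of c d] y z c d by blast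
    then have "(\<lambda>c. p (frame_act c x) * q (frame_act c x)) c0 \<noteq> 0" by simp
    from generic_frame_act[OF inf xH polyfun.pmult[OF pol] this]
    obtain c where c: "p (frame_act c x) * q (frame_act c x) \<noteq> 0" "frame_act c x \<in> pts_over Hilb" "Iof (frame_act c x) = Iof x"
      by blast
    then have "frame_act c x \<in> pts_over Y" using x I by (auto simp: pts_over_def)
    then show False using pq c(1) by blast
  qed
  then have "Y \<subseteq> vanishing_locus p \<or> Y \<subseteq> vanishing_locus q"
    using Y H_closed_vanishing_locus[OF p] H_closed_vanishing_locus[OF q] unfolding H_irreducible_def by blast
  then show "(\<forall>x\<in>pts_over Y. p x = 0) \<or> (\<forall>x\<in>pts_over Y. q x = 0)"
    by (auto simp: pts_over_def vanishing_locus_def)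
qed

lemma poly_irreducible_range:
  fixes \<Phi> :: "('v \<Rightarrow> 'k::field) \<Rightarrow> 'w \<Rightarrow> 'k"
  assumes inf: "infinite (UNIV :: 'k set)" and \<Phi>: "\<And>v. (\<lambda>a. \<Phi> a v) \<in> polyfun"
  shows "poly_irreducible (range \<Phi>)"
  unfolding poly_irreducible_def
proof (intro ballI impI)
  fix p q :: "('w \<Rightarrow> 'k) \<Rightarrow> 'k" assume pq: "p \<in> polyfun" "q \<in> polyfun" "\<forall>x\<in>range \<Phi>. p x * q x = 0"
  show "(\<forall>x\<in>range \<Phi>. p x = 0) \<or> (\<forall>x\<in>range \<Phi>. q x = 0)"
  proof (rule ccontr)
    assume "\<not> ?thesis"
    then obtain a b where "p (\<Phi> a) \<noteq> 0" "q (\<Phi> b) \<noteq> 0" by auto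
    moreover have "(\<lambda>a. p (\<Phi> a)) \<in> polyfun" "(\<lambda>a. q (\<Phi> a)) \<in> polyfun"
      by (rule polyfun_subst[OF pq(1) \<Phi>] polyfun_subst[OF pq(2) \<Phi>])+
    ultimately obtain e where "p (\<Phi> e) \<noteq> 0" "q (\<Phi> e) \<noteq> 0"
      using polyfun_common_nonzero[OF inf, of "\<lambda>a. p (\<Phi> a)" "\<lambda>a. q (\<Phi> a)" a b] by blast
    then show False using pq(3) by auto
  qed
qed

text \<open>Two nonempty open conditions on an affine space have a common point, so a polynomial
  that vanishes over \<open>D\<close> cannot be nonzero at the special frame. This brings degenerate
  ideals into a closure.\<close>

lemma closed_generic:
  fixes \<Psi> :: "('v \<Rightarrow> 'k::field) \<Rightarrow> 'k frame"
  assumes inf: "infinite (UNIV :: 'k set)" and D: "H_closed D"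
    and \<Psi>: "\<And>v. (\<lambda>a. \<Psi> a v) \<in> polyfun"
    and h: "h \<in> polyfun" "h a0 \<noteq> 0" "\<And>a. h a \<noteq> 0 \<Longrightarrow> \<Psi> a \<in> pts_over D"
    and a: "\<Psi> a \<in> pts_over Hilb"
  shows "\<Psi> a \<in> pts_over D"
proof (rule ccontr)
  assume "\<Psi> a \<notin> pts_over D"
  then obtain p where p: "p \<in> polyfun" "p (\<Psi> a) \<noteq> 0" "\<And>y. y \<in> pts_over D \<Longrightarrow> p y = 0"
    using H_closedD[OF D a] by metis
  have "(\<lambda>a. p (\<Psi> a)) \<in> polyfun" by (rule polyfun_subst[OF p(1) \<Psi>])
  then obtain b where "p (\<Psi> b) \<noteq> 0" "h b \<noteq> 0"
    using polyfun_common_nonzero[OF inf, of "\<lambda>a. p (\<Psi> a)" h a a0] h(1,2) p(2) by blast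
  then show False using h(3) p(3) by blast
qed

lemma H_irreducible_closure_range:
  fixes \<Phi> :: "('v \<Rightarrow> 'k::field) \<Rightarrow> 'k frame"
  assumes inf: "infinite (UNIV :: 'k set)" and \<Phi>: "\<And>v. (\<lambda>a. \<Phi> a v) \<in> polyfun"
    and pts: "\<And>a. \<Phi> a \<in> pts_over Hilb"
  shows "H_irreducible (H_closure (range (\<lambda>a. Iof (\<Phi> a))))"
  unfolding H_irreducible_def
proof (intro conjI allI impI)
  let ?X = "range (\<lambda>a. Iof (\<Phi> a))"
  have sub: "?X \<subseteq> Hilb" using pts by (auto simp: pts_over_def)
  show "H_closed (H_closure ?X)" by (rule H_closed_closure[OF sub])
  show "H_closure ?X \<noteq> {}" using H_closure_subset[of ?X] by blast
  fix C D assume C: "H_closed C" and D: "H_closed D" and CD: "H_closure ?X \<subseteq> C \<union> D"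
  have "?X \<subseteq> C \<or> ?X \<subseteq> D"
  proof (rule ccontr)
    assume "\<not> (?X \<subseteq> C \<or> ?X \<subseteq> D)"
    then obtain a b where "\<Phi> a \<notin> pts_over C" "\<Phi> b \<notin> pts_over D" by (auto simp: pts_over_def)
    obtain p where p: "p \<in> polyfun" "p (\<Phi> a) \<noteq> 0" "\<And>y. y \<in> pts_over C \<Longrightarrow> p y = 0"
      using H_closedD[OF C pts \<open>\<Phi> a \<notin> pts_over C\<close>] by metis
    obtain q where q: "q \<in> polyfun" "q (\<Phi> b) \<noteq> 0" "\<And>y. y \<in> pts_over D \<Longrightarrow> q y = 0"
      using H_closedD[OF D pts \<open>\<Phi> b \<notin> pts_over D\<close>] by metis
    have "(\<lambda>a. p (\<Phi> a)) \<in> polyfun" "(\<lambda>a. q (\<Phi> a)) \<in> polyfun"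
      by (rule polyfun_subst[OF p(1) \<Phi>] polyfun_subst[OF q(1) \<Phi>])+
    then obtain e where e: "p (\<Phi> e) \<noteq> 0" "q (\<Phi> e) \<noteq> 0"
      using polyfun_common_nonzero[OF inf, of "\<lambda>a. p (\<Phi> a)" "\<lambda>a. q (\<Phi> a)" a b] p(2) q(2) by blast
    have "Iof (\<Phi> e) \<in> C \<union> D" using CD H_closure_subset[of ?X] by blast
    then show False using e p(3)[of "\<Phi> e"] q(3)[of "\<Phi> e"] pts[of e] by (auto simp: pts_over_def)
  qed
  then show "H_closure ?X \<subseteq> C \<or> H_closure ?X \<subseteq> D" using H_closure_minimal C D by blast
qed

section \<open>Dimension of parametrized closed subsets\<close>

definition frame_indices :: "(nat \<times> nat \<times> nat) set" where
  "frame_indices = {2} \<times> {..<3} \<times> {..<3} \<union> {3} \<times> {..<8} \<times> {..<8}"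

lemma frame_indices_iff: "(d,i,j) \<in> frame_indices \<longleftrightarrow> i < frame_size d \<and> j < frame_size d"
  by (auto simp: frame_indices_def frame_size_def)

lemma frame_indices_enum: obtains \<beta> where "bij_betw \<beta> {..<73::nat} frame_indices"
proof -
  have f: "finite frame_indices" by (simp add: frame_indices_def)
  have "card frame_indices = 73"
    unfolding frame_indices_def by (subst card_Un_disjoint) (auto simp: card_cartesian_product)
  then show thesis using ex_bij_betw_nat_finite[OF f] that by (auto simp: atLeast0LessThan)
qed

text \<open>Complete the rows of \<open>x\<close> to an invertible square matrix; the matching
  columns of its inverse recover the base change linearly from \<open>frame_act c x\<close>.\<close>

lemma frame_coordinates:
  fixes x :: "'k::field frame"
  assumes x: "x \<in> pts_over Hilb"
  obtains T where "\<And>v. T v \<in> polyfun" "\<And>c v. v \<in> frame_indices \<Longrightarrow> T v (frame_act c x) = c v"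
proof -
  have ex: "\<exists>P. \<forall>i<frame_size d. \<forall>j<frame_size d. (\<Sum>S\<in>deg_sets d. x (d,i,S) * P S j) = (if i = j then 1 else 0)" for d
  proof (cases "d = 2 \<or> d = 3")
    case True
    then have c: "card (deg_sets d) = 10" by (auto simp: card_deg_sets choose_5)
    have "rows_indep (frame_size d) (row x d) (deg_sets d)"
      unfolding rows_indep_def
    proof (intro allI impI)
      fix c i assume c: "\<forall>S\<in>deg_sets d. (\<Sum>i<frame_size d. c i * x (d,i,S)) = 0" and i: "i < frame_size d"
      have "(\<Sum>i<frame_size d. c i * x (d,i,S)) = 0" if "S \<notin> deg_sets d" for S
        using that framesD[OF pts_Hilb_frames[OF x], of d _ S] by (intro sum.neutral) (auto simp: deg_sets_def)
      then show "c i = 0" using rows_indepD[OF pts_Hilb_rows[OF x] _ i] c by blast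
    qed
    then obtain z where z: "rows_indep (card (deg_sets d)) z (deg_sets d)" "\<forall>i<frame_size d. z i = row x d i"
      using rows_indep_extend[of "frame_size d" "row x d" "deg_sets d"] True c by auto
    obtain P where P: "\<And>i j. i < card (deg_sets d) \<Longrightarrow> j < card (deg_sets d) \<Longrightarrow> (\<Sum>S\<in>deg_sets d. z i S * P S j) = (if i = j then 1 else 0)"
      using rows_indep_dual[OF z(1)] by (metis finite_deg_sets)
    show ?thesis
    proof (intro exI[of _ P] allI impI)
      fix i j assume ij: "i < frame_size d" "j < frame_size d"
      then have "i < card (deg_sets d)" "j < card (deg_sets d)" using True c by auto
      from P[OF this] show "(\<Sum>S\<in>deg_sets d. x (d,i,S) * P S j) = (if i = j then 1 else 0)" using z(2) ij by simp
    qed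
  qed (auto simp: frame_size_def)
  define P where "P d = (SOME P. \<forall>i<frame_size d. \<forall>j<frame_size d. (\<Sum>S\<in>deg_sets d. x (d,i,S) * P S j) = (if i = j then 1 else 0))" for d
  have P: "(\<Sum>S\<in>deg_sets d. x (d,i,S) * P d S j) = (if i = j then 1 else 0)" if "i < frame_size d" "j < frame_size d" for d i j
    using someI_ex[OF ex[of d]] that unfolding P_def[symmetric] by blast
  define T where "T = (\<lambda>(d,i,j) (y :: 'k frame). \<Sum>S\<in>deg_sets d. y (d,i,S) * P d S j)"
  show thesis
  proof (rule that)
    show "T v \<in> polyfun" for v by (cases v) (auto simp: T_def intro!: polyfun.intros)
    fix c v assume v: "v \<in> frame_indices"
    obtain d i j where dij: "v = (d,i,j)" by (cases v)
    then have ij: "i < frame_size d" "j < frame_size d" using v by (auto simp: frame_indices_iff)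
    have "T v (frame_act c x) = (\<Sum>S\<in>deg_sets d. (\<Sum>l<frame_size d. c (d,i,l) * x (d,l,S)) * P d S j)"
      using ij by (simp add: T_def dij frame_act_def)
    also have "\<dots> = (\<Sum>l<frame_size d. c (d,i,l) * (\<Sum>S\<in>deg_sets d. x (d,l,S) * P d S j))"
      by (simp add: sum_distrib_right sum_distrib_left mult.assoc) (rule sum.swap)
    also have "\<dots> = (\<Sum>l<frame_size d. if l = j then c (d,i,l) else 0)"
      using P ij by (intro sum.cong) auto
    also have "\<dots> = c v" using ij by (simp add: dij)
    finally show "T v (frame_act c x) = c v" .
  qed
qed

text \<open>The entries of the base change are switched on one at a time: coordinate number
  \<open>k\<close> vanishes as long as only the first \<open>k\<close> entries are used. Singular
  matrices are allowed on the way and are removed at the end by density.\<close>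

lemma frame_coordinates_alg_indep:
  fixes x :: "'k::field frame"
  assumes inf: "infinite (UNIV :: 'k set)" and x: "x \<in> pts_over Hilb" and \<beta>: "bij_betw \<beta> {..<73::nat} frame_indices"
    and T: "\<And>v. T v \<in> polyfun" "\<And>c v. v \<in> frame_indices \<Longrightarrow> T v (frame_act c x) = c v"
    and X: "{y \<in> frames. Iof y = Iof x} \<subseteq> X"
  shows "alg_indep d 73 (\<lambda>l. T (\<beta> l)) X"
proof -
  define r where "r k c = (\<lambda>v. if v \<in> \<beta> ` {..<k} then c v else (0::'k))" for k c
  have rpol: "(\<lambda>c. r k c v) \<in> polyfun" for k v unfolding r_def by (intro polyfun_if polyfun.intros)
  have actpol: "(\<lambda>c. frame_act (r k c) x v) \<in> polyfun" for k v
    by (rule frame_act_polyfun[OF rpol polyfun.pconst])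
  have inj: "inj_on \<beta> {..<73}" and im: "\<beta> ` {..<73} = frame_indices" using \<beta> by (auto simp: bij_betw_def)
  have "alg_indep d k (\<lambda>l. T (\<beta> l)) (range (\<lambda>c. frame_act (r k c) x))" if "k \<le> 73" for k
    using that
  proof (induction k)
    case 0
    then show ?case by (auto simp: alg_indep_def)
  next
    case (Suc k)
    have bk: "\<beta> k \<in> frame_indices" using Suc.prems im by auto
    have nk: "\<beta> k \<notin> \<beta> ` {..<k}"
    proof
      assume "\<beta> k \<in> \<beta> ` {..<k}"
      then obtain l where "l < k" "\<beta> k = \<beta> l" by auto
      then show False using inj_onD[OF inj, of k l] Suc.prems by auto
    qed
    show ?case
    proof (rule alg_indep_Suc)
      show "alg_indep d k (\<lambda>l. T (\<beta> l)) (range (\<lambda>c. frame_act (r k c) x))" using Suc by simp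
      have "frame_act (r k c) x = frame_act (r (Suc k) (r k c)) x" for c
        by (rule frame_act_cong) (auto simp: r_def)
      then show "range (\<lambda>c. frame_act (r k c) x) \<subseteq> range (\<lambda>c. frame_act (r (Suc k) c) x)" by (metis image_subsetI rangeI)
      show "poly_irreducible (range (\<lambda>c. frame_act (r (Suc k) c) x))"
        by (rule poly_irreducible_range[OF inf actpol])
      show "T (\<beta> k) y = 0" if "y \<in> range (\<lambda>c. frame_act (r k c) x)" for y
        using that T(2)[OF bk] nk by (auto simp: r_def)
      show "frame_act (r (Suc k) (\<lambda>_. 1)) x \<in> range (\<lambda>c. frame_act (r (Suc k) c) x)" by blast
      show "T (\<beta> k) (frame_act (r (Suc k) (\<lambda>_. 1)) x) \<noteq> 0" using T(2)[OF bk] by (simp add: r_def)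
    qed (rule T)
  qed
  from this[of 73] have ind: "alg_indep d 73 (\<lambda>l. T (\<beta> l)) (range (\<lambda>c. frame_act (r 73 c) x))" by simp
  show ?thesis
    unfolding alg_indep_def
  proof (intro allI impI)
    fix c N assume c: "\<forall>y\<in>X. (\<Sum>N<d ^ 73. c N * digit_monomial d (\<lambda>l. T (\<beta> l)) 73 N y) = 0" and N: "N < d ^ 73"
    define p where "p y = (\<Sum>N<d ^ 73. c N * digit_monomial d (\<lambda>l. T (\<beta> l)) 73 N y)" for y
    have p: "p \<in> polyfun" unfolding p_def using digit_monomial_polyfun[OF T(1)] by (auto intro!: polyfun.intros)
    \<comment> \<open>The relation is known at frames only, that is for invertible matrices; if it
      failed at some matrix, it would fail at an invertible one.\<close>
    have "p (frame_act e x) = 0" for e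
    proof (rule ccontr)
      assume ne: "p (frame_act e x) \<noteq> 0"
      have "(\<lambda>e. p (frame_act e x)) \<in> polyfun"
        by (rule polyfun_subst[OF p]) (rule frame_act_polyfun; rule polyfun.intros)
      from generic_frame_act[OF inf x this ne]
      obtain e' where e': "p (frame_act e' x) \<noteq> 0" "frame_act e' x \<in> pts_over Hilb" "Iof (frame_act e' x) = Iof x" by blast
      then have "frame_act e' x \<in> X" using X pts_Hilb_frames by blast
      then show False using c e'(1) unfolding p_def by blast
    qed
    then show "c N = 0" using ind N unfolding alg_indep_def p_def by blast
  qed
qed

text \<open>A longer chain would give, at a frame of the smallest member, 73 frame coordinates and one
  further function for each strict inclusion that are algebraically independent; but they pull back
  to polynomials in the n parameters and the 73 entries of the base change.\<close>
theorem H_chain_upper_bound: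
  fixes \<Phi> :: "(nat \<Rightarrow> 'k::field) \<Rightarrow> 'k frame"
  assumes inf: "infinite (UNIV :: 'k set)" and \<Phi>: "\<And>v. (\<lambda>a. \<Phi> a v) \<in> polyfun"
    and pts: "\<And>a. \<Phi> a \<in> pts_over Hilb" and tr: "\<And>a. \<Phi> (truncate_seq n a) = \<Phi> a"
  shows "\<not> H_chain (H_closure (range (\<lambda>a. Iof (\<Phi> a)))) (Suc n)"
proof
  let ?C = "H_closure (range (\<lambda>a. Iof (\<Phi> a)))"
  assume "H_chain ?C (Suc n)"
  then obtain f where f: "\<And>i. i \<le> Suc n \<Longrightarrow> H_irreducible (f i)" "\<And>i. i \<le> Suc n \<Longrightarrow> f i \<subseteq> ?C"
    "\<And>i. i < Suc n \<Longrightarrow> f i \<subset> f (Suc i)" unfolding H_chain_def by blast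
  have fcl: "H_closed (f i)" if "i \<le> Suc n" for i using f(1)[OF that] by (simp add: H_irreducible_def)
  have fH: "f i \<subseteq> Hilb" if "i \<le> Suc n" for i using H_closed_subset[OF fcl[OF that]] .
  obtain I0 where I0: "I0 \<in> f 0" using f(1)[of 0] by (auto simp: H_irreducible_def)
  then obtain x where x: "x \<in> frames" "Iof x = I0" using Hilb_frame fH[of 0] by blast
  then have xH: "x \<in> pts_over Hilb" using I0 fH[of 0] by (auto simp: pts_over_def)
  obtain \<beta> where \<beta>: "bij_betw \<beta> {..<73::nat} frame_indices" using frame_indices_enum by blast
  obtain T where T: "\<And>v. T v \<in> polyfun" "\<And>c v. v \<in> frame_indices \<Longrightarrow> T v (frame_act c x) = c v"
    using frame_coordinates[OF xH] by blast
  \<comment> \<open>A frame over a point of \<open>f (Suc i)\<close> outside \<open>f i\<close> is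
    separated from \<open>f i\<close> by a polynomial; these polynomials play the role of a
    transcendence basis along the chain.\<close>
  have "\<exists>g. g \<in> polyfun \<and> (\<forall>y\<in>pts_over (f i). g y = 0) \<and> (\<exists>y\<in>pts_over (f (Suc i)). g y \<noteq> 0)" if i: "i < Suc n" for i
  proof -
    obtain J where J: "J \<in> f (Suc i)" "J \<notin> f i" using f(3)[OF i] by blast
    obtain y where y: "y \<in> frames" "Iof y = J" using Hilb_frame fH[of "Suc i"] i J by (meson Suc_leI subset_iff)
    then have "y \<in> pts_over Hilb" "y \<notin> pts_over (f i)" "y \<in> pts_over (f (Suc i))" using J fH[of "Suc i"] i by (auto simp: pts_over_def)
    moreover obtain g where "g \<in> polyfun" "g y \<noteq> 0" "\<And>z. z \<in> pts_over (f i) \<Longrightarrow> g z = 0"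
      using H_closedD[OF fcl \<open>y \<in> pts_over Hilb\<close> \<open>y \<notin> pts_over (f i)\<close>] i by auto
    ultimately show ?thesis by blast
  qed
  then obtain g where g: "\<And>i. i < Suc n \<Longrightarrow> g i \<in> polyfun" "\<And>i y. i < Suc n \<Longrightarrow> y \<in> pts_over (f i) \<Longrightarrow> g i y = 0"
    "\<And>i. i < Suc n \<Longrightarrow> \<exists>y\<in>pts_over (f (Suc i)). g i y \<noteq> 0" by metis
  define F where "F i = (if i < 73 then T (\<beta> i) else g (i - 73))" for i
  have Fp: "F i \<in> polyfun" if "i < 73 + Suc n" for i using T(1) g(1)[of "i - 73"] that by (auto simp: F_def)
  have ind: "alg_indep d (73 + l) F (pts_over (f l))" if "l \<le> Suc n" for d l
    using that
  proof (induction l)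
    case 0
    have "{y \<in> frames. Iof y = Iof x} \<subseteq> pts_over (f 0)" using I0 x by (auto simp: pts_over_def)
    from frame_coordinates_alg_indep[OF inf xH \<beta> T this]
    have "alg_indep d 73 (\<lambda>l. T (\<beta> l)) (pts_over (f 0))" .
    also have "alg_indep d 73 (\<lambda>l. T (\<beta> l)) (pts_over (f 0)) = alg_indep d 73 F (pts_over (f 0))"
      by (rule alg_indep_cong) (simp add: F_def)
    finally show ?case by simp
  next
    case (Suc l)
    then have l: "l < Suc n" by simp
    obtain y where y: "y \<in> pts_over (f (Suc l))" "g l y \<noteq> 0" using g(3)[OF l] by blast
    have "alg_indep d (Suc (73 + l)) F (pts_over (f (Suc l)))"
    proof (rule alg_indep_Suc)
      show "alg_indep d (73 + l) F (pts_over (f l))" using Suc by simp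
      show "pts_over (f l) \<subseteq> pts_over (f (Suc l))" using f(3)[OF l] by (intro pts_over_mono) auto
      show "poly_irreducible (pts_over (f (Suc l)))" using f(1)[of "Suc l"] l by (intro pts_over_irreducible[OF inf]) simp
      show "F i \<in> polyfun" if "i \<le> 73 + l" for i using Fp that l by simp
      show "F (73 + l) z = 0" if "z \<in> pts_over (f l)" for z using g(2)[OF l that] by (simp add: F_def)
      show "y \<in> pts_over (f (Suc l))" by (rule y)
      show "F (73 + l) y \<noteq> 0" using y by (simp add: F_def)
    qed
    then show ?case by simp
  qed
  define m where "m = 73 + Suc n"
  define \<gamma> where "\<gamma> = inv_into {..<73} \<beta>"
  \<comment> \<open>Entries 0, ..., n - 1 of \<open>b\<close> are the parameters of
    \<open>\<Phi>\<close>, the next 73 are the entries of the base change in the order given by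
    \<open>\<beta>\<close>.\<close>
  define \<Theta> where "\<Theta> b = frame_act (\<lambda>v. b (n + \<gamma> v)) (\<Phi> b)" for b :: "nat \<Rightarrow> 'k"
  have \<Theta>p: "(\<lambda>b. \<Theta> b v) \<in> polyfun" for v unfolding \<Theta>_def by (intro frame_act_polyfun polyfun.pvar \<Phi>)
  have "(\<lambda>b. F i (\<Theta> b)) \<in> polyfun" if "i < m" for i
    by (rule polyfun_subst[OF Fp \<Theta>p]) (use that m_def in simp)
  \<comment> \<open>Here n + 74 functions of n + 73 variables are compared, so some relation must
    exist.\<close>
  from algebraic_dependence[of m "\<lambda>i b. F i (\<Theta> b)" "n + 73", OF this]
  obtain d c where c: "\<exists>N<d ^ m. c N \<noteq> 0"
    "\<And>b. (\<Sum>N<d ^ m. c N * digit_monomial d (\<lambda>i b. F i (\<Theta> b)) m N (truncate_seq (n + 73) b)) = 0"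
    unfolding m_def by auto
  define P where "P y = (\<Sum>N<d ^ m. c N * digit_monomial d F m N y)" for y
  have Pp: "P \<in> polyfun" unfolding P_def using digit_monomial_polyfun[of m F d] Fp unfolding m_def by (auto intro!: polyfun.intros)
  have P\<Theta>: "P (\<Theta> (truncate_seq (n + 73) b)) = 0" for b
  proof -
    have "digit_monomial d (\<lambda>i b. F i (\<Theta> b)) m N (truncate_seq (n + 73) b) = digit_monomial d F m N (\<Theta> (truncate_seq (n + 73) b))" for N
      by (rule digit_monomial_cong) simp
    then show ?thesis using c(2)[of b] by (simp add: P_def)
  qed
  \<comment> \<open>Every frame of every member of the family is a value of \<open>\<Theta>\<close>
    at a truncated sequence, so the relation holds at all these frames and passes to the
    closure.\<close>
  have "range (\<lambda>a. Iof (\<Phi> a)) \<subseteq> vanishing_locus P"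
  proof
    fix I assume "I \<in> range (\<lambda>a. Iof (\<Phi> a))"
    then obtain a where a: "I = Iof (\<Phi> a)" by blast
    have "P y = 0" if y: "y \<in> frames" "Iof y = I" for y
    proof -
      obtain e where e: "y = frame_act e (\<Phi> a)" using same_point_act[OF pts y(1)] y(2) a by metis
      define b where "b i = (if i < n then a i else e (\<beta> (i - n)))" for i
      have "truncate_seq n (truncate_seq (n + 73) b) = truncate_seq n a" by (auto simp: truncate_seq_def b_def fun_eq_iff)
      then have "\<Phi> (truncate_seq (n + 73) b) = \<Phi> a" using tr by metis
      moreover have "frame_act (\<lambda>v. truncate_seq (n + 73) b (n + \<gamma> v)) z = frame_act e z" for z
      proof (rule frame_act_cong)
        fix d i j assume "i < frame_size d" "j < frame_size d"
        then have v: "(d,i,j) \<in> \<beta> ` {..<73}" using \<beta> by (simp add: frame_indices_iff bij_betw_def)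
        then have "\<gamma> (d,i,j) < 73" "\<beta> (\<gamma> (d,i,j)) = (d,i,j)" unfolding \<gamma>_def
          using inv_into_into[OF v] f_inv_into_f[OF v] by auto
        then show "truncate_seq (n + 73) b (n + \<gamma> (d,i,j)) = e (d,i,j)" by (simp add: truncate_seq_def b_def)
      qed
      ultimately have "\<Theta> (truncate_seq (n + 73) b) = y" by (simp add: \<Theta>_def e)
      then show ?thesis using P\<Theta> by metis
    qed
    then show "I \<in> vanishing_locus P" using pts[of a] a by (auto simp: vanishing_locus_def pts_over_def)
  qed
  then have "?C \<subseteq> vanishing_locus P" by (rule H_closure_minimal[OF H_closed_vanishing_locus[OF Pp]])
  then have "f (Suc n) \<subseteq> vanishing_locus P" using f(2)[of "Suc n"] by auto
  then have "\<forall>y\<in>pts_over (f (Suc n)). P y = 0" by (auto simp: pts_over_def vanishing_locus_def)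
  then have "\<forall>N<d ^ m. c N = 0" using ind[of "Suc n" d] unfolding alg_indep_def P_def m_def by blast
  then show False using c(1) by blast
qed

text \<open>The chain consists of the closures of the images of coordinate subspaces;
  \<open>D i\<close> contains the member with \<open>i\<close> parameters and misses a point of the
  next one.\<close>

theorem H_chain_lower_bound:
  fixes \<Phi> :: "(nat \<Rightarrow> 'k::field) \<Rightarrow> 'k frame"
  assumes inf: "infinite (UNIV :: 'k set)" and \<Phi>: "\<And>v. (\<lambda>a. \<Phi> a v) \<in> polyfun"
    and pts: "\<And>a. \<Phi> a \<in> pts_over Hilb"
    and D: "\<And>i. i < n \<Longrightarrow> H_closed (D i)"
      "\<And>i a. i < n \<Longrightarrow> (\<And>j. j \<ge> i \<Longrightarrow> a j = 0) \<Longrightarrow> Iof (\<Phi> a) \<in> D i"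
      "\<And>i. i < n \<Longrightarrow> Iof (\<Phi> (\<lambda>j. if j = i then 1 else 0)) \<notin> D i"
  shows "H_chain (H_closure (range (\<lambda>a. Iof (\<Phi> a)))) n"
  unfolding H_chain_def
proof (intro exI conjI allI impI)
  define X where "X i = range (\<lambda>a. Iof (\<Phi> (truncate_seq i a)))" for i
  have sub: "X i \<subseteq> range (\<lambda>a. Iof (\<Phi> a))" for i by (auto simp: X_def)
  show "H_irreducible (H_closure (X i))" for i
    unfolding X_def by (rule H_irreducible_closure_range[OF inf polyfun_subst[OF \<Phi> polyfun_truncate_seq] pts])
  have mono: "H_closure X \<subseteq> H_closure Y" if "X \<subseteq> Y" for X Y :: "'k ext set set"
    using that by (auto simp: H_closure_def)
  show "H_closure (X i) \<subseteq> H_closure (range (\<lambda>a. Iof (\<Phi> a)))" for i by (rule mono[OF sub])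
  fix i assume i: "i < n"
  have "truncate_seq i a = truncate_seq (Suc i) (truncate_seq i a)" for a :: "nat \<Rightarrow> 'k" by (auto simp: truncate_seq_def)
  then have "X i \<subseteq> X (Suc i)" unfolding X_def by (metis image_subsetI rangeI)
  then have le: "H_closure (X i) \<subseteq> H_closure (X (Suc i))" by (rule mono)
  let ?u = "\<lambda>j. if j = i then 1 else 0 :: 'k"
  have u: "truncate_seq (Suc i) ?u = ?u" by (auto simp: truncate_seq_def)
  have "X i \<subseteq> D i" unfolding X_def using D(2)[OF i] by (auto simp: truncate_seq_def)
  then have "H_closure (X i) \<subseteq> D i" by (rule H_closure_minimal[OF D(1)[OF i]])
  moreover have "Iof (\<Phi> ?u) \<in> X (Suc i)" unfolding X_def using u by (metis rangeI)
  then have "Iof (\<Phi> ?u) \<in> H_closure (X (Suc i))" using H_closure_subset by blast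
  ultimately show "H_closure (X i) \<subset> H_closure (X (Suc i))" using le D(3)[OF i] by blast
qed

section \<open>The action of invertible matrices\<close>

lemma sum_lessThan_5: "(\<Sum>i<(5::nat). f i) = f 0 + f 1 + f 2 + f 3 + (f 4 :: 'a::comm_monoid_add)"
  by (simp add: eval_nat_numeral ac_simps)

lemma sum_lessThan_3: "(\<Sum>i<(3::nat). f i) = f 0 + f 1 + (f 2 :: 'a::comm_monoid_add)"
  by (simp add: eval_nat_numeral ac_simps)

lemma sum_lessThan_8: "(\<Sum>i<(8::nat). f i) = f 0 + f 1 + f 2 + f 3 + f 4 + f 5 + f 6 + (f 7 :: 'a::comm_monoid_add)"
  by (simp add: eval_nat_numeral ac_simps)

lemma less_5_cases: "i < (5::nat) \<Longrightarrow> i = 0 \<or> i = 1 \<or> i = 2 \<or> i = 3 \<or> i = 4"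
  by linarith

text \<open>Keeps index sets such as \<open>{0,1}\<close> in numeral form, so that the evaluation lemmas below apply to them.\<close>
declare One_nat_def [simp del]

lemma filter_insert_if: "{t \<in> insert a B. P t} = (if P a then insert a {t \<in> B. P t} else {t \<in> B. P t})"
  by auto

lemma filter_empty: "{t \<in> {}. P t} = {}"
  by auto

lemma lessThan_5: "{..<5} = {0,1,2,3,4::nat}"
  by auto

section \<open>Coordinates and products in degrees 2 and 3\<close>

lemma deg_sets_2: "deg_sets 2 = {{0,1},{0,2},{0,3},{0,4},{1,2},{1,3},{1,4},{2,3},{2,4},{3,4}}" (is "_ = ?R")
proof (rule card_subset_eq[symmetric])
  show "?R \<subseteq> deg_sets 2" by (simp add: deg_sets_def lessThan_5)
  show "card ?R = card (deg_sets 2)" by (simp add: card_deg_sets choose_5 doubleton_eq_iff)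
qed simp

lemma deg_sets_3: "deg_sets 3 = {{0,1,2},{0,1,3},{0,1,4},{0,2,3},{0,2,4},{0,3,4},{1,2,3},{1,2,4},{1,3,4},{2,3,4}}" (is "_ = ?R")
proof (rule card_subset_eq[symmetric])
  show "?R \<subseteq> deg_sets 3" by (simp add: deg_sets_def lessThan_5)
  have ne: "A \<noteq> B \<longleftrightarrow> (A - B) \<union> (B - A) \<noteq> {}" for A B :: "nat set" by auto
  have "distinct [{0,1,2},{0,1,3},{0,1,4},{0,2,3},{0,2,4},{0,3,4},{1,2,3},{1,2,4},{1,3,4},{2,3,4::nat}]"
    by (simp add: ne)
  from distinct_card[OF this] show "card ?R = card (deg_sets 3)" by (simp add: card_deg_sets choose_5)
qed simp

lemma ext_deg_2_eqI:
  assumes "u \<in> ext_deg 2" "v \<in> ext_deg 2" "u {0,1} = v {0,1}" "u {0,2} = v {0,2}" "u {0,3} = v {0,3}" "u {0,4} = v {0,4}"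
    "u {1,2} = v {1,2}" "u {1,3} = v {1,3}" "u {1,4} = v {1,4}" "u {2,3} = v {2,3}" "u {2,4} = v {2,4}" "u {3,4} = v {3,4}"
  shows "u = v"
proof
  fix S show "u S = v S"
  proof (cases "S \<in> deg_sets 2")
    case True then show ?thesis unfolding deg_sets_2 using assms(3-) by auto
  next
    case False
    then have "u S = 0" "v S = 0" using assms(1,2) unfolding ext_deg_eq by blast+
    then show ?thesis by simp
  qed
qed

lemma ext_deg_3_eqI:
  assumes "u \<in> ext_deg 3" "v \<in> ext_deg 3" "u {0,1,2} = v {0,1,2}" "u {0,1,3} = v {0,1,3}" "u {0,1,4} = v {0,1,4}"
    "u {0,2,3} = v {0,2,3}" "u {0,2,4} = v {0,2,4}" "u {0,3,4} = v {0,3,4}" "u {1,2,3} = v {1,2,3}" "u {1,2,4} = v {1,2,4}"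
    "u {1,3,4} = v {1,3,4}" "u {2,3,4} = v {2,3,4}"
  shows "u = v"
proof
  fix S show "u S = v S"
  proof (cases "S \<in> deg_sets 3")
    case True then show ?thesis unfolding deg_sets_3 using assms(3-) by auto
  next
    case False
    then have "u S = 0" "v S = 0" using assms(1,2) unfolding ext_deg_eq by blast+
    then show ?thesis by simp
  qed
qed

text \<open>Left multiplication by the vector with coordinates \<open>x\<close>; \<open>w2\<close>
  and \<open>w3\<close> are the products of two and of three vectors.\<close>

definition vw :: "(nat \<Rightarrow> 'k::field) \<Rightarrow> 'k ext \<Rightarrow> 'k ext" where
  "vw x v = lincomb 5 x (\<lambda>i. ew i v)"

definition w2 :: "(nat \<Rightarrow> 'k::field) \<Rightarrow> (nat \<Rightarrow> 'k) \<Rightarrow> 'k ext" where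
  "w2 x y = (\<lambda>S. if S \<in> deg_sets 2 then x (Min S) * y (Max S) - x (Max S) * y (Min S) else 0)"

definition w3 :: "(nat \<Rightarrow> 'k::field) \<Rightarrow> (nat \<Rightarrow> 'k) \<Rightarrow> (nat \<Rightarrow> 'k) \<Rightarrow> 'k ext" where
  "w3 x y z = vw x (w2 y z)"

lemma w2_eval [simp]:
  "w2 x y {0,1} = x 0 * y 1 - x 1 * y 0" "w2 x y {0,2} = x 0 * y 2 - x 2 * y 0" "w2 x y {0,3} = x 0 * y 3 - x 3 * y 0"
  "w2 x y {0,4} = x 0 * y 4 - x 4 * y 0" "w2 x y {1,2} = x 1 * y 2 - x 2 * y 1" "w2 x y {1,3} = x 1 * y 3 - x 3 * y 1"
  "w2 x y {1,4} = x 1 * y 4 - x 4 * y 1" "w2 x y {2,3} = x 2 * y 3 - x 3 * y 2" "w2 x y {2,4} = x 2 * y 4 - x 4 * y 2"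
  "w2 x y {3,4} = x 3 * y 4 - x 4 * y 3"
  by (simp_all add: w2_def deg_sets_def lessThan_5 min_def max_def)

lemma vw_eval [simp]:
  "vw x v {0,1,2} = x 0 * v {1,2} - x 1 * v {0,2} + x 2 * v {0,1}"
  "vw x v {0,1,3} = x 0 * v {1,3} - x 1 * v {0,3} + x 3 * v {0,1}"
  "vw x v {0,1,4} = x 0 * v {1,4} - x 1 * v {0,4} + x 4 * v {0,1}"
  "vw x v {0,2,3} = x 0 * v {2,3} - x 2 * v {0,3} + x 3 * v {0,2}"
  "vw x v {0,2,4} = x 0 * v {2,4} - x 2 * v {0,4} + x 4 * v {0,2}"
  "vw x v {0,3,4} = x 0 * v {3,4} - x 3 * v {0,4} + x 4 * v {0,3}"
  "vw x v {1,2,3} = x 1 * v {2,3} - x 2 * v {1,3} + x 3 * v {1,2}"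
  "vw x v {1,2,4} = x 1 * v {2,4} - x 2 * v {1,4} + x 4 * v {1,2}"
  "vw x v {1,3,4} = x 1 * v {3,4} - x 3 * v {1,4} + x 4 * v {1,3}"
  "vw x v {2,3,4} = x 2 * v {3,4} - x 3 * v {2,4} + x 4 * v {2,3}"
  unfolding vw_def lincomb_def ew_def sum_lessThan_5 filter_insert_if filter_empty
  by (simp_all add: lessThan_5 insert_Diff_if)

lemma w2_ext_deg [simp]: "w2 x y \<in> ext_deg 2"
  by (auto simp: w2_def ext_deg_eq)

lemma lincomb_ext_deg: "(\<And>i. i < r \<Longrightarrow> y i \<in> ext_deg d) \<Longrightarrow> lincomb r c y \<in> ext_deg d"
  unfolding ext_deg_eq lincomb_def by (auto, metis (no_types, lifting) lessThan_iff mult_zero_right sum.neutral)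

lemma vw_ext_deg: "v \<in> ext_deg d \<Longrightarrow> vw x v \<in> ext_deg (Suc d)"
  unfolding vw_def by (intro lincomb_ext_deg ew_ext_deg)

lemma vw_ext_deg_3: "v \<in> ext_deg 2 \<Longrightarrow> vw x v \<in> ext_deg 3"
  using vw_ext_deg[of v 2] by (simp add: eval_nat_numeral One_nat_def)

lemma w3_ext_deg [simp]: "w3 x y z \<in> ext_deg 3"
  unfolding w3_def by (rule vw_ext_deg_3) simp

lemma vw_in_rowspan:
  assumes "x \<in> pts_over Hilb" "v \<in> rowspan 3 (row x 2)"
  shows "vw c v \<in> rowspan 8 (row x 3)"
  unfolding vw_def using assms
  by (intro lincomb_in_closed[OF rowspan_zero rowspan_add rowspan_scale]) (auto simp: pts_over_Hilb_iff)

definition unit_vec :: "nat \<Rightarrow> nat \<Rightarrow> 'k::field" where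
  "unit_vec i = (\<lambda>j. if j = i then 1 else 0)"

lemma ew_eq_vw: "i < 5 \<Longrightarrow> ew i v = vw (unit_vec i) v"
  unfolding vw_def lincomb_def
proof
  fix S assume "i < 5"
  then have "ew i v S = (\<Sum>j<5. if j = i then ew j v S else 0)" by simp
  also have "\<dots> = (\<Sum>j<5. unit_vec i j * ew j v S)" by (rule sum.cong) (auto simp: unit_vec_def)
  finally show "ew i v S = (\<Sum>j<5. unit_vec i j * ew j v S)" .
qed

text \<open>The row \<open>g k\<close> is the image of the basis vector number \<open>k\<close>. The
  maps \<open>gl2\<close> and \<open>gl3\<close> are the second and third exterior powers of this
  linear map.\<close>

definition gl1 :: "(nat \<Rightarrow> nat \<Rightarrow> 'k::field) \<Rightarrow> (nat \<Rightarrow> 'k) \<Rightarrow> nat \<Rightarrow> 'k" where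
  "gl1 g x = lincomb 5 x g"

definition gl2 :: "(nat \<Rightarrow> nat \<Rightarrow> 'k::field) \<Rightarrow> 'k ext \<Rightarrow> 'k ext" where
  "gl2 g v = (\<lambda>S. v {0,1} * w2 (g 0) (g 1) S + v {0,2} * w2 (g 0) (g 2) S + v {0,3} * w2 (g 0) (g 3) S
     + v {0,4} * w2 (g 0) (g 4) S + v {1,2} * w2 (g 1) (g 2) S + v {1,3} * w2 (g 1) (g 3) S
     + v {1,4} * w2 (g 1) (g 4) S + v {2,3} * w2 (g 2) (g 3) S + v {2,4} * w2 (g 2) (g 4) S
     + v {3,4} * w2 (g 3) (g 4) S)"

definition gl3 :: "(nat \<Rightarrow> nat \<Rightarrow> 'k::field) \<Rightarrow> 'k ext \<Rightarrow> 'k ext" where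
  "gl3 g w = (\<lambda>S. w {0,1,2} * w3 (g 0) (g 1) (g 2) S + w {0,1,3} * w3 (g 0) (g 1) (g 3) S
     + w {0,1,4} * w3 (g 0) (g 1) (g 4) S + w {0,2,3} * w3 (g 0) (g 2) (g 3) S
     + w {0,2,4} * w3 (g 0) (g 2) (g 4) S + w {0,3,4} * w3 (g 0) (g 3) (g 4) S
     + w {1,2,3} * w3 (g 1) (g 2) (g 3) S + w {1,2,4} * w3 (g 1) (g 2) (g 4) S
     + w {1,3,4} * w3 (g 1) (g 3) (g 4) S + w {2,3,4} * w3 (g 2) (g 3) (g 4) S)"

lemma gl2_ext_deg [simp]: "gl2 g v \<in> ext_deg 2"
proof -
  have "w2 x y S = 0" if "S \<notin> deg_sets 2" for x y :: "nat \<Rightarrow> 'a" and S using that by (simp add: w2_def)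
  then show ?thesis unfolding ext_deg_eq gl2_def by fastforce
qed

lemma gl3_ext_deg [simp]: "gl3 g w \<in> ext_deg 3"
proof -
  have "w3 x y z S = 0" if "S \<notin> deg_sets 3" for x y z :: "nat \<Rightarrow> 'a" and S
    using that w3_ext_deg[of x y z] by (auto simp: ext_deg_eq)
  then show ?thesis unfolding ext_deg_eq gl3_def by fastforce
qed

lemma gl1_eval: "gl1 g x i = x 0 * g 0 i + x 1 * g 1 i + x 2 * g 2 i + x 3 * g 3 i + x 4 * g 4 i"
  by (simp add: gl1_def lincomb_def sum_lessThan_5)

lemma gl2_w2: "gl2 g (w2 x y) = w2 (gl1 g x) (gl1 g y)"
proof (rule ext_deg_2_eqI)
  show "gl2 g (w2 x y) \<in> ext_deg 2" "w2 (gl1 g x) (gl1 g y) \<in> ext_deg 2" by simp_all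
qed (simp_all add: gl2_def gl1_eval algebra_simps)

lemma w3_eval:
  "w3 x y z {0,1,2} = x 0 * (y 1 * z 2 - y 2 * z 1) - x 1 * (y 0 * z 2 - y 2 * z 0) + x 2 * (y 0 * z 1 - y 1 * z 0)"
  "w3 x y z {0,1,3} = x 0 * (y 1 * z 3 - y 3 * z 1) - x 1 * (y 0 * z 3 - y 3 * z 0) + x 3 * (y 0 * z 1 - y 1 * z 0)"
  "w3 x y z {0,1,4} = x 0 * (y 1 * z 4 - y 4 * z 1) - x 1 * (y 0 * z 4 - y 4 * z 0) + x 4 * (y 0 * z 1 - y 1 * z 0)"
  "w3 x y z {0,2,3} = x 0 * (y 2 * z 3 - y 3 * z 2) - x 2 * (y 0 * z 3 - y 3 * z 0) + x 3 * (y 0 * z 2 - y 2 * z 0)"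
  "w3 x y z {0,2,4} = x 0 * (y 2 * z 4 - y 4 * z 2) - x 2 * (y 0 * z 4 - y 4 * z 0) + x 4 * (y 0 * z 2 - y 2 * z 0)"
  "w3 x y z {0,3,4} = x 0 * (y 3 * z 4 - y 4 * z 3) - x 3 * (y 0 * z 4 - y 4 * z 0) + x 4 * (y 0 * z 3 - y 3 * z 0)"
  "w3 x y z {1,2,3} = x 1 * (y 2 * z 3 - y 3 * z 2) - x 2 * (y 1 * z 3 - y 3 * z 1) + x 3 * (y 1 * z 2 - y 2 * z 1)"
  "w3 x y z {1,2,4} = x 1 * (y 2 * z 4 - y 4 * z 2) - x 2 * (y 1 * z 4 - y 4 * z 1) + x 4 * (y 1 * z 2 - y 2 * z 1)"
  "w3 x y z {1,3,4} = x 1 * (y 3 * z 4 - y 4 * z 3) - x 3 * (y 1 * z 4 - y 4 * z 1) + x 4 * (y 1 * z 3 - y 3 * z 1)"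
  "w3 x y z {2,3,4} = x 2 * (y 3 * z 4 - y 4 * z 3) - x 3 * (y 2 * z 4 - y 4 * z 2) + x 4 * (y 2 * z 3 - y 3 * z 2)"
  by (simp_all add: w3_def)

lemma zero_ext_deg [simp]: "0 \<in> ext_deg d"
  by (simp add: ext_deg_eq)

lemma uminus_ext_deg: "v \<in> ext_deg d \<Longrightarrow> - v \<in> ext_deg d"
  by (simp add: ext_deg_eq)

lemma w3_alternating:
  "w3 x x y S = 0" "w3 x y x S = 0" "w3 x y y S = 0"
  "w3 y x z S = - w3 x y z S" "w3 y z x S = w3 x y z S"
proof -
  have "w3 x x y = 0" "w3 x y x = 0" "w3 x y y = 0" "w3 y x z = - w3 x y z" "w3 y z x = w3 x y z"
    by (rule ext_deg_3_eqI; (simp add: w3_eval uminus_ext_deg algebra_simps; fail))+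
  then show "w3 x x y S = 0" "w3 x y x S = 0" "w3 x y y S = 0" "w3 y x z S = - w3 x y z S" "w3 y z x S = w3 x y z S"
    by simp_all
qed

lemma vw_eq_sum: "vw x v S = x 0 * ew 0 v S + x 1 * ew 1 v S + x 2 * ew 2 v S + x 3 * ew 3 v S + x 4 * ew 4 v S"
  by (simp add: vw_def lincomb_def sum_lessThan_5)

lemma vw_gl1: "vw (gl1 g x) v S = x 0 * vw (g 0) v S + x 1 * vw (g 1) v S + x 2 * vw (g 2) v S + x 3 * vw (g 3) v S + x 4 * vw (g 4) v S"
  unfolding vw_eq_sum gl1_eval by (simp add: algebra_simps)

lemma vw_add_right: "vw x (\<lambda>S. u S + v S) S = vw x u S + vw x v S"
  and vw_scale_right: "vw x (\<lambda>S. c * v S) S = c * vw x v S"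
  unfolding vw_eq_sum ew_add[unfolded plus_fun_def] ew_scale by (simp_all add: algebra_simps)

lemma vw_gl2: "vw x (gl2 g v) S = v {0,1} * w3 x (g 0) (g 1) S + v {0,2} * w3 x (g 0) (g 2) S + v {0,3} * w3 x (g 0) (g 3) S
     + v {0,4} * w3 x (g 0) (g 4) S + v {1,2} * w3 x (g 1) (g 2) S + v {1,3} * w3 x (g 1) (g 3) S
     + v {1,4} * w3 x (g 1) (g 4) S + v {2,3} * w3 x (g 2) (g 3) S + v {2,4} * w3 x (g 2) (g 4) S
     + v {3,4} * w3 x (g 3) (g 4) S"
  unfolding gl2_def vw_add_right vw_scale_right w3_def by simp

lemma w3_swap:
  "w3 (g 1) (g 0) y S = - w3 (g 0) (g 1) y S" "w3 (g 2) (g 0) y S = - w3 (g 0) (g 2) y S" "w3 (g 3) (g 0) y S = - w3 (g 0) (g 3) y S"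
  "w3 (g 4) (g 0) y S = - w3 (g 0) (g 4) y S" "w3 (g 2) (g 1) y S = - w3 (g 1) (g 2) y S" "w3 (g 3) (g 1) y S = - w3 (g 1) (g 3) y S"
  "w3 (g 4) (g 1) y S = - w3 (g 1) (g 4) y S" "w3 (g 3) (g 2) y S = - w3 (g 2) (g 3) y S" "w3 (g 4) (g 2) y S = - w3 (g 2) (g 4) y S"
  "w3 (g 4) (g 3) y S = - w3 (g 3) (g 4) y S" for g :: "nat \<Rightarrow> nat \<Rightarrow> 'k::field"
  by (rule w3_alternating(4))+

text \<open>Exterior powers are multiplicative: products with a repeated row vanish, and the others
  collect by alternation into the coefficients of \<open>vw x v\<close>. This is what lets matrices
  act on ideals.\<close>

lemma vw_gl: "vw (gl1 g x) (gl2 g v) = gl3 g (vw x v)"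
proof
  fix S
  have rot: "w3 (g 2) (g 0) (g 1) S = w3 (g 0) (g 1) (g 2) S" "w3 (g 3) (g 0) (g 1) S = w3 (g 0) (g 1) (g 3) S"
    "w3 (g 4) (g 0) (g 1) S = w3 (g 0) (g 1) (g 4) S" "w3 (g 3) (g 0) (g 2) S = w3 (g 0) (g 2) (g 3) S"
    "w3 (g 4) (g 0) (g 2) S = w3 (g 0) (g 2) (g 4) S" "w3 (g 4) (g 0) (g 3) S = w3 (g 0) (g 3) (g 4) S"
    "w3 (g 3) (g 1) (g 2) S = w3 (g 1) (g 2) (g 3) S" "w3 (g 4) (g 1) (g 2) S = w3 (g 1) (g 2) (g 4) S"
    "w3 (g 4) (g 1) (g 3) S = w3 (g 1) (g 3) (g 4) S" "w3 (g 4) (g 2) (g 3) S = w3 (g 2) (g 3) (g 4) S"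
    by (rule w3_alternating(5)[symmetric])+
  show "vw (gl1 g x) (gl2 g v) S = gl3 g (vw x v) S"
    unfolding vw_gl1 unfolding vw_gl2 gl3_def vw_eval w3_alternating(1-3) rot unfolding w3_swap by (simp add: algebra_simps)
qed

lemma gl3_w3: "gl3 g (w3 x y z) = w3 (gl1 g x) (gl1 g y) (gl1 g z)"
  by (simp add: w3_def vw_gl[symmetric] gl2_w2)

lemma gl2_lincomb: "gl2 g (lincomb r c y) = lincomb r c (\<lambda>i. gl2 g (y i))"
proof (induction r)
  case 0 then show ?case by (auto simp: lincomb_def gl2_def fun_eq_iff)
next
  case (Suc r)
  have 1: "lincomb (Suc r) c z S = lincomb r c z S + c r * z r S" for z and S :: "nat set" by (simp add: lincomb_def)
  have "gl2 g (lincomb (Suc r) c y) S = gl2 g (lincomb r c y) S + c r * gl2 g (y r) S" for S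
    by (simp add: gl2_def 1 algebra_simps)
  then show ?case using Suc 1[of "\<lambda>i. gl2 g (y i)"] by (intro ext) simp
qed

lemma gl3_lincomb: "gl3 g (lincomb r c y) = lincomb r c (\<lambda>i. gl3 g (y i))"
proof (induction r)
  case 0 then show ?case by (auto simp: lincomb_def gl3_def fun_eq_iff)
next
  case (Suc r)
  have 1: "lincomb (Suc r) c z S = lincomb r c z S + c r * z r S" for z and S :: "nat set" by (simp add: lincomb_def)
  have "gl3 g (lincomb (Suc r) c y) S = gl3 g (lincomb r c y) S + c r * gl3 g (y r) S" for S
    by (simp add: gl3_def 1 algebra_simps)
  then show ?case using Suc 1[of "\<lambda>i. gl3 g (y i)"] by (intro ext) simp
qed

lemma gl2_add: "gl2 g (u + v) = gl2 g u + gl2 g v"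
  and gl2_scale: "gl2 g (\<lambda>S. c * v S) = (\<lambda>S. c * gl2 g v S)"
  and gl3_add: "gl3 g (u + v) = gl3 g u + gl3 g v"
  and gl3_scale: "gl3 g (\<lambda>S. c * v S) = (\<lambda>S. c * gl3 g v S)"
  and gl2_zero: "gl2 g 0 = 0" and gl3_zero: "gl3 g 0 = 0"
  by (auto simp: gl2_def gl3_def fun_eq_iff algebra_simps)

lemma w2_cong: "(\<And>i. i < 5 \<Longrightarrow> x i = x' i) \<Longrightarrow> (\<And>i. i < 5 \<Longrightarrow> y i = y' i) \<Longrightarrow> w2 x y = w2 x' y'"
  by (rule ext_deg_2_eqI) simp_all

lemma w3_cong: "(\<And>i. i < 5 \<Longrightarrow> x i = x' i) \<Longrightarrow> (\<And>i. i < 5 \<Longrightarrow> y i = y' i) \<Longrightarrow> (\<And>i. i < 5 \<Longrightarrow> z i = z' i) \<Longrightarrow> w3 x y z = w3 x' y' z'"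
  by (rule ext_deg_3_eqI) (simp_all add: w3_eval)

text \<open>Only the first five rows and columns of a matrix matter; \<open>h k\<close> is the image of the k-th basis vector.\<close>
definition mat_mult :: "(nat \<Rightarrow> nat \<Rightarrow> 'k::field) \<Rightarrow> (nat \<Rightarrow> nat \<Rightarrow> 'k) \<Rightarrow> nat \<Rightarrow> nat \<Rightarrow> 'k" where
  "mat_mult g h = (\<lambda>k. gl1 g (h k))"

lemma gl2_mult: "gl2 g (gl2 h v) = gl2 (mat_mult g h) v"
proof -
  have "gl2 g (gl2 h v) = (\<lambda>S. v {0,1} * gl2 g (w2 (h 0) (h 1)) S + v {0,2} * gl2 g (w2 (h 0) (h 2)) S + v {0,3} * gl2 g (w2 (h 0) (h 3)) S
     + v {0,4} * gl2 g (w2 (h 0) (h 4)) S + v {1,2} * gl2 g (w2 (h 1) (h 2)) S + v {1,3} * gl2 g (w2 (h 1) (h 3)) S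
     + v {1,4} * gl2 g (w2 (h 1) (h 4)) S + v {2,3} * gl2 g (w2 (h 2) (h 3)) S + v {2,4} * gl2 g (w2 (h 2) (h 4)) S
     + v {3,4} * gl2 g (w2 (h 3) (h 4)) S)"
    unfolding gl2_def[of h v] gl2_add[unfolded plus_fun_def] gl2_scale by simp
  then show ?thesis unfolding gl2_def[of "mat_mult g h"] unfolding mat_mult_def gl2_w2 .
qed

lemma gl3_mult: "gl3 g (gl3 h w) = gl3 (mat_mult g h) w"
proof -
  have "gl3 g (gl3 h w) = (\<lambda>S. w {0,1,2} * gl3 g (w3 (h 0) (h 1) (h 2)) S + w {0,1,3} * gl3 g (w3 (h 0) (h 1) (h 3)) S
     + w {0,1,4} * gl3 g (w3 (h 0) (h 1) (h 4)) S + w {0,2,3} * gl3 g (w3 (h 0) (h 2) (h 3)) S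
     + w {0,2,4} * gl3 g (w3 (h 0) (h 2) (h 4)) S + w {0,3,4} * gl3 g (w3 (h 0) (h 3) (h 4)) S
     + w {1,2,3} * gl3 g (w3 (h 1) (h 2) (h 3)) S + w {1,2,4} * gl3 g (w3 (h 1) (h 2) (h 4)) S
     + w {1,3,4} * gl3 g (w3 (h 1) (h 3) (h 4)) S + w {2,3,4} * gl3 g (w3 (h 2) (h 3) (h 4)) S)"
    unfolding gl3_def[of h w] gl3_add[unfolded plus_fun_def] gl3_scale by simp
  then show ?thesis unfolding gl3_def[of "mat_mult g h"] unfolding mat_mult_def gl3_w3 .
qed

definition mat_eq :: "(nat \<Rightarrow> nat \<Rightarrow> 'k::field) \<Rightarrow> (nat \<Rightarrow> nat \<Rightarrow> 'k) \<Rightarrow> bool" where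
  "mat_eq g h \<longleftrightarrow> (\<forall>k<5. \<forall>i<5. g k i = h k i)"

lemma gl2_cong: "mat_eq g h \<Longrightarrow> gl2 g v = gl2 h v"
proof -
  assume "mat_eq g h"
  then have "w2 (g k) (g l) = w2 (h k) (h l)" if "k < 5" "l < 5" for k l using that by (intro w2_cong) (auto simp: mat_eq_def)
  then show ?thesis by (simp add: gl2_def)
qed

lemma gl3_cong: "mat_eq g h \<Longrightarrow> gl3 g v = gl3 h v"
proof -
  assume "mat_eq g h"
  then have "w3 (g k) (g l) (g m) = w3 (h k) (h l) (h m)" if "k < 5" "l < 5" "m < 5" for k l m using that by (intro w3_cong) (auto simp: mat_eq_def)
  then show ?thesis by (simp add: gl3_def)
qed

lemma gl2_unit: "v \<in> ext_deg 2 \<Longrightarrow> gl2 unit_vec v = v"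
proof (rule ext_deg_2_eqI)
  show "gl2 unit_vec v \<in> ext_deg 2" by simp
qed (simp_all add: gl2_def unit_vec_def)

lemma gl3_unit: "v \<in> ext_deg 3 \<Longrightarrow> gl3 unit_vec v = v"
proof (rule ext_deg_3_eqI)
  show "gl3 unit_vec v \<in> ext_deg 3" by simp
qed (simp_all add: gl3_def unit_vec_def w3_eval)

section \<open>Invertible matrices acting on frames\<close>

definition mat_inverse :: "(nat \<Rightarrow> nat \<Rightarrow> 'k::field) \<Rightarrow> (nat \<Rightarrow> nat \<Rightarrow> 'k) \<Rightarrow> bool" where
  "mat_inverse g h \<longleftrightarrow> mat_eq (mat_mult g h) unit_vec \<and> mat_eq (mat_mult h g) unit_vec"

lemma mat_inverse_sym: "mat_inverse g h \<Longrightarrow> mat_inverse h g"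
  by (simp add: mat_inverse_def)

lemma mat_inverse_exists:
  assumes "rows_indep 5 g {..<5::nat}" obtains h where "mat_inverse g h"
proof -
  have "rows_indep (card {..<5::nat}) g {..<5}" using assms by simp
  from rows_indep_dual[OF this] obtain P where P: "\<And>S T. S < 5 \<Longrightarrow> T < 5 \<Longrightarrow> (\<Sum>i<5. P T i * g i S) = (if S = T then 1 else 0)"
    "\<And>i j. i < 5 \<Longrightarrow> j < 5 \<Longrightarrow> (\<Sum>S<5. g i S * P S j) = (if i = j then 1 else 0)" by auto
  have "mat_inverse g P"
    unfolding mat_inverse_def mat_eq_def mat_mult_def gl1_def lincomb_def unit_vec_def using P by auto
  then show thesis by (rule that)
qed

lemma gl2_inverse: "mat_inverse g h \<Longrightarrow> v \<in> ext_deg 2 \<Longrightarrow> gl2 g (gl2 h v) = v"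
  unfolding gl2_mult mat_inverse_def using gl2_cong gl2_unit by metis

lemma gl3_inverse: "mat_inverse g h \<Longrightarrow> v \<in> ext_deg 3 \<Longrightarrow> gl3 g (gl3 h v) = v"
  unfolding gl3_mult mat_inverse_def using gl3_cong gl3_unit by metis

definition gl_act :: "(nat \<Rightarrow> nat \<Rightarrow> 'k::field) \<Rightarrow> 'k frame \<Rightarrow> 'k frame" where
  "gl_act g x = (\<lambda>(d,i,S). if d = 2 then gl2 g (row x 2 i) S else if d = 3 then gl3 g (row x 3 i) S else 0)"

lemma row_gl_act: "row (gl_act g x) 2 = (\<lambda>i. gl2 g (row x 2 i))" "row (gl_act g x) 3 = (\<lambda>i. gl3 g (row x 3 i))"
  by (simp_all add: gl_act_def fun_eq_iff)

lemma rowspan_gl_act: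
  "rowspan r (row (gl_act g x) 2) = gl2 g ` rowspan r (row x 2)"
  "rowspan r (row (gl_act g x) 3) = gl3 g ` rowspan r (row x 3)"
  unfolding row_gl_act rowspan_def gl2_lincomb[symmetric] gl3_lincomb[symmetric] by auto

lemma gl_act_frames: "x \<in> frames \<Longrightarrow> gl_act g x \<in> frames"
proof -
  assume x: "x \<in> frames"
  have "row x 2 i = 0" if "\<not> i < 3" for i using framesD[OF x, of 2 i] that by fastforce
  then have 2: "gl2 g (row x 2 i) S = 0" if "\<not> i < 3" for i S using that gl2_zero[of g] by simp
  have "row x 3 i = 0" if "\<not> i < 8" for i using framesD[OF x, of 3 i] that by fastforce
  then have 3: "gl3 g (row x 3 i) S = 0" if "\<not> i < 8" for i S using that gl3_zero[of g] by simp
  show ?thesis unfolding frames_def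
  proof (intro CollectI allI impI)
    fix d i S assume ne: "gl_act g x (d,i,S) \<noteq> 0"
    then consider "d = 2" "gl2 g (row x 2 i) S \<noteq> 0" | "d = 3" "gl3 g (row x 3 i) S \<noteq> 0"
      by (auto simp: gl_act_def split: if_splits)
    then show "(d = 2 \<and> i < 3 \<or> d = 3 \<and> i < 8) \<and> S \<subseteq> {..<5} \<and> card S = d"
    proof cases
      case 1
      then have "S \<in> deg_sets 2" using gl2_ext_deg unfolding ext_deg_eq by blast
      then show ?thesis using 1 2[of i S] by (auto simp: deg_sets_def)
    next
      case 2
      then have "S \<in> deg_sets 3" using gl3_ext_deg unfolding ext_deg_eq by blast
      then show ?thesis using 2 3[of i S] by (auto simp: deg_sets_def)
    qed
  qed
qed

lemma row_ext_deg: "x \<in> frames \<Longrightarrow> row x d i \<in> ext_deg d"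
  using framesD[of x d i] by (auto simp: ext_deg_eq deg_sets_def)

lemma gl_act_indep:
  assumes "x \<in> frames" "mat_inverse g h"
  shows "rows_indep r (row x 2) UNIV \<longleftrightarrow> rows_indep r (row (gl_act g x) 2) UNIV"
    "rows_indep r (row x 3) UNIV \<longleftrightarrow> rows_indep r (row (gl_act g x) 3) UNIV"
proof -
  have "lincomb r c (row x 2) = 0 \<longleftrightarrow> gl2 g (lincomb r c (row x 2)) = 0" for c
    using gl2_inverse[OF mat_inverse_sym[OF assms(2)]] lincomb_ext_deg row_ext_deg[OF assms(1)] gl2_zero by metis
  then show "rows_indep r (row x 2) UNIV \<longleftrightarrow> rows_indep r (row (gl_act g x) 2) UNIV"
    unfolding rows_indep_UNIV_iff row_gl_act gl2_lincomb[symmetric] by simp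
  have "lincomb r c (row x 3) = 0 \<longleftrightarrow> gl3 g (lincomb r c (row x 3)) = 0" for c
    using gl3_inverse[OF mat_inverse_sym[OF assms(2)]] lincomb_ext_deg row_ext_deg[OF assms(1)] gl3_zero by metis
  then show "rows_indep r (row x 3) UNIV \<longleftrightarrow> rows_indep r (row (gl_act g x) 3) UNIV"
    unfolding rows_indep_UNIV_iff row_gl_act gl3_lincomb[symmetric] by simp
qed

text \<open>With \<open>h\<close> inverse to \<open>g\<close>, the product of e_i with g(u) is g
  applied to the product of h(e_i) with u. So the condition E_1 I_2 in I_3 is carried along.\<close>

lemma gl_act_pts:
  assumes x: "x \<in> pts_over Hilb" and g: "mat_inverse g h"
  shows "gl_act g x \<in> pts_over Hilb"
  unfolding pts_over_Hilb_iff
proof (intro conjI allI impI ballI)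
  note xf = pts_Hilb_frames[OF x]
  show "gl_act g x \<in> frames" by (rule gl_act_frames[OF xf])
  show "rows_indep 3 (row (gl_act g x) 2) UNIV" "rows_indep 8 (row (gl_act g x) 3) UNIV"
    using x gl_act_indep[OF xf g] by (auto simp: pts_over_Hilb_iff)
  fix i :: nat and v assume i: "i < 5" and "v \<in> rowspan 3 (row (gl_act g x) 2)"
  then obtain u where u: "v = gl2 g u" "u \<in> rowspan 3 (row x 2)" unfolding rowspan_gl_act by blast
  have "ew i v = vw (gl1 g (h i)) v"
    unfolding ew_eq_vw[OF i] vw_def using g i
    by (intro lincomb_cong refl) (auto simp: mat_inverse_def mat_eq_def mat_mult_def)
  also have "\<dots> = gl3 g (vw (h i) u)" unfolding u(1) by (rule vw_gl)
  finally show "ew i v \<in> rowspan 8 (row (gl_act g x) 3)"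
    unfolding rowspan_gl_act using vw_in_rowspan[OF x u(2)] by blast
qed

lemma gl_act_inverse:
  assumes x: "x \<in> frames" and g: "mat_inverse g h" shows "gl_act g (gl_act h x) = x"
proof
  fix v :: "nat \<times> nat \<times> nat set"
  obtain d i S where v: "v = (d,i,S)" by (cases v)
  show "gl_act g (gl_act h x) v = x v"
    using gl2_inverse[OF g row_ext_deg[OF x]] gl3_inverse[OF g row_ext_deg[OF x]] framesD[OF x, of d i S]
    by (auto simp: v gl_act_def)
qed

lemma gl_act_mult: "gl_act g (gl_act h x) = gl_act (mat_mult g h) x"
  by (auto simp: gl_act_def fun_eq_iff gl2_mult gl3_mult)

lemma gl_act_cong: "mat_eq g h \<Longrightarrow> gl_act g x = gl_act h x"
  by (auto simp: gl_act_def fun_eq_iff gl2_cong[of g h] gl3_cong[of g h])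

lemma gl_act_Iof_cong:
  assumes "x \<in> frames" "y \<in> frames" "Iof x = Iof y"
  shows "Iof (gl_act g x) = Iof (gl_act g y)"
  using assms by (simp add: Iof_eq_iff gl_act_frames rowspan_gl_act)

lemma w2_polyfun: "(\<And>i. (\<lambda>a. x a i) \<in> polyfun) \<Longrightarrow> (\<And>i. (\<lambda>a. y a i) \<in> polyfun) \<Longrightarrow> (\<lambda>a. w2 (x a) (y a) S) \<in> polyfun"
  unfolding w2_def by (intro polyfun_intros)

lemma w3_polyfun:
  assumes "\<And>i. (\<lambda>a. x a i) \<in> polyfun" "\<And>i. (\<lambda>a. y a i) \<in> polyfun" "\<And>i. (\<lambda>a. z a i) \<in> polyfun"
  shows "(\<lambda>a. w3 (x a) (y a) (z a) S) \<in> polyfun"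
  unfolding w3_def vw_def lincomb_def ew_def
  by (intro polyfun_sum polyfun.pmult polyfun_if polyfun.pconst w2_polyfun assms)

lemma gl_act_polyfun:
  assumes g: "\<And>k i. (\<lambda>a. g a k i) \<in> polyfun" and x: "\<And>v. (\<lambda>a. x a v) \<in> polyfun"
  shows "(\<lambda>a. gl_act (g a) (x a) v) \<in> polyfun"
proof -
  obtain d i S where v: "v = (d,i,S)" by (cases v)
  show ?thesis unfolding v gl_act_def prod.case gl2_def gl3_def
    by (intro polyfun_if polyfun.padd polyfun.pmult w2_polyfun w3_polyfun g x polyfun.pconst)
qed

section \<open>The first family\<close>

lemma triple_eq_iff [simp]:
  fixes a b c d e f :: nat
  assumes "a < b" "b < c" "d < e" "e < f"
  shows "{a,b,c} = {d,e,f} \<longleftrightarrow> a = d \<and> b = e \<and> c = f"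
proof
  assume eq: "{a,b,c} = {d,e,f}"
  have "Min {a,b,c} = a" "Max {a,b,c} = c" using assms by (auto simp: min_def max_def)
  moreover have "Min {d,e,f} = d" "Max {d,e,f} = f" using assms by (auto simp: min_def max_def)
  ultimately have "a = d" "c = f" using eq by auto
  moreover have "b \<in> {d,e,f}" using eq by auto
  ultimately show "a = d \<and> b = e \<and> c = f" using assms by auto
qed simp

lemma lincomb_basis_mon:
  assumes "inj_on f {..<r}"
  shows "j < r \<Longrightarrow> lincomb r c (\<lambda>i. basis_mon (f i)) (f j) = c j"
    "S \<notin> f ` {..<r} \<Longrightarrow> lincomb r c (\<lambda>i. basis_mon (f i)) S = 0"
proof -
  show "lincomb r c (\<lambda>i. basis_mon (f i)) (f j) = c j" if "j < r"
  proof -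
    have "lincomb r c (\<lambda>i. basis_mon (f i)) (f j) = (\<Sum>i<r. if i = j then c i else 0)"
      unfolding lincomb_def using assms that by (intro sum.cong) (auto simp: basis_mon_def inj_on_def)
    then show ?thesis using that by simp
  qed
  show "lincomb r c (\<lambda>i. basis_mon (f i)) S = 0" if "S \<notin> f ` {..<r}"
    unfolding lincomb_def using that by (intro sum.neutral) (auto simp: basis_mon_def)
qed

lemma rowspan_basis_mon:
  fixes f :: "nat \<Rightarrow> nat set"
  assumes f: "inj_on f {..<r}"
  shows "rowspan r (\<lambda>i. basis_mon (f i)) = {w :: 'k::field ext. \<forall>S. S \<notin> f ` {..<r} \<longrightarrow> w S = 0}"
    and "rows_indep r (\<lambda>i. basis_mon (f i) :: 'k ext) UNIV"
proof -
  have A: "w \<in> rowspan r (\<lambda>i. basis_mon (f i))" if w: "\<forall>S. S \<notin> f ` {..<r} \<longrightarrow> w S = 0" for w :: "'k ext"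
  proof -
    have "w = lincomb r (\<lambda>i. w (f i)) (\<lambda>i. basis_mon (f i))"
    proof
      fix S show "w S = lincomb r (\<lambda>i. w (f i)) (\<lambda>i. basis_mon (f i)) S"
      proof (cases "S \<in> f ` {..<r}")
        case True
        then obtain j where "j < r" "S = f j" by blast
        then show ?thesis using lincomb_basis_mon(1)[OF f, of j "\<lambda>i. w (f i)"] by simp
      next
        case False
        then show ?thesis using lincomb_basis_mon(2)[OF f False] w by simp
      qed
    qed
    then show ?thesis by (auto simp: rowspan_def)
  qed
  have B: "w S = 0" if "w \<in> rowspan r (\<lambda>i. basis_mon (f i))" "S \<notin> f ` {..<r}" for w :: "'k ext" and S
  proof -
    from that(1) obtain c where "w = lincomb r c (\<lambda>i. basis_mon (f i))" unfolding rowspan_def by blast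
    then show ?thesis using lincomb_basis_mon(2)[OF f that(2)] by simp
  qed
  show "rowspan r (\<lambda>i. basis_mon (f i)) = {w :: 'k ext. \<forall>S. S \<notin> f ` {..<r} \<longrightarrow> w S = 0}"
  proof (intro set_eqI iffI CollectI allI impI)
    fix w :: "'k ext" and S assume "w \<in> rowspan r (\<lambda>i. basis_mon (f i))" "S \<notin> f ` {..<r}"
    then show "w S = 0" by (rule B)
  next
    fix w :: "'k ext" assume "w \<in> {w. \<forall>S. S \<notin> f ` {..<r} \<longrightarrow> w S = 0}"
    then show "w \<in> rowspan r (\<lambda>i. basis_mon (f i))" using A[of w] by simp
  qed
  show "rows_indep r (\<lambda>i. basis_mon (f i) :: 'k ext) UNIV"
    unfolding rows_indep_UNIV_iff
  proof (intro allI impI)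
    fix c :: "nat \<Rightarrow> 'k" and j assume "lincomb r c (\<lambda>i. basis_mon (f i)) = 0" "j < r"
    then show "c j = 0" using lincomb_basis_mon(1)[OF f, of j c] by simp
  qed
qed

lemma rows_indep_unit_vec: "{..<r} \<subseteq> A \<Longrightarrow> rows_indep r unit_vec A"
  unfolding rows_indep_def
proof (intro allI impI)
  fix c :: "nat \<Rightarrow> 'a" and i assume A: "{..<r} \<subseteq> A" and c: "\<forall>S\<in>A. (\<Sum>i<r. c i * unit_vec i S) = 0" and i: "i < r"
  have "(\<Sum>l<r. c l * unit_vec l i) = (\<Sum>l<r. if l = i then c l else 0)"
    by (intro sum.cong) (auto simp: unit_vec_def)
  then show "c i = 0" using c A i by auto
qed

text \<open>The monomials of degree 2 in the lexicographic ideal; together with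
  \<open>pivots3\<close> in degree 3 they are the pivots of the charts around that ideal.\<close>

definition pivots2 :: "nat set set" where "pivots2 = {{0,1},{0,2},{0,3}}"
definition pivots3 :: "nat set set" where "pivots3 = deg_sets 3 - {{1,3,4},{2,3,4}}"

text \<open>Monomial basis of e_0 E_1 + <e_1 e_2>, the five-dimensional space available for I_2; its
  first three members are the pivots.\<close>

definition v1_set :: "nat \<Rightarrow> nat set" where
  "v1_set j = (if j = 0 then {0,1} else if j = 1 then {0,2} else if j = 2 then {0,3} else if j = 3 then {0,4} else {1,2})"

definition w1_set :: "nat \<Rightarrow> nat set" where
  "w1_set j = (if j = 0 then {0,1,2} else if j = 1 then {0,1,3} else if j = 2 then {0,1,4} else if j = 3 then {0,2,3}
     else if j = 4 then {0,2,4} else if j = 5 then {0,3,4} else if j = 6 then {1,2,3} else {1,2,4})"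

lemma pivots3_eq: "pivots3 = {{0,1,2},{0,1,3},{0,1,4},{0,2,3},{0,2,4},{0,3,4},{1,2,3},{1,2,4}}"
  unfolding pivots3_def deg_sets_3 by (simp add: insert_Diff_if)

lemma w1_set_image: "w1_set ` {..<8} = pivots3"
proof -
  have "{..<8::nat} = {0,1,2,3,4,5,6,7}" by auto
  then show ?thesis unfolding pivots3_eq by (simp add: w1_set_def insert_commute)
qed

lemma card_pivots3: "card pivots3 = 8"
  unfolding pivots3_eq by simp

lemma finite_pivots3 [simp]: "finite pivots3"
  by (simp add: pivots3_def)

lemma w1_set_inj: "inj_on w1_set {..<8}"
  using card_pivots3 w1_set_image by (intro eq_card_imp_inj_on) auto

text \<open>In coordinates adapted to F_1 = <e_0> and F_3 = <e_0, e_1, e_2>, the members of the first family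
  are I_2 in F_1 E + F_3 F_3 and I_3 = F_1 E E + F_3 F_3 E.\<close>
definition std1 :: "'k::field frame \<Rightarrow> bool" where
  "std1 x \<longleftrightarrow> (\<forall>v\<in>rowspan 3 (row x 2). v {1,3} = 0 \<and> v {1,4} = 0 \<and> v {2,3} = 0 \<and> v {2,4} = 0 \<and> v {3,4} = 0) \<and>
     (\<forall>w\<in>rowspan 8 (row x 3). w {1,3,4} = 0 \<and> w {2,3,4} = 0)"

definition std1_frame :: "(nat \<Rightarrow> nat \<Rightarrow> 'k::field) \<Rightarrow> 'k frame" where
  "std1_frame c = (\<lambda>(d,i,S). if d = 2 \<and> i < 3 then lincomb 5 (c i) (\<lambda>j. basis_mon (v1_set j)) S
     else if d = 3 \<and> i < 8 then basis_mon (w1_set i) S else 0)"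

definition std1_vec :: "(nat \<Rightarrow> 'k::field) \<Rightarrow> 'k ext" where
  "std1_vec c = lincomb 5 c (\<lambda>j. basis_mon (v1_set j))"

lemma v1_set_deg: "v1_set j \<in> deg_sets 2"
  by (auto simp: v1_set_def deg_sets_2)

lemma basis_mon_ext_deg: "S \<in> deg_sets d \<Longrightarrow> basis_mon S \<in> ext_deg d"
  by (auto simp: ext_deg_eq basis_mon_def)

lemma std1_vec_ext_deg [simp]: "std1_vec c \<in> ext_deg 2"
  unfolding std1_vec_def by (intro lincomb_ext_deg basis_mon_ext_deg v1_set_deg)

lemma std1_vec_eval [simp]:
  "std1_vec c {0,1} = c 0" "std1_vec c {0,2} = c 1" "std1_vec c {0,3} = c 2" "std1_vec c {0,4} = c 3"
  "std1_vec c {1,2} = c 4" "std1_vec c {1,3} = 0" "std1_vec c {1,4} = 0" "std1_vec c {2,3} = 0"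
  "std1_vec c {2,4} = 0" "std1_vec c {3,4} = 0"
  by (simp_all add: std1_vec_def lincomb_def sum_lessThan_5 basis_mon_def v1_set_def doubleton_eq_iff)

lemma row_std1_frame:
  "i < 3 \<Longrightarrow> row (std1_frame c) 2 i = std1_vec (c i)" "i < 8 \<Longrightarrow> row (std1_frame c) 3 i = basis_mon (w1_set i)"
  by (simp_all add: std1_frame_def std1_vec_def)

lemma std1_frame_frames: "std1_frame c \<in> frames"
proof -
  have v: "std1_vec c S = 0" if "S \<notin> deg_sets 2" for c :: "nat \<Rightarrow> 'a" and S
    using that std1_vec_ext_deg[of c] by (auto simp: ext_deg_eq)
  have w: "w1_set i \<in> deg_sets 3" if "i < 8" for i using w1_set_image that by (auto simp: pivots3_def)
  show ?thesis unfolding frames_def std1_frame_def std1_vec_def[symmetric]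
  proof (intro CollectI allI impI)
    fix d i :: nat and S
    assume ne: "(case (d, i, S) of (d, i, S) \<Rightarrow> if d = 2 \<and> i < 3 then std1_vec (c i) S
      else if d = 3 \<and> i < 8 then basis_mon (w1_set i) S else 0) \<noteq> 0"
    then consider "d = 2" "i < 3" "std1_vec (c i) S \<noteq> 0" | "d = 3" "i < 8" "S = w1_set i"
      by (auto simp: basis_mon_def split: if_splits)
    then show "(d = 2 \<and> i < 3 \<or> d = 3 \<and> i < 8) \<and> S \<subseteq> {..<5} \<and> card S = d"
      using v[of S "c i"] w[of i] by cases (auto simp: deg_sets_def)
  qed
qed

lemma std1_W: "rowspan 8 (row (std1_frame c) 3) = {w \<in> ext_deg 3. w {1,3,4} = 0 \<and> w {2,3,4} = 0}"
proof -
  have "rowspan 8 (row (std1_frame c) 3) = rowspan 8 (\<lambda>i. basis_mon (w1_set i))"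
    by (rule rowspan_cong) (simp add: row_std1_frame)
  also have "\<dots> = {w. \<forall>S. S \<notin> pivots3 \<longrightarrow> w S = 0}"
    unfolding rowspan_basis_mon[OF w1_set_inj] w1_set_image ..
  also have "\<dots> = {w \<in> ext_deg 3. w {1,3,4} = 0 \<and> w {2,3,4} = 0}"
    by (auto simp: pivots3_def ext_deg_eq)
  finally show ?thesis .
qed

lemma std1_frame_W_indep: "rows_indep 8 (row (std1_frame c) 3) UNIV"
proof -
  have "rows_indep 8 (row (std1_frame c) 3) UNIV = rows_indep 8 (\<lambda>i. basis_mon (w1_set i) :: 'a ext) UNIV"
    by (rule rows_indep_cong) (simp add: fun_cong[OF row_std1_frame(2)])
  then show ?thesis using rowspan_basis_mon(2)[OF w1_set_inj] by simp
qed

lemma std1_std1_frame: "std1 (std1_frame c)"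
proof -
  have "v {1,3} = 0 \<and> v {1,4} = 0 \<and> v {2,3} = 0 \<and> v {2,4} = 0 \<and> v {3,4} = 0" if "v \<in> rowspan 3 (row (std1_frame c) 2)" for v
  proof -
    have "rowspan 3 (row (std1_frame c) 2) = rowspan 3 (\<lambda>i. std1_vec (c i))"
      by (rule rowspan_cong) (simp add: row_std1_frame)
    then show ?thesis using that by (auto simp: rowspan_def lincomb_def)
  qed
  then show ?thesis unfolding std1_def std1_W by simp
qed

lemma std1_ew:
  assumes "v \<in> ext_deg 2" "v {1,3} = 0" "v {1,4} = 0" "v {2,3} = 0" "v {2,4} = 0" "v {3,4} = 0" "i < 5"
  shows "ew i v \<in> {w \<in> ext_deg 3. w {1,3,4} = 0 \<and> w {2,3,4} = 0}"
  unfolding ew_eq_vw[OF assms(7)] using assms vw_ext_deg_3 by simp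

lemma std1_frame_pts:
  assumes "rows_indep 3 (row (std1_frame c) 2) UNIV" shows "std1_frame c \<in> pts_over Hilb"
  unfolding pts_over_Hilb_iff
proof (intro conjI allI impI ballI)
  fix i :: nat and v assume i: "i < 5" and v: "v \<in> rowspan 3 (row (std1_frame c) 2)"
  have "v \<in> ext_deg 2" using v rowspan_frames[OF std1_frame_frames] by blast
  then show "ew i v \<in> rowspan 8 (row (std1_frame c) 3)"
    unfolding std1_W using std1_std1_frame[of c] v i unfolding std1_def by (intro std1_ew) auto
qed (use assms std1_frame_frames std1_frame_W_indep in auto)

text \<open>The condition puts I_3 into a space of dimension 8, which it must fill.\<close>

lemma std1_rows_W:
  assumes "z \<in> pts_over Hilb" "std1 z"
  shows "rowspan 8 (row z 3) = {w \<in> ext_deg 3. w {1,3,4} = 0 \<and> w {2,3,4} = 0}"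
  unfolding std1_W[of undefined, symmetric]
proof (rule rowspan_eqI)
  show "rows_indep 8 (row z 3) UNIV" using assms by (simp add: pts_over_Hilb_iff)
  fix i :: nat assume "i < 8"
  then have "row z 3 i \<in> rowspan 8 (row z 3)" by (rule row_in_rowspan)
  then show "row z 3 i \<in> rowspan 8 (row (std1_frame undefined) 3)"
    unfolding std1_W using assms(2) row_ext_deg[OF pts_Hilb_frames[OF assms(1)]] by (auto simp: std1_def)
qed

lemma std1_same_point:
  assumes z: "z \<in> pts_over Hilb" "std1 z"
    and c: "\<And>i. i < 3 \<Longrightarrow> std1_vec (c i) \<in> rowspan 3 (row z 2)" "rows_indep 3 (\<lambda>i. std1_vec (c i)) UNIV"
  shows "std1_frame c \<in> pts_over Hilb \<and> Iof (std1_frame c) = Iof z"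
proof (rule same_pointI[OF z(1) std1_frame_frames])
  show "row (std1_frame c) 3 i \<in> rowspan 8 (row z 3)" if "i < 8" for i
    unfolding std1_rows_W[OF z] std1_W[of c, symmetric] using that by (rule row_in_rowspan)
  show "rows_indep 3 (row (std1_frame c) 2) UNIV"
    using c(2) rows_indep_cong[of 3 UNIV "row (std1_frame c) 2" "\<lambda>i. std1_vec (c i)"] by (simp add: fun_cong[OF row_std1_frame(1)])
qed (use c std1_frame_W_indep in \<open>auto simp: row_std1_frame\<close>)

text \<open>The parameters 6, ..., 13 move the flag F_1, F_3; the parameters 0, ..., 5 are the coefficients
  of the rows of I_2 at e_0 e_4 and e_1 e_2.\<close>
definition phi1_mat :: "(nat \<Rightarrow> 'k::field) \<Rightarrow> nat \<Rightarrow> nat \<Rightarrow> 'k" where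
  "phi1_mat b = (\<lambda>k i.
     if k = 0 then (if i = 0 then 1 else if i = 1 then b 8 else if i = 2 then b 9 else if i = 3 then b 6 else if i = 4 then b 7 else 0)
     else if k = 1 then (if i = 1 then 1 else if i = 3 then b 10 else if i = 4 then b 11 else 0)
     else if k = 2 then (if i = 2 then 1 else if i = 3 then b 12 else if i = 4 then b 13 else 0)
     else unit_vec k i)"

definition phi1_coeff :: "(nat \<Rightarrow> 'k::field) \<Rightarrow> nat \<Rightarrow> nat \<Rightarrow> 'k" where
  "phi1_coeff b = (\<lambda>i j. if j = i then 1 else if j = 3 then b i else if j = 4 then b (3 + i) else 0)"

definition phi1 :: "(nat \<Rightarrow> 'k::field) \<Rightarrow> 'k frame" where
  "phi1 b = gl_act (phi1_mat b) (std1_frame (phi1_coeff b))"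

lemma phi1_mat_inverse: obtains h where "mat_inverse (phi1_mat b) h"
proof (rule mat_inverse_exists)
  show "rows_indep 5 (phi1_mat b) {..<5}"
    unfolding rows_indep_def lessThan_5 by (auto simp: sum_lessThan_5 phi1_mat_def unit_vec_def dest!: less_5_cases)
qed

lemma less_3_cases: "i < (3::nat) \<Longrightarrow> i = 0 \<or> i = 1 \<or> i = 2"
  by linarith

lemma phi1_coeff_indep: "rows_indep 3 (\<lambda>i. std1_vec (phi1_coeff b i)) pivots2"
  unfolding rows_indep_def pivots2_def by (auto simp: sum_lessThan_3 phi1_coeff_def dest!: less_3_cases)

lemma phi1_coeff_pts: "std1_frame (phi1_coeff b) \<in> pts_over Hilb"
proof (rule std1_frame_pts)
  have "rows_indep 3 (\<lambda>i. std1_vec (phi1_coeff b i)) UNIV" using phi1_coeff_indep rows_indep_mono by blast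
  then show "rows_indep 3 (row (std1_frame (phi1_coeff b)) 2) UNIV"
    using rows_indep_cong[of 3 UNIV "row (std1_frame (phi1_coeff b)) 2" "\<lambda>i. std1_vec (phi1_coeff b i)"]
    by (simp add: fun_cong[OF row_std1_frame(1)])
qed

lemma phi1_pts: "phi1 b \<in> pts_over Hilb"
  unfolding phi1_def using phi1_mat_inverse[of b] gl_act_pts[OF phi1_coeff_pts] by metis

lemma std1_frame_polyfun: "(\<And>i j. (\<lambda>a. c a i j) \<in> polyfun) \<Longrightarrow> (\<lambda>a. std1_frame (c a) v) \<in> polyfun"
  unfolding std1_frame_def lincomb_def by (cases v) (simp only: prod.case, intro polyfun_if polyfun_sum polyfun.pmult polyfun.pconst)

lemma phi1_polyfun: "(\<lambda>b. phi1 b v) \<in> polyfun"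
  unfolding phi1_def phi1_mat_def phi1_coeff_def
  by (intro gl_act_polyfun std1_frame_polyfun polyfun_if polyfun.pconst polyfun.pvar)

lemma phi1_truncate: "phi1 (truncate_seq 14 b) = phi1 b"
proof -
  have "phi1_mat (truncate_seq 14 b) = phi1_mat b" by (auto simp: phi1_mat_def truncate_seq_def fun_eq_iff)
  moreover have "std1_frame (phi1_coeff (truncate_seq 14 b)) = std1_frame (phi1_coeff b)"
  proof
    fix v
    have "phi1_coeff (truncate_seq 14 b) i = phi1_coeff b i" if "i < 3" for i
      using that by (auto simp: phi1_coeff_def truncate_seq_def fun_eq_iff)
    then show "std1_frame (phi1_coeff (truncate_seq 14 b)) v = std1_frame (phi1_coeff b) v"
      by (cases v) (auto simp: std1_frame_def)
  qed
  ultimately show ?thesis by (simp add: phi1_def)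
qed

text \<open>I_2 has a reduced basis with the identity at the pivots; its entries at e_0 e_4 and e_1
  e_2 are the parameters. Those from 6 on stay free, since they will describe the flag.\<close>

lemma std1_normal_form:
  assumes z: "z \<in> pts_over Hilb" "std1 z" and ind: "rows_indep 3 (row z 2) pivots2"
  shows "\<exists>u. \<forall>b. (\<forall>i<6. b i = u i) \<longrightarrow> Iof (std1_frame (phi1_coeff b)) = Iof z"
proof -
  have card: "card pivots2 = 3" "finite pivots2" by (simp_all add: pivots2_def doubleton_eq_iff)
  have "\<exists>v\<in>rowspan 3 (row z 2). \<forall>S\<in>pivots2. v S = f S" for f
    using rows_indep_surj[OF ind card(2,1), of f] by (auto simp: rowspan_def lincomb_def)
  then have "\<forall>k. \<exists>v\<in>rowspan 3 (row z 2). \<forall>S\<in>pivots2. v S = std1_vec (unit_vec k) S" by blast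
  then obtain v where v: "\<And>k. v k \<in> rowspan 3 (row z 2)" "\<And>k S. S \<in> pivots2 \<Longrightarrow> v k S = std1_vec (unit_vec k) S" by metis
  define u where "u i = (if i < 3 then v i {0,4} else v (i - 3) {1,2})" for i
  have eq: "std1_vec (phi1_coeff b k) = v k" if "k < 3" "\<forall>i<6. b i = u i" for b k
  proof (rule ext_deg_2_eqI)
    show "v k \<in> ext_deg 2" using v(1) rowspan_frames[OF pts_Hilb_frames[OF z(1)]] by blast
  qed (use v(2)[of _ k] that z(2) v(1)[of k] in
      \<open>simp_all add: pivots2_def phi1_coeff_def unit_vec_def u_def std1_def\<close>)
  have "Iof (std1_frame (phi1_coeff b)) = Iof z" if "\<forall>i<6. b i = u i" for b
    using std1_same_point[OF z, of "phi1_coeff b"] eq[OF _ that] v(1)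
      rows_indep_mono[OF phi1_coeff_indep subset_UNIV, of b] by simp
  then show ?thesis by blast
qed

lemma mat_mult_gl_act: "mat_eq (mat_mult g M) k \<Longrightarrow> gl_act k z = gl_act g (gl_act M z)"
  using gl_act_cong gl_act_mult by metis

text \<open>The zeros say that \<open>M\<close> preserves the flag <e_0>, <e_0, e_1, e_2>; hence its
  exterior powers preserve the coordinate subspaces in \<open>std1\<close>.\<close>

lemma std1_gl_act:
  assumes z: "std1 z"
    and M: "\<And>i. i \<in> {1,2,3,4} \<Longrightarrow> M 0 i = 0" "\<And>i. i \<in> {3,4} \<Longrightarrow> M 1 i = 0" "\<And>i. i \<in> {3,4} \<Longrightarrow> M 2 i = 0"
  shows "std1 (gl_act M z)"
  using z unfolding std1_def rowspan_gl_act by (auto simp: gl2_def gl3_def w3_eval M)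

text \<open>When the flag of \<open>g\<close> lies in the big cell, \<open>g\<close> factors as
  \<open>phi1_mat b0\<close> after a matrix \<open>M\<close> that preserves the standard flag. Then
  \<open>M\<close> moves \<open>z\<close> to another ideal with \<open>std1\<close>, which has a
  normal form.\<close>

lemma chart1:
  assumes g: "mat_inverse g h" and z: "z \<in> pts_over Hilb" "std1 z"
    and ind: "rows_indep 1 g {0}" "rows_indep 3 g {0,1,2}" "rows_indep 3 (row (gl_act g z) 2) pivots2"
  shows "Iof (gl_act g z) \<in> range (\<lambda>b. Iof (phi1 b))"
proof -
  have g0: "g 0 0 \<noteq> 0" using rows_indepD[OF ind(1), of "\<lambda>_. 1" 0] by auto
  have "\<exists>c. \<forall>S\<in>{0,1,2}. (\<Sum>i<3. c i * g i S) = unit_vec k S" for k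
    by (rule rows_indep_surj[OF ind(2)]) auto
  then have c: "\<exists>v\<in>rowspan 3 g. v 0 = unit_vec k 0 \<and> v 1 = unit_vec k 1 \<and> v 2 = unit_vec k 2" for k
    by (auto simp: rowspan_def lincomb_def)
  \<comment> \<open>The vectors \<open>q\<close>, \<open>r\<close> and the rescaled first row
    \<open>p\<close> normalize the flag <g 0>, <g 0, g 1, g 2>: \<open>q\<close> and
    \<open>r\<close> have no e_0 coordinate, while \<open>p\<close> keeps its e_1 and e_2
    coordinates as parameters 8 and 9.\<close>
  obtain q where q: "q \<in> rowspan 3 g" "q 0 = 0" "q 1 = 1" "q 2 = 0" using c[of 1] by (auto simp: unit_vec_def)
  obtain r where r: "r \<in> rowspan 3 g" "r 0 = 0" "r 1 = 0" "r 2 = 1" using c[of 2] by (auto simp: unit_vec_def)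
  define p where "p = (\<lambda>i. (1 / g 0 0) * g 0 i)"
  have "p \<in> rowspan 3 g" unfolding p_def by (rule rowspan_scale[OF row_in_rowspan]) simp
  moreover have "p 0 = 1" using g0 by (simp add: p_def)
  ultimately have p: "p \<in> rowspan 3 g" "p 0 = 1" by simp_all
  define y where "y = (\<lambda>k::nat. if k = 0 then p else if k = 1 then q else r)"
  have "rows_indep 3 y UNIV"
  proof (rule rows_indep_mono)
    show "rows_indep 3 y {0,1,2}" unfolding rows_indep_def
      using p(2) q r by (auto simp: sum_lessThan_3 y_def dest!: less_3_cases)
  qed simp
  moreover have "y i \<in> rowspan 3 g" for i using p q r by (simp add: y_def)
  ultimately have "rowspan 3 y = rowspan 3 g" by (intro rowspan_eqI)
  then have "\<exists>m. g k = lincomb 3 m y" if "k < 3" for k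
    using row_in_rowspan[OF that, of g] by (auto simp: rowspan_def)
  then obtain m1 m2 where m: "g 1 = lincomb 3 m1 y" "g 2 = lincomb 3 m2 y" by (metis one_less_numeral_iff semiring_norm(77) lessI numeral_3_eq_3 numeral_2_eq_2 One_nat_def)
  define b0 where "b0 = (\<lambda>i::nat. if i = 8 then p 1 else if i = 9 then p 2 else if i = 6 then p 3 else if i = 7 then p 4
    else if i = 10 then q 3 else if i = 11 then q 4 else if i = 12 then r 3 else if i = 13 then r 4 else 0)"
  obtain h' where h': "mat_inverse (phi1_mat b0) h'" using phi1_mat_inverse by blast
  \<comment> \<open>The rows of \<open>M\<close> express the rows of \<open>g\<close> in those of
    \<open>phi1_mat b0\<close>: the first is a multiple of \<open>p\<close>, the next two are
    combinations of \<open>p\<close>, \<open>q\<close>, \<open>r\<close>.\<close>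
  define M where "M = (\<lambda>k i. if k = 0 then if i = 0 then g 0 0 else 0 else if k = 1 then if i < 3 then m1 i else 0
    else if k = 2 then if i < 3 then m2 i else 0 else gl1 h' (g k) i)"
  have G: "phi1_mat b0 0 i = p i" "phi1_mat b0 1 i = q i" "phi1_mat b0 2 i = r i" if "i < 5" for i
    using less_5_cases[OF that] p(2) q r by (auto simp: phi1_mat_def b0_def)
  have inv: "gl1 (phi1_mat b0) (gl1 h' x) i = x i" if i: "i < 5" for x i
  proof -
    have "gl1 (phi1_mat b0) (gl1 h' x) i = (\<Sum>k<5. (\<Sum>l<5. x l * h' l k) * phi1_mat b0 k i)" by (simp add: gl1_def lincomb_def)
    also have "\<dots> = (\<Sum>l<5. x l * (\<Sum>k<5. h' l k * phi1_mat b0 k i))"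
      by (simp add: sum_distrib_right sum_distrib_left mult.assoc) (rule sum.swap)
    also have "\<dots> = (\<Sum>l<5. x l * unit_vec l i)"
      using h' i by (intro sum.cong refl arg_cong2[where f="(*)"])
        (auto simp: mat_inverse_def mat_eq_def mat_mult_def gl1_def lincomb_def)
    also have "\<dots> = (\<Sum>l<5. if l = i then x l else 0)" by (intro sum.cong) (auto simp: unit_vec_def)
    also have "\<dots> = x i" using i by simp
    finally show ?thesis .
  qed
  have "mat_eq (mat_mult (phi1_mat b0) M) g"
    unfolding mat_eq_def mat_mult_def
  proof (intro allI impI)
    fix k i :: nat assume k: "k < 5" and i: "i < 5"
    consider "k = 0" | "k = 1" | "k = 2" | "k \<ge> 3" by linarith
    then show "gl1 (phi1_mat b0) (M k) i = g k i"
    proof cases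
      case 4
      then have "M k = gl1 h' (g k)" by (auto simp: M_def)
      then show ?thesis using inv[OF i] by simp
    qed (use g0 m in \<open>simp_all add: gl1_eval M_def G[OF i] p_def lincomb_def sum_lessThan_3 y_def\<close>)
  qed
  then have gz: "gl_act g z = gl_act (phi1_mat b0) (gl_act M z)" by (rule mat_mult_gl_act)
  define z1 where "z1 = gl_act M z"
  have z1f: "z1 \<in> frames" unfolding z1_def by (rule gl_act_frames[OF pts_Hilb_frames[OF z(1)]])
  have "z1 = gl_act h' (gl_act g z)" unfolding gz z1_def[symmetric] using gl_act_inverse[OF z1f mat_inverse_sym[OF h']] by simp
  then have z1: "z1 \<in> pts_over Hilb" using gl_act_pts[OF gl_act_pts[OF z(1) g] mat_inverse_sym[OF h']] by simp
  have s1: "std1 z1" unfolding z1_def by (rule std1_gl_act[OF z(2)]) (auto simp: M_def)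
  have "rows_indep 3 (row z1 2) pivots2"
    unfolding rows_indep_def
  proof (intro allI impI)
    fix e i assume e: "\<forall>S\<in>pivots2. (\<Sum>i<3. e i * z1 (2, i, S)) = 0" and i: "i < (3::nat)"
    define v where "v = lincomb 3 e (row z1 2)"
    have v: "v {0,1} = 0" "v {0,2} = 0" "v {0,3} = 0" using e by (auto simp: v_def lincomb_def pivots2_def)
    have "v \<in> rowspan 3 (row z1 2)" by (auto simp: v_def rowspan_def)
    then have v': "v {1,3} = 0" "v {1,4} = 0" "v {2,3} = 0" "v {2,4} = 0" "v {3,4} = 0" using s1 by (auto simp: std1_def)
    \<comment> \<open>With vanishing pivots \<open>v\<close> is a combination of e_0 e_4 and e_1
      e_2. These go to p e_4 and q r, and as \<open>q\<close> and \<open>r\<close> have no e_0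
      coordinate, neither image has a pivot coordinate.\<close>
    have "gl2 (phi1_mat b0) v S = 0" if "S \<in> pivots2" for S
      using that v v' by (auto simp: pivots2_def gl2_def phi1_mat_def unit_vec_def)
    moreover have "gl2 (phi1_mat b0) v = lincomb 3 e (row (gl_act g z) 2)"
      unfolding gz z1_def[symmetric] row_gl_act v_def gl2_lincomb ..
    ultimately show "e i = 0" using rows_indepD[OF ind(3) _ i, of e] by (simp add: lincomb_def)
  qed
  from std1_normal_form[OF z1 s1 this] obtain u where u: "\<And>b. (\<forall>i<6. b i = u i) \<Longrightarrow> Iof (std1_frame (phi1_coeff b)) = Iof z1" by blast
  define b where "b = (\<lambda>i. if i < 6 then u i else b0 i)"
  have "phi1_mat b = phi1_mat b0" by (auto simp: phi1_mat_def b_def fun_eq_iff)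
  moreover have "Iof (std1_frame (phi1_coeff b)) = Iof z1" by (rule u) (simp add: b_def)
  ultimately have "Iof (phi1 b) = Iof (gl_act g z)"
    unfolding phi1_def gz z1_def[symmetric] using gl_act_Iof_cong[OF std1_frame_frames z1f] by metis
  then show ?thesis by (metis rangeI)
qed

lemma rows_indep_open_ex:
  fixes x :: "('v \<Rightarrow> 'k::field) \<Rightarrow> nat \<Rightarrow> 's \<Rightarrow> 'k"
  assumes "rows_indep r (x a0) A" "\<And>i S. (\<lambda>a. x a i S) \<in> polyfun"
  shows "\<exists>h. h \<in> polyfun \<and> h a0 \<noteq> 0 \<and> (\<forall>a. h a \<noteq> 0 \<longrightarrow> rows_indep r (x a) A)"
proof (rule rows_indep_open_subst[of r x a0 A, OF assms])
  fix h assume "h \<in> polyfun" "h a0 \<noteq> 0" "\<And>a. h a \<noteq> 0 \<Longrightarrow> rows_indep r (x a) A"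
  then show ?thesis by blast
qed

text \<open>Moving both the matrix and the coefficients to general position along a family keeps the point
  in the closure, and general members lie in the chart.\<close>
theorem density1:
  fixes z :: "'k::field frame"
  assumes inf: "infinite (UNIV :: 'k set)" and g: "mat_inverse g h" and z: "z \<in> pts_over Hilb" "std1 z"
  shows "Iof (gl_act g z) \<in> H_closure (range (\<lambda>b. Iof (phi1 b)))"
proof -
  let ?D = "H_closure (range (\<lambda>b. Iof (phi1 b :: _ \<Rightarrow> 'k)))"
  have D: "H_closed ?D" using phi1_pts by (intro H_closed_closure) (auto simp: pts_over_def)
  define G where "G a = (\<lambda>k i. a (0::nat,k,i))" for a :: "nat \<times> nat \<times> nat \<Rightarrow> 'k"
  define C where "C a = (\<lambda>i j. a (1::nat,i,j))" for a :: "nat \<times> nat \<times> nat \<Rightarrow> 'k"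
  define \<Psi> where "\<Psi> a = gl_act (G a) (std1_frame (C a))" for a
  have Gp: "(\<lambda>a. G a k i) \<in> polyfun" and Cp: "(\<lambda>a. C a k i) \<in> polyfun" for k i
    by (auto simp: G_def C_def intro: polyfun.intros)
  have \<Psi>p: "(\<lambda>a. \<Psi> a v) \<in> polyfun" for v
    unfolding \<Psi>_def by (intro gl_act_polyfun std1_frame_polyfun Gp Cp)
  \<comment> \<open>At \<open>a0\<close> the matrix is the identity and I_2 is spanned by the
    pivots, so all open conditions of the chart hold there.\<close>
  define a0 where "a0 = (\<lambda>(d::nat,k,i). unit_vec k i :: 'k)"
  have G0: "G a0 = unit_vec" "C a0 = unit_vec" by (auto simp: G_def C_def a0_def fun_eq_iff)
  have ind0: "rows_indep 5 (G a0) {..<5}" "rows_indep 1 (G a0) {0}" "rows_indep 3 (G a0) {0,1,2}"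
    unfolding G0 by (rule rows_indep_unit_vec; auto)+
  note open_conds = rows_indep_open_ex[of 5 G, OF ind0(1) Gp] rows_indep_open_ex[of 1 G, OF ind0(2) Gp]
    rows_indep_open_ex[of 3 G, OF ind0(3) Gp]
  obtain h1 where h1: "h1 \<in> polyfun" "h1 a0 \<noteq> 0" "\<And>a. h1 a \<noteq> 0 \<Longrightarrow> rows_indep 5 (G a) {..<5}"
    using open_conds(1) by blast
  obtain h2 where h2: "h2 \<in> polyfun" "h2 a0 \<noteq> 0" "\<And>a. h2 a \<noteq> 0 \<Longrightarrow> rows_indep 1 (G a) {0}"
    using open_conds(2) by blast
  obtain h3 where h3: "h3 \<in> polyfun" "h3 a0 \<noteq> 0" "\<And>a. h3 a \<noteq> 0 \<Longrightarrow> rows_indep 3 (G a) {0,1,2}"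
    using open_conds(3) by blast
  have "row (\<Psi> a0) 2 i = std1_vec (unit_vec i)" if "i < 3" for i
    using that unfolding \<Psi>_def G0 by (subst fun_cong[OF row_gl_act(1)]) (simp add: row_std1_frame gl2_unit)
  then have "rows_indep 3 (row (\<Psi> a0) 2) pivots2 \<longleftrightarrow> rows_indep 3 (\<lambda>i. std1_vec (unit_vec i) :: 'k ext) pivots2"
    by (intro rows_indep_cong) (metis (no_types, lifting))
  moreover have "rows_indep 3 (\<lambda>i. std1_vec (unit_vec i) :: 'k ext) pivots2"
    unfolding rows_indep_def pivots2_def by (auto simp: sum_lessThan_3 unit_vec_def dest!: less_3_cases)
  ultimately have "rows_indep 3 (row (\<Psi> a0) 2) pivots2" by simp
  from rows_indep_open_ex[of 3 "\<lambda>a. row (\<Psi> a) 2", OF this \<Psi>p]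
  obtain h4 where h4: "h4 \<in> polyfun" "h4 a0 \<noteq> 0" "\<And>a. h4 a \<noteq> 0 \<Longrightarrow> rows_indep 3 (row (\<Psi> a) 2) pivots2"
    by blast
  \<comment> \<open>The parameter of the given ideal: block 0 is \<open>g\<close>, block 1 holds the
    coefficients of the rows of its I_2.\<close>
  define a where "a = (\<lambda>(d::nat,k,i). if d = 0 then g k i else z (2, k, v1_set i))"
  have Ga: "G a = g" by (auto simp: G_def a_def fun_eq_iff)
  have eq: "std1_vec (C a i) = row z 2 i" if "i < 3" for i
  proof (rule ext_deg_2_eqI)
    show r: "row z 2 i \<in> ext_deg 2" by (rule row_ext_deg[OF pts_Hilb_frames[OF z(1)]])
    from z(2) have "\<And>v. v \<in> rowspan 3 (row z 2) \<Longrightarrow> v {1,3} = 0 \<and> v {1,4} = 0 \<and> v {2,3} = 0 \<and> v {2,4} = 0 \<and> v {3,4} = 0"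
      by (simp add: std1_def)
    from this[OF row_in_rowspan[OF that]]
    show "std1_vec (C a i) {1,3} = z (2,i,{1,3})" "std1_vec (C a i) {1,4} = z (2,i,{1,4})" "std1_vec (C a i) {2,3} = z (2,i,{2,3})"
      "std1_vec (C a i) {2,4} = z (2,i,{2,4})" "std1_vec (C a i) {3,4} = z (2,i,{3,4})" by simp_all
  qed (simp_all add: C_def a_def v1_set_def)
  have "std1_frame (C a) \<in> pts_over Hilb \<and> Iof (std1_frame (C a)) = Iof z"
  proof (rule std1_same_point[OF z])
    show "std1_vec (C a i) \<in> rowspan 3 (row z 2)" if "i < 3" for i unfolding eq[OF that] using that by (rule row_in_rowspan)
    show "rows_indep 3 (\<lambda>i. std1_vec (C a i)) UNIV"
      using z(1) rows_indep_cong[of 3 UNIV "\<lambda>i. std1_vec (C a i)" "row z 2"] eq by (simp add: pts_over_Hilb_iff)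
  qed
  then have a: "\<Psi> a \<in> pts_over Hilb" "Iof (\<Psi> a) = Iof (gl_act g z)"
    unfolding \<Psi>_def Ga using gl_act_pts[OF _ g] gl_act_Iof_cong[OF std1_frame_frames pts_Hilb_frames[OF z(1)]] by auto
  have "\<Psi> a \<in> pts_over ?D"
  proof (rule closed_generic[OF inf D \<Psi>p _ _ _ a(1)])
    show "(\<lambda>a. h1 a * h2 a * (h3 a * h4 a)) \<in> polyfun" using h1 h2 h3 h4 by (intro polyfun.pmult) auto
    show "h1 a0 * h2 a0 * (h3 a0 * h4 a0) \<noteq> 0" using h1 h2 h3 h4 by simp
    fix e assume "h1 e * h2 e * (h3 e * h4 e) \<noteq> 0"
    then have e: "rows_indep 5 (G e) {..<5}" "rows_indep 1 (G e) {0}" "rows_indep 3 (G e) {0,1,2}" "rows_indep 3 (row (\<Psi> e) 2) pivots2"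
      using h1(3)[of e] h2(3)[of e] h3(3)[of e] h4(3)[of e] by auto
    obtain k where k: "mat_inverse (G e) k" using mat_inverse_exists[OF e(1)] by blast
    have "rows_indep 3 (row (\<Psi> e) 2) UNIV" by (rule rows_indep_mono[OF e(4)]) simp
    then have "rows_indep 3 (row (std1_frame (C e)) 2) UNIV"
      unfolding \<Psi>_def using gl_act_indep(1)[OF std1_frame_frames k] by metis
    then have y: "std1_frame (C e) \<in> pts_over Hilb" by (rule std1_frame_pts)
    have "Iof (\<Psi> e) \<in> range (\<lambda>b. Iof (phi1 b))"
      unfolding \<Psi>_def using chart1[OF k y std1_std1_frame e(2,3)] e(4) unfolding \<Psi>_def by simp
    moreover have "\<Psi> e \<in> frames" unfolding \<Psi>_def by (rule gl_act_frames[OF std1_frame_frames])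
    ultimately show "\<Psi> e \<in> pts_over ?D" by (simp add: pts_over_def subsetD[OF H_closure_subset])
  qed
  then show ?thesis using a(2) by (simp add: pts_over_def)
qed

section \<open>The second family\<close>

lemma sum_lessThan_4: "(\<Sum>i<(4::nat). f i) = f 0 + f 1 + f 2 + (f 3 :: 'a::comm_monoid_add)"
  by (simp add: eval_nat_numeral One_nat_def ac_simps)

lemma sum_lessThan_6: "(\<Sum>i<(6::nat). f i) = f 0 + f 1 + f 2 + f 3 + f 4 + (f 5 :: 'a::comm_monoid_add)"
  by (simp add: eval_nat_numeral One_nat_def ac_simps)

lemma less_4_cases: "i < (4::nat) \<Longrightarrow> i = 0 \<or> i = 1 \<or> i = 2 \<or> i = 3"
  by linarith

lemma less_8_cases: "i < (8::nat) \<Longrightarrow> i = 0 \<or> i = 1 \<or> i = 2 \<or> i = 3 \<or> i = 4 \<or> i = 5 \<or> i = 6 \<or> i = 7"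
  by linarith

text \<open>In coordinates adapted to the hyperplane H = <e_0, e_1, e_2, e_3>, the members of the second
  family satisfy I_2 in H H, and I_3 contains H H H.\<close>
definition std2 :: "'k::field frame \<Rightarrow> bool" where
  "std2 x \<longleftrightarrow> (\<forall>v\<in>rowspan 3 (row x 2). v {0,4} = 0 \<and> v {1,4} = 0 \<and> v {2,4} = 0 \<and> v {3,4} = 0) \<and>
     (\<forall>w\<in>ext_deg 3. w {0,1,4} = 0 \<and> w {0,2,4} = 0 \<and> w {0,3,4} = 0 \<and> w {1,2,4} = 0 \<and> w {1,3,4} = 0 \<and> w {2,3,4} = 0
        \<longrightarrow> w \<in> rowspan 8 (row x 3))"

definition v2_set :: "nat \<Rightarrow> nat set" where
  "v2_set l = (if l = 0 then {0,1} else if l = 1 then {0,2} else if l = 2 then {0,3} else if l = 3 then {1,2}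
     else if l = 4 then {1,3} else {2,3})"

definition h_set :: "nat \<Rightarrow> nat set" where
  "h_set i = (if i = 0 then {0,1,2} else if i = 1 then {0,1,3} else if i = 2 then {0,2,3} else {1,2,3})"

definition std2_vec :: "(nat \<Rightarrow> 'k::field) \<Rightarrow> 'k ext" where
  "std2_vec t = lincomb 6 t (\<lambda>l. basis_mon (v2_set l))"

lemma std2_vec_ext_deg [simp]: "std2_vec t \<in> ext_deg 2"
  unfolding std2_vec_def by (intro lincomb_ext_deg basis_mon_ext_deg) (auto simp: v2_set_def deg_sets_2)

lemma std2_vec_eval [simp]:
  "std2_vec t {0,1} = t 0" "std2_vec t {0,2} = t 1" "std2_vec t {0,3} = t 2" "std2_vec t {1,2} = t 3"
  "std2_vec t {1,3} = t 4" "std2_vec t {2,3} = t 5" "std2_vec t {0,4} = 0" "std2_vec t {1,4} = 0"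
  "std2_vec t {2,4} = 0" "std2_vec t {3,4} = 0"
  by (simp_all add: std2_vec_def lincomb_def sum_lessThan_6 basis_mon_def v2_set_def doubleton_eq_iff)

lemma ew_4_eval [simp]:
  "ew 4 v {0,1,2} = 0" "ew 4 v {0,1,3} = 0" "ew 4 v {0,2,3} = 0" "ew 4 v {1,2,3} = 0"
  "ew 4 v {0,1,4} = v {0,1}" "ew 4 v {0,2,4} = v {0,2}" "ew 4 v {0,3,4} = v {0,3}" "ew 4 v {1,2,4} = v {1,2}"
  "ew 4 v {1,3,4} = v {1,3}" "ew 4 v {2,3,4} = v {2,3}"
  by (simp_all add: ew_eq_vw unit_vec_def)

lemma ew_lincomb: "ew i (lincomb r c y) = lincomb r c (\<lambda>j. ew i (y j))"
proof (induction r)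
  case 0
  have 0: "lincomb 0 c z = 0" for z :: "nat \<Rightarrow> 'a ext" by (simp add: lincomb_def fun_eq_iff)
  show ?case unfolding 0 by (rule ew_zero)
next
  case (Suc r)
  have 1: "lincomb (Suc r) c z = lincomb r c z + (\<lambda>S. c r * z r S)" for z :: "nat \<Rightarrow> 'a ext" by (simp add: lincomb_def fun_eq_iff)
  show ?case unfolding 1 ew_add ew_scale Suc ..
qed

lemma ew_ext_deg_3: "v \<in> ext_deg 2 \<Longrightarrow> ew i v \<in> ext_deg 3"
  using ew_ext_deg[of v 2] by (simp add: eval_nat_numeral One_nat_def)

lemma basis_mon_h_set_eval [simp]:
  "basis_mon (h_set i) {0,1,4} = 0" "basis_mon (h_set i) {0,2,4} = 0" "basis_mon (h_set i) {0,3,4} = 0"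
  "basis_mon (h_set i) {1,2,4} = 0" "basis_mon (h_set i) {1,3,4} = 0" "basis_mon (h_set i) {2,3,4} = 0"
  by (simp_all add: basis_mon_def h_set_def)

lemma h_set_ext_deg: "basis_mon (h_set i) \<in> ext_deg 3"
  by (intro basis_mon_ext_deg) (auto simp: h_set_def deg_sets_3)

lemma std2_h_set:
  assumes "std2 z" shows "basis_mon (h_set i) \<in> rowspan 8 (row z 3)"
proof -
  have "basis_mon (h_set i) {0,1,4} = (0::'a) \<and> basis_mon (h_set i) {0,2,4} = (0::'a) \<and> basis_mon (h_set i) {0,3,4} = (0::'a)
    \<and> basis_mon (h_set i) {1,2,4} = (0::'a) \<and> basis_mon (h_set i) {1,3,4} = (0::'a) \<and> basis_mon (h_set i) {2,3,4} = (0::'a)"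
    by simp
  then show ?thesis using assms h_set_ext_deg[of i] unfolding std2_def by blast
qed

text \<open>In adapted coordinates I_3 = H H H + e_4 T, where T is spanned by the vectors
  \<open>std2_vec (t j)\<close>; the matrix \<open>c\<close> expresses the rows of I_2 in
  these.\<close>

definition std2_frame :: "(nat \<Rightarrow> nat \<Rightarrow> 'k::field) \<Rightarrow> (nat \<Rightarrow> nat \<Rightarrow> 'k) \<Rightarrow> 'k frame" where
  "std2_frame t c = (\<lambda>(d,i,S). if d = 2 \<and> i < 3 then lincomb 4 (c i) (\<lambda>j. std2_vec (t j)) S
     else if d = 3 \<and> i < 4 then basis_mon (h_set i) S
     else if d = 3 \<and> i < 8 then ew 4 (std2_vec (t (i - 4))) S else 0)"

lemma row_std2_frame:
  "i < 3 \<Longrightarrow> row (std2_frame t c) 2 i = lincomb 4 (c i) (\<lambda>j. std2_vec (t j))"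
  "i < 4 \<Longrightarrow> row (std2_frame t c) 3 i = basis_mon (h_set i)"
  "4 \<le> i \<Longrightarrow> i < 8 \<Longrightarrow> row (std2_frame t c) 3 i = ew 4 (std2_vec (t (i - 4)))"
  by (simp_all add: std2_frame_def)

lemma std2_frame_rows:
  "std2_frame t c (3, 0, S) = basis_mon {0,1,2} S" "std2_frame t c (3, 1, S) = basis_mon {0,1,3} S"
  "std2_frame t c (3, 2, S) = basis_mon {0,2,3} S" "std2_frame t c (3, 3, S) = basis_mon {1,2,3} S"
  "std2_frame t c (3, 4, S) = ew 4 (std2_vec (t 0)) S" "std2_frame t c (3, 5, S) = ew 4 (std2_vec (t 1)) S"
  "std2_frame t c (3, 6, S) = ew 4 (std2_vec (t 2)) S" "std2_frame t c (3, 7, S) = ew 4 (std2_vec (t 3)) S"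
  by (simp_all add: std2_frame_def h_set_def flip: One_nat_def)

lemma std2_frame_frames: "std2_frame t c \<in> frames"
proof -
  have "lincomb 4 (c i) (\<lambda>j. std2_vec (t j)) \<in> ext_deg 2" for i by (intro lincomb_ext_deg) simp
  then have 2: "S \<in> deg_sets 2" if "lincomb 4 (c i) (\<lambda>j. std2_vec (t j)) S \<noteq> 0" for i S
    using that unfolding ext_deg_eq by blast
  have 3: "S \<in> deg_sets 3" if "basis_mon (h_set i) S \<noteq> (0::'a)" for i S using h_set_ext_deg[of i, where 'a='a] that unfolding ext_deg_eq by blast
  have 4: "S \<in> deg_sets 3" if "ew 4 (std2_vec (t i)) S \<noteq> 0" for i S
    using ew_ext_deg_3[OF std2_vec_ext_deg, of 4 "t i"] that unfolding ext_deg_eq by blast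
  show ?thesis unfolding frames_def
  proof (intro CollectI allI impI)
    fix d i S assume "std2_frame t c (d,i,S) \<noteq> 0"
    then consider "d = 2" "i < 3" "S \<in> deg_sets 2" | "d = 3" "i < 8" "S \<in> deg_sets 3"
      using 2[of i S] 3[of i S] 4[of "i - 4" S] by (auto simp: std2_frame_def split: if_splits)
    then show "(d = 2 \<and> i < 3 \<or> d = 3 \<and> i < 8) \<and> S \<subseteq> {..<5} \<and> card S = d" by cases (auto simp: deg_sets_def)
  qed
qed

text \<open>The coefficients without index 4 are free, since I_3 contains H H H; those with index 4
  must form an element of T.\<close>

lemma std2_W_mem:
  assumes w: "w \<in> ext_deg 3"
    and e: "w {0,1,4} = lincomb 4 e (\<lambda>j. std2_vec (t j)) {0,1}" "w {0,2,4} = lincomb 4 e (\<lambda>j. std2_vec (t j)) {0,2}"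
    "w {0,3,4} = lincomb 4 e (\<lambda>j. std2_vec (t j)) {0,3}" "w {1,2,4} = lincomb 4 e (\<lambda>j. std2_vec (t j)) {1,2}"
    "w {1,3,4} = lincomb 4 e (\<lambda>j. std2_vec (t j)) {1,3}" "w {2,3,4} = lincomb 4 e (\<lambda>j. std2_vec (t j)) {2,3}"
  shows "w \<in> rowspan 8 (row (std2_frame t c) 3)"
proof -
  define f where "f i = (if i < 4 then w (h_set i) else e (i - 4))" for i
  have "w = lincomb 8 f (row (std2_frame t c) 3)"
  proof (rule ext_deg_3_eqI[OF w])
    show "lincomb 8 f (row (std2_frame t c) 3) \<in> ext_deg 3"
      by (intro lincomb_ext_deg row_ext_deg std2_frame_frames)
  qed (use e in \<open>simp_all add: lincomb_def sum_lessThan_8 sum_lessThan_4 std2_frame_rows f_def h_set_def basis_mon_def flip: One_nat_def\<close>)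
  then show ?thesis by (auto simp: rowspan_def)
qed

lemma std2_V_vec: "v \<in> rowspan 3 (row (std2_frame t c) 2) \<Longrightarrow> \<exists>e. v = lincomb 4 e (\<lambda>j. std2_vec (t j))"
proof -
  assume v: "v \<in> rowspan 3 (row (std2_frame t c) 2)"
  have "rowspan 3 (row (std2_frame t c) 2) \<subseteq> rowspan 4 (\<lambda>j. std2_vec (t j))"
    by (intro rowspan_subsetI) (auto simp: row_std2_frame rowspan_def)
  then show ?thesis using v by (auto simp: rowspan_def)
qed

lemma std2_std2_frame: "std2 (std2_frame t c)"
  unfolding std2_def
proof (intro conjI ballI impI)
  fix v assume "v \<in> rowspan 3 (row (std2_frame t c) 2)"
  then obtain e where "v = lincomb 4 e (\<lambda>j. std2_vec (t j))" using std2_V_vec by blast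
  then show "v {0,4} = 0" "v {1,4} = 0" "v {2,4} = 0" "v {3,4} = 0" by (simp_all add: lincomb_def)
next
  fix w :: "'a ext" assume "w \<in> ext_deg 3" "w {0,1,4} = 0 \<and> w {0,2,4} = 0 \<and> w {0,3,4} = 0 \<and> w {1,2,4} = 0 \<and> w {1,3,4} = 0 \<and> w {2,3,4} = 0"
  then show "w \<in> rowspan 8 (row (std2_frame t c) 3)" by (intro std2_W_mem[of w "\<lambda>_. 0"]) (auto simp: lincomb_def)
qed

text \<open>For i < 4 multiplication by e_i sends I_2 into H H H, and e_4 sends it into e_4 T
  because I_2 lies in T.\<close>

lemma std2_frame_pts:
  assumes "rows_indep 3 (row (std2_frame t c) 2) UNIV" "rows_indep 8 (row (std2_frame t c) 3) UNIV"
  shows "std2_frame t c \<in> pts_over Hilb"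
  unfolding pts_over_Hilb_iff
proof (intro conjI allI impI ballI)
  fix i :: nat and v assume i: "i < 5" and v: "v \<in> rowspan 3 (row (std2_frame t c) 2)"
  have d: "v \<in> ext_deg 2" using v rowspan_frames[OF std2_frame_frames] by blast
  have v0: "v {0,4} = 0" "v {1,4} = 0" "v {2,4} = 0" "v {3,4} = 0" using std2_std2_frame[of t c] v by (auto simp: std2_def)
  obtain e where e: "v = lincomb 4 e (\<lambda>j. std2_vec (t j))" using std2_V_vec[OF v] by blast
  show "ew i v \<in> rowspan 8 (row (std2_frame t c) 3)"
  proof (cases "i = 4")
    case True
    then show ?thesis by (intro std2_W_mem[of _ e]) (simp_all add: ew_ext_deg_3 d flip: e)
  next
    case False
    then show ?thesis using ew_ext_deg_3[OF d, of i] v0 i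
      by (intro std2_W_mem[of _ "\<lambda>_. 0"]) (auto simp: lincomb_def ew_eq_vw unit_vec_def)
  qed
qed (use assms std2_frame_frames in auto)

lemma std2_W_indep:
  assumes "rows_indep 4 (\<lambda>j. std2_vec (t j)) UNIV" shows "rows_indep 8 (row (std2_frame t c) 3) UNIV"
  unfolding rows_indep_def
proof (intro allI impI)
  fix f i assume f: "\<forall>S\<in>UNIV. (\<Sum>i<8. f i * std2_frame t c (3, i, S)) = 0" and i: "i < (8::nat)"
  have f': "(\<Sum>i<8. f i * std2_frame t c (3, i, S)) = 0" for S using f by blast
  have low: "f 0 = 0" "f 1 = 0" "f 2 = 0" "f 3 = 0"
    using f'[of "{0,1,2}"] f'[of "{0,1,3}"] f'[of "{0,2,3}"] f'[of "{1,2,3}"]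
    by (simp_all add: sum_lessThan_8 std2_frame_rows basis_mon_def)
  have "lincomb 4 (\<lambda>j. f (4 + j)) (\<lambda>j. std2_vec (t j)) = 0"
  proof (rule ext_deg_2_eqI)
    show "lincomb 4 (\<lambda>j. f (4 + j)) (\<lambda>j. std2_vec (t j)) \<in> ext_deg 2" by (intro lincomb_ext_deg) simp
  qed (use f'[of "{0,1,4}"] f'[of "{0,2,4}"] f'[of "{0,3,4}"] f'[of "{1,2,4}"] f'[of "{1,3,4}"] f'[of "{2,3,4}"]
      in \<open>simp_all add: sum_lessThan_8 std2_frame_rows basis_mon_def lincomb_def sum_lessThan_4\<close>)
  then have "\<forall>j<4. f (4 + j) = 0" using assms unfolding rows_indep_UNIV_iff by blast
  then have "f (4 + 0) = 0" "f (4 + 1) = 0" "f (4 + 2) = 0" "f (4 + 3) = 0" by (meson zero_less_numeral one_less_numeral_iff numeral_less_iff semiring_norm)+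
  then show "f i = 0" using low less_8_cases[OF i] by auto
qed

lemma std2_same_point:
  assumes z: "z \<in> pts_over Hilb" "std2 z"
    and t: "\<And>j. j < 4 \<Longrightarrow> ew 4 (std2_vec (t j)) \<in> rowspan 8 (row z 3)" "rows_indep 4 (\<lambda>j. std2_vec (t j)) UNIV"
    and c: "\<And>i. i < 3 \<Longrightarrow> lincomb 4 (c i) (\<lambda>j. std2_vec (t j)) \<in> rowspan 3 (row z 2)"
      "rows_indep 3 (\<lambda>i. lincomb 4 (c i) (\<lambda>j. std2_vec (t j))) UNIV"
  shows "std2_frame t c \<in> pts_over Hilb \<and> Iof (std2_frame t c) = Iof z"
proof (rule same_pointI[OF z(1) std2_frame_frames])
  show "row (std2_frame t c) 3 i \<in> rowspan 8 (row z 3)" if "i < 8" for i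
  proof (cases "i < 4")
    case True
    then show ?thesis using std2_h_set[OF z(2)] by (simp add: row_std2_frame)
  next
    case False
    then show ?thesis using t(1)[of "i - 4"] that by (simp add: row_std2_frame)
  qed
  show "rows_indep 3 (row (std2_frame t c) 2) UNIV"
    using c(2) rows_indep_cong[of 3 UNIV "row (std2_frame t c) 2" "\<lambda>i. lincomb 4 (c i) (\<lambda>j. std2_vec (t j))"]
    by (simp add: fun_cong[OF row_std2_frame(1)])
qed (use c std2_W_indep[OF t(2)] in \<open>auto simp: row_std2_frame\<close>)

text \<open>The parameters 11, ..., 14 move the hyperplane H; the parameters 3, ..., 10 choose the
  four-dimensional space T of 2-vectors of H for which I_3 = H H H + T e_4; the parameters 0, 1, 2 choose I_2 in T.\<close>
definition phi2_mat :: "(nat \<Rightarrow> 'k::field) \<Rightarrow> nat \<Rightarrow> nat \<Rightarrow> 'k" where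
  "phi2_mat b = (\<lambda>k i. if k < 4 \<and> i = 4 then b (11 + k) else unit_vec k i)"

definition phi2_T :: "(nat \<Rightarrow> 'k::field) \<Rightarrow> nat \<Rightarrow> nat \<Rightarrow> 'k" where
  "phi2_T b = (\<lambda>j l. if l = 4 then (if j < 3 then b (3 + j) else b 9) else if l = 5 then (if j < 3 then b (6 + j) else b 10)
     else unit_vec j l)"

definition phi2_coeff :: "(nat \<Rightarrow> 'k::field) \<Rightarrow> nat \<Rightarrow> nat \<Rightarrow> 'k" where
  "phi2_coeff b = (\<lambda>i j. if j = 3 then b i else unit_vec i j)"

definition phi2 :: "(nat \<Rightarrow> 'k::field) \<Rightarrow> 'k frame" where
  "phi2 b = gl_act (phi2_mat b) (std2_frame (phi2_T b) (phi2_coeff b))"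

lemma phi2_mat_inverse: obtains h where "mat_inverse (phi2_mat b) h"
proof (rule mat_inverse_exists)
  show "rows_indep 5 (phi2_mat b) {..<5}"
    unfolding rows_indep_def lessThan_5 by (auto simp: sum_lessThan_5 phi2_mat_def unit_vec_def dest!: less_5_cases)
qed

lemma phi2_V_indep: "rows_indep 3 (\<lambda>i. lincomb 4 (phi2_coeff b i) (\<lambda>j. std2_vec (phi2_T b j))) pivots2"
  unfolding rows_indep_def pivots2_def lincomb_def sum_lessThan_4
  by (auto simp: sum_lessThan_3 phi2_coeff_def phi2_T_def unit_vec_def dest!: less_3_cases)

lemma phi2_T_indep: "rows_indep 4 (\<lambda>j. std2_vec (phi2_T b j)) UNIV"
proof (rule rows_indep_mono)
  show "rows_indep 4 (\<lambda>j. std2_vec (phi2_T b j)) {{0,1},{0,2},{0,3},{1,2}}"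
    unfolding rows_indep_def by (auto simp: sum_lessThan_4 phi2_T_def unit_vec_def dest!: less_4_cases)
qed simp

lemma phi2_frame_pts: "std2_frame (phi2_T b) (phi2_coeff b) \<in> pts_over Hilb"
proof (rule std2_frame_pts)
  have "rows_indep 3 (\<lambda>i. lincomb 4 (phi2_coeff b i) (\<lambda>j. std2_vec (phi2_T b j))) UNIV" by (rule rows_indep_mono[OF phi2_V_indep]) simp
  then show "rows_indep 3 (row (std2_frame (phi2_T b) (phi2_coeff b)) 2) UNIV"
    using rows_indep_cong[of 3 UNIV "row (std2_frame (phi2_T b) (phi2_coeff b)) 2" "\<lambda>i. lincomb 4 (phi2_coeff b i) (\<lambda>j. std2_vec (phi2_T b j))"]
    by (simp add: fun_cong[OF row_std2_frame(1)])
qed (rule std2_W_indep[OF phi2_T_indep])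

lemma phi2_pts: "phi2 b \<in> pts_over Hilb"
  unfolding phi2_def using phi2_mat_inverse[of b] gl_act_pts[OF phi2_frame_pts] by metis

lemma std2_frame_polyfun:
  assumes "\<And>i j. (\<lambda>a. t a i j) \<in> polyfun" "\<And>i j. (\<lambda>a. c a i j) \<in> polyfun"
  shows "(\<lambda>a. std2_frame (t a) (c a) v) \<in> polyfun"
  unfolding std2_frame_def lincomb_def std2_vec_def ew_def using assms
  by (cases v) (simp only: prod.case, intro polyfun_if polyfun_sum polyfun.pmult polyfun.pconst assms)

lemma phi2_polyfun: "(\<lambda>b. phi2 b v) \<in> polyfun"
  unfolding phi2_def phi2_mat_def phi2_coeff_def phi2_T_def
  by (intro gl_act_polyfun std2_frame_polyfun polyfun_if polyfun.pconst polyfun.pvar)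

lemma phi2_truncate: "phi2 (truncate_seq 15 b) = phi2 b"
proof -
  have "phi2_mat (truncate_seq 15 b) = phi2_mat b" by (auto simp: phi2_mat_def truncate_seq_def fun_eq_iff)
  moreover have "phi2_T (truncate_seq 15 b) = phi2_T b" by (auto simp: phi2_T_def truncate_seq_def fun_eq_iff)
  moreover have "std2_frame t (phi2_coeff (truncate_seq 15 b)) = std2_frame t (phi2_coeff b)" for t
  proof
    fix v
    have "phi2_coeff (truncate_seq 15 b) i = phi2_coeff b i" if "i < 3" for i
      using that by (auto simp: phi2_coeff_def truncate_seq_def fun_eq_iff)
    then show "std2_frame t (phi2_coeff (truncate_seq 15 b)) v = std2_frame t (phi2_coeff b) v"
      by (cases v) (auto simp: std2_frame_def)
  qed
  ultimately show ?thesis by (simp add: phi2_def)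
qed

lemma card_pivots2: "card pivots2 = 3" "finite pivots2"
  by (simp_all add: pivots2_def doubleton_eq_iff)

text \<open>Reduced bases of I_2 and I_3 supply the parameters: the rows of I_3 with pivots e_0 e_1
  e_4, e_0 e_2 e_4, e_0 e_3 e_4, e_1 e_2 e_4 span e_4 T, and comparing pivots places I_2 in
  T.\<close>

lemma std2_normal_form:
  fixes z :: "'k::field frame"
  assumes z: "z \<in> pts_over Hilb" "std2 z" and ind: "rows_indep 3 (row z 2) pivots2" "rows_indep 8 (row z 3) pivots3"
  shows "\<exists>u. \<forall>b. (\<forall>i<11. b i = u i) \<longrightarrow> Iof (std2_frame (phi2_T b) (phi2_coeff b)) = Iof z"
proof -
  have "\<exists>v\<in>rowspan 3 (row z 2). \<forall>S\<in>pivots2. v S = f S" for f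
    using rows_indep_surj[OF ind(1) card_pivots2(2,1), of f] by (auto simp: rowspan_def lincomb_def)
  then have "\<forall>k. \<exists>v\<in>rowspan 3 (row z 2). \<forall>S\<in>pivots2. v S = std2_vec (unit_vec k) S" by blast
  then obtain v where v: "\<And>k. v k \<in> rowspan 3 (row z 2)" "\<And>k S. S \<in> pivots2 \<Longrightarrow> v k S = std2_vec (unit_vec k) S" by metis
  have "\<exists>w\<in>rowspan 8 (row z 3). \<forall>S\<in>pivots3. w S = f S" for f
    using rows_indep_surj[OF ind(2) finite_pivots3 card_pivots3, of f] by (auto simp: rowspan_def lincomb_def)
  then have "\<forall>k. \<exists>w\<in>rowspan 8 (row z 3). \<forall>S\<in>pivots3. w S = ew 4 (std2_vec (unit_vec k)) S" by blast
  then obtain w where w: "\<And>k. w k \<in> rowspan 8 (row z 3)" "\<And>k S. S \<in> pivots3 \<Longrightarrow> w k S = ew 4 (std2_vec (unit_vec k)) S" by metis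
  note zf = pts_Hilb_frames[OF z(1)]
  have vd: "v k \<in> ext_deg 2" and wd: "w k \<in> ext_deg 3" for k
    using v(1)[of k] w(1)[of k] rowspan_frames[OF zf] by blast+
  have v0: "v k {0,4} = 0" "v k {1,4} = 0" "v k {2,4} = 0" "v k {3,4} = 0" for k using z(2) v(1)[of k] by (auto simp: std2_def)
  have W0: "x = 0" if "x \<in> rowspan 8 (row z 3)" "\<forall>S\<in>pivots3. x S = 0" for x
  proof -
    from that(1) obtain c where c: "x = lincomb 8 c (row z 3)" by (auto simp: rowspan_def)
    then have "\<forall>i<8. c i = 0" using that(2) ind(2) unfolding rows_indep_def lincomb_def by blast
    then show ?thesis unfolding c by (auto simp: lincomb_def fun_eq_iff)
  qed
  have wv: "w k {0,1,2} = 0" "w k {0,1,3} = 0" "w k {0,2,3} = 0" "w k {1,2,3} = 0" "w k {0,1,4} = unit_vec k 0"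
    "w k {0,2,4} = unit_vec k 1" "w k {0,3,4} = unit_vec k 2" "w k {1,2,4} = unit_vec k 3" for k
    by (simp_all add: w(2) pivots3_eq)
  have vv: "v k {0,1} = unit_vec k 0" "v k {0,2} = unit_vec k 1" "v k {0,3} = unit_vec k 2" for k
    by (simp_all add: v(2) pivots2_def)
  define u where "u i = (if i < 3 then v i {1,2} else if i < 6 then w (i - 3) {1,3,4} else if i < 9 then w (i - 6) {2,3,4}
     else if i = 9 then w 3 {1,3,4} else w 3 {2,3,4})" for i
  \<comment> \<open>The product of e_4 with v_k lies in I_3; its pivot coordinates are 1 at position
    k and the e_1 e_2 entry of v_k at e_1 e_2 e_4. Elements of I_3 are determined by their
    pivots.\<close>
  have rel: "ew 4 (v k) = (\<lambda>S. w k S + v k {1,2} * w 3 S)" if "k < 3" for k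
  proof -
    have "ew 4 (v k) + (\<lambda>S. (-1) * w k S) + (\<lambda>S. - v k {1,2} * w 3 S) = 0"
    proof (rule W0)
      have "ew 4 (v k) \<in> rowspan 8 (row z 3)" using z(1) v(1) by (auto simp: pts_over_Hilb_iff)
      then show "ew 4 (v k) + (\<lambda>S. (-1) * w k S) + (\<lambda>S. - v k {1,2} * w 3 S) \<in> rowspan 8 (row z 3)"
        by (intro rowspan_add rowspan_scale w(1))
      show "\<forall>S\<in>pivots3. (ew 4 (v k) + (\<lambda>S. (-1) * w k S) + (\<lambda>S. - v k {1,2} * w 3 S)) S = 0"
        unfolding pivots3_eq using less_3_cases[OF that]
        by (elim disjE) (simp_all add: wv vv unit_vec_def)
    qed
    then have z0: "(ew 4 (v k) + (\<lambda>S. (-1) * w k S) + (\<lambda>S. - v k {1,2} * w 3 S)) S = 0" for S by simp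
    show ?thesis
    proof
      fix S show "ew 4 (v k) S = w k S + v k {1,2} * w 3 S" using z0[of S] by (simp add: algebra_simps)
    qed
  qed
  have eq: "ew 4 (std2_vec (phi2_T b j)) = w j" if b: "\<forall>i<11. b i = u i" and j: "j < 4" for b j
  proof (rule ext_deg_3_eqI[OF ew_ext_deg_3[OF std2_vec_ext_deg] wd])
  qed (use b less_4_cases[OF j] in \<open>auto simp: wv phi2_T_def unit_vec_def u_def simp flip: One_nat_def\<close>)
  have eqv: "lincomb 4 (phi2_coeff b k) (\<lambda>j. std2_vec (phi2_T b j)) = v k" if b: "\<forall>i<11. b i = u i" and k: "k < 3" for b k
  proof (rule ext_deg_2_eqI[OF _ vd])
    show "lincomb 4 (phi2_coeff b k) (\<lambda>j. std2_vec (phi2_T b j)) \<in> ext_deg 2" by (intro lincomb_ext_deg) simp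
  qed (use vv[of k] b less_3_cases[OF k] v0[of k] fun_cong[OF rel[OF k], of "{1,3,4}"] fun_cong[OF rel[OF k], of "{2,3,4}"]
      in \<open>auto simp: phi2_T_def phi2_coeff_def unit_vec_def u_def lincomb_def sum_lessThan_4 simp flip: One_nat_def\<close>)
  have "Iof (std2_frame (phi2_T b) (phi2_coeff b)) = Iof z" if b: "\<forall>i<11. b i = u i" for b
    using std2_same_point[OF z, of "phi2_T b" "phi2_coeff b"] eq[OF b] eqv[OF b] v(1) w(1) phi2_T_indep[of b]
      rows_indep_mono[OF phi2_V_indep subset_UNIV, of b] by simp
  then show ?thesis by blast
qed

lemma gl1_inverse_lincomb:
  assumes h: "mat_inverse g h" and r: "r \<le> 5" and i: "i < 5"
  shows "gl1 h (lincomb r m g) i = (if i < r then m i else 0)"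
proof -
  have "gl1 h (lincomb r m g) i = (\<Sum>k<5. (\<Sum>l<r. m l * g l k) * h k i)" by (simp add: gl1_def lincomb_def)
  also have "\<dots> = (\<Sum>l<r. m l * (\<Sum>k<5. g l k * h k i))"
    by (simp add: sum_distrib_right sum_distrib_left mult.assoc) (rule sum.swap)
  also have "\<dots> = (\<Sum>l<r. m l * unit_vec l i)"
    using h i r by (intro sum.cong refl arg_cong2[where f="(*)"])
      (auto simp: mat_inverse_def mat_eq_def mat_mult_def gl1_def lincomb_def)
  also have "\<dots> = (\<Sum>l<r. if l = i then m l else 0)" by (intro sum.cong) (auto simp: unit_vec_def)
  finally show ?thesis by simp
qed

lemma gl1_cong: "(\<And>i. i < 5 \<Longrightarrow> x i = y i) \<Longrightarrow> gl1 g x = gl1 g y"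
  unfolding gl1_def by (rule lincomb_cong) auto

text \<open>The zeros say that \<open>M\<close> maps the hyperplane H = <e_0, e_1, e_2, e_3> into
  itself, hence also H H and H H H.\<close>

lemma std2_support_gl:
  assumes M: "M 0 4 = 0" "M 1 4 = 0" "M 2 4 = 0" "M 3 4 = 0"
  shows "v {0,4} = 0 \<Longrightarrow> v {1,4} = 0 \<Longrightarrow> v {2,4} = 0 \<Longrightarrow> v {3,4} = 0 \<Longrightarrow>
      gl2 M v {0,4} = 0 \<and> gl2 M v {1,4} = 0 \<and> gl2 M v {2,4} = 0 \<and> gl2 M v {3,4} = 0"
    and "w {0,1,4} = 0 \<and> w {0,2,4} = 0 \<and> w {0,3,4} = 0 \<and> w {1,2,4} = 0 \<and> w {1,3,4} = 0 \<and> w {2,3,4} = 0 \<Longrightarrow>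
      gl3 M w {0,1,4} = 0 \<and> gl3 M w {0,2,4} = 0 \<and> gl3 M w {0,3,4} = 0 \<and> gl3 M w {1,2,4} = 0 \<and> gl3 M w {1,3,4} = 0 \<and> gl3 M w {2,3,4} = 0"
  by (simp_all add: gl2_def gl3_def w3_eval M)

text \<open>If g(H) has a basis with the identity at e_0, ..., e_3, the matrix \<open>k\<close>
  moves H to g(H), and comparing \<open>g\<close> with \<open>k\<close> leaves a matrix
  \<open>M\<close> that preserves H.\<close>

lemma chart2:
  fixes z :: "'k::field frame"
  assumes g: "mat_inverse g h" and z: "z \<in> pts_over Hilb" "std2 z"
    and ind: "rows_indep 4 g {0,1,2,3}" "rows_indep 3 (row (gl_act g z) 2) pivots2" "rows_indep 8 (row (gl_act g z) 3) pivots3"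
  shows "Iof (gl_act g z) \<in> range (\<lambda>b. Iof (phi2 b))"
proof -
  note zf = pts_Hilb_frames[OF z(1)]
  have "\<exists>c. \<forall>S\<in>{0,1,2,3}. (\<Sum>i<4. c i * g i S) = unit_vec k S" for k
    by (rule rows_indep_surj[OF ind(1)]) auto
  then have "\<forall>k. \<exists>v\<in>rowspan 4 g. \<forall>S\<in>{0,1,2,3}. v S = unit_vec k S"
    by (auto simp: rowspan_def lincomb_def)
  then obtain y where y: "\<And>k. y k \<in> rowspan 4 g" "\<And>k S. S \<in> {0,1,2,3} \<Longrightarrow> y k S = unit_vec k S" by metis
  define b0 where "b0 i = y (i - 11) 4" for i
  define k where "k = phi2_mat b0"
  obtain h' where h': "mat_inverse k h'" unfolding k_def using phi2_mat_inverse by blast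
  have ky: "k l i = y l i" if "l < 4" "i < 5" for l i
    using less_5_cases[OF that(2)] that(1) y(2)[of i l] by (auto simp: k_def phi2_mat_def b0_def unit_vec_def)
  have "rows_indep 4 y UNIV"
  proof (rule rows_indep_mono)
    show "rows_indep 4 y {0,1,2,3}" unfolding rows_indep_def
      by (auto simp: sum_lessThan_4 y(2) unit_vec_def dest!: less_4_cases)
  qed simp
  then have span: "rowspan 4 y = rowspan 4 g" by (rule rowspan_eqI) (rule y(1))
  define M where "M = mat_mult h' g"
  \<comment> \<open>\<open>M'\<close> is inverse to \<open>M\<close> and preserves H as well. It is
    needed because \<open>std2\<close> asks I_3 to contain H H H, and such a lower bound is
    transported through the inverse.\<close>
  define M' where "M' = mat_mult h k"
  have M4: "M l 4 = 0" if "l < 4" for l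
  proof -
    from row_in_rowspan[OF that, of g] obtain m where m: "g l = lincomb 4 m y"
      unfolding span[symmetric] by (auto simp: rowspan_def)
    have "M l = gl1 h' (lincomb 4 m k)" unfolding M_def mat_mult_def m
      by (rule gl1_cong) (simp add: lincomb_def ky)
    then show ?thesis using gl1_inverse_lincomb[OF h', of 4 4 m] by simp
  qed
  have M'4: "M' l 4 = 0" if "l < 4" for l
  proof -
    obtain m where m: "y l = lincomb 4 m g" using y(1)[of l] by (auto simp: rowspan_def)
    have "M' l = gl1 h (lincomb 4 m g)" unfolding M'_def mat_mult_def m[symmetric]
      by (rule gl1_cong) (rule ky[OF that])
    then show ?thesis using gl1_inverse_lincomb[OF g, of 4 4 m] by simp
  qed
  define z1 where "z1 = gl_act h' (gl_act g z)"
  have z1M: "z1 = gl_act M z" by (simp add: z1_def gl_act_mult M_def)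
  have z1: "z1 \<in> pts_over Hilb" unfolding z1_def by (rule gl_act_pts[OF gl_act_pts[OF z(1) g] mat_inverse_sym[OF h']])
  note z1f = pts_Hilb_frames[OF z1]
  have gz: "gl_act g z = gl_act k z1" unfolding z1_def by (rule gl_act_inverse[OF gl_act_frames[OF zf] h', symmetric])
  have s1: "std2 z1"
    unfolding std2_def
  proof (intro conjI ballI impI)
    fix v assume "v \<in> rowspan 3 (row z1 2)"
    then obtain v' where v': "v = gl2 M v'" "v' \<in> rowspan 3 (row z 2)" unfolding z1M rowspan_gl_act by blast
    then show "v {0,4} = 0" "v {1,4} = 0" "v {2,4} = 0" "v {3,4} = 0"
      using z(2) std2_support_gl(1)[of M v'] M4 by (auto simp: std2_def)
  next
    fix w :: "'k ext" assume wd: "w \<in> ext_deg 3" and w: "w {0,1,4} = 0 \<and> w {0,2,4} = 0 \<and> w {0,3,4} = 0 \<and> w {1,2,4} = 0 \<and> w {1,3,4} = 0 \<and> w {2,3,4} = 0"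
    have "gl3 M' w \<in> rowspan 8 (row z 3)"
      using z(2) std2_support_gl(2)[of M' w] M'4 w by (auto simp: std2_def)
    moreover have "gl3 M (gl3 M' w) = w"
      unfolding M_def M'_def gl3_mult[symmetric] gl3_inverse[OF g gl3_ext_deg] by (rule gl3_inverse[OF mat_inverse_sym[OF h'] wd])
    ultimately show "w \<in> rowspan 8 (row z1 3)" unfolding z1M rowspan_gl_act by (metis image_eqI)
  qed
  have "rows_indep 3 (row z1 2) pivots2"
    unfolding rows_indep_def
  proof (intro allI impI)
    fix e i assume e: "\<forall>S\<in>pivots2. (\<Sum>i<3. e i * z1 (2, i, S)) = 0" and i: "i < (3::nat)"
    define v where "v = lincomb 3 e (row z1 2)"
    have v: "v {0,1} = 0" "v {0,2} = 0" "v {0,3} = 0" using e by (auto simp: v_def lincomb_def pivots2_def)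
    have "v \<in> rowspan 3 (row z1 2)" by (auto simp: v_def rowspan_def)
    then have v': "v {0,4} = 0" "v {1,4} = 0" "v {2,4} = 0" "v {3,4} = 0" using s1 by (auto simp: std2_def)
    \<comment> \<open>With vanishing pivots \<open>v\<close> involves only e_1, e_2, e_3, which
      \<open>k\<close> sends into <e_1, ..., e_4>, so no coordinate with index 0 arises.\<close>
    have "gl2 k v S = 0" if "S \<in> pivots2" for S
      using that v v' by (auto simp: pivots2_def gl2_def k_def phi2_mat_def unit_vec_def)
    moreover have "gl2 k v = lincomb 3 e (row (gl_act g z) 2)"
      unfolding gz row_gl_act v_def gl2_lincomb ..
    ultimately show "e i = 0" using rows_indepD[OF ind(2) _ i, of e] by (simp add: lincomb_def)
  qed
  moreover have "rows_indep 8 (row z1 3) pivots3"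
    unfolding rows_indep_def
  proof (intro allI impI)
    fix e i assume e: "\<forall>S\<in>pivots3. (\<Sum>i<8. e i * z1 (3, i, S)) = 0" and i: "i < (8::nat)"
    define w where "w = lincomb 8 e (row z1 3)"
    have w: "w S = 0" if "S \<in> pivots3" for S using e that by (auto simp: w_def lincomb_def)
    \<comment> \<open>With vanishing pivots \<open>w\<close> is a combination of e_1 e_3 e_4 and e_2
      e_3 e_4. Both are fixed by \<open>k\<close>, which fixes e_4 and changes the other basis
      vectors by multiples of e_4.\<close>
    have "gl3 k w S = 0" if "S \<in> pivots3" for S
      using that unfolding gl3_def pivots3_eq
      by (auto simp: w[unfolded pivots3_eq] w3_eval k_def phi2_mat_def unit_vec_def)
    moreover have "gl3 k w = lincomb 8 e (row (gl_act g z) 3)"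
      unfolding gz row_gl_act w_def gl3_lincomb ..
    ultimately show "e i = 0" using rows_indepD[OF ind(3) _ i, of e] by (simp add: lincomb_def)
  qed
  ultimately obtain u where u: "\<And>b. (\<forall>i<11. b i = u i) \<Longrightarrow> Iof (std2_frame (phi2_T b) (phi2_coeff b)) = Iof z1"
    using std2_normal_form[OF z1 s1] by blast
  define b where "b = (\<lambda>i. if i < 11 then u i else b0 i)"
  have "phi2_mat b = k" by (auto simp: k_def phi2_mat_def b_def fun_eq_iff)
  moreover have "Iof (std2_frame (phi2_T b) (phi2_coeff b)) = Iof z1" by (rule u) (simp add: b_def)
  ultimately have "Iof (phi2 b) = Iof (gl_act g z)"
    unfolding phi2_def gz using gl_act_Iof_cong[OF std2_frame_frames z1f] by metis
  then show ?thesis by (metis rangeI)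
qed

text \<open>Modulo H H H, which has dimension 4, every 3-vector is a multiple of e_4, so dividing
  I_3 by e_4 gives a four-dimensional T. As e_4 I_2 lies in I_3, the space I_2 lies in T.\<close>

lemma std2_representation:
  fixes z :: "'k::field frame"
  assumes z: "z \<in> pts_over Hilb" "std2 z"
  shows "\<exists>t c. std2_frame t c \<in> pts_over Hilb \<and> Iof (std2_frame t c) = Iof z"
proof -
  note zf = pts_Hilb_frames[OF z(1)]
  \<comment> \<open>The elements of I_3 divisible by e_4; they complement H H H in I_3.\<close>
  define X where "X = {w \<in> rowspan 8 (row z 3). w {0,1,2} = 0 \<and> w {0,1,3} = 0 \<and> w {0,2,3} = 0 \<and> w {1,2,3} = 0}"
  have "ext.subspace X" unfolding X_def
    using rowspan_add[of _ 8 "row z 3"] rowspan_scale[of _ 8 "row z 3"]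
    by (intro ext.subspaceI) (auto simp: ext_scale_def)
  moreover have "X \<subseteq> rowspan 8 (row z 3)" by (auto simp: X_def)
  ultimately obtain s where s: "rows_indep (kdim X) s UNIV" "X = rowspan (kdim X) s" by (rule subspace_rows)
  have sX: "s j \<in> X" if "j < kdim X" for j using row_in_rowspan[OF that, of s] s(2) by simp
  define y where "y i = (if i < 4 then basis_mon (h_set i) else s (i - 4))" for i
  have split: "lincomb (4 + kdim X) c y = lincomb 4 c (\<lambda>i. basis_mon (h_set i)) + lincomb (kdim X) (\<lambda>j. c (j + 4)) s" for c
    by (auto simp: lincomb_def sum_lessThan_add y_def fun_eq_iff)
  have XinX: "lincomb (kdim X) c s \<in> X" for c by (subst s(2)) (auto simp: rowspan_def)
  have low: "lincomb 4 c (\<lambda>i. basis_mon (h_set i)) {0,1,2} = c 0" "lincomb 4 c (\<lambda>i. basis_mon (h_set i)) {0,1,3} = c 1"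
    "lincomb 4 c (\<lambda>i. basis_mon (h_set i)) {0,2,3} = c 2" "lincomb 4 c (\<lambda>i. basis_mon (h_set i)) {1,2,3} = c 3" for c :: "nat \<Rightarrow> 'k"
    by (simp_all add: lincomb_def sum_lessThan_4 basis_mon_def h_set_def)
  have hs: "h_set 0 = {0,1,2}" "h_set 1 = {0,1,3}" "h_set 2 = {0,2,3}" "h_set 3 = {1,2,3}"
    by (simp_all add: h_set_def)
  have "rows_indep (4 + kdim X) y UNIV"
    unfolding rows_indep_UNIV_iff
  proof (intro allI impI)
    fix c i assume c: "lincomb (4 + kdim X) c y = 0" and i: "i < 4 + kdim X"
    have "c 0 = 0" "c 1 = 0" "c 2 = 0" "c 3 = 0"
      using fun_cong[OF c[unfolded split], of "{0,1,2}"] fun_cong[OF c[unfolded split], of "{0,1,3}"]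
        fun_cong[OF c[unfolded split], of "{0,2,3}"] fun_cong[OF c[unfolded split], of "{1,2,3}"] XinX[of "\<lambda>j. c (j + 4)"]
      by (simp_all add: low X_def)
    then have c0: "c j = 0" if "j < 4" for j using less_4_cases[OF that] by auto
    then have "lincomb 4 c (\<lambda>i. basis_mon (h_set i)) = (0 :: 'k ext)" by (auto simp: lincomb_def fun_eq_iff)
    then have "\<forall>j<kdim X. c (j + 4) = 0"
      using c s(1)[unfolded rows_indep_UNIV_iff, rule_format, of "\<lambda>j. c (j + 4)"] unfolding split by simp
    then show "c i = 0" using c0[of i] i by (cases "i < 4") (auto dest: spec[of _ "i - 4"])
  qed
  moreover have "rowspan (4 + kdim X) y = rowspan 8 (row z 3)"
  proof
    have "y i \<in> rowspan 8 (row z 3)" if "i < 4 + kdim X" for i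
      using std2_h_set[OF z(2)] sX[of "i - 4"] that by (auto simp: y_def X_def)
    then show "rowspan (4 + kdim X) y \<subseteq> rowspan 8 (row z 3)" by (rule rowspan_subsetI)
    show "rowspan 8 (row z 3) \<subseteq> rowspan (4 + kdim X) y"
    proof
      fix w assume w: "w \<in> rowspan 8 (row z 3)"
      define w' where "w' = w + lincomb 4 (\<lambda>i. - w (h_set i)) (\<lambda>i. basis_mon (h_set i))"
      have "lincomb 4 (\<lambda>i. - w (h_set i)) (\<lambda>i. basis_mon (h_set i)) \<in> rowspan 8 (row z 3)"
        using std2_h_set[OF z(2)] by (intro lincomb_in_closed[OF rowspan_zero rowspan_add rowspan_scale])
      then have "w' \<in> X" using w by (simp add: X_def w'_def rowspan_add low hs)
      then obtain e where e: "w' = lincomb (kdim X) e s" using s(2) by (auto simp: rowspan_def)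
      define d where "d i = (if i < 4 then w (h_set i) else e (i - 4))" for i
      have d4: "lincomb 4 d (\<lambda>i. basis_mon (h_set i)) = lincomb 4 (\<lambda>i. w (h_set i)) (\<lambda>i. basis_mon (h_set i))"
        and de: "lincomb (kdim X) (\<lambda>j. d (j + 4)) s = lincomb (kdim X) e s"
        by (rule lincomb_cong; simp add: d_def)+
      have neg: "lincomb 4 (\<lambda>i. - w (h_set i)) (\<lambda>i. basis_mon (h_set i)) = - lincomb 4 (\<lambda>i. w (h_set i)) (\<lambda>i. basis_mon (h_set i))"
        by (simp add: lincomb_def fun_eq_iff sum_negf)
      have "w = lincomb (4 + kdim X) d y"
        unfolding split d4 de e[symmetric] w'_def neg by simp
      then show "w \<in> rowspan (4 + kdim X) y" by (auto simp: rowspan_def)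
    qed
  qed
  moreover have "kdim (rowspan 8 (row z 3)) = 8" using z(1) by (intro kdim_rowspan) (simp add: pts_over_Hilb_iff)
  ultimately have k4: "kdim X = 4" using kdim_rowspan by fastforce
  have Xs: "X = rowspan 4 s" using s(2) unfolding k4 .
  define t where "t j l = s j (insert 4 (v2_set l))" for j l
  have c4: "insert 4 {0,1} = {0,1,4::nat}" "insert 4 {0,2} = {0,2,4::nat}" "insert 4 {0,3} = {0,3,4::nat}" "insert 4 {1,2} = {1,2,4::nat}"
    "insert 4 {1,3} = {1,3,4::nat}" "insert 4 {2,3} = {2,3,4::nat}" by auto
  have ts: "ew 4 (std2_vec (t j)) = s j" if "j < 4" for j
  proof (rule ext_deg_3_eqI[OF ew_ext_deg_3[OF std2_vec_ext_deg]])
    show "s j \<in> ext_deg 3" using sX[of j] that k4 rowspan_frames[OF zf] by (auto simp: X_def)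
  qed (use sX[of j] that k4 in \<open>simp_all add: X_def t_def v2_set_def c4\<close>)
  have t_ind: "rows_indep 4 (\<lambda>j. std2_vec (t j)) UNIV"
    unfolding rows_indep_UNIV_iff
  proof (intro allI impI)
    fix c i assume c: "lincomb 4 c (\<lambda>j. std2_vec (t j)) = 0" and i: "i < (4::nat)"
    have "lincomb 4 c s = lincomb 4 c (\<lambda>j. ew 4 (std2_vec (t j)))" by (rule lincomb_cong) (simp_all add: ts)
    also have "\<dots> = 0" unfolding ew_lincomb[symmetric] c ew_zero ..
    finally have "lincomb 4 c s = 0" .
    then show "c i = 0" using s(1) i unfolding k4 rows_indep_UNIV_iff by blast
  qed
  have "\<exists>e. row z 2 i = lincomb 4 e (\<lambda>j. std2_vec (t j))" if i: "i < 3" for i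
  proof -
    have v: "row z 2 i \<in> rowspan 3 (row z 2)" by (rule row_in_rowspan[OF i])
    then have "ew 4 (row z 2 i) \<in> rowspan 8 (row z 3)" using z(1) by (auto simp: pts_over_Hilb_iff)
    then have "ew 4 (row z 2 i) \<in> X" by (simp add: X_def)
    then have "ew 4 (row z 2 i) \<in> rowspan 4 s" unfolding Xs .
    then obtain e where e: "ew 4 (row z 2 i) = lincomb 4 e s" by (auto simp: rowspan_def)
    have v0: "\<And>v. v \<in> rowspan 3 (row z 2) \<Longrightarrow> v {0,4} = 0 \<and> v {1,4} = 0 \<and> v {2,4} = 0 \<and> v {3,4} = 0"
      using z(2) by (simp add: std2_def)
    have E: "z (2,i,{0,1}) = lincomb 4 e s {0,1,4}" "z (2,i,{0,2}) = lincomb 4 e s {0,2,4}" "z (2,i,{0,3}) = lincomb 4 e s {0,3,4}"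
      "z (2,i,{1,2}) = lincomb 4 e s {1,2,4}" "z (2,i,{1,3}) = lincomb 4 e s {1,3,4}" "z (2,i,{2,3}) = lincomb 4 e s {2,3,4}"
      by (simp_all flip: e)
    have "row z 2 i = lincomb 4 e (\<lambda>j. std2_vec (t j))"
    proof (rule ext_deg_2_eqI[OF row_ext_deg[OF zf]])
      show "lincomb 4 e (\<lambda>j. std2_vec (t j)) \<in> ext_deg 2" by (intro lincomb_ext_deg) simp
    qed (use v0[OF v] in \<open>simp_all add: E\<close>, simp_all add: lincomb_def t_def v2_set_def c4)
    then show ?thesis by blast
  qed
  then obtain c where c: "\<And>i. i < 3 \<Longrightarrow> row z 2 i = lincomb 4 (c i) (\<lambda>j. std2_vec (t j))" by metis
  have "std2_frame t c \<in> pts_over Hilb \<and> Iof (std2_frame t c) = Iof z"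
  proof (rule std2_same_point[OF z _ t_ind])
    show "ew 4 (std2_vec (t j)) \<in> rowspan 8 (row z 3)" if "j < 4" for j
      using sX[of j] that k4 by (simp add: ts X_def)
    show "lincomb 4 (c i) (\<lambda>j. std2_vec (t j)) \<in> rowspan 3 (row z 2)" if "i < 3" for i
      unfolding c[OF that, symmetric] using that by (rule row_in_rowspan)
    show "rows_indep 3 (\<lambda>i. lincomb 4 (c i) (\<lambda>j. std2_vec (t j))) UNIV"
    proof -
      have "rows_indep 3 (\<lambda>i. lincomb 4 (c i) (\<lambda>j. std2_vec (t j))) UNIV = rows_indep 3 (row z 2) UNIV"
        by (rule rows_indep_cong) (simp flip: fun_cong[OF c])
      then show ?thesis using z(1) by (simp add: pts_over_Hilb_iff)
    qed
  qed
  then show ?thesis by blast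
qed

text \<open>The deformation of \<open>density1\<close> with the spanning vectors of T as a further
  block of parameters; \<open>std2_representation\<close> supplies the parameters of the given
  ideal.\<close>

theorem density2:
  fixes z :: "'k::field frame"
  assumes inf: "infinite (UNIV :: 'k set)" and g: "mat_inverse g h" and z: "z \<in> pts_over Hilb" "std2 z"
  shows "Iof (gl_act g z) \<in> H_closure (range (\<lambda>b. Iof (phi2 b)))"
proof -
  let ?D = "H_closure (range (\<lambda>b. Iof (phi2 b :: _ \<Rightarrow> 'k)))"
  have D: "H_closed ?D" using phi2_pts by (intro H_closed_closure) (auto simp: pts_over_def)
  define G where "G a = (\<lambda>k i. a (0::nat,k,i))" for a :: "nat \<times> nat \<times> nat \<Rightarrow> 'k"
  define T where "T a = (\<lambda>i j. a (1::nat,i,j))" for a :: "nat \<times> nat \<times> nat \<Rightarrow> 'k"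
  define C where "C a = (\<lambda>i j. a (2::nat,i,j))" for a :: "nat \<times> nat \<times> nat \<Rightarrow> 'k"
  define \<Psi> where "\<Psi> a = gl_act (G a) (std2_frame (T a) (C a))" for a
  have Gp: "(\<lambda>a. G a k i) \<in> polyfun" and Tp: "(\<lambda>a. T a k i) \<in> polyfun" and Cp: "(\<lambda>a. C a k i) \<in> polyfun" for k i
    by (auto simp: G_def C_def T_def intro: polyfun.intros)
  have \<Psi>p: "(\<lambda>a. \<Psi> a v) \<in> polyfun" for v
    unfolding \<Psi>_def by (intro gl_act_polyfun std2_frame_polyfun Gp Cp Tp)
  \<comment> \<open>At \<open>a0\<close> the matrix is the identity, T is spanned by e_0 e_1, e_0
    e_2, e_0 e_3, e_1 e_2 and I_2 by the first three, so all pivots are present.\<close>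
  define a0 where "a0 = (\<lambda>(d::nat,k,i). unit_vec k i :: 'k)"
  have G0: "G a0 = unit_vec" "C a0 = unit_vec" "T a0 = unit_vec" by (auto simp: G_def C_def T_def a0_def fun_eq_iff)
  have ind0: "rows_indep 5 (G a0) {..<5}" "rows_indep 4 (G a0) {0,1,2,3}"
    unfolding G0 by (rule rows_indep_unit_vec; auto)+
  have r2: "row (\<Psi> a0) 2 i = lincomb 4 (unit_vec i) (\<lambda>j. std2_vec (unit_vec j))" if "i < 3" for i
    using that unfolding \<Psi>_def G0
    by (subst fun_cong[OF row_gl_act(1)]) (simp add: row_std2_frame gl2_unit lincomb_ext_deg)
  have r3: "row (\<Psi> a0) 3 i = row (std2_frame unit_vec unit_vec) 3 i" for i
    unfolding \<Psi>_def G0 by (subst fun_cong[OF row_gl_act(2)]) (rule gl3_unit[OF row_ext_deg[OF std2_frame_frames]])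
  have "rows_indep 3 (row (\<Psi> a0) 2) pivots2 \<longleftrightarrow> rows_indep 3 (\<lambda>i. lincomb 4 (unit_vec i) (\<lambda>j. std2_vec (unit_vec j)) :: 'k ext) pivots2"
    by (intro rows_indep_cong) (metis (no_types, lifting) r2)
  moreover have "rows_indep 3 (\<lambda>i. lincomb 4 (unit_vec i) (\<lambda>j. std2_vec (unit_vec j)) :: 'k ext) pivots2"
    unfolding rows_indep_def pivots2_def lincomb_def sum_lessThan_4 by (auto simp: sum_lessThan_3 unit_vec_def dest!: less_3_cases)
  ultimately have ind2: "rows_indep 3 (row (\<Psi> a0) 2) pivots2" by simp
  have "rows_indep 8 (row (\<Psi> a0) 3) pivots3 \<longleftrightarrow> rows_indep 8 (row (std2_frame unit_vec unit_vec :: _ \<Rightarrow> 'k) 3) pivots3"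
    by (intro rows_indep_cong) (metis (no_types, lifting) r3)
  moreover have "rows_indep 8 (row (std2_frame unit_vec unit_vec :: _ \<Rightarrow> 'k) 3) pivots3"
    unfolding rows_indep_def pivots3_eq
    by (auto simp: sum_lessThan_8 std2_frame_rows basis_mon_def unit_vec_def dest!: less_8_cases)
  ultimately have ind3: "rows_indep 8 (row (\<Psi> a0) 3) pivots3" by simp
  obtain h1 where h1: "h1 \<in> polyfun" "h1 a0 \<noteq> 0" "\<And>a. h1 a \<noteq> 0 \<Longrightarrow> rows_indep 5 (G a) {..<5}"
    using rows_indep_open_ex[of 5 G, OF ind0(1) Gp] by blast
  obtain h2 where h2: "h2 \<in> polyfun" "h2 a0 \<noteq> 0" "\<And>a. h2 a \<noteq> 0 \<Longrightarrow> rows_indep 4 (G a) {0,1,2,3}"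
    using rows_indep_open_ex[of 4 G, OF ind0(2) Gp] by blast
  obtain h3 where h3: "h3 \<in> polyfun" "h3 a0 \<noteq> 0" "\<And>a. h3 a \<noteq> 0 \<Longrightarrow> rows_indep 3 (row (\<Psi> a) 2) pivots2"
    using rows_indep_open_ex[of 3 "\<lambda>a. row (\<Psi> a) 2", OF ind2 \<Psi>p] by blast
  obtain h4 where h4: "h4 \<in> polyfun" "h4 a0 \<noteq> 0" "\<And>a. h4 a \<noteq> 0 \<Longrightarrow> rows_indep 8 (row (\<Psi> a) 3) pivots3"
    using rows_indep_open_ex[of 8 "\<lambda>a. row (\<Psi> a) 3", OF ind3 \<Psi>p] by blast
  obtain t c where tc: "std2_frame t c \<in> pts_over Hilb" "Iof (std2_frame t c) = Iof z"
    using std2_representation[OF z] by blast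
  define a where "a = (\<lambda>(d::nat,k,i). if d = 0 then g k i else if d = 1 then t k i else c k i)"
  have Ga: "G a = g" "T a = t" "C a = c" by (auto simp: G_def T_def C_def a_def fun_eq_iff)
  have a: "\<Psi> a \<in> pts_over Hilb" "Iof (\<Psi> a) = Iof (gl_act g z)"
    unfolding \<Psi>_def Ga using gl_act_pts[OF tc(1) g] gl_act_Iof_cong[OF std2_frame_frames pts_Hilb_frames[OF z(1)] tc(2)] by auto
  have "\<Psi> a \<in> pts_over ?D"
  proof (rule closed_generic[OF inf D \<Psi>p _ _ _ a(1)])
    show "(\<lambda>a. h1 a * h2 a * (h3 a * h4 a)) \<in> polyfun" using h1 h2 h3 h4 by (intro polyfun.pmult) auto
    show "h1 a0 * h2 a0 * (h3 a0 * h4 a0) \<noteq> 0" using h1 h2 h3 h4 by simp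
    fix e assume "h1 e * h2 e * (h3 e * h4 e) \<noteq> 0"
    then have e: "rows_indep 5 (G e) {..<5}" "rows_indep 4 (G e) {0,1,2,3}" "rows_indep 3 (row (\<Psi> e) 2) pivots2" "rows_indep 8 (row (\<Psi> e) 3) pivots3"
      using h1(3)[of e] h2(3)[of e] h3(3)[of e] h4(3)[of e] by auto
    obtain k where k: "mat_inverse (G e) k" using mat_inverse_exists[OF e(1)] by blast
    have "rows_indep 3 (row (\<Psi> e) 2) UNIV" by (rule rows_indep_mono[OF e(3)]) simp
    then have i2: "rows_indep 3 (row (std2_frame (T e) (C e)) 2) UNIV"
      unfolding \<Psi>_def using gl_act_indep(1)[OF std2_frame_frames k] by metis
    have "rows_indep 8 (row (\<Psi> e) 3) UNIV" by (rule rows_indep_mono[OF e(4)]) simp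
    then have i3: "rows_indep 8 (row (std2_frame (T e) (C e)) 3) UNIV"
      unfolding \<Psi>_def using gl_act_indep(2)[OF std2_frame_frames k] by metis
    have y: "std2_frame (T e) (C e) \<in> pts_over Hilb" by (rule std2_frame_pts[OF i2 i3])
    have "Iof (\<Psi> e) \<in> range (\<lambda>b. Iof (phi2 b))"
      unfolding \<Psi>_def using chart2[OF k y std2_std2_frame e(2)] e(3,4) unfolding \<Psi>_def by simp
    moreover have "\<Psi> e \<in> frames" unfolding \<Psi>_def by (rule gl_act_frames[OF std2_frame_frames])
    ultimately show "\<Psi> e \<in> pts_over ?D" by (simp add: pts_over_def subsetD[OF H_closure_subset])
  qed
  then show ?thesis using a(2) by (simp add: pts_over_def)
qed

section \<open>Classification of the points\<close>

text \<open>The coefficient of e_0 e_1 e_2 e_3 e_4 in the product of u in degree 2 and w in degree 3.\<close>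
definition ext_pair :: "'k::field ext \<Rightarrow> 'k ext \<Rightarrow> 'k" where
  "ext_pair u w = u {0,1} * w {2,3,4} - u {0,2} * w {1,3,4} + u {0,3} * w {1,2,4} - u {0,4} * w {1,2,3} + u {1,2} * w {0,3,4}
     - u {1,3} * w {0,2,4} + u {1,4} * w {0,2,3} + u {2,3} * w {0,1,4} - u {2,4} * w {0,1,3} + u {3,4} * w {0,1,2}"

text \<open>The product of two elements of degree 2, read as a linear form on degree 1.\<close>
definition wedge_form :: "'k::field ext \<Rightarrow> 'k ext \<Rightarrow> nat \<Rightarrow> 'k" where
  "wedge_form u v i = ext_pair u (vw (unit_vec i) v)"

lemma wedge_form_eval:
  "wedge_form u v 0 = u {1,2} * v {3,4} - u {1,3} * v {2,4} + u {1,4} * v {2,3} + u {2,3} * v {1,4} - u {2,4} * v {1,3} + u {3,4} * v {1,2}"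
  "wedge_form u v 1 = - (u {0,2} * v {3,4} - u {0,3} * v {2,4} + u {0,4} * v {2,3} + u {2,3} * v {0,4} - u {2,4} * v {0,3} + u {3,4} * v {0,2})"
  "wedge_form u v 2 = u {0,1} * v {3,4} - u {0,3} * v {1,4} + u {0,4} * v {1,3} + u {1,3} * v {0,4} - u {1,4} * v {0,3} + u {3,4} * v {0,1}"
  "wedge_form u v 3 = - (u {0,1} * v {2,4} - u {0,2} * v {1,4} + u {0,4} * v {1,2} + u {1,2} * v {0,4} - u {1,4} * v {0,2} + u {2,4} * v {0,1})"
  "wedge_form u v 4 = u {0,1} * v {2,3} - u {0,2} * v {1,3} + u {0,3} * v {1,2} + u {1,2} * v {0,3} - u {1,3} * v {0,2} + u {2,3} * v {0,1}"
  by (simp_all add: wedge_form_def ext_pair_def unit_vec_def algebra_simps)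

lemma ext_pair_gl2: "ext_pair (gl2 g u) w = u {0,1} * ext_pair (w2 (g 0) (g 1)) w + u {0,2} * ext_pair (w2 (g 0) (g 2)) w
    + u {0,3} * ext_pair (w2 (g 0) (g 3)) w + u {0,4} * ext_pair (w2 (g 0) (g 4)) w + u {1,2} * ext_pair (w2 (g 1) (g 2)) w
    + u {1,3} * ext_pair (w2 (g 1) (g 3)) w + u {1,4} * ext_pair (w2 (g 1) (g 4)) w + u {2,3} * ext_pair (w2 (g 2) (g 3)) w
    + u {2,4} * ext_pair (w2 (g 2) (g 4)) w + u {3,4} * ext_pair (w2 (g 3) (g 4)) w"
  unfolding ext_pair_def gl2_def by (simp add: algebra_simps)

lemma ext_pair_gl3: "ext_pair u (gl3 g w) = w {0,1,2} * ext_pair u (w3 (g 0) (g 1) (g 2)) + w {0,1,3} * ext_pair u (w3 (g 0) (g 1) (g 3))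
    + w {0,1,4} * ext_pair u (w3 (g 0) (g 1) (g 4)) + w {0,2,3} * ext_pair u (w3 (g 0) (g 2) (g 3)) + w {0,2,4} * ext_pair u (w3 (g 0) (g 2) (g 4))
    + w {0,3,4} * ext_pair u (w3 (g 0) (g 3) (g 4)) + w {1,2,3} * ext_pair u (w3 (g 1) (g 2) (g 3)) + w {1,2,4} * ext_pair u (w3 (g 1) (g 2) (g 4))
    + w {1,3,4} * ext_pair u (w3 (g 1) (g 3) (g 4)) + w {2,3,4} * ext_pair u (w3 (g 2) (g 3) (g 4))"
  unfolding ext_pair_def gl3_def by (simp add: algebra_simps)

lemma ext_pair_repeated:
  "ext_pair (w2 x y) (w3 x z t) = 0" "ext_pair (w2 x y) (w3 z x t) = 0" "ext_pair (w2 x y) (w3 z t x) = 0"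
  "ext_pair (w2 y x) (w3 x z t) = 0" "ext_pair (w2 y x) (w3 z x t) = 0" "ext_pair (w2 y x) (w3 z t x) = 0"
  unfolding ext_pair_def w2_eval w3_eval by (simp_all add: algebra_simps)

lemma ext_pair_swap: "ext_pair (w2 x z) (w3 y t s) = - ext_pair (w2 x y) (w3 z t s)"
  unfolding ext_pair_def w2_eval w3_eval by (simp add: algebra_simps)

lemma w2_swap: "w2 y x = (\<lambda>S. - w2 x y S)"
proof
  fix S show "w2 y x S = - w2 x y S" by (simp add: w2_def)
qed

lemma ext_pair_swap': "ext_pair (w2 y x) w = - ext_pair (w2 x y) w"
  unfolding w2_swap[of y x] by (simp add: ext_pair_def algebra_simps)

lemma ext_pair_w3_rotate: "ext_pair u (w3 y x z) = - ext_pair u (w3 x y z)" "ext_pair u (w3 y z x) = ext_pair u (w3 x y z)"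
  unfolding ext_pair_def by (simp_all add: w3_alternating(4)[of y x z] w3_alternating(5)[of y z x])

text \<open>The determinant of the 5 x 5 block, as the product of all five rows.\<close>

definition mat_det :: "(nat \<Rightarrow> nat \<Rightarrow> 'k::field) \<Rightarrow> 'k" where
  "mat_det g = ext_pair (w2 (g 0) (g 1)) (w3 (g 2) (g 3) (g 4))"

lemma ext_pair_complement:
  "ext_pair (w2 (g 0) (g 2)) (w3 (g 1) (g 3) (g 4)) = - mat_det g"
  "ext_pair (w2 (g 0) (g 3)) (w3 (g 1) (g 2) (g 4)) = mat_det g"
  "ext_pair (w2 (g 0) (g 4)) (w3 (g 1) (g 2) (g 3)) = - mat_det g"
  "ext_pair (w2 (g 1) (g 2)) (w3 (g 0) (g 3) (g 4)) = mat_det g"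
  "ext_pair (w2 (g 1) (g 3)) (w3 (g 0) (g 2) (g 4)) = - mat_det g"
  "ext_pair (w2 (g 1) (g 4)) (w3 (g 0) (g 2) (g 3)) = mat_det g"
  "ext_pair (w2 (g 2) (g 3)) (w3 (g 0) (g 1) (g 4)) = mat_det g"
  "ext_pair (w2 (g 2) (g 4)) (w3 (g 0) (g 1) (g 3)) = - mat_det g"
  "ext_pair (w2 (g 3) (g 4)) (w3 (g 0) (g 1) (g 2)) = mat_det g"
  "ext_pair (w2 (g 0) (g 1)) (w3 (g 2) (g 3) (g 4)) = mat_det g"
  using ext_pair_swap[of "g 0" "g 2" "g 1" "g 3" "g 4"] ext_pair_swap[of "g 0" "g 3" "g 1" "g 2" "g 4"]
    ext_pair_swap[of "g 0" "g 4" "g 1" "g 2" "g 3"] ext_pair_swap[of "g 1" "g 2" "g 0" "g 3" "g 4"]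
    ext_pair_swap[of "g 1" "g 3" "g 0" "g 2" "g 4"] ext_pair_swap[of "g 1" "g 4" "g 0" "g 2" "g 3"]
    ext_pair_swap[of "g 2" "g 3" "g 0" "g 1" "g 4"] ext_pair_swap[of "g 2" "g 4" "g 0" "g 1" "g 3"]
    ext_pair_swap[of "g 3" "g 4" "g 0" "g 1" "g 2"]
  by (simp_all add: mat_det_def ext_pair_swap'[of "g 1" "g 0"] ext_pair_swap'[of "g 2" "g 0"] ext_pair_swap'[of "g 3" "g 0"]
    ext_pair_w3_rotate(1)[of _ "g 3" "g 2"] ext_pair_w3_rotate(1)[of _ "g 3" "g 1"]
    ext_pair_w3_rotate(2)[of _ "g 2" "g 3" "g 4", symmetric] ext_pair_w3_rotate(2)[of _ "g 1" "g 3" "g 4", symmetric]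
    ext_pair_w3_rotate(2)[of _ "g 1" "g 2" "g 4", symmetric])

text \<open>By bilinearity monomials suffice: with a common index the product of the images repeats
  a row, and with complementary indices it is the determinant up to the sign in
  \<open>ext_pair\<close>.\<close>

lemma ext_pair_gl: "ext_pair (gl2 g u) (gl3 g w) = mat_det g * ext_pair u w"
  unfolding ext_pair_gl2 ext_pair_gl3 ext_pair_repeated ext_pair_complement
  by (simp add: ext_pair_def[of u w] algebra_simps)

lemma vw_eq_sum_unit: "vw x v S = x 0 * vw (unit_vec 0) v S + x 1 * vw (unit_vec 1) v S + x 2 * vw (unit_vec 2) v S
    + x 3 * vw (unit_vec 3) v S + x 4 * vw (unit_vec 4) v S"
  unfolding vw_eq_sum[of x] by (simp add: ew_eq_vw)

lemma ext_pair_vw: "ext_pair u (vw x v) = (\<Sum>i<5. x i * wedge_form u v i)"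
proof -
  have e: "vw x v S = x 0 * vw (unit_vec 0) v S + x 1 * vw (unit_vec 1) v S + x 2 * vw (unit_vec 2) v S
    + x 3 * vw (unit_vec 3) v S + x 4 * vw (unit_vec 4) v S" for S by (rule vw_eq_sum_unit)
  show ?thesis unfolding sum_lessThan_5 wedge_form_def ext_pair_def e[of "{2,3,4}"] e[of "{1,3,4}"] e[of "{1,2,4}"] e[of "{1,2,3}"]
    e[of "{0,3,4}"] e[of "{0,2,4}"] e[of "{0,2,3}"] e[of "{0,1,4}"] e[of "{0,1,3}"] e[of "{0,1,2}"]
    by (simp add: algebra_simps)
qed

lemma gl1_unit_vec: "k < 5 \<Longrightarrow> gl1 g (unit_vec k) = g k"
  unfolding gl1_def lincomb_def
proof
  fix i assume k: "k < 5"
  have "(\<Sum>l<5. unit_vec k l * g l i) = (\<Sum>l<5. if l = k then g l i else 0)" by (intro sum.cong) (auto simp: unit_vec_def)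
  then show "(\<Sum>l<5. unit_vec k l * g l i) = g k i" using k by simp
qed

text \<open>As a linear form, \<open>wedge_form u v\<close> sends x to the top coefficient of u x v;
  applying \<open>g\<close> to all three factors multiplies it by the determinant.\<close>

lemma wedge_form_gl: "k < 5 \<Longrightarrow> mat_det g * wedge_form u v k = (\<Sum>i<5. g k i * wedge_form (gl2 g u) (gl2 g v) i)"
  unfolding wedge_form_def[of u v k] ext_pair_gl[symmetric] vw_gl[symmetric] by (simp add: gl1_unit_vec ext_pair_vw)

text \<open>Otherwise the pairing would vanish on all images under \<open>g\<close>; but everything
  is such an image, and e_0 e_1 pairs with e_2 e_3 e_4 to 1.\<close>

lemma mat_det_nonzero:
  assumes "mat_inverse g h" shows "mat_det g \<noteq> 0"
proof
  assume "mat_det g = 0"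
  then have "ext_pair (gl2 g u) (gl3 g w) = 0" for u w by (simp add: ext_pair_gl)
  from this[of "gl2 h (basis_mon {0,1})" "gl3 h (basis_mon {2,3,4})"]
  have "ext_pair (basis_mon {0,1}) (basis_mon {2,3,4} :: 'a ext) = 0"
    using gl2_inverse[OF assms basis_mon_ext_deg[of "{0,1}" 2]] gl3_inverse[OF assms basis_mon_ext_deg[of "{2,3,4}" 3]]
    by (simp add: deg_sets_2 deg_sets_3)
  then show False by (simp add: ext_pair_def basis_mon_def doubleton_eq_iff)
qed

lemma rows_indep_dual_ex:
  fixes y :: "nat \<Rightarrow> 's \<Rightarrow> 'k::field"
  assumes "rows_indep (card A) y A" "finite A"
  shows "\<exists>P. (\<forall>S\<in>A. \<forall>T\<in>A. (\<Sum>i<card A. P T i * y i S) = (if S = T then 1 else 0)) \<and>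
    (\<forall>i<card A. \<forall>j<card A. (\<Sum>S\<in>A. y i S * P S j) = (if i = j then 1 else 0))"
proof (rule rows_indep_dual[OF assms])
  fix P
  assume "\<And>S T. S \<in> A \<Longrightarrow> T \<in> A \<Longrightarrow> (\<Sum>i<card A. P T i * y i S) = (if S = T then 1 else 0)"
    "\<And>i j. i < card A \<Longrightarrow> j < card A \<Longrightarrow> (\<Sum>S\<in>A. y i S * P S j) = (if i = j then 1 else 0)"
  then show ?thesis by (intro exI[of _ P]) simp
qed

text \<open>After completing the rows of I_3 to a basis of E_3, the last two dual coordinates cut
  out I_3; the perfect pairing with E_2 realizes them by 2-vectors.\<close>

lemma annihilator_exists:
  fixes x :: "'k::field frame"
  assumes x: "x \<in> pts_over Hilb"
  shows "\<exists>u1 u2. u1 \<in> ext_deg 2 \<and> u2 \<in> ext_deg 2 \<and>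
    (\<forall>w\<in>ext_deg 3. w \<in> rowspan 8 (row x 3) \<longleftrightarrow> ext_pair u1 w = 0 \<and> ext_pair u2 w = 0) \<and>
    (\<forall>a b. (\<forall>S. a * u1 S + b * u2 S = 0) \<longrightarrow> a = 0 \<and> b = 0)"
proof -
  note xf = pts_Hilb_frames[OF x]
  have c10: "card (deg_sets 3) = 10" by (simp add: card_deg_sets choose_5)
  have "rows_indep 8 (row x 3) (deg_sets 3)"
    unfolding rows_indep_def
  proof (intro allI impI)
    fix c i assume c: "\<forall>S\<in>deg_sets 3. (\<Sum>i<8. c i * x (3,i,S)) = 0" and i: "i < (8::nat)"
    have "(\<Sum>i<8. c i * x (3,i,S)) = 0" if "S \<notin> deg_sets 3" for S
      using that framesD[OF xf, of 3 _ S] by (intro sum.neutral) (auto simp: deg_sets_def)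
    then show "c i = 0" using rows_indepD[OF pts_Hilb_rows[OF x, of 3], of c i] c i by auto
  qed
  then obtain z where z: "rows_indep 10 z (deg_sets 3)" "\<forall>i<8. z i = row x 3 i"
    using rows_indep_extend[of 8 "row x 3" "deg_sets 3"] c10 by auto
  have "rows_indep (card (deg_sets 3)) z (deg_sets 3)" using z(1) c10 by simp
  from rows_indep_dual_ex[OF this finite_deg_sets] obtain P
    where P': "(\<forall>S\<in>deg_sets 3. \<forall>T\<in>deg_sets 3. (\<Sum>i<10. P T i * z i S) = (if S = T then 1 else 0)) \<and>
      (\<forall>i<10. \<forall>j<10. (\<Sum>S\<in>deg_sets 3. z i S * P S j) = (if i = j then 1 else 0))"
    unfolding c10 by (elim exE)
  then have P: "\<And>S T. S \<in> deg_sets 3 \<Longrightarrow> T \<in> deg_sets 3 \<Longrightarrow> (\<Sum>i<10. P T i * z i S) = (if S = T then 1 else 0)"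
    "\<And>i j. i < 10 \<Longrightarrow> j < 10 \<Longrightarrow> (\<Sum>S\<in>deg_sets 3. z i S * P S j) = (if i = j then 1 else 0)" by simp_all
  \<comment> \<open>The coefficient at a pair comes from the complementary triple, with the sign
    that \<open>ext_pair\<close> attaches to it.\<close>
  define u :: "nat \<Rightarrow> 'k ext" where "u j = (\<lambda>S. if S = {0,1} then P {2,3,4} j else if S = {0,2} then - P {1,3,4} j else if S = {0,3} then P {1,2,4} j
     else if S = {0,4} then - P {1,2,3} j else if S = {1,2} then P {0,3,4} j else if S = {1,3} then - P {0,2,4} j
     else if S = {1,4} then P {0,2,3} j else if S = {2,3} then P {0,1,4} j else if S = {2,4} then - P {0,1,3} j
     else if S = {3,4} then P {0,1,2} j else 0)" for j
  have ud: "u j \<in> ext_deg 2" for j by (auto simp: ext_deg_eq u_def deg_sets_2 split: if_splits)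
  have pair: "ext_pair (u j) w = (\<Sum>S\<in>deg_sets 3. w S * P S j)" for j w
    unfolding deg_sets_3 by (simp add: ext_pair_def u_def doubleton_eq_iff algebra_simps)
  have mem: "w \<in> rowspan 8 (row x 3) \<longleftrightarrow> ext_pair (u 8) w = 0 \<and> ext_pair (u 9) w = 0" if w: "w \<in> ext_deg 3" for w
  proof
    assume "w \<in> rowspan 8 (row x 3)"
    then obtain c where c: "w = lincomb 8 c (row x 3)" by (auto simp: rowspan_def)
    have "(\<Sum>S\<in>deg_sets 3. w S * P S j) = (\<Sum>i<8. c i * (\<Sum>S\<in>deg_sets 3. z i S * P S j))" for j
      unfolding c lincomb_def by (simp add: z(2) sum_distrib_right sum_distrib_left mult.assoc) (rule sum.swap)
    moreover have "(\<Sum>i<8. c i * (\<Sum>S\<in>deg_sets 3. z i S * P S j)) = 0" if "j = 8 \<or> j = 9" for j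
      using P(2)[of _ j] that by (intro sum.neutral) auto
    ultimately show "ext_pair (u 8) w = 0 \<and> ext_pair (u 9) w = 0" unfolding pair by metis
  next
    assume w0: "ext_pair (u 8) w = 0 \<and> ext_pair (u 9) w = 0"
    define c where "c i = (\<Sum>S\<in>deg_sets 3. w S * P S i)" for i
    have "w = lincomb 8 c (row x 3)"
    proof
      fix T
      show "w T = lincomb 8 c (row x 3) T"
      proof (cases "T \<in> deg_sets 3")
        case True
        have "(\<Sum>i<10. c i * z i T) = (\<Sum>S\<in>deg_sets 3. w S * (\<Sum>i<10. P S i * z i T))"
          unfolding c_def by (simp add: sum_distrib_right sum_distrib_left mult.assoc) (rule sum.swap)
        also have "\<dots> = (\<Sum>S\<in>deg_sets 3. if S = T then w S else 0)" using P(1)[OF True] by (intro sum.cong) auto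
        also have "\<dots> = w T" using True by simp
        finally have 1: "(\<Sum>i<10. c i * z i T) = w T" .
        have "c 8 = 0" "c 9 = 0" using w0 by (simp_all add: pair c_def)
        have "{..<10} = {..<8} \<union> {8,9::nat}" by auto
        then have "(\<Sum>i<10. c i * z i T) = (\<Sum>i\<in>{..<8} \<union> {8,9}. c i * z i T)" by simp
        also have "\<dots> = (\<Sum>i<8. c i * z i T) + (\<Sum>i\<in>{8,9}. c i * z i T)" by (rule sum.union_disjoint) auto
        also have "\<dots> = (\<Sum>i<8. c i * z i T)" using \<open>c 8 = 0\<close> \<open>c 9 = 0\<close> by simp
        finally show ?thesis using 1 z(2) by (simp add: lincomb_def)
      next
        case False
        then have "w T = 0" using w by (auto simp: ext_deg_eq)
        moreover have "lincomb 8 c (row x 3) T = 0"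
          using False lincomb_ext_deg[of 8 "row x 3" 3 c] row_ext_deg[OF xf] by (auto simp: ext_deg_eq)
        ultimately show ?thesis by simp
      qed
    qed
    then show "w \<in> rowspan 8 (row x 3)" by (auto simp: rowspan_def)
  qed
  have "a = 0 \<and> b = 0" if ab: "\<forall>S. a * u 8 S + b * u 9 S = 0" for a b
  proof -
    have "a * ext_pair (u 8) w + b * ext_pair (u 9) w = ext_pair (\<lambda>S. a * u 8 S + b * u 9 S) w" for w
      by (simp add: ext_pair_def algebra_simps)
    then have "a * ext_pair (u 8) w + b * ext_pair (u 9) w = 0" for w using ab by (simp add: ext_pair_def)
    from this[of "z 8"] this[of "z 9"] show ?thesis unfolding pair using P(2) by simp
  qed
  note ind = this
  show ?thesis
    by (rule exI[of _ "u 8"], rule exI[of _ "u 9"])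
      (intro conjI ballI allI impI; (rule ud | rule mem | erule conjunct1[OF ind] | erule conjunct2[OF ind]); assumption?)
qed

text \<open>Since x v lies in I_3 for every vector x, an annihilator u of I_3 satisfies u v =
  0.\<close>

lemma wedge_form_V:
  assumes x: "x \<in> pts_over Hilb" and u: "\<And>w. w \<in> rowspan 8 (row x 3) \<Longrightarrow> ext_pair u w = 0"
    and v: "v \<in> rowspan 3 (row x 2)" and i: "i < 5"
  shows "wedge_form u v i = 0"
  unfolding wedge_form_def by (rule u) (rule vw_in_rowspan[OF x v])

section \<open>Decomposable 2-vectors and pencils of them\<close>

definition skew :: "'k::field ext \<Rightarrow> nat \<Rightarrow> nat \<Rightarrow> 'k" where
  "skew u i j = (if i < j then u {i,j} else if j < i then - u {j,i} else 0)"

lemma ext_deg_2_skew_eqI: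
  assumes "u \<in> ext_deg 2" "v \<in> ext_deg 2" "\<And>k l. k < l \<Longrightarrow> l < 5 \<Longrightarrow> skew u k l = skew v k l"
  shows "u = v"
proof -
  have "u {k,l} = v {k,l}" if "k < l" "l < 5" for k l using assms(3)[OF that] that by (simp add: skew_def)
  then show ?thesis by (intro ext_deg_2_eqI[OF assms(1,2)]) simp_all
qed

lemma skew_w2: "k < 5 \<Longrightarrow> l < 5 \<Longrightarrow> skew (w2 x y) k l = x k * y l - x l * y k"
  by (auto simp: skew_def dest!: less_5_cases)

lemma all_less_5: "(\<forall>i<5. P i) \<longleftrightarrow> P 0 \<and> P 1 \<and> P 2 \<and> P 3 \<and> P (4::nat)"
  using less_5_cases by auto

text \<open>The coefficients of u u are, up to sign, twice the five three-term Pluecker expressions,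
  and 2 can be cancelled; the remaining index patterns follow by antisymmetry or are
  trivial.\<close>

lemma pluecker:
  fixes u :: "'k::field ext"
  assumes two: "(2::'k) \<noteq> 0" and u: "\<And>i. i < 5 \<Longrightarrow> wedge_form u u i = 0"
  shows "\<forall>i<5. \<forall>j<5. \<forall>k<5. \<forall>l<5. skew u i j * skew u k l - skew u i k * skew u j l + skew u i l * skew u j k = 0"
proof -
  have e: "wedge_form u u 0 = 2 * (u {1,2} * u {3,4} - u {1,3} * u {2,4} + u {1,4} * u {2,3})"
    "wedge_form u u 1 = - 2 * (u {0,2} * u {3,4} - u {0,3} * u {2,4} + u {0,4} * u {2,3})"
    "wedge_form u u 2 = 2 * (u {0,1} * u {3,4} - u {0,3} * u {1,4} + u {0,4} * u {1,3})"
    "wedge_form u u 3 = - 2 * (u {0,1} * u {2,4} - u {0,2} * u {1,4} + u {0,4} * u {1,2})"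
    "wedge_form u u 4 = 2 * (u {0,1} * u {2,3} - u {0,2} * u {1,3} + u {0,3} * u {1,2})"
    unfolding wedge_form_eval by (simp_all add: algebra_simps)
  have c: "a = 0" if "2 * a = 0 \<or> - 2 * a = 0" for a :: 'k using that two by auto
  have h: "u {1,2} * u {3,4} - u {1,3} * u {2,4} + u {1,4} * u {2,3} = 0"
    "u {0,2} * u {3,4} - u {0,3} * u {2,4} + u {0,4} * u {2,3} = 0"
    "u {0,1} * u {3,4} - u {0,3} * u {1,4} + u {0,4} * u {1,3} = 0"
    "u {0,1} * u {2,4} - u {0,2} * u {1,4} + u {0,4} * u {1,2} = 0"
    "u {0,1} * u {2,3} - u {0,2} * u {1,3} + u {0,3} * u {1,2} = 0"
    by (rule c, rule disjI1, rule trans[OF e(1)[symmetric] u], simp)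
      (rule c, rule disjI2, rule trans[OF e(2)[symmetric] u], simp,
       rule c, rule disjI1, rule trans[OF e(3)[symmetric] u], simp,
       rule c, rule disjI2, rule trans[OF e(4)[symmetric] u], simp,
       rule c, rule disjI1, rule trans[OF e(5)[symmetric] u], simp)
  have r: "a = b - d" if "a - b + d = 0" for a b d :: 'k
  proof -
    have "a = (a - b + d) + (b - d)" by simp
    then show ?thesis unfolding that by simp
  qed
  have p: "u {1,2} * u {3,4} = u {1,3} * u {2,4} - u {1,4} * u {2,3}"
    "u {0,2} * u {3,4} = u {0,3} * u {2,4} - u {0,4} * u {2,3}"
    "u {0,1} * u {3,4} = u {0,3} * u {1,4} - u {0,4} * u {1,3}"
    "u {0,1} * u {2,4} = u {0,2} * u {1,4} - u {0,4} * u {1,2}"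
    "u {0,1} * u {2,3} = u {0,2} * u {1,3} - u {0,3} * u {1,2}"
    by (rule r[OF h(1)] r[OF h(2)] r[OF h(3)] r[OF h(4)] r[OF h(5)])+
  then show ?thesis unfolding all_less_5 by (simp add: skew_def mult.commute)
qed

text \<open>If the entry (i, j) of the skew matrix of \<open>u\<close> is nonzero, the three-term
  relations state that \<open>u\<close> is the product of rows i and j divided by that
  entry.\<close>

lemma decomposable:
  fixes u :: "'k::field ext"
  assumes two: "(2::'k) \<noteq> 0" and u: "u \<in> ext_deg 2" "\<And>i. i < 5 \<Longrightarrow> wedge_form u u i = 0"
  shows "\<exists>x y. u = w2 x y"
proof (cases "\<exists>i<5. \<exists>j<5. skew u i j \<noteq> 0")
  case True
  then obtain i j where ij: "i < 5" "j < 5" "skew u i j \<noteq> 0" by blast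
  have "u = w2 (\<lambda>k. skew u i k / skew u i j) (skew u j)"
  proof (rule ext_deg_2_skew_eqI[OF u(1) w2_ext_deg])
    fix k l :: nat assume kl: "k < l" "l < 5"
    then have "skew u i j * skew u k l = skew u i k * skew u j l - skew u i l * skew u j k"
      using pluecker[OF two u(2)] ij by (auto simp: algebra_simps)
    then show "skew u k l = skew (w2 (\<lambda>k. skew u i k / skew u i j) (skew u j)) k l"
      using kl ij by (simp add: skew_w2 field_simps)
  qed
  then show ?thesis by blast
next
  case False
  have "u = w2 (\<lambda>_. 0) (\<lambda>_. 0)" by (rule ext_deg_2_skew_eqI[OF u(1) w2_ext_deg]) (use False in \<open>auto simp: skew_w2\<close>)
  then show ?thesis by blast
qed

lemma w2_linear:
  "w2 (\<lambda>i. a * x i + b * y i) z S = a * w2 x z S + b * w2 y z S"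
  "w2 z (\<lambda>i. a * x i + b * y i) S = a * w2 z x S + b * w2 z y S"
  by (simp_all add: w2_def algebra_simps)

lemma w2_zero [simp]: "w2 (\<lambda>_. 0) y = 0"
  by (rule ext_deg_2_eqI) simp_all

lemma w2_self [simp]: "w2 x x S = 0"
  by (simp add: w2_def)

text \<open>A basis change of determinant 1 in the plane of \<open>x\<close> and \<open>y\<close>
  makes any combination with coefficients not both zero the first factor.\<close>

lemma w2_factor:
  assumes "w2 x y \<noteq> 0" "a \<noteq> 0 \<or> b \<noteq> 0" shows "\<exists>q. w2 x y = w2 (\<lambda>i. a * x i + b * y i) q"
proof (cases "a = 0")
  case False
  have "w2 x y = w2 (\<lambda>i. a * x i + b * y i) (\<lambda>i. (1/a) * y i + 0 * y i)"
    unfolding fun_eq_iff w2_linear using False by simp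
  then show ?thesis by blast
next
  case True
  then have b: "b \<noteq> 0" using assms by simp
  have "w2 x y = w2 (\<lambda>i. a * x i + b * y i) (\<lambda>i. (- 1/b) * x i + 0 * x i)"
    unfolding fun_eq_iff w2_linear using True b by (simp add: w2_swap[of y x])
  then show ?thesis by blast
qed

text \<open>Decomposable 2-vectors are planes, and a zero product makes the two planes meet in a
  line <p>, which becomes the common factor.\<close>

lemma pencil_of_decomposables:
  fixes u1 u2 :: "'k::field ext"
  assumes two: "(2::'k) \<noteq> 0" and u: "u1 \<in> ext_deg 2" "u2 \<in> ext_deg 2"
    and f: "\<And>i. i < 5 \<Longrightarrow> wedge_form u1 u1 i = 0" "\<And>i. i < 5 \<Longrightarrow> wedge_form u2 u2 i = 0" "\<And>i. i < 5 \<Longrightarrow> wedge_form u1 u2 i = 0"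
    and ind: "\<And>a b. (\<forall>S. a * u1 S + b * u2 S = 0) \<Longrightarrow> a = 0 \<and> b = 0"
  shows "\<exists>p q r. u1 = w2 p q \<and> u2 = w2 p r \<and>
    (\<forall>a b c. (\<forall>i<5. a * p i + b * q i + c * r i = 0) \<longrightarrow> a = 0 \<and> b = 0 \<and> c = 0)"
proof -
  have n1: "u1 \<noteq> 0"
  proof
    assume "u1 = 0"
    then have "\<forall>S. 1 * u1 S + 0 * u2 S = 0" by simp
    from ind[OF this] show False by simp
  qed
  have n2: "u2 \<noteq> 0"
  proof
    assume "u2 = 0"
    then have "\<forall>S. 0 * u1 S + 1 * u2 S = 0" by simp
    from ind[OF this] show False by simp
  qed
  obtain x y where xy: "u1 = w2 x y" using decomposable[OF two u(1) f(1)] by blast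
  obtain z t where zt: "u2 = w2 z t" using decomposable[OF two u(2) f(2)] by blast
  define m where "m = (\<lambda>k::nat. if k = 0 then x else if k = 1 then y else if k = 2 then z else t)"
  have "\<not> rows_indep 4 m {..<5}"
  proof
    assume "rows_indep 4 m {..<5}"
    then obtain g where g: "rows_indep 5 g {..<5}" "\<forall>i<4. g i = m i"
      using rows_indep_extend[of 4 m "{..<5::nat}"] by auto
    obtain h where h: "mat_inverse g h" using mat_inverse_exists[OF g(1)] by blast
    \<comment> \<open>If the four factors were independent and completed by a fifth vector, the
      product of all five would be the determinant, yet it contains u1 u2 = 0.\<close>
    have "ext_pair u1 (vw (g 4) u2) = 0" unfolding ext_pair_vw using f(3) by simp
    then have "ext_pair (w2 (g 0) (g 1)) (w3 (g 4) (g 2) (g 3)) = 0" using g(2) by (simp add: xy zt m_def w3_def)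
    then have "mat_det g = 0" unfolding mat_det_def ext_pair_w3_rotate(2)[of _ "g 4" "g 2" "g 3", symmetric]
      using ext_pair_w3_rotate(2)[of "w2 (g 0) (g 1)" "g 2" "g 3" "g 4"] by simp
    then show False using mat_det_nonzero[OF h] by simp
  qed
  then obtain c where c: "\<forall>i<5. (\<Sum>k<4. c k * m k i) = 0" "\<exists>k<4. c k \<noteq> 0" unfolding rows_indep_def by auto
  \<comment> \<open>The relation c_0 x + c_1 y = - c_2 z - c_3 t exhibits a vector common to both
    planes; it is nonzero because neither 2-vector is zero.\<close>
  define p where "p = (\<lambda>i. c 0 * x i + c 1 * y i)"
  have p2: "p i = - c 2 * z i + - c 3 * t i" if "i < 5" for i
  proof -
    have "c 0 * x i + c 1 * y i + c 2 * z i + c 3 * t i = 0" using c(1) that by (simp add: sum_lessThan_4 m_def)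
    then have "p i - (- c 2 * z i + - c 3 * t i) = 0" by (simp add: p_def algebra_simps)
    then show ?thesis by simp
  qed
  have c01: "c 0 \<noteq> 0 \<or> c 1 \<noteq> 0"
  proof (rule ccontr)
    assume "\<not> (c 0 \<noteq> 0 \<or> c 1 \<noteq> 0)"
    then have c0: "c 0 = 0" "c 1 = 0" and "c 2 \<noteq> 0 \<or> c 3 \<noteq> 0" using c(2) less_4_cases by auto
    then have "- c 2 \<noteq> 0 \<or> - c 3 \<noteq> 0" by simp
    then obtain q where q: "u2 = w2 (\<lambda>i. - c 2 * z i + - c 3 * t i) q" using w2_factor n2 unfolding zt by blast
    have "u2 = w2 p q" unfolding q by (rule w2_cong) (use p2 in auto)
    moreover have "p = (\<lambda>_. 0)" by (simp add: p_def c0)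
    ultimately show False using n2 by simp
  qed
  have c23: "- c 2 \<noteq> 0 \<or> - c 3 \<noteq> 0"
  proof (rule ccontr)
    assume "\<not> (- c 2 \<noteq> 0 \<or> - c 3 \<noteq> 0)"
    then have p0: "p i = 0" if "i < 5" for i using p2[OF that] by simp
    obtain q where q: "u1 = w2 p q" using w2_factor[of x y "c 0" "c 1"] n1 c01 unfolding xy p_def by blast
    have "u1 = w2 (\<lambda>_. 0) q" unfolding q by (rule w2_cong) (use p0 in auto)
    then show False using n1 by simp
  qed
  obtain q where q: "u1 = w2 p q" using w2_factor[of x y "c 0" "c 1"] n1 c01 unfolding xy p_def by blast
  obtain r where r': "u2 = w2 (\<lambda>i. - c 2 * z i + - c 3 * t i) r" using w2_factor c23 n2 unfolding zt by blast
  have r: "u2 = w2 p r" unfolding r' by (rule w2_cong) (use p2 in auto)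
  have "a = 0 \<and> b = 0 \<and> e = 0" if abc: "\<forall>i<5. a * p i + b * q i + e * r i = 0" for a b e
  proof -
    \<comment> \<open>Multiplying the relation by \<open>p\<close> removes its first term and leaves
      a relation between \<open>u1\<close> and \<open>u2\<close>.\<close>
    have "w2 p (\<lambda>i. b * q i + e * r i) = w2 p (\<lambda>i. (- a) * p i + 0 * p i)"
    proof (rule w2_cong)
      fix i :: nat assume "i < 5"
      then have "a * p i + (b * q i + e * r i) = 0" using abc by (simp add: add.assoc)
      then show "b * q i + e * r i = (- a) * p i + 0 * p i" by (simp add: eq_neg_iff_add_eq_0 add.commute)
    qed simp
    then have "w2 p (\<lambda>i. b * q i + e * r i) S = w2 p (\<lambda>i. (- a) * p i + 0 * p i) S" for S
      by (rule fun_cong)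
    then have "b * u1 S + e * u2 S = 0" for S unfolding w2_linear by (simp add: q r)
    then have be0: "\<forall>S. b * u1 S + e * u2 S = 0" by (rule allI)
    note be = conjunct1[OF ind[OF be0]] conjunct2[OF ind[OF be0]]
    have "\<exists>i<5. p i \<noteq> 0"
    proof (rule ccontr)
      assume "\<not> ?thesis"
      then have p0: "p i = 0" if "i < 5" for i using that by blast
      have "u1 = w2 (\<lambda>_. 0) q" unfolding q by (rule w2_cong) (use p0 in auto)
      then show False using n1 by simp
    qed
    then obtain i where "i < 5" "p i \<noteq> 0" by blast
    moreover have "a * p i = 0" using spec[OF abc, of i] \<open>i < 5\<close> by (simp add: be)
    ultimately show ?thesis by (simp add: be)
  qed
  then show ?thesis using q r by blast
qed

text \<open>In a basis starting with p, q, r the annihilators are e_0 e_1 and e_0 e_2, and pairing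
  with them reads off the coefficients at {2,3,4} and {1,3,4}. The conditions on I_2 follow by
  multiplying with basis vectors.\<close>

lemma classify_decomposable:
  fixes x :: "'k::field frame"
  assumes x: "x \<in> pts_over Hilb" and u: "\<And>w. w \<in> rowspan 8 (row x 3) \<Longrightarrow> ext_pair u1 w = 0 \<and> ext_pair u2 w = 0"
    and pqr: "u1 = w2 p q" "u2 = w2 p r" "\<And>a b c. (\<forall>i<5. a * p i + b * q i + c * r i = 0) \<Longrightarrow> a = 0 \<and> b = 0 \<and> c = 0"
  shows "\<exists>g h. mat_inverse g h \<and> std1 (gl_act h x)"
proof -
  define m where "m = (\<lambda>k::nat. if k = 0 then p else if k = 1 then q else r)"
  have "rows_indep 3 m {..<5}"
    unfolding rows_indep_def
  proof (intro allI impI)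
    fix c k assume c: "\<forall>i\<in>{..<5}. (\<Sum>k<3. c k * m k i) = 0" and k: "k < (3::nat)"
    have "c 0 = 0 \<and> c 1 = 0 \<and> c 2 = 0" by (rule pqr(3)) (use c in \<open>simp add: sum_lessThan_3 m_def\<close>)
    then show "c k = 0" using less_3_cases[OF k] by auto
  qed
  then obtain g where g: "rows_indep 5 g {..<5}" "\<forall>i<3. g i = m i"
    using rows_indep_extend[of 3 m "{..<5::nat}"] by auto
  obtain h where h: "mat_inverse g h" using mat_inverse_exists[OF g(1)] by blast
  have d: "mat_det g \<noteq> 0" by (rule mat_det_nonzero[OF h])
  have y: "gl_act h x \<in> pts_over Hilb" by (rule gl_act_pts[OF x mat_inverse_sym[OF h]])
  have ug: "u1 = w2 (g 0) (g 1)" "u2 = w2 (g 0) (g 2)" using g(2) pqr by (simp_all add: m_def)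
  have W: "w {1,3,4} = 0 \<and> w {2,3,4} = 0" if "w \<in> rowspan 8 (row (gl_act h x) 3)" for w
  proof -
    from that obtain w' where w': "w = gl3 h w'" "w' \<in> rowspan 8 (row x 3)" unfolding rowspan_gl_act by blast
    have "w' \<in> ext_deg 3" using w'(2) rowspan_frames[OF pts_Hilb_frames[OF x]] by blast
    then have "w' = gl3 g w" unfolding w'(1) by (rule gl3_inverse[OF h, symmetric])
    then have "ext_pair u1 (gl3 g w) = 0" "ext_pair u2 (gl3 g w) = 0" using u[OF w'(2)] by simp_all
    then have "w {2,3,4} * mat_det g = 0" "w {1,3,4} * mat_det g = 0"
      unfolding ug ext_pair_gl3 ext_pair_repeated ext_pair_complement by simp_all
    then show ?thesis using d by simp
  qed
  have "std1 (gl_act h x)"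
    unfolding std1_def
  proof (intro conjI ballI)
    fix v assume v: "v \<in> rowspan 3 (row (gl_act h x) 2)"
    have "vw (unit_vec i) v {1,3,4} = 0 \<and> vw (unit_vec i) v {2,3,4} = 0" for i by (rule W[OF vw_in_rowspan[OF y v]])
    \<comment> \<open>Multiplication by e_4 brings the coefficients at {1,3} and {2,3} to the two
      forbidden triples, e_3 those at {1,4} and {2,4}, and e_1 the one at {3,4}.\<close>
    from this[of 4] this[of 3] this[of 1]
    show "v {1,3} = 0" "v {1,4} = 0" "v {2,3} = 0" "v {2,4} = 0" "v {3,4} = 0" by (simp_all add: unit_vec_def)
  qed (use W in auto)
  then show ?thesis using h by blast
qed

text \<open>The product form of u annihilates, by contraction, u and everything whose product with u vanishes.\<close>
lemma wedge_form_contraction: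
  assumes "wedge_form u u 0 = 0" "wedge_form u u 1 = 0" "wedge_form u u 2 = 0" "wedge_form u u 3 = 0" "wedge_form u u 4 \<noteq> 0"
    and "wedge_form u v 0 = 0" "wedge_form u v 1 = 0" "wedge_form u v 2 = 0" "wedge_form u v 3 = 0" "wedge_form u v 4 = 0"
  shows "v {0,4} = 0" "v {1,4} = 0" "v {2,4} = 0" "v {3,4} = 0"
proof -
  \<comment> \<open>Polarization of the identity that the form of u u contracts u to zero; the
    second summand vanishes because u v = 0.\<close>
  have "wedge_form u u 1 * v {0,1} + wedge_form u u 2 * v {0,2} + wedge_form u u 3 * v {0,3} + wedge_form u u 4 * v {0,4}
    + 2 * (wedge_form u v 1 * u {0,1} + wedge_form u v 2 * u {0,2} + wedge_form u v 3 * u {0,3} + wedge_form u v 4 * u {0,4}) = 0"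
    unfolding wedge_form_eval by (simp add: algebra_simps)
  then show "v {0,4} = 0" using assms by simp
  have "- wedge_form u u 0 * v {0,1} + wedge_form u u 2 * v {1,2} + wedge_form u u 3 * v {1,3} + wedge_form u u 4 * v {1,4}
    + 2 * (- wedge_form u v 0 * u {0,1} + wedge_form u v 2 * u {1,2} + wedge_form u v 3 * u {1,3} + wedge_form u v 4 * u {1,4}) = 0"
    unfolding wedge_form_eval by (simp add: algebra_simps)
  then show "v {1,4} = 0" using assms by simp
  have "- wedge_form u u 0 * v {0,2} - wedge_form u u 1 * v {1,2} + wedge_form u u 3 * v {2,3} + wedge_form u u 4 * v {2,4}
    + 2 * (- wedge_form u v 0 * u {0,2} - wedge_form u v 1 * u {1,2} + wedge_form u v 3 * u {2,3} + wedge_form u v 4 * u {2,4}) = 0"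
    unfolding wedge_form_eval by (simp add: algebra_simps)
  then show "v {2,4} = 0" using assms by simp
  have "- wedge_form u u 0 * v {0,3} - wedge_form u u 1 * v {1,3} - wedge_form u u 2 * v {2,3} + wedge_form u u 4 * v {3,4}
    + 2 * (- wedge_form u v 0 * u {0,3} - wedge_form u v 1 * u {1,3} - wedge_form u v 2 * u {2,3} + wedge_form u v 4 * u {3,4}) = 0"
    unfolding wedge_form_eval by (simp add: algebra_simps)
  then show "v {3,4} = 0" using assms by simp
qed

text \<open>The contraction identity before polarization. Setting \<open>v = u\<close> in the
  polarized one would give three times this, which says nothing in characteristic 3.\<close>

lemma wedge_form_contraction_self:
  assumes "wedge_form u u 0 = 0" "wedge_form u u 1 = 0" "wedge_form u u 2 = 0" "wedge_form u u 3 = 0" "wedge_form u u 4 \<noteq> (0::'k::field)"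
    and two: "(2::'k) \<noteq> 0"
  shows "u {0,4} = 0" "u {1,4} = 0" "u {2,4} = 0" "u {3,4} = 0"
proof -
  have "wedge_form u u 1 * u {0,1} + wedge_form u u 2 * u {0,2} + wedge_form u u 3 * u {0,3} + wedge_form u u 4 * u {0,4} = 0"
    unfolding wedge_form_eval by (simp add: algebra_simps)
  then show "u {0,4} = 0" using assms by simp
  have "- wedge_form u u 0 * u {0,1} + wedge_form u u 2 * u {1,2} + wedge_form u u 3 * u {1,3} + wedge_form u u 4 * u {1,4} = 0"
    unfolding wedge_form_eval by (simp add: algebra_simps)
  then show "u {1,4} = 0" using assms by simp
  have "- wedge_form u u 0 * u {0,2} - wedge_form u u 1 * u {1,2} + wedge_form u u 3 * u {2,3} + wedge_form u u 4 * u {2,4} = 0"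
    unfolding wedge_form_eval by (simp add: algebra_simps)
  then show "u {2,4} = 0" using assms by simp
  have "- wedge_form u u 0 * u {0,3} - wedge_form u u 1 * u {1,3} - wedge_form u u 2 * u {2,3} + wedge_form u u 4 * u {3,4} = 0"
    unfolding wedge_form_eval by (simp add: algebra_simps)
  then show "u {3,4} = 0" using assms by simp
qed

text \<open>If the second annihilator were not supported on the hyperplane, I_2 would be x H for a vector x
  of H, which forces the first annihilator to be decomposable.\<close>
lemma std2_if_hyperplane:
  fixes y :: "'k::field frame"
  assumes y: "y \<in> pts_over Hilb" and two: "(2::'k) \<noteq> 0"
    and W: "\<And>w. w \<in> ext_deg 3 \<Longrightarrow> w \<in> rowspan 8 (row y 3) \<longleftrightarrow> ext_pair u w = 0 \<and> ext_pair u' w = 0"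
    and f: "wedge_form u u 0 = 0" "wedge_form u u 1 = 0" "wedge_form u u 2 = 0" "wedge_form u u 3 = 0" "wedge_form u u 4 \<noteq> 0"
  shows "std2 y"
proof -
  note yf = pts_Hilb_frames[OF y]
  have Wd: "w \<in> ext_deg 3" if "w \<in> rowspan 8 (row y 3)" for w using that rowspan_frames[OF yf] by blast
  have Vf: "wedge_form u v i = 0" "wedge_form u' v i = 0" if "v \<in> rowspan 3 (row y 2)" "i < 5" for v i
    using wedge_form_V[OF y _ that, of u] wedge_form_V[OF y _ that, of u'] W Wd by blast+
  have V4: "v {0,4} = 0" "v {1,4} = 0" "v {2,4} = 0" "v {3,4} = 0" if "v \<in> rowspan 3 (row y 2)" for v
    using wedge_form_contraction[OF f] Vf(1)[OF that] by simp_all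
  have u4: "u {0,4} = 0" "u {1,4} = 0" "u {2,4} = 0" "u {3,4} = 0" by (rule wedge_form_contraction_self[OF f two])+
  \<comment> \<open>Write u' as a 2-vector of H plus x e_4; the vector \<open>x\<close> of H is to
    be shown zero.\<close>
  define x where "x = (\<lambda>i::nat. if i < 4 then u' {i,4} else 0)"
  \<comment> \<open>Since \<open>v\<close> is a 2-vector of H, the part of u' v divisible by e_4 is
    x v e_4; so x v = 0.\<close>
  have xv: "x 0 * v {1,2} - x 1 * v {0,2} + x 2 * v {0,1} = 0" "x 0 * v {1,3} - x 1 * v {0,3} + x 3 * v {0,1} = 0"
    "x 0 * v {2,3} - x 2 * v {0,3} + x 3 * v {0,2} = 0" "x 1 * v {2,3} - x 2 * v {1,3} + x 3 * v {1,2} = 0"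
    if v: "v \<in> rowspan 3 (row y 2)" for v
    using Vf(2)[OF v, of 0] Vf(2)[OF v, of 1] Vf(2)[OF v, of 2] Vf(2)[OF v, of 3] V4[OF v]
    unfolding wedge_form_eval by (simp_all add: x_def algebra_simps)
  have x0: "x k = 0" for k
  proof (rule ccontr)
    assume xk: "x k \<noteq> 0"
    then have k: "k < 4" by (cases "k < 4") (simp_all add: x_def)
    have x4: "x 4 = 0" by (simp add: x_def)
    \<comment> \<open>From x v = 0 and x_k nonzero, \<open>v\<close> is divisible by x: it is x
      times row \<open>k\<close> of its skew matrix, divided by x_k.\<close>
    have rel: "\<forall>i<5. \<forall>j<5. x k * skew v i j = x i * skew v k j - x j * skew v k i" if v: "v \<in> rowspan 3 (row y 2)" for v
    proof -
      have e: "x 0 * v {1,2} = x 1 * v {0,2} - x 2 * v {0,1}" "x 0 * v {1,3} = x 1 * v {0,3} - x 3 * v {0,1}"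
        "x 0 * v {2,3} = x 2 * v {0,3} - x 3 * v {0,2}" "x 1 * v {2,3} = x 2 * v {1,3} - x 3 * v {1,2}"
        using xv[OF v] by (simp_all add: algebra_simps)
      show ?thesis using less_4_cases[OF k] unfolding all_less_5
        by (elim disjE) (simp_all add: skew_def V4[OF v] x4 e mult.commute)
    qed
    \<comment> \<open>The three indices below 4 other than \<open>k\<close>; the products of x with
      these basis vectors span x H.\<close>
    define \<sigma> where "\<sigma> i = (if i < k then i else Suc i)" for i
    have \<sigma>: "\<sigma> i < 4" "\<sigma> i \<noteq> k" if "i < 3" for i using that k by (auto simp: \<sigma>_def)
    have mem: "row y 2 l \<in> rowspan 3 (\<lambda>i. w2 x (unit_vec (\<sigma> i)))" if l: "l < 3" for l
    proof -
      have v: "row y 2 l \<in> rowspan 3 (row y 2)" by (rule row_in_rowspan[OF l])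
      have "row y 2 l = lincomb 3 (\<lambda>i. skew (row y 2 l) k (\<sigma> i) / x k) (\<lambda>i. w2 x (unit_vec (\<sigma> i)))"
      proof (rule ext_deg_2_skew_eqI[OF row_ext_deg[OF yf]])
        show "lincomb 3 (\<lambda>i. skew (row y 2 l) k (\<sigma> i) / x k) (\<lambda>i. w2 x (unit_vec (\<sigma> i))) \<in> ext_deg 2"
          by (intro lincomb_ext_deg) simp
        fix i j :: nat assume ij: "i < j" "j < 5"
        have V4l: "skew (row y 2 l) k 4 = 0" using V4[OF v] less_4_cases[OF k] by (auto simp: skew_def)
        have S: "(\<Sum>a<3. skew (row y 2 l) k (\<sigma> a) * unit_vec (\<sigma> a) b) = skew (row y 2 l) k b" if "b < 5" for b
          using less_4_cases[OF k] less_5_cases[OF that] V4l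
          by (elim disjE) (simp_all add: sum_lessThan_3 \<sigma>_def unit_vec_def skew_def One_nat_def, simp_all add: numeral_2_eq_2)
        have "skew (lincomb 3 (\<lambda>i. skew (row y 2 l) k (\<sigma> i) / x k) (\<lambda>i. w2 x (unit_vec (\<sigma> i)))) i j
          = (\<Sum>a<3. skew (row y 2 l) k (\<sigma> a) / x k * skew (w2 x (unit_vec (\<sigma> a))) i j)"
          using ij by (simp add: skew_def lincomb_def)
        also have "\<dots> = (\<Sum>a<3. (x i * (skew (row y 2 l) k (\<sigma> a) * unit_vec (\<sigma> a) j) - x j * (skew (row y 2 l) k (\<sigma> a) * unit_vec (\<sigma> a) i)) / x k)"
          using ij by (intro sum.cong) (simp_all add: skew_w2 algebra_simps)
        also have "\<dots> = (x i * skew (row y 2 l) k j - x j * skew (row y 2 l) k i) / x k"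
          using ij by (simp add: sum_divide_distrib[symmetric] sum_subtractf sum_distrib_left[symmetric] S)
        also have "\<dots> = skew (row y 2 l) i j" using rel[OF v] ij xk by (simp add: field_simps)
        finally show "skew (row y 2 l) i j = skew (lincomb 3 (\<lambda>i. skew (row y 2 l) k (\<sigma> i) / x k) (\<lambda>i. w2 x (unit_vec (\<sigma> i)))) i j" ..
      qed
      then show ?thesis by (auto simp: rowspan_def)
    qed
    \<comment> \<open>I_2 lies in x H, which is spanned by three elements; having dimension 3, it
      equals x H.\<close>
    have "rowspan 3 (row y 2) = rowspan 3 (\<lambda>i. w2 x (unit_vec (\<sigma> i)))"
      by (rule rowspan_eqI) (use y mem in \<open>auto simp: pts_over_Hilb_iff\<close>)
    then have in_V: "w2 x (unit_vec (\<sigma> i)) \<in> rowspan 3 (row y 2)" if "i < 3" for i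
      using row_in_rowspan[OF that, of "\<lambda>i. w2 x (unit_vec (\<sigma> i))"] by simp
    have R: "wedge_form u (w2 x (unit_vec j)) 4 = 0" if "j < 4" "j \<noteq> k" for j
    proof -
      have "\<exists>i<3. \<sigma> i = j" using that k by (intro exI[of _ "if j < k then j else j - 1"]) (auto simp: \<sigma>_def)
      then show ?thesis using Vf(1)[OF in_V] by auto
    qed
    have R0: "k \<noteq> 0 \<Longrightarrow> - u {1,2} * x 3 + u {1,3} * x 2 - u {2,3} * x 1 = 0"
      and R1: "k \<noteq> 1 \<Longrightarrow> u {0,2} * x 3 - u {0,3} * x 2 + u {2,3} * x 0 = 0"
      and R2: "k \<noteq> 2 \<Longrightarrow> - u {0,1} * x 3 + u {0,3} * x 1 - u {1,3} * x 0 = 0"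
      and R3: "k \<noteq> 3 \<Longrightarrow> u {0,1} * x 2 - u {0,2} * x 1 + u {1,2} * x 0 = 0"
      using R[of 0] R[of 1] R[of 2] R[of 3] unfolding wedge_form_eval by (simp_all add: unit_vec_def algebra_simps)
    \<comment> \<open>As u annihilates x H, the product x u vanishes and \<open>u\<close> is
      divisible by x too; a multiple of a vector has Pfaffian 0.\<close>
    have "x k * (u {0,1} * u {2,3} - u {0,2} * u {1,3} + u {0,3} * u {1,2}) = 0"
      using less_4_cases[OF k]
    proof (elim disjE)
      assume [simp]: "k = 0"
      show ?thesis using R1 R2 R3 by simp algebra
    next
      assume [simp]: "k = 1"
      show ?thesis using R0 R2 R3 by simp algebra
    next
      assume [simp]: "k = 2"
      show ?thesis using R0 R1 R3 by simp algebra
    next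
      assume [simp]: "k = 3"
      show ?thesis using R0 R1 R2 by simp algebra
    qed
    then have "u {0,1} * u {2,3} - u {0,2} * u {1,3} + u {0,3} * u {1,2} = 0" using xk by simp
    moreover have "wedge_form u u 4 = 2 * (u {0,1} * u {2,3} - u {0,2} * u {1,3} + u {0,3} * u {1,2})"
      unfolding wedge_form_eval by (simp add: algebra_simps)
    ultimately show False using f(5) by simp
  qed
  have u'4: "u' {0,4} = 0" "u' {1,4} = 0" "u' {2,4} = 0" "u' {3,4} = 0"
    using x0[of 0] x0[of 1] x0[of 2] x0[of 3] by (simp_all add: x_def)
  show ?thesis
    unfolding std2_def using V4 W u4 u'4 by (auto simp: ext_pair_def)
qed

text \<open>The linear form of u u is completed to a basis of the dual space. In the dual basis of
  vectors, ordered so that this form is the last coordinate, its kernel is H.\<close>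

lemma classify_nondegenerate:
  fixes x :: "'k::field frame"
  assumes x: "x \<in> pts_over Hilb" and two: "(2::'k) \<noteq> 0" and ud: "u \<in> ext_deg 2" "u' \<in> ext_deg 2"
    and W: "\<And>w. w \<in> ext_deg 3 \<Longrightarrow> w \<in> rowspan 8 (row x 3) \<longleftrightarrow> ext_pair u w = 0 \<and> ext_pair u' w = 0"
    and f: "k0 < 5" "wedge_form u u k0 \<noteq> 0"
  shows "\<exists>g h. mat_inverse g h \<and> std2 (gl_act h x)"
proof -
  have "rows_indep 1 (\<lambda>_. wedge_form u u) {..<5}" unfolding rows_indep_def using f by (auto simp: One_nat_def)
  then obtain z where z: "rows_indep 5 z {..<5}" "z 0 = wedge_form u u"
    using rows_indep_extend[of 1 "\<lambda>_. wedge_form u u" "{..<5::nat}"] by auto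
  obtain P where P: "mat_inverse z P" using mat_inverse_exists[OF z(1)] by blast
  \<comment> \<open>Column 0 of \<open>P\<close> is dual to the form of u u and becomes vector
    number 4; the other columns span its kernel.\<close>
  define g where "g k = (\<lambda>i. P i (if k < 4 then Suc k else 0))" for k
  have zg: "(\<Sum>i<5. z l i * g k i) = (if l = (if k < 4 then Suc k else 0) then 1 else 0)" if "l < 5" "k < 5" for k l
  proof -
    have "(if k < 4 then Suc k else 0) < 5" using that by auto
    then have "gl1 P (z l) (if k < 4 then Suc k else 0) = unit_vec l (if k < 4 then Suc k else 0)"
      using P that by (simp add: mat_inverse_def mat_eq_def mat_mult_def)
    then show ?thesis by (auto simp: gl1_def lincomb_def g_def unit_vec_def)
  qed
  have "rows_indep 5 g {..<5}"
    unfolding rows_indep_def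
  proof (intro allI impI)
    fix c k assume c: "\<forall>i\<in>{..<5}. (\<Sum>k<5. c k * g k i) = 0" and k: "k < (5::nat)"
    define l where "l = (if k < 4 then Suc k else 0)"
    have l: "l < 5" using k by (auto simp: l_def)
    have "0 = (\<Sum>i<5. z l i * (\<Sum>k<5. c k * g k i))" using c by simp
    also have "\<dots> = (\<Sum>k<5. c k * (\<Sum>i<5. z l i * g k i))"
      by (simp add: sum_distrib_left mult.left_commute) (rule sum.swap)
    also have "\<dots> = (\<Sum>j<5. if j = k then c j else 0)"
      using k by (intro sum.cong) (auto simp: zg l l_def)
    also have "\<dots> = c k" using k by simp
    finally show "c k = 0" by simp
  qed
  then obtain h where h: "mat_inverse g h" using mat_inverse_exists by blast
  define v where "v = gl2 h u"
  define v' where "v' = gl2 h u'"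
  have uv: "u = gl2 g v" "u' = gl2 g v'" unfolding v_def v'_def using gl2_inverse[OF h] ud by simp_all
  have d: "mat_det g \<noteq> 0" by (rule mat_det_nonzero[OF h])
  have vf: "mat_det g * wedge_form v v k = (if k < 4 then 0 else 1)" if "k < 5" for k
    using zg[of 0 k] that unfolding wedge_form_gl[OF that] uv(1)[symmetric] z(2) by (simp add: mult.commute)
  have y: "gl_act h x \<in> pts_over Hilb" by (rule gl_act_pts[OF x mat_inverse_sym[OF h]])
  have "std2 (gl_act h x)"
  proof (rule std2_if_hyperplane[OF y two])
    fix w :: "'k ext" assume w: "w \<in> ext_deg 3"
    have "w \<in> rowspan 8 (row (gl_act h x) 3) \<longleftrightarrow> gl3 g w \<in> rowspan 8 (row x 3)"
    proof
      assume "w \<in> rowspan 8 (row (gl_act h x) 3)"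
      then obtain w' where w': "w = gl3 h w'" "w' \<in> rowspan 8 (row x 3)" unfolding rowspan_gl_act by blast
      then have "w' \<in> ext_deg 3" using rowspan_frames[OF pts_Hilb_frames[OF x]] by blast
      then show "gl3 g w \<in> rowspan 8 (row x 3)" unfolding w'(1) using gl3_inverse[OF h] w'(2) by simp
    next
      assume "gl3 g w \<in> rowspan 8 (row x 3)"
      then show "w \<in> rowspan 8 (row (gl_act h x) 3)"
        unfolding rowspan_gl_act using gl3_inverse[OF mat_inverse_sym[OF h] w] by (metis image_eqI)
    qed
    also have "\<dots> \<longleftrightarrow> ext_pair v w = 0 \<and> ext_pair v' w = 0"
      unfolding W[OF gl3_ext_deg] uv ext_pair_gl using d by simp
    finally show "w \<in> rowspan 8 (row (gl_act h x) 3) \<longleftrightarrow> ext_pair v w = 0 \<and> ext_pair v' w = 0" .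
  qed (use vf[of 0] vf[of 1] vf[of 2] vf[of 3] vf[of 4] d in auto)
  then show ?thesis using h by blast
qed

text \<open>Squares on the pencil are governed by u1 u1, u1 u2 and u2 u2. Unless all three vanish,
  one of u1, u2, u1 + u2 has a nonzero square, as 2 is nonzero.\<close>

theorem classification:
  fixes x :: "'k::field frame"
  assumes x: "x \<in> pts_over Hilb" and two: "(2::'k) \<noteq> 0"
  shows "\<exists>g h. mat_inverse g h \<and> (std1 (gl_act h x) \<or> std2 (gl_act h x))"
proof -
  obtain u1 u2 where U: "u1 \<in> ext_deg 2 \<and> u2 \<in> ext_deg 2 \<and>
    (\<forall>w\<in>ext_deg 3. w \<in> rowspan 8 (row x 3) \<longleftrightarrow> ext_pair u1 w = 0 \<and> ext_pair u2 w = 0) \<and>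
    (\<forall>a b. (\<forall>S. a * u1 S + b * u2 S = 0) \<longrightarrow> a = 0 \<and> b = 0)"
    using annihilator_exists[OF x] by (elim exE)
  have u: "u1 \<in> ext_deg 2" "u2 \<in> ext_deg 2" by (rule conjunct1[OF U], rule conjunct1[OF conjunct2[OF U]])
  have W: "w \<in> rowspan 8 (row x 3) \<longleftrightarrow> ext_pair u1 w = 0 \<and> ext_pair u2 w = 0" if "w \<in> ext_deg 3" for w
    by (rule bspec[OF conjunct1[OF conjunct2[OF conjunct2[OF U]]] that])
  have ind: "a = 0 \<and> b = 0" if "\<forall>S. a * u1 S + b * u2 S = 0" for a b
    by (rule conjunct2[OF conjunct2[OF conjunct2[OF U]], THEN spec, THEN spec, THEN mp, OF that])
  have Wd: "w \<in> ext_deg 3" if "w \<in> rowspan 8 (row x 3)" for w using that rowspan_frames[OF pts_Hilb_frames[OF x]] by blast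
  consider (a) "\<forall>i<5. wedge_form u1 u1 i = 0 \<and> wedge_form u2 u2 i = 0 \<and> wedge_form u1 u2 i = 0"
    | (b) i where "i < 5" "wedge_form u1 u1 i \<noteq> 0" | (c) i where "i < 5" "wedge_form u2 u2 i \<noteq> 0"
    | (d) i where "i < 5" "wedge_form u1 u1 i = 0" "wedge_form u2 u2 i = 0" "wedge_form u1 u2 i \<noteq> 0" by blast
  then show ?thesis
  proof cases
    case a
    have "\<exists>p q r. u1 = w2 p q \<and> u2 = w2 p r \<and>
      (\<forall>a b c. (\<forall>i<5. a * p i + b * q i + c * r i = 0) \<longrightarrow> a = 0 \<and> b = 0 \<and> c = 0)"
      by (rule pencil_of_decomposables[OF two u]) (use a in simp, use a in simp, use a in simp, rule ind)
    then obtain p q r where pqr: "u1 = w2 p q" "u2 = w2 p r"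
      "\<forall>a b c. (\<forall>i<5. a * p i + b * q i + c * r i = 0) \<longrightarrow> a = 0 \<and> b = 0 \<and> c = 0"
      by (elim exE conjE)
    have "\<exists>g h. mat_inverse g h \<and> std1 (gl_act h x)"
      by (rule classify_decomposable[OF x _ pqr(1,2) pqr(3)[rule_format]]) (use W Wd in auto)
    then show ?thesis by blast
  next
    case b
    from classify_nondegenerate[OF x two u W b] show ?thesis by blast
  next
    case c
    have "\<exists>g h. mat_inverse g h \<and> std2 (gl_act h x)"
      by (rule classify_nondegenerate[OF x two u(2,1) _ c]) (use W in blast)
    then show ?thesis by blast
  next
    case d
    \<comment> \<open>The pencil is also spanned by u1 + u2 and u2, so these can serve as the two
      annihilators.\<close>
    define u where "u = u1 + u2"
    have ud: "u \<in> ext_deg 2" unfolding u_def by (rule ext.subspace_add[OF subspace_ext_deg u])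
    have pair: "ext_pair u w = ext_pair u1 w + ext_pair u2 w" for w by (simp add: u_def ext_pair_def algebra_simps)
    have "wedge_form u u i = wedge_form u1 u1 i + 2 * wedge_form u1 u2 i + wedge_form u2 u2 i"
      using less_5_cases[OF d(1)] by (elim disjE) (simp_all add: wedge_form_eval u_def algebra_simps)
    then have ne: "wedge_form u u i \<noteq> 0" using d two by simp
    have "\<exists>g h. mat_inverse g h \<and> std2 (gl_act h x)"
      by (rule classify_nondegenerate[OF x two ud \<open>u2 \<in> ext_deg 2\<close> _ d(1) ne]) (use W pair in auto)
    then show ?thesis by blast
  qed
qed

section \<open>The two components\<close>

text \<open>A closed set witnessing that parameter \<open>i\<close> enlarges the family built from
  the parameters below \<open>i\<close>.\<close>

definition separates :: "((nat \<Rightarrow> 'k::field) \<Rightarrow> 'k frame) \<Rightarrow> nat \<Rightarrow> 'k ext set set \<Rightarrow> bool" where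
  "separates \<Phi> i D \<longleftrightarrow> H_closed D \<and> (\<forall>a. (\<forall>j\<ge>i. a j = 0) \<longrightarrow> Iof (\<Phi> a) \<in> D) \<and> Iof (\<Phi> (unit_vec i)) \<notin> D"

lemma H_chain_separators:
  fixes \<Phi> :: "(nat \<Rightarrow> 'k::field) \<Rightarrow> 'k frame"
  assumes "infinite (UNIV :: 'k set)" "\<And>v. (\<lambda>a. \<Phi> a v) \<in> polyfun" "\<And>a. \<Phi> a \<in> pts_over Hilb"
    and sep: "\<And>i. i < n \<Longrightarrow> \<exists>D. separates \<Phi> i D"
  shows "H_chain (H_closure (range (\<lambda>a. Iof (\<Phi> a)))) n"
proof -
  have "separates \<Phi> i (SOME D. separates \<Phi> i D)" if "i < n" for i
    using sep[OF that] by (rule someI_ex)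
  then show ?thesis
    by (intro H_chain_lower_bound[where D = "\<lambda>i. SOME D. separates \<Phi> i D"] assms(1-3))
      (auto simp: separates_def unit_vec_def)
qed

lemma separates_meets:
  assumes pts: "\<And>a. \<Phi> a \<in> pts_over Hilb" and d: "d = 2 \<or> d = 3"
    and zero: "\<And>a. (\<And>m. m \<ge> i \<Longrightarrow> a m = 0) \<Longrightarrow> Iof (\<Phi> a) \<in> meets d A"
    and nonzero: "Iof (\<Phi> (unit_vec i)) \<notin> meets d A"
  shows "\<exists>D. separates \<Phi> i D"
  using H_closed_meets[OF d] zero nonzero unfolding separates_def by blast

lemma meets_if_row:
  assumes "x \<in> pts_over Hilb" "d = 2 \<or> d = 3" "k < frame_size d" "\<And>S. S \<in> A \<Longrightarrow> x (d,k,S) = 0"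
  shows "Iof x \<in> meets d A"
proof -
  have "(\<Sum>i<frame_size d. unit_vec k i * x (d,i,S)) = 0" if "S \<in> A" for S
    using assms(4)[OF that] by (intro sum.neutral) (simp add: unit_vec_def)
  moreover have "unit_vec k k = (1::'a)" by (simp add: unit_vec_def)
  ultimately show ?thesis
    unfolding meets_iff[OF assms(1,2)] rows_indep_def using assms(3) by (metis zero_neq_one)
qed

text \<open>Row \<open>k\<close> of the reduced frame vanishes at the other two pivots. While
  parameter \<open>i\<close> is 0 it vanishes at \<open>T\<close> too; the unit parameter makes that
  entry nonzero, and then the three rows are independent on these columns.\<close>

lemma separates_row:
  assumes pts: "\<And>a. \<Phi> a \<in> pts_over Hilb" and k: "k < 3"
    and piv: "\<And>a j l. (\<And>m. m > i \<Longrightarrow> a m = 0) \<Longrightarrow> j < 3 \<Longrightarrow> l < 3 \<Longrightarrow> \<Phi> a (2,j,v1_set l) = unit_vec j l"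
    and zero: "\<And>a. (\<And>m. m \<ge> i \<Longrightarrow> a m = 0) \<Longrightarrow> \<Phi> a (2,k,T) = 0"
    and nonzero: "\<Phi> (unit_vec i) (2,k,T) \<noteq> 0"
  shows "\<exists>D. separates \<Phi> i D"
proof (rule separates_meets[OF pts, where d = 2 and i = i and A = "insert T (v1_set ` ({..<3} - {k}))"])
  show "Iof (\<Phi> a) \<in> meets 2 (insert T (v1_set ` ({..<3} - {k})))" if a: "\<And>m. m \<ge> i \<Longrightarrow> a m = 0" for a
  proof (rule meets_if_row[OF pts, of _ k])
    fix S assume "S \<in> insert T (v1_set ` ({..<3} - {k}))"
    then consider "S = T" | l where "l < 3" "l \<noteq> k" "S = v1_set l" by auto
    then show "\<Phi> a (2,k,S) = 0"
    proof cases
      case 1 then show ?thesis using zero[of a] a by simp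
    next
      case 2
      have "\<Phi> a (2,k,v1_set l) = unit_vec k l" by (rule piv) (simp_all add: a k 2)
      then show ?thesis using 2 by (simp add: unit_vec_def)
    qed
  qed (use k in simp_all)
  have "rows_indep 3 (row (\<Phi> (unit_vec i)) 2) (insert T (v1_set ` ({..<3} - {k})))"
    unfolding rows_indep_def
  proof (intro allI impI)
    fix c l assume c: "\<forall>S\<in>insert T (v1_set ` ({..<3} - {k})). (\<Sum>j<3. c j * \<Phi> (unit_vec i) (2,j,S)) = 0" and l: "l < (3::nat)"
    have others: "c l = 0" if l: "l < 3" "l \<noteq> k" for l
    proof -
      have "(\<Sum>j<3. c j * \<Phi> (unit_vec i) (2,j,v1_set l)) = (\<Sum>j<3. c j * unit_vec j l)"
        using l by (intro sum.cong) (simp_all add: piv unit_vec_def)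
      also have "\<dots> = (\<Sum>j<3. if j = l then c l else 0)" by (intro sum.cong) (auto simp: unit_vec_def)
      also have "\<dots> = c l" using l by simp
      finally show ?thesis using c l by auto
    qed
    have "(\<Sum>j<3. c j * \<Phi> (unit_vec i) (2,j,T)) = (\<Sum>j<3. if j = k then c k * \<Phi> (unit_vec i) (2,k,T) else 0)"
      by (intro sum.cong) (auto simp: others)
    also have "\<dots> = c k * \<Phi> (unit_vec i) (2,k,T)" using k by simp
    finally have "c k * \<Phi> (unit_vec i) (2,k,T) = 0" using c by simp
    then show "c l = 0" using nonzero others[OF l] by (cases "l = k") auto
  qed
  then show "Iof (\<Phi> (unit_vec i)) \<notin> meets 2 (insert T (v1_set ` ({..<3} - {k})))"
    using meets_iff[OF pts, of 2] by simp
qed simp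

section \<open>Separators for the first family\<close>

lemma linear_system_2:
  fixes a b c d :: "'k::field"
  shows "(\<exists>\<alpha> \<beta>. (\<alpha> \<noteq> 0 \<or> \<beta> \<noteq> 0) \<and> \<alpha> * a + \<beta> * b = 0 \<and> \<alpha> * c + \<beta> * d = 0) \<longleftrightarrow> a * d = b * c" (is "?L \<longleftrightarrow> ?R")
proof
  assume ?L
  then obtain \<alpha> \<beta> where h: "\<alpha> \<noteq> 0 \<or> \<beta> \<noteq> 0" "\<alpha> * a + \<beta> * b = 0" "\<alpha> * c + \<beta> * d = 0" by blast
  have "\<alpha> * (a * d - b * c) = d * (\<alpha> * a + \<beta> * b) - b * (\<alpha> * c + \<beta> * d)"
    "\<beta> * (a * d - b * c) = a * (\<alpha> * c + \<beta> * d) - c * (\<alpha> * a + \<beta> * b)" by (simp_all add: algebra_simps)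
  then show ?R using h by auto
next
  assume R: ?R
  consider "b \<noteq> 0 \<or> a \<noteq> 0" | "d \<noteq> 0 \<or> c \<noteq> 0" | "a = 0 \<and> b = 0 \<and> c = 0 \<and> d = 0" by blast
  then show ?L
  proof cases
    case 1 then show ?thesis using R by (intro exI[of _ b] exI[of _ "- a"]) (auto simp: algebra_simps)
  next
    case 2 then show ?thesis using R by (intro exI[of _ d] exI[of _ "- c"]) (auto simp: algebra_simps)
  next
    case 3 then show ?thesis by (intro exI[of _ 1]) simp
  qed
qed

lemma phi1_V: "i < 3 \<Longrightarrow> phi1 b (2,i,S) = gl2 (phi1_mat b) (std1_vec (phi1_coeff b i)) S"
  using row_std1_frame(1)[of i "phi1_coeff b"] by (simp add: phi1_def gl_act_def)

text \<open>In adapted coordinates the annihilator of I_3 is <e_0 e_1, e_0 e_2>; the pairing is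
  invariant up to a nonzero determinant, so \<open>phi1_mat b\<close> transports it.\<close>

lemma phi1_W:
  assumes w: "w \<in> ext_deg 3"
  shows "w \<in> rowspan 8 (row (phi1 b) 3) \<longleftrightarrow>
    ext_pair (w2 (phi1_mat b 0) (phi1_mat b 1)) w = 0 \<and> ext_pair (w2 (phi1_mat b 0) (phi1_mat b 2)) w = 0"
proof -
  obtain h where h: "mat_inverse (phi1_mat b) h" by (rule phi1_mat_inverse)
  have u: "w2 (phi1_mat b 0) (phi1_mat b 1) = gl2 (phi1_mat b) (basis_mon {0,1})"
    "w2 (phi1_mat b 0) (phi1_mat b 2) = gl2 (phi1_mat b) (basis_mon {0,2})"
    by (simp_all add: gl2_def basis_mon_def fun_eq_iff doubleton_eq_iff)
  have e: "w = gl3 (phi1_mat b) (gl3 h w)" by (rule gl3_inverse[OF h w, symmetric])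
  have "w \<in> rowspan 8 (row (phi1 b) 3) \<longleftrightarrow> gl3 h w \<in> rowspan 8 (row (std1_frame (phi1_coeff b)) 3)"
  proof
    assume "w \<in> rowspan 8 (row (phi1 b) 3)"
    then obtain w' where w': "w' \<in> rowspan 8 (row (std1_frame (phi1_coeff b)) 3)" "w = gl3 (phi1_mat b) w'"
      unfolding phi1_def rowspan_gl_act by blast
    then have "w' \<in> ext_deg 3" unfolding std1_W by blast
    then have "gl3 h w = w'" unfolding w'(2) by (rule gl3_inverse[OF mat_inverse_sym[OF h]])
    then show "gl3 h w \<in> rowspan 8 (row (std1_frame (phi1_coeff b)) 3)" using w'(1) by simp
  next
    assume "gl3 h w \<in> rowspan 8 (row (std1_frame (phi1_coeff b)) 3)"
    then show "w \<in> rowspan 8 (row (phi1 b) 3)" unfolding phi1_def rowspan_gl_act using e by blast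
  qed
  also have "\<dots> \<longleftrightarrow> gl3 h w {2,3,4} = 0 \<and> gl3 h w {1,3,4} = 0" unfolding std1_W by auto
  also have "\<dots> \<longleftrightarrow> ext_pair (gl2 (phi1_mat b) (basis_mon {0,1})) (gl3 (phi1_mat b) (gl3 h w)) = 0
      \<and> ext_pair (gl2 (phi1_mat b) (basis_mon {0,2})) (gl3 (phi1_mat b) (gl3 h w)) = 0"
    unfolding ext_pair_gl using mat_det_nonzero[OF h]
    by (simp add: ext_pair_def basis_mon_def doubleton_eq_iff)
  finally show ?thesis unfolding u e[symmetric] .
qed

lemma ext_pair_linear: "ext_pair u (\<lambda>S. a * v S + b * w S) = a * ext_pair u v + b * ext_pair u w"
  by (simp add: ext_pair_def algebra_simps)

text \<open>I_3 contains a nonzero vector supported on \<open>A\<close> and \<open>B\<close> iff its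
  two defining linear forms become dependent on the plane of these monomials, which is a 2 x 2
  determinant.\<close>

lemma phi1_meets:
  assumes AB: "A \<in> deg_sets 3" "B \<in> deg_sets 3" "A \<noteq> B"
  defines "f \<equiv> \<lambda>b k S. ext_pair (w2 (phi1_mat b 0) (phi1_mat b k)) (basis_mon S)"
  shows "Iof (phi1 b) \<in> meets 3 (deg_sets 3 - {A, B}) \<longleftrightarrow> f b 1 A * f b 2 B = f b 1 B * f b 2 A"
proof -
  have W: "(\<lambda>S. \<alpha> * basis_mon A S + \<beta> * basis_mon B S) \<in> rowspan 8 (row (phi1 b) 3) \<longleftrightarrow>
      \<alpha> * f b 1 A + \<beta> * f b 1 B = 0 \<and> \<alpha> * f b 2 A + \<beta> * f b 2 B = 0" for \<alpha> \<beta>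
  proof -
    have "(\<lambda>S. \<alpha> * basis_mon A S + \<beta> * basis_mon B S) \<in> ext_deg 3"
      using AB by (auto simp: ext_deg_eq basis_mon_def)
    then show ?thesis unfolding f_def ext_pair_linear[symmetric] by (rule phi1_W)
  qed
  have "Iof (phi1 b) \<in> meets 3 (deg_sets 3 - {A, B}) \<longleftrightarrow>
      (\<exists>v\<in>rowspan 8 (row (phi1 b) 3). v \<noteq> 0 \<and> (\<forall>S\<in>deg_sets 3 - {A,B}. v S = 0))"
    using phi1_pts[of b] Iof_inter_ext_deg[OF pts_Hilb_frames[OF phi1_pts], of 3 b] by (simp add: meets_def pts_over_def)
  also have "\<dots> \<longleftrightarrow> (\<exists>\<alpha> \<beta>. (\<alpha> \<noteq> 0 \<or> \<beta> \<noteq> 0) \<and>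
      (\<lambda>S. \<alpha> * basis_mon A S + \<beta> * basis_mon B S) \<in> rowspan 8 (row (phi1 b) 3))" (is "?L \<longleftrightarrow> ?R")
  proof
    assume ?L
    then obtain v where v: "v \<in> rowspan 8 (row (phi1 b) 3)" "v \<noteq> 0" "\<forall>S\<in>deg_sets 3 - {A,B}. v S = 0" by blast
    have vd: "v \<in> ext_deg 3" using rowspan_frames[OF pts_Hilb_frames[OF phi1_pts]] v(1) by blast
    have e: "v = (\<lambda>S. v A * basis_mon A S + v B * basis_mon B S)"
    proof
      fix S show "v S = v A * basis_mon A S + v B * basis_mon B S"
      proof (cases "S = A \<or> S = B")
        case True then show ?thesis using AB(3) by (elim disjE) (simp_all add: basis_mon_def)
      next
        case False
        have "v S = 0"
        proof (cases "S \<in> deg_sets 3")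
          case True
          then have "S \<in> deg_sets 3 - {A, B}" using False by simp
          then show ?thesis by (rule bspec[OF v(3)])
        next
          case out: False
          have "\<forall>S. v S \<noteq> 0 \<longrightarrow> S \<in> deg_sets 3" using vd unfolding ext_deg_eq by (rule CollectD)
          from spec[OF this, of S] out show ?thesis by blast
        qed
        then show ?thesis using False by (simp add: basis_mon_def)
      qed
    qed
    have "v A \<noteq> 0 \<or> v B \<noteq> 0"
    proof (rule ccontr)
      assume "\<not> ?thesis" then have "v A = 0" "v B = 0" by simp_all
      then have "(\<lambda>S. v A * basis_mon A S + v B * basis_mon B S) = 0" by (simp add: fun_eq_iff)
      then have "v = 0" unfolding e[symmetric] .
      then show False using v(2) by simp
    qed
    moreover have "(\<lambda>S. v A * basis_mon A S + v B * basis_mon B S) \<in> rowspan 8 (row (phi1 b) 3)" using v(1) unfolding e[symmetric] .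
    ultimately show ?R by (intro exI conjI)
  next
    assume ?R
    then obtain \<alpha> \<beta> where h: "\<alpha> \<noteq> 0 \<or> \<beta> \<noteq> 0" "(\<lambda>S. \<alpha> * basis_mon A S + \<beta> * basis_mon B S) \<in> rowspan 8 (row (phi1 b) 3)" by blast
    have "(\<lambda>S. \<alpha> * basis_mon A S + \<beta> * basis_mon B S) \<noteq> 0"
      using h(1) AB(3) by (auto simp: fun_eq_iff basis_mon_def split: if_splits)
    moreover have "\<forall>S\<in>deg_sets 3 - {A,B}. \<alpha> * basis_mon A S + \<beta> * basis_mon B S = 0" by (simp add: basis_mon_def)
    ultimately show ?L by (intro bexI[OF _ h(2)] conjI)
  qed
  also have "\<dots> \<longleftrightarrow> f b 1 A * f b 2 B = f b 1 B * f b 2 A"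
    unfolding W by (rule linear_system_2)
  finally show ?thesis .
qed

lemma separates_phi1_W:
  fixes i :: nat
  assumes AB: "A \<in> deg_sets 3" "B \<in> deg_sets 3" "A \<noteq> B"
  defines "f \<equiv> \<lambda>b k S. ext_pair (w2 (phi1_mat b 0) (phi1_mat b k)) (basis_mon S :: 'k::field ext)"
  assumes zero: "\<And>b. (\<And>m. m \<ge> i \<Longrightarrow> b m = 0) \<Longrightarrow> f b 1 A * f b 2 B = f b 1 B * f b 2 A"
    and nonzero: "f (unit_vec i) 1 A * f (unit_vec i) 2 B \<noteq> f (unit_vec i) 1 B * f (unit_vec i) 2 A"
  shows "\<exists>D. separates (phi1 :: (nat \<Rightarrow> 'k) \<Rightarrow> _) i D"
  by (rule separates_meets[where d = 3 and A = "deg_sets 3 - {A, B}"])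
    (use zero nonzero in \<open>simp_all add: phi1_pts phi1_meets[OF AB] f_def\<close>)

text \<open>The parameters below 6 are entries of the reduced basis of I_2, the others show up in 2
  x 2 minors of the annihilator pencil of I_3. A separator need only detect parameter
  \<open>i\<close> while the later ones are 0.\<close>

lemma separates_phi1:
  fixes i :: nat
  assumes i: "i < 14"
  shows "\<exists>D. separates (phi1 :: (nat \<Rightarrow> 'k::field) \<Rightarrow> _) i D"
proof -
  have M: "gl2 (phi1_mat a) (std1_vec c) = std1_vec c" if "\<And>m. m > i \<Longrightarrow> a m = 0" "i < 6" for a c :: "nat \<Rightarrow> 'k"
  proof -
    have "mat_eq (phi1_mat a) unit_vec"
      using that by (auto simp: mat_eq_def phi1_mat_def unit_vec_def)
    then have "gl2 (phi1_mat a) (std1_vec c) = gl2 unit_vec (std1_vec c)" by (rule gl2_cong)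
    then show ?thesis by (simp add: gl2_unit)
  qed
  have piv: "phi1 a (2,j,v1_set l) = unit_vec j l" if "\<And>m. m > i \<Longrightarrow> a m = 0" "i < 6" "j < 3" "l < 3" for a :: "nat \<Rightarrow> 'k" and j l
  proof -
    have "gl2 (phi1_mat a) (std1_vec (phi1_coeff a j)) = std1_vec (phi1_coeff a j)" by (rule M) (simp_all add: that)
    then have "phi1 a (2,j,v1_set l) = std1_vec (phi1_coeff a j) (v1_set l)" unfolding phi1_V[OF that(3)] by (rule fun_cong)
    then show ?thesis using less_3_cases[OF that(4)]
      by (elim disjE) (simp_all add: v1_set_def phi1_coeff_def unit_vec_def)
  qed
  consider "i < 3" | "3 \<le> i \<and> i < 6" | "i = 6" | "i = 7" | "i = 8" | "i = 9" | "i = 10" | "i = 11" | "i = 12" | "i = 13"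
    using i by linarith
  then show ?thesis
  proof cases
    case 1
    then have i6: "i < 6" by simp
    show ?thesis
    proof (rule separates_row[of phi1 i i "{0,4}"])
      show "phi1 a (2,i,{0,4}) = 0" if "\<And>m. m \<ge> i \<Longrightarrow> a m = 0" for a :: "nat \<Rightarrow> 'k"
        unfolding phi1_V[OF 1] using that 1 by (subst M) (simp_all add: i6 phi1_coeff_def)
      show "phi1 (unit_vec i) (2,i,{0,4}) \<noteq> (0 :: 'k)"
        unfolding phi1_V[OF 1] using 1 by (subst M) (simp_all add: i6 phi1_coeff_def unit_vec_def)
    qed (use 1 piv i6 phi1_pts in auto)
  next
    case 2
    then have i6: "i < 6" and k: "i - 3 < 3" by auto
    show ?thesis
    proof (rule separates_row[of phi1 "i - 3" i "{1,2}"])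
      show "phi1 a (2,i-3,{1,2}) = 0" if "\<And>m. m \<ge> i \<Longrightarrow> a m = 0" for a :: "nat \<Rightarrow> 'k"
        unfolding phi1_V[OF k] using that 2 k by (subst M) (simp_all add: i6 phi1_coeff_def)
      show "phi1 (unit_vec i) (2,i-3,{1,2}) \<noteq> (0 :: 'k)"
        unfolding phi1_V[OF k] using 2 k by (subst M) (simp_all add: i6 phi1_coeff_def unit_vec_def)
    qed (use k piv i6 phi1_pts in auto)
  next
    \<comment> \<open>Up to sign, the minor consists of the coordinates of p q and p r complementary
      to \<open>A\<close> and \<open>B\<close>. At the complements {0,2} of {1,3,4} and {0,1} of
      {2,3,4} one of them is 1 and the other 0, so a single coordinate at the complement of
      \<open>A\<close> survives: parameter \<open>i\<close> up to sign.\<close>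
    case 3 show ?thesis unfolding 3
      by (rule separates_phi1_W[of "{0,2,4}" "{1,3,4}"])
        (simp_all add: deg_sets_3 ext_pair_def basis_mon_def phi1_mat_def unit_vec_def)
  next
    case 4 show ?thesis unfolding 4
      by (rule separates_phi1_W[of "{0,2,3}" "{1,3,4}"])
        (simp_all add: deg_sets_3 ext_pair_def basis_mon_def phi1_mat_def unit_vec_def)
  next
    case 5 show ?thesis unfolding 5
      by (rule separates_phi1_W[of "{0,3,4}" "{2,3,4}"])
        (simp_all add: deg_sets_3 ext_pair_def basis_mon_def phi1_mat_def unit_vec_def)
  next
    case 6 show ?thesis unfolding 6
      by (rule separates_phi1_W[of "{0,3,4}" "{1,3,4}"])
        (simp_all add: deg_sets_3 ext_pair_def basis_mon_def phi1_mat_def unit_vec_def)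
  next
    case 7 show ?thesis unfolding 7
      by (rule separates_phi1_W[of "{1,2,4}" "{1,3,4}"])
        (simp_all add: deg_sets_3 ext_pair_def basis_mon_def phi1_mat_def unit_vec_def)
  next
    case 8 show ?thesis unfolding 8
      by (rule separates_phi1_W[of "{1,2,3}" "{1,3,4}"])
        (simp_all add: deg_sets_3 ext_pair_def basis_mon_def phi1_mat_def unit_vec_def)
  next
    case 9 show ?thesis unfolding 9
      by (rule separates_phi1_W[of "{1,2,4}" "{2,3,4}"])
        (simp_all add: deg_sets_3 ext_pair_def basis_mon_def phi1_mat_def unit_vec_def)
  next
    case 10 show ?thesis unfolding 10
      by (rule separates_phi1_W[of "{1,2,3}" "{2,3,4}"])
        (simp_all add: deg_sets_3 ext_pair_def basis_mon_def phi1_mat_def unit_vec_def)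
  qed
qed

section \<open>Separators for the second family\<close>

lemma phi2_V: "i < 3 \<Longrightarrow> phi2 b (2,i,S) = gl2 (phi2_mat b) (lincomb 4 (phi2_coeff b i) (\<lambda>j. std2_vec (phi2_T b j))) S"
  using row_std2_frame(1)[of i "phi2_T b" "phi2_coeff b"] by (simp add: phi2_def gl_act_def)

lemma phi2_V_eval:
  assumes "i < 3"
  shows "phi2 b (2,i,{0,1}) = unit_vec i 0" "phi2 b (2,i,{0,2}) = unit_vec i 1" "phi2 b (2,i,{0,3}) = unit_vec i 2"
    "phi2 b (2,i,{1,2}) = b i" "phi2 b (2,i,{1,3}) = b (3 + i) + b i * b 9" "phi2 b (2,i,{2,3}) = b (6 + i) + b i * b 10"
    "phi2 b (2,i,{0,4}) = unit_vec i 0 * b 12 + unit_vec i 1 * b 13 + unit_vec i 2 * b 14"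
    "phi2 b (2,i,{1,4}) = - unit_vec i 0 * b 11 + b i * b 13 + (b (3 + i) + b i * b 9) * b 14"
  using less_3_cases[OF assms] unfolding phi2_V[OF assms]
  by (elim disjE; simp add: gl2_def phi2_mat_def phi2_T_def phi2_coeff_def lincomb_def sum_lessThan_4 unit_vec_def
      flip: One_nat_def)+

text \<open>Most parameters are, up to sign, entries of the reduced basis of I_2 once the later ones
  are 0. Parameters 9 and 10 describe the fourth basis vector of T and enter I_2 only multiplied by
  its coefficients there, so they are detected in I_3.\<close>

lemma separates_phi2:
  fixes i :: nat
  assumes i: "i < 15"
  shows "\<exists>D. separates (phi2 :: (nat \<Rightarrow> 'k::field) \<Rightarrow> _) i D"
proof -
  have piv: "phi2 a (2,j,v1_set l) = unit_vec j l" if "j < 3" "l < 3" for a :: "nat \<Rightarrow> 'k" and j l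
    using less_3_cases[OF that(2)] by (elim disjE) (simp_all add: v1_set_def phi2_V_eval[OF that(1)])
  have sep: "\<exists>D. separates (phi2 :: (nat \<Rightarrow> 'k) \<Rightarrow> _) i D"
    if "k < 3" "\<And>a. (\<And>m. m \<ge> i \<Longrightarrow> a m = 0) \<Longrightarrow> phi2 a (2,k,T) = (0::'k)" "phi2 (unit_vec i) (2,k,T) \<noteq> (0::'k)" for k T
    by (rule separates_row[where \<Phi> = phi2 and k = k and T = T]) (simp_all add: phi2_pts that piv)
  have W: "phi2 a (3,j,S) = std2_frame (phi2_T a) (phi2_coeff a) (3,j,S)"
    if "\<And>m. m > i \<Longrightarrow> a m = 0" "i < 11" for a :: "nat \<Rightarrow> 'k" and j S
  proof -
    have "mat_eq (phi2_mat a) unit_vec" using that by (auto simp: mat_eq_def phi2_mat_def unit_vec_def)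
    then have "phi2 a = gl_act unit_vec (std2_frame (phi2_T a) (phi2_coeff a))" unfolding phi2_def by (rule gl_act_cong)
    then have "phi2 a (3,j,S) = gl3 unit_vec (row (std2_frame (phi2_T a) (phi2_coeff a)) 3 j) S" by (simp add: gl_act_def)
    also have "\<dots> = std2_frame (phi2_T a) (phi2_coeff a) (3,j,S)"
      by (rule fun_cong[OF gl3_unit[OF row_ext_deg[OF pts_Hilb_frames[OF phi2_frame_pts]]]])
    finally show ?thesis .
  qed
  \<comment> \<open>Row 7 of I_3 is e_4 (e_1 e_2 + b_9 e_1 e_3 + b_10 e_2 e_3) before the matrix
    acts. \<open>B\<close> contains the monomials where it may be nonzero before parameter
    \<open>i\<close> is switched on, and \<open>T\<close> is the one where parameter
    \<open>i\<close> appears.\<close>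
  have sep_W: "\<exists>D. separates (phi2 :: (nat \<Rightarrow> 'k) \<Rightarrow> _) i D"
    if i: "9 \<le> i" "i < 11" and zero: "\<And>a S. (\<And>m. m \<ge> i \<Longrightarrow> a m = 0) \<Longrightarrow> S \<in> deg_sets 3 - B \<Longrightarrow> ew 4 (std2_vec (phi2_T a 3)) S = (0::'k)"
      and B: "B \<inter> {{0,1,2},{0,1,3},{0,2,3},{1,2,3},{0,1,4},{0,2,4},{0,3,4}} = {}"
      and T: "T \<in> deg_sets 3" "T \<notin> B" "ew 4 (std2_vec (phi2_T (unit_vec i) 3)) T \<noteq> (0::'k)" for B T
  proof (rule separates_meets[OF phi2_pts, where d = 3 and A = "deg_sets 3 - B"])
    show "Iof (phi2 a) \<in> meets 3 (deg_sets 3 - B)" if a: "\<And>m. m \<ge> i \<Longrightarrow> a m = 0" for a :: "nat \<Rightarrow> 'k"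
    proof (rule meets_if_row[OF phi2_pts, of _ 7])
      fix S assume S: "S \<in> deg_sets 3 - B"
      have "phi2 a (3,7,S) = std2_frame (phi2_T a) (phi2_coeff a) (3,7,S)" by (rule W) (simp_all add: a i)
      then show "phi2 a (3,7,S) = 0" using zero[OF _ S, of a] a by (simp add: std2_frame_rows)
    qed simp_all
    have W': "phi2 (unit_vec i :: nat \<Rightarrow> 'k) (3,j,S) = std2_frame (phi2_T (unit_vec i)) (phi2_coeff (unit_vec i)) (3,j,S :: nat set)" for j S
      by (rule W) (simp_all add: i unit_vec_def)
    have "rows_indep 8 (row (phi2 (unit_vec i :: nat \<Rightarrow> 'k)) 3) (deg_sets 3 - B)"
      unfolding rows_indep_def
    proof (intro allI impI)
      fix c j assume c: "\<forall>S\<in>deg_sets 3 - B. (\<Sum>j<8. c j * phi2 (unit_vec i :: nat \<Rightarrow> 'k) (3,j,S)) = 0" and j: "j < (8::nat)"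
      have c': "(\<Sum>j<8. c j * std2_frame (phi2_T (unit_vec i)) (phi2_coeff (unit_vec i)) (3,j,S)) = 0" if "S \<in> deg_sets 3 - B" for S
        using bspec[OF c that] unfolding W' .
      have "c 0 = 0" using c'[of "{0,1,2}"] B by (simp add: deg_sets_3 sum_lessThan_8 std2_frame_rows basis_mon_def)
      moreover have "c 1 = 0" using c'[of "{0,1,3}"] B by (simp add: deg_sets_3 sum_lessThan_8 std2_frame_rows basis_mon_def)
      moreover have "c 2 = 0" using c'[of "{0,2,3}"] B by (simp add: deg_sets_3 sum_lessThan_8 std2_frame_rows basis_mon_def)
      moreover have "c 3 = 0" using c'[of "{1,2,3}"] B by (simp add: deg_sets_3 sum_lessThan_8 std2_frame_rows basis_mon_def)
      moreover have "c 4 = 0" using c'[of "{0,1,4}"] B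
        by (simp add: deg_sets_3 sum_lessThan_8 std2_frame_rows basis_mon_def phi2_T_def unit_vec_def)
      moreover have "c 5 = 0" using c'[of "{0,2,4}"] B
        by (simp add: deg_sets_3 sum_lessThan_8 std2_frame_rows basis_mon_def phi2_T_def unit_vec_def)
      moreover have "c 6 = 0" using c'[of "{0,3,4}"] B
        by (simp add: deg_sets_3 sum_lessThan_8 std2_frame_rows basis_mon_def phi2_T_def unit_vec_def)
      moreover have "c 7 = 0" if "c 0 = 0" "c 1 = 0" "c 2 = 0" "c 3 = 0" "c 4 = 0" "c 5 = 0" "c 6 = 0"
        using c'[of T] T that by (simp add: sum_lessThan_8 std2_frame_rows)
      ultimately show "c j = 0" using less_8_cases[OF j] by (elim disjE) simp_all
    qed
    then show "Iof (phi2 (unit_vec i :: nat \<Rightarrow> 'k)) \<notin> meets 3 (deg_sets 3 - B)" using meets_iff[OF phi2_pts[of "unit_vec i :: nat \<Rightarrow> 'k"], of 3] by simp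
  qed simp
  consider "i < 3" | "3 \<le> i \<and> i < 6" | "6 \<le> i \<and> i < 9" | "i = 9" | "i = 10" | "i = 11" | "i = 12" | "i = 13" | "i = 14"
    using i by linarith
  then show ?thesis
  proof cases
    case 1 then show ?thesis
      by (intro sep[of i "{1,2}"]) (simp_all add: phi2_V_eval, simp add: unit_vec_def)
  next
    case 2
    then have k: "i - 3 < 3" by linarith
    show ?thesis
    proof (rule sep[OF k])
      show "phi2 a (2,i-3,{1,3}) = 0" if "\<And>m. m \<ge> i \<Longrightarrow> a m = 0" for a :: "nat \<Rightarrow> 'k"
        unfolding phi2_V_eval[OF k] using that 2 by simp
      show "phi2 (unit_vec i) (2,i-3,{1,3}) \<noteq> (0::'k)"
        unfolding phi2_V_eval[OF k] using 2 by (simp add: unit_vec_def)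
    qed
  next
    case 3
    then have k: "i - 6 < 3" by linarith
    show ?thesis
    proof (rule sep[OF k])
      show "phi2 a (2,i-6,{2,3}) = 0" if "\<And>m. m \<ge> i \<Longrightarrow> a m = 0" for a :: "nat \<Rightarrow> 'k"
        unfolding phi2_V_eval[OF k] using that 3 by simp
      show "phi2 (unit_vec i) (2,i-6,{2,3}) \<noteq> (0::'k)"
        unfolding phi2_V_eval[OF k] using 3 by (simp add: unit_vec_def)
    qed
  next
    case 6 then show ?thesis
      by (intro sep[of 0 "{1,4}"]) (simp_all add: phi2_V_eval, simp add: unit_vec_def)
  next
    case 7 then show ?thesis
      by (intro sep[of 0 "{0,4}"]) (simp_all add: phi2_V_eval, simp_all add: unit_vec_def)
  next
    case 8 then show ?thesis
      by (intro sep[of 1 "{0,4}"]) (simp_all add: phi2_V_eval, simp_all add: unit_vec_def)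
  next
    case 9 then show ?thesis
      by (intro sep[of 2 "{0,4}"]) (simp_all add: phi2_V_eval, simp_all add: unit_vec_def)
  next
    case 4 show ?thesis
      by (rule sep_W[of "{{1,2,4},{2,3,4}}" "{1,3,4}"]) (auto simp: 4 deg_sets_3 phi2_T_def unit_vec_def)
  next
    case 5 show ?thesis
      by (rule sep_W[of "{{1,2,4},{1,3,4}}" "{2,3,4}"]) (auto simp: 5 deg_sets_3 phi2_T_def unit_vec_def)
  qed
qed

section \<open>The decomposition into components\<close>

definition component1 :: "'k::field ext set set" where
  "component1 = H_closure (range (\<lambda>b. Iof (phi1 b)))"

definition component2 :: "'k::field ext set set" where
  "component2 = H_closure (range (\<lambda>b. Iof (phi2 b)))"

lemma H_irreducible_components:
  assumes "infinite (UNIV :: 'k::field set)"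
  shows "H_irreducible (component1 :: 'k ext set set)" "H_irreducible (component2 :: 'k ext set set)"
  unfolding component1_def component2_def
  using H_irreducible_closure_range[OF assms phi1_polyfun phi1_pts] H_irreducible_closure_range[OF assms phi2_polyfun phi2_pts]
  by blast+

lemma H_dim_components:
  assumes "infinite (UNIV :: 'k::field set)"
  shows "H_dim_eq (component1 :: 'k ext set set) 14" "H_dim_eq (component2 :: 'k ext set set) 15"
  unfolding component1_def component2_def H_dim_eq_def
  using H_chain_separators[OF assms phi1_polyfun phi1_pts separates_phi1] H_chain_upper_bound[OF assms phi1_polyfun phi1_pts phi1_truncate]
    H_chain_separators[OF assms phi2_polyfun phi2_pts separates_phi2] H_chain_upper_bound[OF assms phi2_polyfun phi2_pts phi2_truncate]
  by simp_all

lemma H_irreducible_closed: "H_irreducible C \<Longrightarrow> H_closed C"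
  by (simp add: H_irreducible_def)

lemma Hilb_eq_components:
  assumes inf: "infinite (UNIV :: 'k::field set)" and two: "(2::'k) \<noteq> 0"
  shows "(Hilb :: 'k ext set set) = component1 \<union> component2"
proof
  show "component1 \<union> component2 \<subseteq> (Hilb :: 'k ext set set)"
    using H_irreducible_components[OF inf] by (simp add: H_closed_subset H_irreducible_closed)
  show "(Hilb :: 'k ext set set) \<subseteq> component1 \<union> component2"
  proof
    fix I :: "'k ext set" assume I: "I \<in> Hilb"
    obtain x where x: "x \<in> frames" "Iof x = I" by (rule Hilb_frame[OF I])
    then have xp: "x \<in> pts_over Hilb" using I by (simp add: pts_over_def)
    obtain g h where gh: "mat_inverse g h" "std1 (gl_act h x) \<or> std2 (gl_act h x)"
      using classification[OF xp two] by blast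
    have y: "gl_act h x \<in> pts_over Hilb" by (rule gl_act_pts[OF xp mat_inverse_sym[OF gh(1)]])
    have "I = Iof (gl_act g (gl_act h x))" by (simp add: gl_act_inverse[OF x(1) gh(1)] x(2))
    then show "I \<in> component1 \<union> component2"
      using density1[OF inf gh(1) y] density2[OF inf gh(1) y] gh(2)
      unfolding component1_def component2_def by blast
  qed
qed

text \<open>On the second component the products of pairs of quadrics lie in the fourth exterior power of a
  hyperplane, so they are proportional.\<close>
lemma not_component1_subset:
  "\<not> (component1 :: 'k::field ext set set) \<subseteq> component2"
proof
  assume sub: "(component1 :: 'k ext set set) \<subseteq> component2"
  \<comment> \<open>A minor of the products of the first row of I_2 with the other two; it vanishes
    when these are proportional.\<close>
  define p where "p x = wedge_form (row x 2 0) (row x 2 1) 3 * wedge_form (row x 2 0) (row x 2 2) 4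
    - wedge_form (row x 2 0) (row x 2 1) 4 * wedge_form (row x 2 0) (row x 2 2) 3" for x :: "'k frame"
  have p: "p \<in> polyfun"
    unfolding p_def wedge_form_eval by (intro polyfun.intros polyfun_diff polyfun_uminus)
  have "Iof (phi2 b) \<in> vanishing_locus p" for b :: "nat \<Rightarrow> 'k"
  proof -
    obtain h where h: "mat_inverse (phi2_mat b) h" by (rule phi2_mat_inverse)
    have ex: "\<exists>v'. v = gl2 (phi2_mat b) v' \<and> v' {0,4} = 0 \<and> v' {1,4} = 0 \<and> v' {2,4} = 0 \<and> v' {3,4} = 0"
      if v: "v \<in> rowspan 3 (row (phi2 b) 2)" for v
    proof -
      obtain v' where v': "v' \<in> rowspan 3 (row (std2_frame (phi2_T b) (phi2_coeff b)) 2)" "v = gl2 (phi2_mat b) v'"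
        using v unfolding phi2_def rowspan_gl_act by blast
      then show ?thesis using std2_std2_frame[of "phi2_T b" "phi2_coeff b"] unfolding std2_def by blast
    qed
    \<comment> \<open>The vector e_3 + b_14 e_4 lies in the moved hyperplane, and the product of two
      2-vectors of a hyperplane, read as a linear form, vanishes on that hyperplane.\<close>
    have V: "wedge_form u v 3 = - b 14 * wedge_form u v 4"
      if uv: "u \<in> rowspan 3 (row (phi2 b) 2)" "v \<in> rowspan 3 (row (phi2 b) 2)" for u v
    proof -
      obtain u' where u': "u = gl2 (phi2_mat b) u'" "u' {0,4} = 0" "u' {1,4} = 0" "u' {2,4} = 0" "u' {3,4} = 0"
        using ex[OF uv(1)] by blast
      obtain v' where v': "v = gl2 (phi2_mat b) v'" "v' {0,4} = 0" "v' {1,4} = 0" "v' {2,4} = 0" "v' {3,4} = 0"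
        using ex[OF uv(2)] by blast
      have "(\<Sum>i<5. phi2_mat b 3 i * wedge_form u v i) = mat_det (phi2_mat b) * wedge_form u' v' 3"
        unfolding u'(1) v'(1) by (rule wedge_form_gl[symmetric]) simp
      then have "wedge_form u v 3 + b 14 * wedge_form u v 4 = 0"
        by (simp add: wedge_form_eval(4)[of u' v'] u' v' sum_lessThan_5 phi2_mat_def unit_vec_def)
      then show ?thesis by (simp add: add_eq_0_iff)
    qed
    have "p x = 0" if x: "x \<in> frames" "Iof x = Iof (phi2 b)" for x
    proof -
      have "rowspan 3 (row x 2) = rowspan 3 (row (phi2 b) 2)"
        using x Iof_eq_iff[OF x(1) pts_Hilb_frames[OF phi2_pts]] by blast
      then have m: "row x 2 i \<in> rowspan 3 (row (phi2 b) 2)" if "i < 3" for i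
        using row_in_rowspan[OF that, of "row x 2"] by simp
      show ?thesis unfolding p_def V[OF m m, of 0 1, simplified] V[OF m m, of 0 2, simplified] by simp
    qed
    then show ?thesis using phi2_pts[of b] by (simp add: vanishing_locus_def pts_over_def)
  qed
  then have c2: "component2 \<subseteq> vanishing_locus p"
    unfolding component2_def by (intro H_closure_minimal H_closed_vanishing_locus p image_subsetI)
  \<comment> \<open>Here I_2 = <e_0 e_1 + e_1 e_2, e_0 e_2 + e_0 e_4, e_0 e_3>: the products of the
    first element with the other two are, up to sign, e_0 e_1 e_2 e_4 and e_0 e_1 e_2 e_3, which are
    independent.\<close>
  define b where "b i = (if i = 1 \<or> i = 3 then 1 else 0 :: 'k)" for i :: nat
  have "Iof (phi1 b) \<in> component1" unfolding component1_def by (rule subsetD[OF H_closure_subset rangeI])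
  then have "Iof (phi1 b) \<in> vanishing_locus p" by (rule subsetD[OF c2, OF subsetD[OF sub]])
  then have "p (phi1 b) = 0" using pts_Hilb_frames[OF phi1_pts[of b]] by (simp add: vanishing_locus_def)
  moreover have "mat_eq (phi1_mat b) unit_vec" by (auto simp: mat_eq_def phi1_mat_def unit_vec_def b_def)
  then have "gl2 (phi1_mat b) (std1_vec c) = std1_vec c" for c
    using gl2_cong[of "phi1_mat b" unit_vec "std1_vec c"] by (simp add: gl2_unit)
  then have "row (phi1 b) 2 i = std1_vec (phi1_coeff b i)" if "i < 3" for i
    using that by (simp add: phi1_V fun_eq_iff)
  then have "p (phi1 b) = wedge_form (std1_vec (phi1_coeff b 0)) (std1_vec (phi1_coeff b 1)) 3 * wedge_form (std1_vec (phi1_coeff b 0)) (std1_vec (phi1_coeff b 2)) 4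
    - wedge_form (std1_vec (phi1_coeff b 0)) (std1_vec (phi1_coeff b 1)) 4 * wedge_form (std1_vec (phi1_coeff b 0)) (std1_vec (phi1_coeff b 2)) 3"
    unfolding p_def by simp
  then have "p (phi1 b) \<noteq> 0" unfolding wedge_form_eval by (simp add: phi1_coeff_def b_def flip: One_nat_def)
  ultimately show False by simp
qed

text \<open>An irreducible closed set lies in one of two closed sets covering everything, so the
  maximal ones are these two, neither containing the other.\<close>

lemma H_component_pair:
  assumes irr: "H_irreducible C1" "H_irreducible C2" and un: "Hilb = C1 \<union> C2"
    and "\<not> C1 \<subseteq> C2" "\<not> C2 \<subseteq> C1"
  shows "{C. H_component C} = {C1, C2}"
proof -
  have "D \<subseteq> C1 \<or> D \<subseteq> C2" if "H_irreducible D" for D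
  proof -
    have "D \<subseteq> C1 \<union> C2" using H_closed_subset[OF H_irreducible_closed[OF that]] un by simp
    moreover have "\<forall>C1 C2. H_closed C1 \<longrightarrow> H_closed C2 \<longrightarrow> D \<subseteq> C1 \<union> C2 \<longrightarrow> D \<subseteq> C1 \<or> D \<subseteq> C2"
      using that by (simp add: H_irreducible_def)
    ultimately show ?thesis using H_irreducible_closed[OF irr(1)] H_irreducible_closed[OF irr(2)] by blast
  qed
  note cover = this
  have "H_component C1" unfolding H_component_def
    using irr(1) cover assms(4) by (meson order_trans subset_antisym)
  moreover have "H_component C2" unfolding H_component_def
    using irr(2) cover assms(5) by (meson order_trans subset_antisym)
  moreover have "C = C1 \<or> C = C2" if "H_component C" for C
    using that cover[of C] irr by (auto simp: H_component_def)
  ultimately show ?thesis by blast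
qed

text \<open>Over a finite field the product of all linear factors, plus 1, has positive degree and
  takes the value 1 everywhere.\<close>

lemma infinite_if_alg_closed:
  assumes "alg_closed_field TYPE('k::field)" shows "infinite (UNIV :: 'k set)"
proof
  assume fin: "finite (UNIV :: 'k set)"
  define p :: "'k poly" where "p = (\<Prod>a\<in>UNIV. [:- a, 1:])"
  have "degree p = card (UNIV :: 'k set)" unfolding p_def by (subst degree_prod_eq_sum_degree) simp_all
  then have "degree (p + 1) = card (UNIV :: 'k set)" using fin by (simp add: degree_add_eq_left card_gt_0_iff)
  then have "degree (p + 1) > 0" using fin by (simp add: card_gt_0_iff)
  then obtain z where "poly (p + 1) z = 0" using assms unfolding alg_closed_field_def by blast
  moreover have "poly p z = 0" unfolding p_def poly_prod using fin by (intro prod_zero) auto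
  ultimately show False by simp
qed

section \<open>The lexicographic point\<close>

lemma gl_act_unit:
  assumes x: "x \<in> frames" shows "gl_act unit_vec x = x"
proof
  fix v :: "nat \<times> nat \<times> nat set"
  obtain d i S where v: "v = (d,i,S)" by (cases v) auto
  consider "d = 2" | "d = 3" | "d \<noteq> 2" "d \<noteq> 3" by blast
  then show "gl_act unit_vec x v = x v"
  proof cases
    case 1 then show ?thesis using gl2_unit[OF row_ext_deg[OF x]] by (simp add: v gl_act_def)
  next
    case 2 then show ?thesis using gl3_unit[OF row_ext_deg[OF x]] by (simp add: v gl_act_def)
  next
    case 3 then show ?thesis using framesD[OF x, of d i S] by (auto simp: v gl_act_def)
  qed
qed

lemma phi1_0: "phi1 (\<lambda>_. 0) = std1_frame (phi1_coeff (\<lambda>_. 0))"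
proof -
  have "mat_eq (phi1_mat (\<lambda>_. 0)) unit_vec" by (auto simp: mat_eq_def phi1_mat_def unit_vec_def)
  then have "phi1 (\<lambda>_. 0) = gl_act unit_vec (std1_frame (phi1_coeff (\<lambda>_. 0)))" unfolding phi1_def by (rule gl_act_cong)
  then show ?thesis by (simp add: gl_act_unit std1_frame_frames)
qed

lemma phi2_0: "phi2 (\<lambda>_. 0) = std2_frame (phi2_T (\<lambda>_. 0)) (phi2_coeff (\<lambda>_. 0))"
proof -
  have "mat_eq (phi2_mat (\<lambda>_. 0)) unit_vec" by (auto simp: mat_eq_def phi2_mat_def unit_vec_def)
  then have "phi2 (\<lambda>_. 0) = gl_act unit_vec (std2_frame (phi2_T (\<lambda>_. 0)) (phi2_coeff (\<lambda>_. 0)))"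
    unfolding phi2_def by (rule gl_act_cong)
  then show ?thesis by (simp add: gl_act_unit pts_Hilb_frames[OF phi2_frame_pts])
qed

text \<open>At parameter 0 both families give I_2 = <e_0 e_1, e_0 e_2, e_0 e_3>, and I_3 of the
  second has no coefficient at e_1 e_3 e_4 or e_2 e_3 e_4, so by dimension it is that of the
  first.\<close>

lemma Iof_phi_0: "Iof (phi2 (\<lambda>_. 0)) = Iof (phi1 (\<lambda>_. 0 :: 'k::field))"
proof -
  have rows2: "row (phi2 (\<lambda>_. 0 :: 'k)) 2 i = row (phi1 (\<lambda>_. 0)) 2 i" if "i < 3" for i
    using less_3_cases[OF that] unfolding phi1_0 row_std1_frame(1)[OF that]
    by (intro ext_deg_2_eqI row_ext_deg[OF pts_Hilb_frames[OF phi2_pts]] std1_vec_ext_deg; elim disjE;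
        simp add: gl2_def phi2_V phi2_mat_def phi2_T_def phi2_coeff_def phi1_coeff_def lincomb_def sum_lessThan_4 unit_vec_def flip: One_nat_def)
  have rows3: "row (phi2 (\<lambda>_. 0 :: 'k)) 3 i \<in> rowspan 8 (row (phi1 (\<lambda>_. 0)) 3)" if "i < 8" for i
  proof -
    have "phi2 (\<lambda>_. 0 :: 'k) (3,i,{1,3,4}) = 0 \<and> phi2 (\<lambda>_. 0 :: 'k) (3,i,{2,3,4}) = 0"
      using less_8_cases[OF that] unfolding phi2_0
      by (elim disjE; simp add: std2_frame_rows basis_mon_def phi2_T_def unit_vec_def)
    then show ?thesis unfolding phi1_0 std1_W using row_ext_deg[OF pts_Hilb_frames[OF phi2_pts]] by blast
  qed
  show ?thesis
    using same_pointI[OF phi1_pts[of "\<lambda>_. 0 :: 'k"] pts_Hilb_frames[OF phi2_pts] _ rows3] pts_Hilb_rows[OF phi2_pts[of "\<lambda>_. 0 :: 'k"], of 2] pts_Hilb_rows[OF phi2_pts[of "\<lambda>_. 0 :: 'k"], of 3]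
      row_in_rowspan[of _ 3 "row (phi1 (\<lambda>_. 0 :: 'k)) 2"]
    by (simp add: rows2)
qed

text \<open>The sign is kept as an unspecified \<open>e\<close> with \<open>e * e = 1\<close>, so
  that scaling by it once more removes it.\<close>

lemma ew_basis_mon:
  assumes "i < 5" "S \<subseteq> {..<5}" "i \<notin> S"
  shows "\<exists>e. e * e = 1 \<and> ew i (basis_mon S) = ext_scale e (basis_mon (insert i S) :: 'k::field ext)"
proof -
  have "ew i (basis_mon S) U = ((-1) ^ card {t \<in> insert i S. t < i}) * (basis_mon (insert i S) U :: 'k)" for U
    using assms by (auto simp: ew_def basis_mon_def)
  then show ?thesis
    by (intro exI[of _ "(-1) ^ card {t \<in> insert i S. t < i}"]) (simp add: ext_scale_def fun_eq_iff flip: power_mult_distrib)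
qed

lemma basis_mon_in_ideal:
  assumes I: "ext_ideal (I :: 'k::field ext set)" and S: "basis_mon S \<in> I" and "S \<subseteq> T" "T \<subseteq> {..<5}"
  shows "basis_mon T \<in> I"
proof -
  have "finite (T - S)" using assms(4) finite_subset by blast
  moreover have "basis_mon (S \<union> A) \<in> I" if "finite A" "A \<subseteq> {..<5}" for A
    using that
  proof (induction A rule: finite_induct)
    case (insert i A)
    then have IH: "basis_mon (S \<union> A) \<in> I" and i: "i < 5" by auto
    show ?case
    proof (cases "i \<in> S \<union> A")
      case True
      then have "S \<union> insert i A = S \<union> A" by blast
      then show ?thesis using IH by simp
    next
      case False
      obtain e :: 'k where e: "e * e = 1" "ew i (basis_mon (S \<union> A)) = ext_scale e (basis_mon (insert i (S \<union> A)))"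
        using ew_basis_mon[OF i _ False] insert.prems assms(3,4) by blast
      have "ext_elem (basis_mon {i} :: 'k ext)" using i by (auto simp: ext_elem_def basis_mon_def)
      then have "wedge (basis_mon {i}) (basis_mon (S \<union> A)) \<in> I" using I IH by (simp add: ext_ideal_def)
      moreover have "\<forall>c. \<forall>x\<in>I. ext_scale c x \<in> I" using I by (simp add: ext_ideal_def)
      ultimately have "ext_scale e (ext_scale e (basis_mon (insert i (S \<union> A)))) \<in> I"
        unfolding wedge_basis_mon_singleton[OF i] e(2) by blast
      moreover have "ext_scale e (ext_scale e (basis_mon (insert i (S \<union> A)))) = (basis_mon (insert i (S \<union> A)) :: 'k ext)"
        using e(1) by (simp add: ext_scale_def fun_eq_iff flip: mult.assoc)
      ultimately show ?thesis by simp
    qed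
  qed (use S in simp)
  ultimately have "basis_mon (S \<union> (T - S)) \<in> I" using assms(4) by blast
  then show ?thesis using assms(3) by (simp add: Un_absorb1)
qed

lemma in_ideal_if_support:
  assumes I: "ext_ideal (I :: 'k::field ext set)" and y: "ext_elem y" "\<And>S. y S \<noteq> 0 \<Longrightarrow> basis_mon S \<in> I"
  shows "y \<in> I"
proof -
  have "(\<lambda>U. \<Sum>S\<in>F. y S * basis_mon S U) \<in> I" if "finite F" for F
    using that
  proof (induction F rule: finite_induct)
    case empty
    then show ?case using I by (simp add: ext_ideal_def zero_fun_def)
  next
    case (insert S F)
    have "ext_scale (y S) (basis_mon S) \<in> I"
    proof (cases "y S = 0")
      case True
      then have e: "ext_scale (y S) (basis_mon S) = 0" by (simp add: ext_scale_def fun_eq_iff)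
      show ?thesis unfolding e using I by (simp add: ext_ideal_def)
    qed (use I y(2) in \<open>simp add: ext_ideal_def\<close>)
    then have "ext_scale (y S) (basis_mon S) + (\<lambda>U. \<Sum>S\<in>F. y S * basis_mon S U) \<in> I"
      using I insert.IH by (simp add: ext_ideal_def)
    then show ?case using insert.hyps by (simp add: ext_scale_def plus_fun_def)
  qed
  from this[of "Pow {..<5}"] have "(\<lambda>U. \<Sum>S\<in>Pow {..<5}. y S * basis_mon S U) \<in> I" by simp
  moreover have "(\<Sum>S\<in>Pow {..<5}. y S * basis_mon S U) = y U" for U
  proof -
    have "(\<Sum>S\<in>Pow {..<5}. y S * basis_mon S U) = (\<Sum>S\<in>Pow {..<5}. if S = U then y U else 0)"
      by (intro sum.cong) (auto simp: basis_mon_def)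
    also have "\<dots> = y U" using y(1) by (auto simp: ext_elem_def)
    finally show ?thesis .
  qed
  ultimately show ?thesis by simp
qed

lemma std1_V_0: "rowspan 3 (row (phi1 (\<lambda>_. 0)) 2) = {v :: 'k::field ext. \<forall>S. S \<notin> pivots2 \<longrightarrow> v S = 0}"
proof -
  have "row (phi1 (\<lambda>_. 0)) 2 i = (basis_mon (v1_set i) :: 'k ext)" if "i < 3" for i
    using less_3_cases[OF that] unfolding phi1_0 row_std1_frame(1)[OF that]
    by (intro ext_deg_2_eqI std1_vec_ext_deg basis_mon_ext_deg v1_set_deg; elim disjE;
        simp add: phi1_coeff_def v1_set_def basis_mon_def doubleton_eq_iff flip: One_nat_def)
  then have "rowspan 3 (row (phi1 (\<lambda>_. 0)) 2) = rowspan 3 (\<lambda>i. basis_mon (v1_set i) :: 'k ext)" by (rule rowspan_cong)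
  also have "\<dots> = {v. \<forall>S. S \<notin> v1_set ` {..<3} \<longrightarrow> v S = 0}"
    by (rule rowspan_basis_mon) (auto simp: inj_on_def v1_set_def doubleton_eq_iff dest!: less_3_cases)
  also have "v1_set ` {..<3} = pivots2"
  proof -
    have "{..<3} = {0,1,2::nat}" by auto
    then show ?thesis by (auto simp: v1_set_def pivots2_def)
  qed
  finally show ?thesis .
qed

text \<open>Avoiding all three listed sets takes at least two missing indices. This puts all
  monomials of degrees 4 and 5 into the lexicographic ideal.\<close>

lemma large_subset_cases:
  assumes "T \<subseteq> {..<5::nat}" "card T \<ge> 4"
  shows "{0,1} \<subseteq> T \<or> {0,2} \<subseteq> T \<or> {1,2,3} \<subseteq> T"
proof (rule ccontr)
  assume n: "\<not> ?thesis"
  then obtain a b where ab: "a \<noteq> b" "a < 5" "b < 5" "a \<notin> T" "b \<notin> T"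
  proof -
    have "(0 \<notin> T \<and> (1 \<notin> T \<or> 2 \<notin> T \<or> 3 \<notin> T)) \<or> (1 \<notin> T \<and> 2 \<notin> T)" using n by auto
    then consider "0 \<notin> T" "1 \<notin> T" | "0 \<notin> T" "2 \<notin> T" | "0 \<notin> T" "3 \<notin> T" | "1 \<notin> T" "2 \<notin> T" by blast
    then show thesis by cases (auto intro: that[of 0 1] that[of 0 2] that[of 0 3] that[of 1 2])
  qed
  then have "card T \<le> card ({..<5} - {a,b})" using assms(1) by (intro card_mono) auto
  also have "\<dots> = 3" using ab by (subst card_Diff_subset) auto
  finally show False using assms(2) by simp
qed

text \<open>One inclusion needs the generators only. For the other, every monomial in the support of
  an element contains a generator: in degrees 2 and 3 by the list of pivots, in degrees 4 and 5
  because at most one index is missing.\<close>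

lemma lex_point_eq: "(lex_point :: 'k::field ext set) = Iof (phi1 (\<lambda>_. 0))"
proof
  let ?G = "basis_mon ` {{0,1},{0,2},{0,3},{1,2,3},{1,2,4}} :: 'k ext set"
  note fr = pts_Hilb_frames[OF phi1_pts[of "\<lambda>_. 0 :: 'k"]]
  have "ext_ideal (Iof (phi1 (\<lambda>_. 0 :: 'k)))"
    using phi1_pts[of "\<lambda>_. 0 :: 'k"] by (simp add: pts_over_def Hilb_def hom_ideal_def)
  moreover have "basis_mon S \<in> Iof (phi1 (\<lambda>_. 0 :: 'k))" if S: "S \<in> pivots2" for S
  proof -
    have "basis_mon S \<in> rowspan 3 (row (phi1 (\<lambda>_. 0 :: 'k)) 2)"
      unfolding std1_V_0 using S by (auto simp: basis_mon_def)
    then show ?thesis using Iof_deg(3)[OF fr] by blast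
  qed
  moreover have "basis_mon S \<in> Iof (phi1 (\<lambda>_. 0 :: 'k))" if S: "S \<in> pivots3" for S
  proof -
    have "basis_mon S \<in> rowspan 8 (row (phi1 (\<lambda>_. 0 :: 'k)) 3)"
      unfolding phi1_0 std1_W
    proof (intro CollectI conjI)
      show "basis_mon S \<in> ext_deg 3" using S by (intro basis_mon_ext_deg) (simp add: pivots3_def)
      have "S \<noteq> {1,3,4}" "S \<noteq> {2,3,4}" using S unfolding pivots3_def by fast+
      then show "basis_mon S {1,3,4} = 0" "basis_mon S {2,3,4} = 0" by (simp_all add: basis_mon_def)
    qed
    then show ?thesis using Iof_deg(4)[OF fr] by blast
  qed
  ultimately show "lex_point \<subseteq> Iof (phi1 (\<lambda>_. 0 :: 'k))"
    unfolding lex_point_def ideal_gen_def by (intro Inter_lower) (simp add: pivots2_def pivots3_eq)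
  have "y \<in> I" if y: "y \<in> Iof (phi1 (\<lambda>_. 0))" and I: "ext_ideal I" "?G \<subseteq> I" for y I
  proof (rule in_ideal_if_support[OF I(1)])
    note up = basis_mon_in_ideal[OF I(1)]
    have y': "ext_elem y" "hom_comp 0 y = 0" "hom_comp 1 y = 0" "hom_comp 2 y \<in> rowspan 3 (row (phi1 (\<lambda>_. 0)) 2)"
      "hom_comp 3 y \<in> rowspan 8 (row (phi1 (\<lambda>_. 0)) 3)"
      using y unfolding Iof_def rspan_eq by simp_all
    show "ext_elem y" by fact
    show "basis_mon S \<in> I" if S: "y S \<noteq> 0" for S
    proof -
      have S5: "S \<subseteq> {..<5}" using S y'(1) by (simp add: ext_elem_def)
      have g: "basis_mon {0,1} \<in> I" "basis_mon {0,2} \<in> I" "basis_mon {0,3} \<in> I" "basis_mon {1,2,3} \<in> I" "basis_mon {1,2,4} \<in> I"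
        using I(2) by auto
      have hc: "hom_comp (card S) y S \<noteq> 0" using S by (simp add: hom_comp_def)
      have "card S \<noteq> 0"
      proof
        assume "card S = 0"
        then show False using hc y'(2) by simp
      qed
      moreover have "card S \<noteq> 1"
      proof
        assume "card S = 1"
        then show False using hc y'(3) by simp
      qed
      ultimately have c: "card S \<ge> 2" by linarith
      consider "card S = 2" | "card S = 3" | "card S \<ge> 4" using c by linarith
      then show ?thesis
      proof cases
        case 1
        then have "S \<in> pivots2" using CollectD[OF y'(4)[unfolded std1_V_0], THEN spec, of S] hc by (cases "S \<in> pivots2") simp_all
        then show ?thesis using g unfolding pivots2_def by (elim insertE) simp_all
      next
        case 2
        then have "hom_comp 3 y {1,3,4} = 0" "hom_comp 3 y {2,3,4} = 0" using y'(5) unfolding phi1_0 std1_W by simp_all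
        then have "S \<noteq> {1,3,4}" "S \<noteq> {2,3,4}" using hc 2 by auto
        then have "S \<in> pivots3" using S5 2 by (simp add: pivots3_def deg_sets_def)
        then consider "{0,1} \<subseteq> S" | "{0,2} \<subseteq> S" | "{0,3} \<subseteq> S" | "{1,2,3} \<subseteq> S" | "{1,2,4} \<subseteq> S"
          unfolding pivots3_eq by auto
        then show ?thesis by cases (rule up[OF g(1) _ S5] up[OF g(2) _ S5] up[OF g(3) _ S5] up[OF g(4) _ S5] up[OF g(5) _ S5]; assumption)+
      next
        case 3
        show ?thesis using large_subset_cases[OF S5 3] up[OF g(1) _ S5] up[OF g(2) _ S5] up[OF g(4) _ S5] by (elim disjE)
      qed
    qed
  qed
  then show "Iof (phi1 (\<lambda>_. 0)) \<subseteq> (lex_point :: 'k ext set)"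
    unfolding lex_point_def ideal_gen_def by blast
qed

theorem theorem5p9:
  assumes "alg_closed_field TYPE('k::field)"
    and "(2::'k) \<noteq> 0"
  shows "\<exists>C1 C2 :: 'k ext set set.
           C1 \<noteq> C2 \<and> {C. H_component C} = {C1, C2} \<and> Hilb = C1 \<union> C2 \<and>
           H_dim_eq C1 14 \<and> H_dim_eq C2 15 \<and>
           lex_point \<in> C1 \<and> lex_point \<in> C2"
proof -
  have inf: "infinite (UNIV :: 'k set)" by (rule infinite_if_alg_closed[OF assms(1)])
  note un = Hilb_eq_components[OF inf assms(2)] and dim = H_dim_components[OF inf]
  have n12: "\<not> (component1 :: 'k ext set set) \<subseteq> component2" by (rule not_component1_subset)
  have n21: "\<not> (component2 :: 'k ext set set) \<subseteq> component1"
  proof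
    assume sub: "(component2 :: 'k ext set set) \<subseteq> component1"
    have "H_chain (component2 :: 'k ext set set) 15" "\<not> H_chain (component1 :: 'k ext set set) 15"
      using dim by (simp_all add: H_dim_eq_def)
    then show False using sub unfolding H_chain_def by (meson order_trans)
  qed
  have "(lex_point :: 'k ext set) \<in> component1"
    unfolding lex_point_eq component1_def by (rule subsetD[OF H_closure_subset rangeI])
  moreover have "(lex_point :: 'k ext set) \<in> component2"
    unfolding lex_point_eq Iof_phi_0[symmetric] component2_def by (rule subsetD[OF H_closure_subset rangeI])
  ultimately show ?thesis
    using n12 un dim H_component_pair[OF H_irreducible_components[OF inf] un n12 n21]
    by (intro exI[of _ component1] exI[of _ component2]) auto
qed

end
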